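(* Let $(\mathcal{G},\mu)$ be a discrete measured groupoid. The following two conditions are equivalent: 1. The groupoid $(\mathcal{G},\mu)$ is ergodic and icc. 2. The groupoid von Neumann algebra $L(\mathcal{G})$ is a factor.
   Context: A discrete Borel groupoid is a groupoid $\mathcal{G}$ that is also a standard Borel space, such that the unit space $\mathcal{G}^{(0)}$ is a Borel subset, the source and target maps $s,t:\mathcal{G}\to\mathcal{G}^{(0)}$ are countable-to-one Borel maps, and composition $(g,h)\mapsto gh$ (defined when $s(g)=t(h)$) and inversion are Borel. A discrete measured groupoid $(\mathcal{G},\mu)$ is a discrete Borel groupoid with a probability measure $\mu$ on $\mathcal{G}^{(0)}$ such that the $\sigma$-finite measures $\mu_s(A)=\int_{\mathcal{G}^{(0)}}|\{g\in A: s(g)=x\}|\,d\mu(x)$ and $\mu_t(A)=\int_{\mathcal{G}^{(0)}}|\{g\in A: t(g)=x\}|\,d\mu(x)$ on $\mathcal{G}$ are equivalent (have the same null sets). $(\mathcal{G},\mu)$ is ergodic if the equivalence relation $\mathcal{R}_{\mathcal{G}}=\{(t(g),s(g)): g\in\mathcal{G}\}$ on $(\mathcal{G}^{(0)},\mu)$ is ergodic, i.e. every invariant Borel subset of $\mathcal{G}^{(0)}$ is null or conull. For $A,B\subset\mathcal{G}$, $A\cdot B=\{gh: g\in A,h\in B,s(g)=t(h)\}$. A bisection is a subset $A\subset\mathcal{G}$ on which both $s$ and $t$ are injective. For a Borel bisection $A$, $\lambda_A\in B(L^2(\mathcal{G},\mu_s))$ is the partial isometry determined by $\lambda_A 1_E=1_{A\cdot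 E}$ for Borel $E\subset\mathcal{G}$ with $\mu_s(E)<\infty$. The groupoid von Neumann algebra is $L(\mathcal{G})=\{\lambda_A: A\subset\mathcal{G}\text{ Borel bisection}\}''$. $\mathrm{Iso}(\mathcal{G})=\{g\in\mathcal{G}: s(g)=t(g)\}$. For a Borel set $A\subset\mathrm{Iso}(\mathcal{G})$, its conjugacy class is the (Borel) set $\Omega_A=\bigcup_{g\in\mathcal{G}}gAg^{-1}=\{gag^{-1}: a\in A, g\in\mathcal{G}, s(g)=t(a)\}$. $(\mathcal{G},\mu)$ is icc if every Borel bisection $A\subset\mathrm{Iso}(\mathcal{G})$ with $\mu_s(A)>0$ and $\mu_s(\Omega_A)<\infty$ is contained in $\mathcal{G}^{(0)}$ up to a $\mu_s$-null set (equivalently, the same for all non-null Borel subsets $A\subset\mathrm{Iso}(\mathcal{G})$). *)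

theory Defs
  imports "HOL-Probability.Probability"
begin

section \<open>Discrete measured groupoids\<close>

definition standard_borel_space :: "'a measure \<Rightarrow> bool" where
  "standard_borel_space M \<longleftrightarrow>
     (\<exists>X. completely_metrizable_space X \<and> second_countable X \<and> topspace X = space M \<and>
          sets M = sigma_sets (space M) {U. openin X U})"

text \<open>
  A groupoid is given by its arrows; units are identified with their identity arrows.
  Of the field \<open>Borel\<close> only the underlying measurable space is used, and its space is the
  set of all arrows. The product \<open>mult G g h\<close> is meaningful only for \<open>src G g = tgt G h\<close>.
\<close>

record 'g groupoid_str =
  Borel :: "'g measure"
  units :: "'g set"
  src :: "'g \<Rightarrow> 'g"
  tgt :: "'g \<Rightarrow> 'g"
  mult :: "'g \<Rightarrow> 'g \<Rightarrow> 'g"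
  ginv :: "'g \<Rightarrow> 'g"

abbreviation arrows :: "'g groupoid_str \<Rightarrow> 'g set" where
  "arrows G \<equiv> space (Borel G)"

definition composable :: "'g groupoid_str \<Rightarrow> ('g \<times> 'g) set" where
  "composable G = {(g, h). g \<in> arrows G \<and> h \<in> arrows G \<and> src G g = tgt G h}"

locale groupoid =
  fixes G :: "'g groupoid_str"
  assumes units_subset: "units G \<subseteq> arrows G"
    and src_in: "g \<in> arrows G \<Longrightarrow> src G g \<in> units G"
    and tgt_in: "g \<in> arrows G \<Longrightarrow> tgt G g \<in> units G"
    and src_unit: "x \<in> units G \<Longrightarrow> src G x = x"
    and tgt_unit: "x \<in> units G \<Longrightarrow> tgt G x = x"
    and mult_in: "(g, h) \<in> composable G \<Longrightarrow> mult G g h \<in> arrows G"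
    and src_mult: "(g, h) \<in> composable G \<Longrightarrow> src G (mult G g h) = src G h"
    and tgt_mult: "(g, h) \<in> composable G \<Longrightarrow> tgt G (mult G g h) = tgt G g"
    and mult_assoc: "(g, h) \<in> composable G \<Longrightarrow> (h, k) \<in> composable G \<Longrightarrow>
          mult G (mult G g h) k = mult G g (mult G h k)"
    and mult_tgt: "g \<in> arrows G \<Longrightarrow> mult G (tgt G g) g = g"
    and mult_src: "g \<in> arrows G \<Longrightarrow> mult G g (src G g) = g"
    and ginv_in: "g \<in> arrows G \<Longrightarrow> ginv G g \<in> arrows G"
    and src_ginv: "g \<in> arrows G \<Longrightarrow> src G (ginv G g) = tgt G g"
    and tgt_ginv: "g \<in> arrows G \<Longrightarrow> tgt G (ginv G g) = src G g"
    and ginv_mult: "g \<in> arrows G \<Longrightarrow> mult G (ginv G g) g = src G g"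
    and mult_ginv: "g \<in> arrows G \<Longrightarrow> mult G g (ginv G g) = tgt G g"

locale discrete_borel_groupoid = groupoid +
  assumes standard: "standard_borel_space (Borel G)"
    and units_sets: "units G \<in> sets (Borel G)"
    and src_measurable: "src G \<in> Borel G \<rightarrow>\<^sub>M restrict_space (Borel G) (units G)"
    and tgt_measurable: "tgt G \<in> Borel G \<rightarrow>\<^sub>M restrict_space (Borel G) (units G)"
    and src_countable: "x \<in> units G \<Longrightarrow> countable {g \<in> arrows G. src G g = x}"
    and tgt_countable: "x \<in> units G \<Longrightarrow> countable {g \<in> arrows G. tgt G g = x}"
    and mult_measurable: "(\<lambda>(g, h). mult G g h)
          \<in> restrict_space (Borel G \<Otimes>\<^sub>M Borel G) (composable G) \<rightarrow>\<^sub>M Borel G"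
    and ginv_measurable: "ginv G \<in> Borel G \<rightarrow>\<^sub>M Borel G"

definition mu_src :: "'g groupoid_str \<Rightarrow> 'g measure \<Rightarrow> 'g measure" where
  "mu_src G \<mu> = measure_of (arrows G) (sets (Borel G))
     (\<lambda>A. \<integral>\<^sup>+x. emeasure (count_space UNIV) {g \<in> A. src G g = x} \<partial>\<mu>)"

definition mu_tgt :: "'g groupoid_str \<Rightarrow> 'g measure \<Rightarrow> 'g measure" where
  "mu_tgt G \<mu> = measure_of (arrows G) (sets (Borel G))
     (\<lambda>A. \<integral>\<^sup>+x. emeasure (count_space UNIV) {g \<in> A. tgt G g = x} \<partial>\<mu>)"

locale discrete_measured_groupoid = discrete_borel_groupoid +
  fixes \<mu> :: "'a measure"
  assumes prob: "prob_space \<mu>"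
    and sets_mu: "sets \<mu> = sets (restrict_space (Borel G) (units G))"
    and equivalent: "null_sets (mu_src G \<mu>) = null_sets (mu_tgt G \<mu>)"

definition orbit_rel :: "'g groupoid_str \<Rightarrow> ('g \<times> 'g) set" where
  "orbit_rel G = {(tgt G g, src G g) | g. g \<in> arrows G}"

definition ergodic :: "'g groupoid_str \<Rightarrow> 'g measure \<Rightarrow> bool" where
  "ergodic G \<mu> \<longleftrightarrow>
     (\<forall>E \<in> sets (Borel G). E \<subseteq> units G \<longrightarrow>
        (\<forall>(x, y) \<in> orbit_rel G. x \<in> E \<longleftrightarrow> y \<in> E) \<longrightarrow>
        emeasure \<mu> E = 0 \<or> emeasure \<mu> (units G - E) = 0)"

definition set_mult :: "'g groupoid_str \<Rightarrow> 'g set \<Rightarrow> 'g set \<Rightarrow> 'g set" where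
  "set_mult G A B = {mult G g h | g h. g \<in> A \<and> h \<in> B \<and> src G g = tgt G h}"

definition bisection :: "'g groupoid_str \<Rightarrow> 'g set \<Rightarrow> bool" where
  "bisection G A \<longleftrightarrow> A \<subseteq> arrows G \<and> inj_on (src G) A \<and> inj_on (tgt G) A"

definition Iso :: "'g groupoid_str \<Rightarrow> 'g set" where
  "Iso G = {g \<in> arrows G. src G g = tgt G g}"

definition conj_class :: "'g groupoid_str \<Rightarrow> 'g set \<Rightarrow> 'g set" where
  "conj_class G A =
     {mult G (mult G g a) (ginv G g) | a g. a \<in> A \<and> g \<in> arrows G \<and> src G g = tgt G a}"

definition icc :: "'g groupoid_str \<Rightarrow> 'g measure \<Rightarrow> bool" where
  "icc G \<mu> \<longleftrightarrow>
     (\<forall>A \<in> sets (Borel G). bisection G A \<longrightarrow> A \<subseteq> Iso G \<longrightarrow>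
        emeasure (mu_src G \<mu>) A > 0 \<longrightarrow> emeasure (mu_src G \<mu>) (conj_class G A) < \<infinity> \<longrightarrow>
        emeasure (mu_src G \<mu>) (A - units G) = 0)"

section \<open>The Hilbert space \<open>L\<^sup>2(M)\<close> and von Neumann algebras on it\<close>

text \<open>
  The measure \<open>M\<close> is a term, so \<open>L\<^sup>2(M)\<close> is not a type but a set of almost-everywhere
  equality classes. Operators are extensional functions on that set, so that equality of
  operators is equality in HOL.
\<close>

definition l2_fun :: "'a measure \<Rightarrow> ('a \<Rightarrow> complex) set" where
  "l2_fun M = {f \<in> borel_measurable M. integrable M (\<lambda>x. (cmod (f x))\<^sup>2)}"

definition l2_class :: "'a measure \<Rightarrow> ('a \<Rightarrow> complex) \<Rightarrow> ('a \<Rightarrow> complex) set" where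
  "l2_class M f = {h \<in> l2_fun M. AE x in M. h x = f x}"

definition L2 :: "'a measure \<Rightarrow> ('a \<Rightarrow> complex) set set" where
  "L2 M = l2_class M ` l2_fun M"

definition l2_rep :: "('a \<Rightarrow> complex) set \<Rightarrow> 'a \<Rightarrow> complex" where
  "l2_rep X = (SOME f. f \<in> X)"

definition l2_add :: "'a measure \<Rightarrow> ('a \<Rightarrow> complex) set \<Rightarrow> ('a \<Rightarrow> complex) set
    \<Rightarrow> ('a \<Rightarrow> complex) set" where
  "l2_add M X Y = l2_class M (\<lambda>x. l2_rep X x + l2_rep Y x)"

definition l2_scale :: "'a measure \<Rightarrow> complex \<Rightarrow> ('a \<Rightarrow> complex) set \<Rightarrow> ('a \<Rightarrow> complex) set" where
  "l2_scale M c X = l2_class M (\<lambda>x. c * l2_rep X x)"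

definition l2_inner :: "'a measure \<Rightarrow> ('a \<Rightarrow> complex) set \<Rightarrow> ('a \<Rightarrow> complex) set \<Rightarrow> complex" where
  "l2_inner M X Y = (\<integral>x. l2_rep X x * cnj (l2_rep Y x) \<partial>M)"

definition l2_norm :: "'a measure \<Rightarrow> ('a \<Rightarrow> complex) set \<Rightarrow> real" where
  "l2_norm M X = sqrt (\<integral>x. (cmod (l2_rep X x))\<^sup>2 \<partial>M)"

type_synonym 'a l2_operator = "('a \<Rightarrow> complex) set \<Rightarrow> ('a \<Rightarrow> complex) set"

definition l2_bounded_ops :: "'a measure \<Rightarrow> 'a l2_operator set" where
  "l2_bounded_ops M = {T \<in> L2 M \<rightarrow>\<^sub>E L2 M.
     (\<forall>X \<in> L2 M. \<forall>Y \<in> L2 M. T (l2_add M X Y) = l2_add M (T X) (T Y)) \<and>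
     (\<forall>c. \<forall>X \<in> L2 M. T (l2_scale M c X) = l2_scale M c (T X)) \<and>
     (\<exists>K. \<forall>X \<in> L2 M. l2_norm M (T X) \<le> K * l2_norm M X)}"

definition commutant :: "'a measure \<Rightarrow> 'a l2_operator set \<Rightarrow> 'a l2_operator set" where
  "commutant M N = {T \<in> l2_bounded_ops M. \<forall>S \<in> N. compose (L2 M) T S = compose (L2 M) S T}"

definition is_l2_adjoint :: "'a measure \<Rightarrow> 'a l2_operator \<Rightarrow> 'a l2_operator \<Rightarrow> bool" where
  "is_l2_adjoint M T S \<longleftrightarrow>
     (\<forall>X \<in> L2 M. \<forall>Y \<in> L2 M. l2_inner M (T X) Y = l2_inner M X (S Y))"

text \<open>Unitality and closure under the algebra operations follow from \<open>N'' = N\<close>.\<close>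

definition von_neumann_algebra :: "'a measure \<Rightarrow> 'a l2_operator set \<Rightarrow> bool" where
  "von_neumann_algebra M N \<longleftrightarrow>
     N \<subseteq> l2_bounded_ops M \<and>
     (\<forall>T \<in> N. \<exists>S \<in> N. is_l2_adjoint M T S) \<and>
     commutant M (commutant M N) = N"

definition factor :: "'a measure \<Rightarrow> 'a l2_operator set \<Rightarrow> bool" where
  "factor M N \<longleftrightarrow>
     von_neumann_algebra M N \<and>
     N \<inter> commutant M N = {restrict (l2_scale M c) (L2 M) | c. True}"

section \<open>The groupoid von Neumann algebra\<close>

text \<open>
  The defining property determines \<open>\<lambda>\<^sub>A\<close> uniquely among bounded operators, because the
  simple functions with support of finite measure are dense; it is then a partial isometry.
\<close>

definition bisection_op :: "'g groupoid_str \<Rightarrow> 'g measure \<Rightarrow> 'g set \<Rightarrow> 'g l2_operator" where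
  "bisection_op G \<mu> A = (THE T. T \<in> l2_bounded_ops (mu_src G \<mu>) \<and>
     (\<forall>E \<in> sets (Borel G). emeasure (mu_src G \<mu>) E < \<infinity> \<longrightarrow>
        T (l2_class (mu_src G \<mu>) (indicator E)) =
          l2_class (mu_src G \<mu>) (indicator (set_mult G A E))))"

definition groupoid_vN :: "'g groupoid_str \<Rightarrow> 'g measure \<Rightarrow> 'g l2_operator set" where
  "groupoid_vN G \<mu> = commutant (mu_src G \<mu>) (commutant (mu_src G \<mu>)
     {bisection_op G \<mu> A | A. A \<in> sets (Borel G) \<and> bisection G A})"

end

theory Submission
  imports Defs
begin

text \<open>
  A central element \<open>T\<close> of \<open>L(G)\<close> is determined by the vector \<open>\<xi> = T 1\<close>, where \<open>1\<close> is the indicator of the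
  units. Commutation with left and right translations by bisections forces \<open>\<xi>\<close> to vanish off the
  isotropy and to be invariant under conjugation. The level sets \<open>|\<xi>| > \<epsilon>\<close> are then conjugation invariant of
  finite measure, so icc confines \<open>\<xi>\<close> to the units, and ergodicity makes it constant there.
  Conversely, an invariant set of units gives a central projection, and a conjugacy class of finite
  measure, cut down to where its fibres have at most \<open>k\<close> elements, splits into \<open>k\<close> bisections whose
  \<open>\<lambda>\<close>-operators add up to a central operator.

  That the measures \<open>\<mu>\<^sub>s\<close> and \<open>\<mu>\<^sub>t\<close> and the conjugacy classes are well behaved rests on the Lusin-Novikov
  theorem: a countable-to-one Borel map is injective on each of countably many Borel pieces, and its
  images of Borel sets are Borel. Adjoints of bounded operators come from the Riesz representation
  theorem in \<open>L\<^sup>2\<close>.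
\<close>

section \<open>Analytic sets and Lusin separation\<close>

text \<open>Vectors of \<open>L2 M\<close> are known only almost everywhere, while invariance and
  conjugacy quantify over all arrows. Writing the arrows as countably many Borel bisections reduces
  every such statement to countably many null sets, which is why the countable-to-one theorems are
  indispensable. \<open>T\<close> is recovered from \<open>T 1\<close> because \<open>lam E\<close>
  sends \<open>1\<close> to the indicator of the bisection \<open>E\<close>, and \<open>T\<close>
  commutes with \<open>lam E\<close>. Membership of \<open>T\<close> in the bicommutant enters
  through commutation with right translations. These distort the measure by a Radon-Nikodym factor
  that may be unbounded, so bisections are cut further into \<open>tame\<close> pieces. In the
  converse direction the cut at \<open>k\<close> elements per fibre preserves conjugation invariance
  because the number of elements in a fibre is constant along orbits; finite measure makes it finite
  almost everywhere. The sum of operators sends \<open>1\<close> to a vector with value 1 on the cut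
  class, which contains non-null many non-units, so it is no scalar.\<close>

text \<open>Topological notions on Baire space in terms of finite prefixes: \<open>decides C f D\<close> says that \<open>f -` D\<close>
  is relatively clopen in \<open>C\<close>.\<close>

definition closedN :: "(nat \<Rightarrow> nat) set \<Rightarrow> bool" where
  "closedN C \<longleftrightarrow> (\<forall>z. (\<forall>k. \<exists>w\<in>C. \<forall>i<k. w i = z i) \<longrightarrow> z \<in> C)"

definition decides :: "(nat \<Rightarrow> nat) set \<Rightarrow> ((nat \<Rightarrow> nat) \<Rightarrow> 'a) \<Rightarrow> 'a set \<Rightarrow> bool" where
  "decides C f D \<longleftrightarrow> (\<forall>z\<in>C. \<exists>k. \<forall>w\<in>C. (\<forall>i<k. w i = z i) \<longrightarrow> (f w \<in> D \<longleftrightarrow> f z \<in> D))"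

lemma closedND: "closedN C \<Longrightarrow> (\<And>k. \<exists>w\<in>C. \<forall>i<k. w i = z i) \<Longrightarrow> z \<in> C"
  unfolding closedN_def by blast

lemma closedN_decided:
  assumes "closedN C" "decides C f D"
  shows "closedN {z\<in>C. f z \<in> D}"
  unfolding closedN_def
proof (intro allI impI)
  fix z assume z: "\<forall>k. \<exists>w\<in>{z\<in>C. f z \<in> D}. \<forall>i<k. w i = z i"
  then have "z \<in> C" using closedND[OF assms(1), of z] by blast
  moreover from this obtain k where k: "\<forall>w\<in>C. (\<forall>i<k. w i = z i) \<longrightarrow> (f w \<in> D \<longleftrightarrow> f z \<in> D)"
    using assms(2) unfolding decides_def by blast
  ultimately show "z \<in> {z\<in>C. f z \<in> D}" using z[rule_format, of k] by blast
qed

lemma decides_subset: "decides C f D \<Longrightarrow> C' \<subseteq> C \<Longrightarrow> decides C' f D"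
  unfolding decides_def by (meson subsetD)

lemma decides_mono:
  assumes "decides C f D" "z \<in> C"
  obtains k where "\<And>w. w \<in> C \<Longrightarrow> (\<And>i. i < k \<Longrightarrow> w i = z i) \<Longrightarrow> (f w \<in> D \<longleftrightarrow> f z \<in> D)"
  using assms unfolding decides_def by metis

section \<open>Countable products and refinements of closed representations\<close>

definition strand :: "nat \<Rightarrow> (nat \<Rightarrow> nat) \<Rightarrow> nat \<Rightarrow> nat" where
  "strand n z i = z (prod_encode (n, i))"

text \<open>Through the pairing function one sequence codes a sequence of sequences, as in the
  homeomorphism of Baire space with its countable power. A prefix of a strand reads finitely many
  positions of \<open>z\<close>, and the sum of their successors bounds them all.\<close>

lemma strand_prefix:
  "\<exists>K. \<forall>w. (\<forall>j<K. w j = z j) \<longrightarrow> (\<forall>i<k. strand n w i = strand n z i)"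
proof (intro exI allI impI)
  fix w i assume *: "\<forall>j<(\<Sum>i<k. Suc (prod_encode (n,i))). w j = z j" and "i < k"
  have "Suc (prod_encode (n,i)) \<le> (\<Sum>i<k. Suc (prod_encode (n,i)))"
    by (rule member_le_sum) (use \<open>i<k\<close> in auto)
  then show "strand n w i = strand n z i" unfolding strand_def by (intro *[rule_format]) simp
qed

lemma strand_surj: "\<exists>z. \<forall>n. strand n z = v n"
  by (rule exI[of _ "\<lambda>j. case prod_decode j of (n,i) \<Rightarrow> v n i"]) (auto simp: strand_def)

text \<open>The new closed set consists of the sequences all of whose strands represent the same
  point. It is closed because two different values would be told apart by some \<open>E\<close> that
  all the maps decide; this happens on a finite prefix, where approximating members already have
  equal values. The common value can be read off any strand, so whatever one factor decides, the
  product decides.\<close>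

lemma fibre_product:
  fixes C :: "nat \<Rightarrow> (nat \<Rightarrow> nat) set" and f :: "nat \<Rightarrow> (nat \<Rightarrow> nat) \<Rightarrow> 'a"
  assumes C: "\<And>n. closedN (C n)" and dec: "\<And>n E. E \<in> \<E> \<Longrightarrow> decides (C n) (f n) E"
    and X: "\<And>n. f n ` C n \<subseteq> X"
    and sep: "\<And>x y. x \<in> X \<Longrightarrow> y \<in> X \<Longrightarrow> x \<noteq> y \<Longrightarrow> \<exists>E\<in>\<E>. (x \<in> E) \<noteq> (y \<in> E)"
  shows "\<exists>C' f'. closedN C' \<and> f' ` C' = (\<Inter>n. f n ` C n) \<and>
    (\<forall>n D. decides (C n) (f n) D \<longrightarrow> decides C' f' D)"
proof -
  define C' where "C' = {z. (\<forall>n. strand n z \<in> C n) \<and> (\<forall>n. f n (strand n z) = f 0 (strand 0 z))}"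
  define f' where "f' = (\<lambda>z. f 0 (strand 0 z))"
  have C'D: "strand n w \<in> C n" if "w \<in> C'" for w n using that unfolding C'_def by blast
  have f'_eq: "f' w = f n (strand n w)" if "w \<in> C'" for w n
  proof -
    have "\<forall>n. f n (strand n w) = f 0 (strand 0 w)" using that unfolding C'_def by blast
    then have "f n (strand n w) = f 0 (strand 0 w)" ..
    then show ?thesis unfolding f'_def by (rule sym)
  qed
  have closed: "closedN C'" unfolding closedN_def
  proof (intro allI impI)
    fix z assume z: "\<forall>k. \<exists>w\<in>C'. \<forall>i<k. w i = z i"
    have zC: "strand n z \<in> C n" for n
    proof (rule closedND[OF C])
      fix k
      obtain K where K: "\<forall>w. (\<forall>j<K. w j = z j) \<longrightarrow> (\<forall>i<k. strand n w i = strand n z i)"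
        using strand_prefix by blast
      obtain w where w: "w \<in> C'" "\<forall>i<K. w i = z i" using z by blast
      have "strand n w \<in> C n" using w(1) by (rule C'D)
      moreover have "\<forall>i<k. strand n w i = strand n z i" using K w(2) by blast
      ultimately show "\<exists>w\<in>C n. \<forall>i<k. w i = strand n z i" by blast
    qed
    have "f n (strand n z) = f 0 (strand 0 z)" for n
    proof (rule ccontr)
      assume ne: "f n (strand n z) \<noteq> f 0 (strand 0 z)"
      then obtain E where E: "E \<in> \<E>" "(f n (strand n z) \<in> E) \<noteq> (f 0 (strand 0 z) \<in> E)"
        using sep[OF _ _ ne] X zC by blast
      have "\<exists>K. \<forall>w\<in>C'. (\<forall>i<K. w i = z i) \<longrightarrow> (f m (strand m w) \<in> E \<longleftrightarrow> f m (strand m z) \<in> E)" for m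
      proof -
        obtain k where k: "\<And>w. w \<in> C m \<Longrightarrow> (\<And>i. i < k \<Longrightarrow> w i = strand m z i) \<Longrightarrow> (f m w \<in> E \<longleftrightarrow> f m (strand m z) \<in> E)"
          using decides_mono[OF dec[OF E(1)] zC] by metis
        obtain K where K: "\<forall>w. (\<forall>j<K. w j = z j) \<longrightarrow> (\<forall>i<k. strand m w i = strand m z i)"
        using strand_prefix by blast
        show ?thesis
        proof (intro exI[of _ K] ballI impI)
          fix w assume w: "w \<in> C'" "\<forall>i<K. w i = z i"
          have "strand m w \<in> C m" using w(1) by (rule C'D)
          moreover have "\<forall>i<k. strand m w i = strand m z i" using K w(2) by blast
          ultimately show "f m (strand m w) \<in> E \<longleftrightarrow> f m (strand m z) \<in> E" by (intro k) auto
        qed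
      qed
      then obtain K where K: "\<And>m w. w \<in> C' \<Longrightarrow> (\<And>i. i < K m \<Longrightarrow> w i = z i) \<Longrightarrow> (f m (strand m w) \<in> E \<longleftrightarrow> f m (strand m z) \<in> E)"
        by metis
      obtain w where w: "w \<in> C'" "\<forall>i<max (K n) (K 0). w i = z i" using z by blast
      then have "f n (strand n w) = f 0 (strand 0 w)" using f'_eq[OF w(1)] by metis
      with K[of w n] K[of w 0] w E(2) show False by auto
    qed
    with zC show "z \<in> C'" unfolding C'_def by blast
  qed
  have image: "f' ` C' = (\<Inter>n. f n ` C n)"
  proof safe
    fix z n assume z: "z \<in> C'"
    show "f' z \<in> f n ` C n" unfolding f'_eq[OF z, of n] by (rule imageI[OF C'D[OF z]])
  next
    fix x assume x: "x \<in> (\<Inter>n. f n ` C n)"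
    have "\<exists>v. v \<in> C n \<and> f n v = x" for n
    proof -
      have "x \<in> f n ` C n" using x by (rule INT_D) simp
      then show ?thesis unfolding image_iff by metis
    qed
    then obtain v where v: "\<And>n. v n \<in> C n" "\<And>n. f n (v n) = x" by metis
    obtain z where "\<forall>n. strand n z = v n" using strand_surj by blast
    then have "z \<in> C'" "f' z = x" using v by (simp_all add: C'_def f'_def)
    then show "x \<in> f' ` C'" by blast
  qed
  have "decides C' f' D" if D: "decides (C n) (f n) D" for n D
    unfolding decides_def
  proof
    fix z assume z: "z \<in> C'"
    then have "strand n z \<in> C n" by (rule C'D)
    then obtain k where k: "\<And>w. w \<in> C n \<Longrightarrow> (\<And>i. i < k \<Longrightarrow> w i = strand n z i) \<Longrightarrow> (f n w \<in> D \<longleftrightarrow> f n (strand n z) \<in> D)"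
      using decides_mono[OF D] by metis
    obtain K where K: "\<forall>w. (\<forall>j<K. w j = z j) \<longrightarrow> (\<forall>i<k. strand n w i = strand n z i)"
        using strand_prefix by blast
    have *: "f' w = f n (strand n w)" if "w \<in> C'" for w using that by (rule f'_eq)
    show "\<exists>k. \<forall>w\<in>C'. (\<forall>i<k. w i = z i) \<longrightarrow> (f' w \<in> D \<longleftrightarrow> f' z \<in> D)"
    proof (intro exI[of _ K] ballI impI)
      fix w assume w: "w \<in> C'" "\<forall>i<K. w i = z i"
      have "strand n w \<in> C n" using w(1) by (rule C'D)
      moreover have "\<forall>i<k. strand n w i = strand n z i" using K w(2) by blast
      ultimately have "f n (strand n w) \<in> D \<longleftrightarrow> f n (strand n z) \<in> D" by (intro k) auto
      then show "f' w \<in> D \<longleftrightarrow> f' z \<in> D" using *[OF w(1)] *[OF z] by simp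
    qed
  qed
  with closed image show ?thesis by (intro exI conjI allI impI)
qed

text \<open>A leading entry is added as a certificate: \<open>0\<close> claims that the value avoids
  every \<open>D m\<close>, and \<open>Suc m\<close> that it lies in \<open>D m\<close>. Membership
  in the union is then visible in that single entry. Certified sequences form a closed set since
  each \<open>D m\<close> is decided, and no value is lost since each point has a true
  certificate.\<close>

lemma closedN_refine_Union:
  fixes D :: "nat \<Rightarrow> 'a set"
  assumes C: "closedN C" and dec: "\<And>m. decides C f (D m)"
  shows "\<exists>C' f'. closedN C' \<and> f' ` C' = f ` C \<and> decides C' f' (\<Union>m. D m) \<and>
    (\<forall>E. decides C f E \<longrightarrow> decides C' f' E)"
proof -
  define sh where "sh z = (\<lambda>i. z (Suc i))" for z :: "nat \<Rightarrow> nat"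
  define C' where "C' = {z. sh z \<in> C \<and> (case z 0 of 0 \<Rightarrow> \<forall>m. f (sh z) \<notin> D m | Suc m \<Rightarrow> f (sh z) \<in> D m)}"
  define f' where "f' z = f (sh z)" for z
  have sh: "sh w i = sh z i" if "\<And>i. i < Suc k \<Longrightarrow> w i = z i" "i < k" for w z i k
    using that by (auto simp: sh_def)
  have closed: "closedN C'" unfolding closedN_def
  proof (intro allI impI)
    fix z assume z: "\<forall>k. \<exists>w\<in>C'. \<forall>i<k. w i = z i"
    have zC: "sh z \<in> C"
    proof (rule closedND[OF C])
      fix k
      obtain w where "w \<in> C'" "\<forall>i<Suc k. w i = z i" using z by blast
      then show "\<exists>w\<in>C. \<forall>i<k. w i = sh z i"
        by (intro bexI[of _ "sh w"]) (auto simp: C'_def sh_def)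
    qed
    have "\<exists>k. \<forall>w\<in>C. (\<forall>i<k. w i = sh z i) \<longrightarrow> (f w \<in> D m \<longleftrightarrow> f (sh z) \<in> D m)" for m
      using dec zC unfolding decides_def by blast
    then obtain k where k: "\<And>w m. w \<in> C \<Longrightarrow> (\<And>i. i < k m \<Longrightarrow> w i = sh z i) \<Longrightarrow> (f w \<in> D m \<longleftrightarrow> f (sh z) \<in> D m)"
      by metis
    have "\<exists>w\<in>C'. w 0 = z 0 \<and> (f (sh w) \<in> D m \<longleftrightarrow> f (sh z) \<in> D m)" for m
    proof -
      obtain w where w: "w \<in> C'" "\<forall>i<Suc (k m). w i = z i" using z by blast
      moreover have "sh w \<in> C" using w(1) by (simp add: C'_def)
      moreover have "\<And>i. i < k m \<Longrightarrow> sh w i = sh z i" using w(2) by (simp add: sh_def)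
      ultimately show ?thesis using k[of "sh w" m] by (intro bexI[of _ w]) auto
    qed
    then obtain w where w: "\<And>m. w m \<in> C'" "\<And>m. w m 0 = z 0" "\<And>m. f (sh (w m)) \<in> D m \<longleftrightarrow> f (sh z) \<in> D m"
      by metis
    have "case z 0 of 0 \<Rightarrow> \<forall>m. f (sh z) \<notin> D m | Suc m \<Rightarrow> f (sh z) \<in> D m"
    proof (cases "z 0")
      case 0
      have "f (sh z) \<notin> D m" for m using w(1)[of m] w(2)[of m] w(3)[of m] 0 by (simp add: C'_def)
      with 0 show ?thesis by simp
    next
      case (Suc m)
      then show ?thesis using w(1)[of m] w(2)[of m] w(3)[of m] by (simp add: C'_def)
    qed
    with zC show "z \<in> C'" by (simp add: C'_def)
  qed
  have image: "f' ` C' = f ` C"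
  proof safe
    fix z assume "z \<in> C'" then show "f' z \<in> f ` C" by (auto simp: C'_def f'_def)
  next
    fix v assume v: "v \<in> C"
    have "\<exists>n. case n of 0 \<Rightarrow> \<forall>m. f v \<notin> D m | Suc m \<Rightarrow> f v \<in> D m"
    proof (cases "\<exists>m. f v \<in> D m")
      case True
      then obtain m where "f v \<in> D m" ..
      then show ?thesis by (intro exI[of _ "Suc m"]) simp
    next
      case False
      then show ?thesis by (intro exI[of _ 0]) simp
    qed
    then obtain n where n: "case n of 0 \<Rightarrow> \<forall>m. f v \<notin> D m | Suc m \<Rightarrow> f v \<in> D m" ..
    have [simp]: "sh (case_nat k v) = v" for k by (auto simp: sh_def)
    show "f v \<in> f' ` C'" using v n by (intro image_eqI[of _ _ "case_nat n v"]) (auto simp: C'_def f'_def split: nat.splits)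
  qed
  have union: "decides C' f' (\<Union>m. D m)" unfolding decides_def
  proof
    fix z assume z: "z \<in> C'"
    have *: "f' w \<in> (\<Union>m. D m) \<longleftrightarrow> w 0 \<noteq> 0" if "w \<in> C'" for w
      using that unfolding C'_def f'_def by (auto split: nat.splits)
    show "\<exists>k. \<forall>w\<in>C'. (\<forall>i<k. w i = z i) \<longrightarrow> (f' w \<in> (\<Union>m. D m) \<longleftrightarrow> f' z \<in> (\<Union>m. D m))"
    proof (intro exI[of _ 1] ballI impI)
      fix w assume "w \<in> C'" "\<forall>i<1. w i = z i"
      then show "f' w \<in> (\<Union>m. D m) \<longleftrightarrow> f' z \<in> (\<Union>m. D m)" using *[of w] *[of z] z by simp
    qed
  qed
  have "decides C' f' E" if E: "decides C f E" for E
    unfolding decides_def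
  proof
    fix z assume "z \<in> C'"
    then have "sh z \<in> C" by (simp add: C'_def)
    then obtain k where k: "\<And>w. w \<in> C \<Longrightarrow> (\<And>i. i < k \<Longrightarrow> w i = sh z i) \<Longrightarrow> (f w \<in> E \<longleftrightarrow> f (sh z) \<in> E)"
      using decides_mono[OF E] by metis
    show "\<exists>k. \<forall>w\<in>C'. (\<forall>i<k. w i = z i) \<longrightarrow> (f' w \<in> E \<longleftrightarrow> f' z \<in> E)"
    proof (intro exI[of _ "Suc k"] ballI impI)
      fix w assume "w \<in> C'" "\<forall>i<Suc k. w i = z i"
      then show "f' w \<in> E \<longleftrightarrow> f' z \<in> E" unfolding f'_def
        by (intro k) (auto simp: C'_def sh_def)
    qed
  qed
  with closed image union show ?thesis by (intro exI conjI allI impI)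
qed

text \<open>A standard Borel space is coded by the sequence of truth values of membership in a base; \<open>coding\<close>
  lists countably many conditions singling out the codes of points, so that completeness of the
  metric is used only here.\<close>

definition coding :: "(nat \<Rightarrow> nat \<Rightarrow> bool) \<Rightarrow> (nat \<Rightarrow> nat \<Rightarrow> bool) \<Rightarrow> (nat \<Rightarrow> nat \<Rightarrow> bool) \<Rightarrow> (nat \<Rightarrow> bool) \<Rightarrow> bool" where
  "coding small meets inn \<omega> \<longleftrightarrow> (\<forall>k. \<exists>p. small k p \<and> \<omega> p) \<and> (\<forall>p q. \<omega> p \<and> \<omega> q \<longrightarrow> meets p q) \<and>
     (\<forall>p. \<omega> p \<longrightarrow> (\<exists>q. inn q p \<and> \<omega> q)) \<and> (\<forall>p q. inn q p \<and> \<omega> q \<longrightarrow> \<omega> p)"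

text \<open>\<open>small\<close> bounds diameters, \<open>meets\<close> is nonempty intersection,
  and \<open>inn q p\<close> gives a uniform neighbourhood of \<open>U q\<close> inside
  \<open>U p\<close>. A code with pairwise meeting members of arbitrarily small diameter yields a
  Cauchy sequence, and its limit is the coded point. The uniformity in \<open>inn\<close> is what
  survives the passage to the limit, where mere containment would not.\<close>

lemma standard_borel_coding:
  assumes "standard_borel_space M"
  obtains U small meets inn where
    "\<And>p::nat. U p \<in> sets M" "sets M = sigma_sets (space M) (range U)"
    "\<And>x. x \<in> space M \<Longrightarrow> coding small meets inn (\<lambda>p. x \<in> U p)"
    "\<And>\<omega>. coding small meets inn \<omega> \<Longrightarrow> \<exists>x\<in>space M. \<forall>p. \<omega> p \<longleftrightarrow> x \<in> U p"
    "\<And>x y. x \<in> space M \<Longrightarrow> y \<in> space M \<Longrightarrow> (\<And>p. x \<in> U p \<longleftrightarrow> y \<in> U p) \<Longrightarrow> x = y"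
proof -
  from assms obtain X where cm: "completely_metrizable_space X" and sc: "second_countable X"
    and tX: "topspace X = space M" and sM: "sets M = sigma_sets (space M) {U. openin X U}"
    unfolding standard_borel_space_def by blast
  from cm obtain S d where met: "Metric_space S d" and comp: "Metric_space.mcomplete S d"
    and X: "X = Metric_space.mtopology S d" unfolding completely_metrizable_space_def by blast
  interpret Metric_space S d by (rule met)
  have S: "S = space M" using tX X by simp
  from sc obtain \<B> where B: "countable \<B>" "\<forall>V\<in>\<B>. openin X V"
    "\<forall>U x. openin X U \<and> x \<in> U \<longrightarrow> (\<exists>V\<in>\<B>. x \<in> V \<and> V \<subseteq> U)"
    unfolding second_countable_def by (elim exE conjE) (rule that)
  define U where "U = from_nat_into (insert {} \<B>)"
  have rU: "range U = insert {} \<B>" unfolding U_def by (rule range_from_nat_into) (use B(1) in simp_all)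
  have Uo: "openin X (U p)" for p
  proof -
    have "U p \<in> insert {} \<B>" using rU by blast
    then show ?thesis using B(2) by auto
  qed
  have US: "U p \<subseteq> S" for p using Uo[of p] X openin_mtopology by auto
  have Ub: "\<exists>p. x \<in> U p \<and> U p \<subseteq> mball x r" if "x \<in> S" "r > 0" for x r
  proof -
    have "openin X (mball x r)" "x \<in> mball x r" using that X by auto
    with B(3) obtain V where V: "V \<in> \<B>" "x \<in> V" "V \<subseteq> mball x r" by blast
    then obtain p where "U p = V" using rU by (metis insertCI rangeE)
    then show ?thesis using V by blast
  qed
  define small where "small k p \<longleftrightarrow> (\<forall>x\<in>U p. \<forall>y\<in>U p. d x y \<le> (1/2)^k)" for k :: nat and p
  define meets where "meets p q \<longleftrightarrow> U p \<inter> U q \<noteq> {}" for p q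
  define inn where "inn q p \<longleftrightarrow> (\<exists>\<epsilon>>0. \<forall>x\<in>U q. mball x \<epsilon> \<subseteq> U p)" for q p
  show thesis
  proof
    show "U p \<in> sets M" for p using Uo sM by blast
    show "sets M = sigma_sets (space M) (range U)"
    proof
      show "sigma_sets (space M) (range U) \<subseteq> sets M"
        using Uo sM by (intro sets.sigma_sets_subset) auto
      have "W \<in> sigma_sets (space M) (range U)" if W: "openin X W" for W
      proof -
        have "W = (\<Union>p\<in>{p. U p \<subseteq> W}. U p)"
        proof safe
          fix x assume "x \<in> W"
          then obtain V where "V \<in> \<B>" "x \<in> V" "V \<subseteq> W" using B(3) W by blast
          moreover then obtain p where "U p = V" using rU by (metis insertCI rangeE)
          ultimately show "x \<in> (\<Union>p\<in>{p. U p \<subseteq> W}. U p)" by auto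
        qed auto
        moreover have "(\<Union>p\<in>{p. U p \<subseteq> W}. U p) \<in> sigma_sets (space M) (range U)"
          by (rule sigma_sets_UNION) auto
        ultimately show ?thesis by simp
      qed
      then have "sigma_sets (space M) {U. openin X U} \<subseteq> sigma_sets (space M) (range U)"
        by (intro sigma_sets_mono) auto
      then show "sets M \<subseteq> sigma_sets (space M) (range U)" using sM by simp
    qed
  next
    fix x assume "x \<in> space M"
    then have x: "x \<in> S" by (simp add: S)
    have "\<exists>p. small k p \<and> x \<in> U p" for k
    proof -
      obtain p where p: "x \<in> U p" "U p \<subseteq> mball x ((1/2)^k/2)" using Ub[OF x, of "(1/2)^k/2"] by auto
      have "d y z \<le> (1/2)^k" if "y \<in> U p" "z \<in> U p" for y z
      proof -
        have "d x y < (1/2)^k/2" "d x z < (1/2)^k/2" "y \<in> S" "z \<in> S" using p that by auto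
        then show ?thesis using triangle[of y x z] x commute[of x y] by simp
      qed
      then show ?thesis using p unfolding small_def by blast
    qed
    moreover have "\<exists>q. inn q p \<and> x \<in> U q" if xp: "x \<in> U p" for p
    proof -
      have "openin mtopology (U p)" using Uo[of p] X by simp
      then obtain r where r: "r > 0" "mball x r \<subseteq> U p" using xp unfolding openin_mtopology by blast
      obtain q where q: "x \<in> U q" "U q \<subseteq> mball x (r/2)" using Ub[OF x, of "r/2"] r by auto
      have "mball y (r/2) \<subseteq> U p" if "y \<in> U q" for y
      proof
        fix z assume z: "z \<in> mball y (r/2)"
        have "d x y < r/2" "y \<in> S" using that q by auto
        then have "z \<in> mball x r" using z x triangle[of x y z] by auto
        then show "z \<in> U p" using r by blast
      qed
      then show ?thesis using q r unfolding inn_def by (metis half_gt_zero)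
    qed
    moreover have "x \<in> U p" if "inn q p" "x \<in> U q" for p q
      using that x unfolding inn_def by (meson centre_in_mball_iff subsetD)
    ultimately show "coding small meets inn (\<lambda>p. x \<in> U p)"
      unfolding coding_def meets_def by blast
  next
    fix \<omega> assume \<omega>: "coding small meets inn \<omega>"
    then have "\<forall>k. \<exists>p. small k p \<and> \<omega> p" unfolding coding_def by blast
    then obtain p where p: "\<And>k. small k (p k)" "\<And>k. \<omega> (p k)" by metis
    have mts: "\<exists>y. y \<in> U q \<and> y \<in> U q'" if "\<omega> q" "\<omega> q'" for q q'
      using \<omega> that unfolding coding_def meets_def by blast
    \<comment> \<open>\<open>meets\<close> between a set and itself means nonemptiness. This keeps
      the empty member of the base, which is \<open>small\<close> for every \<open>k\<close>, out of
      all codes.\<close>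
    have "\<forall>k. \<exists>x. x \<in> U (p k)" using mts[OF p(2) p(2)] by blast
    then obtain x where x: "\<And>k. x k \<in> U (p k)" by metis
    have xS: "x k \<in> S" for k using x US by blast
    have close: "\<exists>y\<in>U q. d (x k) y \<le> (1/2)^k" if "\<omega> q" for q k
      using mts[OF p(2) that, of k] p(1)[of k] x[of k] unfolding small_def by blast
    have cau: "d (x k) (x l) \<le> (1/2)^k + (1/2)^l" for k l
    proof -
      obtain y where y: "y \<in> U (p k)" "y \<in> U (p l)" using mts[OF p(2) p(2)] by blast
      have "d (x k) y \<le> (1/2)^k" "d (x l) y \<le> (1/2)^l" "y \<in> S"
        using p(1) x y US unfolding small_def by blast+
      then show ?thesis using triangle[of "x k" y "x l"] xS commute[of "x l" y] by simp
    qed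
    have "MCauchy x" unfolding MCauchy_def
    proof (intro conjI allI impI)
      show "range x \<subseteq> S" using xS by blast
      fix \<epsilon> :: real assume "\<epsilon> > 0"
      then obtain N where N: "(1/2)^N < \<epsilon>/2" using real_arch_pow_inv[of "\<epsilon>/2" "1/2"] by auto
      have "d (x n) (x n') < \<epsilon>" if "N \<le> n" "N \<le> n'" for n n'
      proof -
        have "(1/2::real)^n \<le> (1/2)^N" "(1/2::real)^n' \<le> (1/2)^N" using that by (auto intro: power_decreasing)
        then show ?thesis using cau[of n n'] N by linarith
      qed
      then show "\<exists>N. \<forall>n n'. N \<le> n \<longrightarrow> N \<le> n' \<longrightarrow> d (x n) (x n') < \<epsilon>" by blast
    qed
    then obtain l where "limitin mtopology x l sequentially" using comp unfolding mcomplete_def by blast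
    then have l: "l \<in> S" and lim: "\<And>\<epsilon>. \<epsilon> > 0 \<Longrightarrow> \<exists>N. \<forall>n\<ge>N. d (x n) l < \<epsilon>"
      unfolding limit_metric_sequentially by blast+
    have big: "\<exists>k. (1/2)^k < \<epsilon> \<and> d (x k) l < \<epsilon>" if e: "\<epsilon> > 0" for \<epsilon> :: real
    proof -
      obtain N where N: "\<forall>n\<ge>N. d (x n) l < \<epsilon>" using lim[OF e] by blast
      obtain m where m: "(1/2)^m < \<epsilon>" using real_arch_pow_inv[of \<epsilon> "1/2"] e by auto
      have "(1/2::real)^(max N m) \<le> (1/2)^m" by (intro power_decreasing) auto
      then have "(1/2)^(max N m) < \<epsilon>" using m by linarith
      then show ?thesis using N by (intro exI[of _ "max N m"]) simp
    qed
    have "\<omega> q \<longleftrightarrow> l \<in> U q" for q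
    proof
      assume "\<omega> q"
      then obtain q' where q': "inn q' q" "\<omega> q'" using \<omega> unfolding coding_def by blast
      then obtain \<epsilon> where e: "\<epsilon> > 0" "\<And>y. y\<in>U q' \<Longrightarrow> mball y \<epsilon> \<subseteq> U q" unfolding inn_def by blast
      obtain k where k: "(1/2)^k < \<epsilon>/2" "d (x k) l < \<epsilon>/2" using big[of "\<epsilon>/2"] e by auto
      obtain y where y: "y \<in> U q'" "d (x k) y \<le> (1/2)^k" using close[OF q'(2)] by blast
      have "y \<in> S" using y US by blast
      then have "d y l < \<epsilon>" using triangle[of y "x k" l] xS l k y commute[of y "x k"] by auto
      then have "l \<in> mball y \<epsilon>" using \<open>y \<in> S\<close> l by auto
      then show "l \<in> U q" using e y by blast
    next
      assume lq: "l \<in> U q"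
      have "openin mtopology (U q)" using Uo[of q] X by simp
      then obtain r where r: "r > 0" "mball l r \<subseteq> U q" using lq unfolding openin_mtopology by blast
      obtain k where k: "(1/2)^k < r/3" "d (x k) l < r/3" using big[of "r/3"] r by auto
      \<comment> \<open>Three thirds of \<open>r\<close>: from \<open>l\<close> to
        \<open>x k\<close>, across \<open>U (p k)\<close>, and out to its neighbourhood.\<close>
      have "inn (p k) q" unfolding inn_def
      proof (intro exI conjI ballI subsetI)
        show "r/3 > 0" using r by simp
        fix y z assume y: "y \<in> U (p k)" and z: "z \<in> mball y (r/3)"
        have "d (x k) y \<le> (1/2)^k" "y \<in> S" using p(1) x y US unfolding small_def by blast+
        then have "d l z < r" using triangle[of l "x k" y] triangle[of l y z] xS l k z commute[of l "x k"] by auto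
        then have "z \<in> mball l r" using l z by auto
        then show "z \<in> U q" using r by blast
      qed
      then show "\<omega> q" using p(2)[of k] \<omega> unfolding coding_def by blast
    qed
    then show "\<exists>x\<in>space M. \<forall>p. \<omega> p \<longleftrightarrow> x \<in> U p" using l S by blast
  next
    fix x y assume xy: "x \<in> space M" "y \<in> space M" and e: "\<And>p. x \<in> U p \<longleftrightarrow> y \<in> U p"
    show "x = y"
    proof (rule ccontr)
      assume "x \<noteq> y"
      then have "d x y > 0" using xy S by auto
      then obtain p where "x \<in> U p" "U p \<subseteq> mball x (d x y)" using Ub xy S by blast
      then show False using e[of p] by auto
    qed
  qed
qed

section \<open>Standard Borel spaces as images of closed sets of sequences\<close>

lemma closedN_approx:
  fixes C :: "(nat \<Rightarrow> nat) set"
  assumes "\<forall>k. \<exists>w\<in>C. \<forall>i<k. w i = z i" "finite J"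
  shows "\<exists>w\<in>C. \<forall>j\<in>J. w j = z j"
proof -
  obtain k where "\<forall>j\<in>J. j < k" using assms(2) using finite_nat_set_iff_bounded by blast
  moreover obtain w where "w \<in> C" "\<forall>i<k. w i = z i" using assms(1) by blast
  ultimately show ?thesis by (intro bexI[of _ w]) auto
qed

text \<open>The existential clauses of \<open>coding\<close> are not closed conditions, so a
  sequence carries witnesses as well. Strand 0 is the code (nonzero means membership), strand 1
  picks a small member for each \<open>k\<close>, and strand 2 picks an inner member for each
  \<open>p\<close>.\<close>

lemma standard_borel_base_rep:
  assumes pts: "\<And>x. x \<in> S \<Longrightarrow> coding small meets inn (\<lambda>p. x \<in> U p)"
    and ex: "\<And>\<omega>. coding small meets inn \<omega> \<Longrightarrow> \<exists>x\<in>S. \<forall>p. \<omega> p \<longleftrightarrow> x \<in> U p"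
    and sep: "\<And>x y. x \<in> S \<Longrightarrow> y \<in> S \<Longrightarrow> (\<And>p. x \<in> U p \<longleftrightarrow> y \<in> U p) \<Longrightarrow> x = y"
  obtains C f where "closedN C" "f ` C = S" "\<And>p::nat. decides C f (U p)"
proof -
  \<comment> \<open>For fixed \<open>k p q\<close> this inspects finitely many entries of
    \<open>z\<close>; the intersection over all \<open>k p q\<close> is therefore closed.\<close>
  define G where "G z k p q \<longleftrightarrow> small k (strand 1 z k) \<and> strand 0 z (strand 1 z k) \<noteq> 0 \<and>
     (strand 0 z p \<noteq> 0 \<and> strand 0 z q \<noteq> 0 \<longrightarrow> meets p q) \<and>
     (strand 0 z p \<noteq> 0 \<longrightarrow> inn (strand 2 z p) p \<and> strand 0 z (strand 2 z p) \<noteq> 0) \<and>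
     (inn q p \<and> strand 0 z q \<noteq> 0 \<longrightarrow> strand 0 z p \<noteq> 0)" for z :: "nat \<Rightarrow> nat" and k p q
  define C where "C = {z. \<forall>k p q. G z k p q}"
  have cod: "coding small meets inn (\<lambda>p. strand 0 z p \<noteq> 0)" if "z \<in> C" for z
    using that unfolding C_def G_def coding_def by blast
  define f where "f z = (SOME x. x \<in> S \<and> (\<forall>p. strand 0 z p \<noteq> 0 \<longleftrightarrow> x \<in> U p))" for z
  have f: "f z \<in> S \<and> (\<forall>p. strand 0 z p \<noteq> 0 \<longleftrightarrow> f z \<in> U p)" if "z \<in> C" for z
    unfolding f_def by (rule someI_ex) (use ex[OF cod[OF that]] in blast)
  show thesis
  proof
    show "closedN C" unfolding closedN_def
    proof (intro allI impI)
      fix z assume z: "\<forall>k. \<exists>w\<in>C. \<forall>i<k. w i = z i"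
      have "G z k p q" for k p q
      proof -
        let ?J = "{prod_encode (1,k), prod_encode (0, strand 1 z k), prod_encode (0,p), prod_encode (0,q),
          prod_encode (2,p), prod_encode (0, strand 2 z p)}"
        obtain w where w: "w \<in> C" "\<forall>j\<in>?J. w j = z j" using closedN_approx[OF z, of ?J] by auto
        then have "strand 1 w k = strand 1 z k" "strand 0 w (strand 1 z k) = strand 0 z (strand 1 z k)"
          "strand 0 w p = strand 0 z p" "strand 0 w q = strand 0 z q" "strand 2 w p = strand 2 z p"
          "strand 0 w (strand 2 z p) = strand 0 z (strand 2 z p)"
          by (simp_all add: strand_def)
        moreover have "G w k p q" using w(1) by (simp add: C_def)
        ultimately show ?thesis unfolding G_def by simp
      qed
      then show "z \<in> C" unfolding C_def by blast
    qed
    show "f ` C = S"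
    proof safe
      fix z assume "z \<in> C" then show "f z \<in> S" using f by blast
    next
      fix x assume x: "x \<in> S"
      have cx: "coding small meets inn (\<lambda>p. x \<in> U p)" by (rule pts[OF x])
      then have "\<forall>k. \<exists>p. small k p \<and> x \<in> U p" unfolding coding_def by blast
      then obtain a where a: "\<And>k. small k (a k)" "\<And>k. x \<in> U (a k)" by metis
      have "\<forall>p. \<exists>q. x \<in> U p \<longrightarrow> inn q p \<and> x \<in> U q" using cx unfolding coding_def by blast
      then obtain c where c: "\<And>p. x \<in> U p \<Longrightarrow> inn (c p) p" "\<And>p. x \<in> U p \<Longrightarrow> x \<in> U (c p)" by metis
      obtain z where z: "\<forall>n. strand n z = (if n = 0 then (\<lambda>p. if x \<in> U p then 1 else 0) else if n = 1 then a else c)"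
        using strand_surj[of "\<lambda>n. (if n = 0 then (\<lambda>p. if x \<in> U p then 1 else 0) else if n = 1 then a else c)"] by blast
      have z0: "strand 0 z p \<noteq> 0 \<longleftrightarrow> x \<in> U p" for p using z by simp
      have z1: "strand 1 z = a" "strand 2 z = c" using z by auto
      have 1: "meets p q" if "x \<in> U p" "x \<in> U q" for p q using cx that unfolding coding_def by blast
      have 2: "x \<in> U p" if "x \<in> U q" "inn q p" for p q using cx that unfolding coding_def by blast
      have "G z k p q" for k p q unfolding G_def z0 z1
        using a[of k] c[of p] 1[of p q] 2[of q p] by simp
      then have zC: "z \<in> C" unfolding C_def by blast
      then have "f z = x" using f[OF zC] z0 x by (intro sep) auto
      then show "x \<in> f ` C" using zC by blast
    qed
    fix p
    show "decides C f (U p)" unfolding decides_def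
    proof
      fix z assume z: "z \<in> C"
      show "\<exists>k. \<forall>w\<in>C. (\<forall>i<k. w i = z i) \<longrightarrow> (f w \<in> U p \<longleftrightarrow> f z \<in> U p)"
      proof (intro exI[of _ "Suc (prod_encode (0,p))"] ballI impI)
        fix w assume "w \<in> C" "\<forall>i<Suc (prod_encode (0,p)). w i = z i"
        then have "w (prod_encode (0,p)) = z (prod_encode (0,p))" by simp
        then have "strand 0 w p = strand 0 z p" by (simp add: strand_def)
        then show "f w \<in> U p \<longleftrightarrow> f z \<in> U p" using f[OF \<open>w \<in> C\<close>] f[OF z] by metis
      qed
    qed
  qed
qed

text \<open>Induction over the generated sigma-algebra. Complements cost nothing because
  \<open>decides\<close> is symmetric in membership and non-membership; for countable unions a fibre
  product decides all members at once and a certificate then decides the union. A last fibre product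
  treats the whole family \<open>\<D>\<close>.\<close>

lemma standard_borel_rep:
  assumes sb: "standard_borel_space M" and "countable \<D>" "\<D> \<subseteq> sets M"
  obtains C f where "closedN C" "f ` C = space M" "\<And>D. D \<in> \<D> \<Longrightarrow> decides C f D"
proof -
  obtain U small meets inn where
    U: "\<And>p::nat. U p \<in> sets M" and gen: "sets M = sigma_sets (space M) (range U)" and
    pts: "\<And>x. x \<in> space M \<Longrightarrow> coding small meets inn (\<lambda>p. x \<in> U p)" and
    ex: "\<And>\<omega>. coding small meets inn \<omega> \<Longrightarrow> \<exists>x\<in>space M. \<forall>p. \<omega> p \<longleftrightarrow> x \<in> U p" and
    sep: "\<And>x y. x \<in> space M \<Longrightarrow> y \<in> space M \<Longrightarrow> (\<And>p. x \<in> U p \<longleftrightarrow> y \<in> U p) \<Longrightarrow> x = y"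
      using standard_borel_coding[OF sb] by blast
  have sep': "\<exists>E\<in>range U. (x \<in> E) \<noteq> (y \<in> E)" if "x \<in> space M" "y \<in> space M" "x \<noteq> y" for x y
    using sep[OF that(1,2)] that(3) by blast
  obtain C0 f0 where
    base: "closedN C0" "f0 ` C0 = space M" "\<And>p. decides C0 f0 (U p)"
      using standard_borel_base_rep[where S="space M", OF pts ex sep] by blast
  \<comment> \<open>The base sets are carried along in the induction because every fibre product
    needs a separating family that all its factors decide.\<close>
  define P where "P D \<longleftrightarrow> (\<exists>C f. closedN C \<and> f ` C = space M \<and> (\<forall>p. decides C f (U p)) \<and> decides C f D)" for D
  have fibre_count: "\<exists>C f. closedN C \<and> f ` C = space M \<and> (\<forall>p. decides C f (U p)) \<and> (\<forall>i. decides C f (D i))"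
    if "\<And>i. P (D i)" for D :: "nat \<Rightarrow> 'a set"
  proof -
    have "\<forall>i. \<exists>C f. closedN C \<and> f ` C = space M \<and> (\<forall>p. decides C f (U p)) \<and> decides C f (D i)"
      using that unfolding P_def by blast
    then obtain C f where Cf: "\<And>i. closedN (C i)" "\<And>i. f i ` C i = space M"
      "\<And>i p. decides (C i) (f i) (U p)" "\<And>i. decides (C i) (f i) (D i)" by metis
    have dec: "\<And>n E. E \<in> range U \<Longrightarrow> decides (C n) (f n) E" using Cf(3) by auto
    have sub: "\<And>n. f n ` C n \<subseteq> space M" using Cf(2) by blast
    obtain C' f' where C': "closedN C'" "f' ` C' = (\<Inter>n. f n ` C n)"
      "\<forall>n D. decides (C n) (f n) D \<longrightarrow> decides C' f' D"
  proof -
    have "\<exists>C' f'. closedN C' \<and> f' ` C' = (\<Inter>n. f n ` C n) \<and> (\<forall>n D. decides (C n) (f n) D \<longrightarrow> decides C' f' D)"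
      by (rule fibre_product[where X="space M" and \<E>="range U"], rule Cf(1), rule dec, assumption, rule sub,
        rule sep', assumption+)
    then show thesis using that by (elim exE conjE) (rule that)
  qed
    have "f' ` C' = space M" using C'(2) Cf(2) by simp
    moreover have "decides C' f' (U p)" for p using C'(3) Cf(3)[of 0 p] by (elim allE impE)
    moreover have "decides C' f' (D i)" for i using C'(3) Cf(4)[of i] by (elim allE impE)
    ultimately show ?thesis using C'(1) by (intro exI conjI allI)
  qed
  have "P D" if "D \<in> sigma_sets (space M) (range U)" for D
    using that
  proof induction
    case (Basic a)
    then show ?case unfolding P_def using base by blast
  next
    case Empty
    have "decides C0 f0 {}" unfolding decides_def by simp
    then show ?case unfolding P_def using base by blast
  next
    case (Compl a)
    then obtain C f where Cf: "closedN C" "f ` C = space M" "\<forall>p. decides C f (U p)" "decides C f a"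
      unfolding P_def by blast
    have "f w \<in> space M" if "w \<in> C" for w using that Cf(2) by blast
    then have "decides C f (space M - a)" using Cf(4) unfolding decides_def by auto
    then show ?case using Cf unfolding P_def by blast
  next
    case (Union a)
    from fibre_count[of a, OF Union(2)] obtain C f where Cf: "closedN C" "f ` C = space M" "\<forall>p. decides C f (U p)"
      "\<And>i. decides C f (a i)" by blast
    obtain C' f' where "closedN C'" "f' ` C' = f ` C" "decides C' f' (\<Union>m. a m)"
      "\<forall>E. decides C f E \<longrightarrow> decides C' f' E"
      using closedN_refine_Union[where D=a, OF Cf(1,4)] by (elim exE conjE) (rule that)
    then show ?case using Cf unfolding P_def by (intro exI[of _ C'] exI[of _ f'] conjI allI) simp_all
  qed
  then have P: "P D" if "D \<in> sets M" for D using gen that by blast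
  define e where "e = from_nat_into (insert {} \<D>)"
  have re: "range e = insert {} \<D>" unfolding e_def by (rule range_from_nat_into) (use assms(2) in simp_all)
  then have "P (e i)" for i using assms(3) P[of "e i"] by (metis insert_iff rangeI sets.empty_sets subsetD)
  from fibre_count[of e, OF this] obtain C f where Cf: "closedN C" "f ` C = space M" "\<And>i. decides C f (e i)" by blast
  show thesis
  proof (rule that[OF Cf(1,2)])
    fix D assume "D \<in> \<D>"
    then obtain i where "D = e i" using re by blast
    then show "decides C f D" using Cf(3) by simp
  qed
qed

text \<open>Analytic sets are continuous images of closed subsets of Baire space. No topology is
  fixed on the target: quantifying over all countable Borel families amounts to continuity for every
  refinement of the topology by countably many Borel sets.\<close>

definition analytic_in :: "'a measure \<Rightarrow> 'a set \<Rightarrow> bool" where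
  "analytic_in M A \<longleftrightarrow> (\<forall>\<D>. countable \<D> \<and> \<D> \<subseteq> sets M \<longrightarrow>
     (\<exists>C f. closedN C \<and> f ` C = A \<and> (\<forall>D\<in>\<D>. decides C f D)))"

lemma analytic_inD:
  assumes "analytic_in M A" "countable \<D>" "\<D> \<subseteq> sets M"
  shows "\<exists>C f. closedN C \<and> f ` C = A \<and> (\<forall>D\<in>\<D>. decides C f D)"
  using assms(1)[unfolded analytic_in_def, rule_format, of \<D>] assms(2,3) by simp

lemma analytic_in_space: "standard_borel_space M \<Longrightarrow> analytic_in M (space M)"
  unfolding analytic_in_def
proof (intro allI impI)
  fix \<D> assume "standard_borel_space M" and D: "countable \<D> \<and> \<D> \<subseteq> sets M"
  then obtain C f where "closedN C" "f ` C = space M" "\<And>D. D \<in> \<D> \<Longrightarrow> decides C f D"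
    using standard_borel_rep[of M \<D>] by auto
  then show "\<exists>C f. closedN C \<and> f ` C = space M \<and> (\<forall>D\<in>\<D>. decides C f D)" by blast
qed

lemma analytic_in_Int:
  assumes "analytic_in M A" "Z \<in> sets M"
  shows "analytic_in M (A \<inter> Z)"
  unfolding analytic_in_def
proof (intro allI impI)
  fix \<D> assume D: "countable \<D> \<and> \<D> \<subseteq> sets M"
  then have "countable (insert Z \<D>)" "insert Z \<D> \<subseteq> sets M" using assms(2) by simp_all
  then obtain C f where Cf: "closedN C" "f ` C = A" "\<forall>D\<in>insert Z \<D>. decides C f D"
    using analytic_inD[OF assms(1), of "insert Z \<D>"] by auto
  show "\<exists>C f. closedN C \<and> f ` C = A \<inter> Z \<and> (\<forall>D\<in>\<D>. decides C f D)"
  proof (intro exI conjI ballI)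
    show "closedN {z\<in>C. f z \<in> Z}" by (rule closedN_decided) (use Cf in auto)
    show "f ` {z\<in>C. f z \<in> Z} = A \<inter> Z" using Cf(2) by blast
    fix D assume "D \<in> \<D>"
    then have "decides C f D" using Cf(3) by simp
    then show "decides {z\<in>C. f z \<in> Z} f D" by (rule decides_subset) simp
  qed
qed

lemma analytic_in_sets:
  assumes "standard_borel_space M" "A \<in> sets M"
  shows "analytic_in M A"
proof -
  have "space M \<inter> A = A" using sets.sets_into_space[OF assms(2)] by blast
  then show ?thesis using analytic_in_Int[OF analytic_in_space[OF assms(1)] assms(2)] by simp
qed

text \<open>A single representation suffices as soon as it decides a separating family. Its fibre
  product with a representation of the whole space that decides \<open>\<D>\<close> has the same
  image and decides \<open>\<D>\<close> too.\<close>

lemma analytic_in_rep: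
  assumes sb: "standard_borel_space M" and C: "closedN C" "f ` C \<subseteq> space M"
    and E: "countable \<E>" "\<E> \<subseteq> sets M" "\<And>E. E \<in> \<E> \<Longrightarrow> decides C f E"
    and sep: "\<And>x y. x \<in> space M \<Longrightarrow> y \<in> space M \<Longrightarrow> x \<noteq> y \<Longrightarrow> \<exists>E\<in>\<E>. (x \<in> E) \<noteq> (y \<in> E)"
  shows "analytic_in M (f ` C)"
  unfolding analytic_in_def
proof (intro allI impI)
  fix \<D> assume D: "countable \<D> \<and> \<D> \<subseteq> sets M"
  then have un: "countable (\<D> \<union> \<E>)" "\<D> \<union> \<E> \<subseteq> sets M" using E by auto
  obtain C1 f1 where
    1: "closedN C1" "f1 ` C1 = space M" "\<And>D. D \<in> \<D> \<union> \<E> \<Longrightarrow> decides C1 f1 D"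
      using standard_borel_rep[OF sb un] by blast
  define Cn where "Cn n = (if n = 0 then C else C1)" for n :: nat
  define fn where "fn n = (if n = 0 then f else f1)" for n :: nat
  have a: "closedN (Cn n)" for n using C 1 by (simp add: Cn_def)
  have b: "decides (Cn n) (fn n) E" if "E \<in> \<E>" for n E using that 1 E by (simp add: Cn_def fn_def)
  have c: "fn n ` Cn n \<subseteq> space M" for n using C 1 by (simp add: Cn_def fn_def)
  obtain C' f' where C': "closedN C'" "f' ` C' = (\<Inter>n. fn n ` Cn n)"
    "\<forall>n D. decides (Cn n) (fn n) D \<longrightarrow> decides C' f' D"
  proof -
    have "\<exists>C' f'. closedN C' \<and> f' ` C' = (\<Inter>n. fn n ` Cn n) \<and> (\<forall>n D. decides (Cn n) (fn n) D \<longrightarrow> decides C' f' D)"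
      by (rule fibre_product[where X="space M" and \<E>=\<E>], rule a, rule b, assumption, rule c,
        rule sep, assumption+)
    then show thesis using that by (elim exE conjE) (rule that)
  qed
  have "(\<Inter>n. fn n ` Cn n) = f ` C"
  proof
    have "(\<Inter>n. fn n ` Cn n) \<subseteq> fn 0 ` Cn 0" by blast
    then show "(\<Inter>n. fn n ` Cn n) \<subseteq> f ` C" by (simp add: fn_def Cn_def)
    show "f ` C \<subseteq> (\<Inter>n. fn n ` Cn n)" using C 1 by (auto simp: fn_def Cn_def)
  qed
  moreover have "decides C' f' D" if "D \<in> \<D>" for D
    by (rule C'(3)[rule_format, of 1]) (use 1(3) that in \<open>simp add: Cn_def fn_def\<close>)
  ultimately show "\<exists>C' f'. closedN C' \<and> f' ` C' = f ` C \<and> (\<forall>D\<in>\<D>. decides C' f' D)"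
    using C' by metis
qed

section \<open>Lusin separation for finite families with empty intersection\<close>

definition borel_separated :: "'b measure \<Rightarrow> 'i set \<Rightarrow> ('i \<Rightarrow> 'b set) \<Rightarrow> bool" where
  "borel_separated N I A \<longleftrightarrow> (\<exists>H. (\<forall>i\<in>I. H i \<in> sets N \<and> A i \<subseteq> H i) \<and> (\<Inter>i\<in>I. H i) = {})"

text \<open>For each assignment of \<open>k\<close>-th entries let \<open>H\<close> be the
  separating hulls, and let \<open>K i\<close> collect the points that, for some \<open>n\<close>,
  lie in \<open>H \<nu> i\<close> for all assignments with \<open>\<nu> i = n\<close>. A point in
  every \<open>K i\<close> selects such an \<open>n i\<close> for each index; it then lies in all
  hulls of the assignment \<open>n\<close>, whose intersection is empty.\<close>

lemma borel_separated_countable_split: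
  fixes P :: "'i \<Rightarrow> (nat \<Rightarrow> nat) set"
  assumes I: "finite I" "I \<noteq> {}"
    and "\<And>\<nu>. \<nu> \<in> I \<rightarrow>\<^sub>E (UNIV :: nat set) \<Longrightarrow> borel_separated N I (\<lambda>i. g i ` {w\<in>P i. w k = \<nu> i})"
  shows "borel_separated N I (\<lambda>i. g i ` P i)"
proof -
  let ?V = "I \<rightarrow>\<^sub>E (UNIV :: nat set)"
  have "\<forall>\<nu>\<in>?V. \<exists>H. (\<forall>i\<in>I. H i \<in> sets N \<and> g i ` {w\<in>P i. w k = \<nu> i} \<subseteq> H i) \<and> (\<Inter>i\<in>I. H i) = {}"
    using assms(3) unfolding borel_separated_def by blast
  from bchoice[OF this] obtain H where H0: "\<forall>\<nu>\<in>?V.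
      (\<forall>i\<in>I. H \<nu> i \<in> sets N \<and> g i ` {w\<in>P i. w k = \<nu> i} \<subseteq> H \<nu> i) \<and> (\<Inter>i\<in>I. H \<nu> i) = {}" ..
  have H: "\<And>\<nu> i. \<nu> \<in> ?V \<Longrightarrow> i \<in> I \<Longrightarrow> H \<nu> i \<in> sets N"
     "\<And>\<nu> i. \<nu> \<in> ?V \<Longrightarrow> i \<in> I \<Longrightarrow> g i ` {w\<in>P i. w k = \<nu> i} \<subseteq> H \<nu> i"
     "\<And>\<nu>. \<nu> \<in> ?V \<Longrightarrow> (\<Inter>i\<in>I. H \<nu> i) = {}" using H0 by simp_all
  define K where "K i = (\<Union>n. \<Inter>\<nu>\<in>{\<nu>\<in>?V. \<nu> i = n}. H \<nu> i)" for i
  have cV: "countable ?V" by (rule countable_PiE) (use I in auto)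
  show ?thesis unfolding borel_separated_def
  proof (intro exI[of _ K] conjI ballI)
    fix i assume i: "i \<in> I"
    have "(\<Inter>\<nu>\<in>{\<nu>\<in>?V. \<nu> i = n}. H \<nu> i) \<in> sets N" for n
    proof -
      have "(\<lambda>j\<in>I. n) \<in> {\<nu>\<in>?V. \<nu> i = n}" using i by auto
      then have ne: "{\<nu>\<in>?V. \<nu> i = n} \<noteq> {}" by blast
      have co: "countable {\<nu>\<in>?V. \<nu> i = n}" using cV by (rule countable_subset[rotated]) auto
      show "(\<Inter>\<nu>\<in>{\<nu>\<in>?V. \<nu> i = n}. H \<nu> i) \<in> sets N"
        by (rule sets.countable_INT'[OF co ne]) (use H(1) i in auto)
    qed
    then show "K i \<in> sets N" unfolding K_def by (intro sets.countable_UN) auto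
    show "g i ` P i \<subseteq> K i"
    proof
      fix y assume "y \<in> g i ` P i"
      then obtain w where w: "w \<in> P i" "y = g i w" by blast
      have "y \<in> H \<nu> i" if "\<nu> \<in> ?V" "\<nu> i = w k" for \<nu> using H(2)[OF that(1) i] w that(2) by auto
      then show "y \<in> K i" unfolding K_def by (intro UN_I[of "w k"]) auto
    qed
  next
    show "(\<Inter>i\<in>I. K i) = {}"
    proof (rule ccontr)
      assume "(\<Inter>i\<in>I. K i) \<noteq> {}"
      then obtain y where y: "\<And>i. i \<in> I \<Longrightarrow> y \<in> K i" by blast
      then have "\<forall>i\<in>I. \<exists>n. \<forall>\<nu>\<in>{\<nu>\<in>?V. \<nu> i = n}. y \<in> H \<nu> i" unfolding K_def by simp
      from bchoice[OF this] obtain n where "\<forall>i\<in>I. \<forall>\<nu>\<in>{\<nu>\<in>?V. \<nu> i = n i}. y \<in> H \<nu> i" ..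
      then have n: "\<And>i \<nu>. i \<in> I \<Longrightarrow> \<nu> \<in> ?V \<Longrightarrow> \<nu> i = n i \<Longrightarrow> y \<in> H \<nu> i" by simp
      have V: "restrict n I \<in> ?V" by auto
      have "y \<in> (\<Inter>i\<in>I. H (restrict n I) i)" using n[OF _ V] by auto
      then show False using H(3)[OF V] by blast
    qed
  qed
qed

text \<open>Inseparability descends: by the splitting lemma some prescription of the next entries
  keeps the pieces inseparable. The limit is one point \<open>z i\<close> in each
  \<open>C i\<close>. Since the images have no common point, two limit values differ, and a set
  deciding between them separates the pieces at a finite stage.\<close>

lemma borel_separated_reps:
  fixes C :: "'i \<Rightarrow> (nat \<Rightarrow> nat) set" and g :: "'i \<Rightarrow> (nat \<Rightarrow> nat) \<Rightarrow> 'b"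
  assumes I: "finite I" "I \<noteq> {}"
    and C: "\<And>i. i \<in> I \<Longrightarrow> closedN (C i)" "\<And>i. i \<in> I \<Longrightarrow> g i ` C i \<subseteq> space N"
    and B: "\<B> \<subseteq> sets N" "\<And>i B. i \<in> I \<Longrightarrow> B \<in> \<B> \<Longrightarrow> decides (C i) (g i) B"
    and sep: "\<And>x y. x \<in> space N \<Longrightarrow> y \<in> space N \<Longrightarrow> x \<noteq> y \<Longrightarrow> \<exists>B\<in>\<B>. (x \<in> B) \<noteq> (y \<in> B)"
    and disj: "(\<Inter>i\<in>I. g i ` C i) = {}"
  shows "borel_separated N I (\<lambda>i. g i ` C i)"
proof (rule ccontr)
  let ?S = "\<lambda>P. borel_separated N I (\<lambda>i. g i ` P i)"
  assume "\<not> ?S C"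
  have "\<exists>F. \<forall>n. (\<not> ?S (F n) \<and> (n = 0 \<longrightarrow> F n = C)) \<and> (\<exists>\<nu>. F (Suc n) = (\<lambda>i. {w\<in>F n i. w n = \<nu> i}))"
  proof (rule dependent_nat_choice)
    show "\<exists>x. \<not> ?S x \<and> ((0::nat) = 0 \<longrightarrow> x = C)" using \<open>\<not> ?S C\<close> by blast
    fix P and n :: nat assume "\<not> ?S P \<and> (n = 0 \<longrightarrow> P = C)"
    then obtain \<nu> where "\<not> ?S (\<lambda>i. {w\<in>P i. w n = \<nu> i})"
      using borel_separated_countable_split[OF I, of N g P n] by blast
    then show "\<exists>y. (\<not> ?S y \<and> (Suc n = 0 \<longrightarrow> y = C)) \<and> (\<exists>\<nu>. y = (\<lambda>i. {w\<in>P i. w n = \<nu> i}))"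
      by (intro exI[of _ "\<lambda>i. {w\<in>P i. w n = \<nu> i}"]) auto
  qed
  then obtain F where F: "\<And>n. \<not> ?S (F n)" "F 0 = C" "\<And>n. \<exists>\<nu>. F (Suc n) = (\<lambda>i. {w\<in>F n i. w n = \<nu> i})" by blast
  have "\<forall>n. \<exists>\<nu>. F (Suc n) = (\<lambda>i. {w\<in>F n i. w n = \<nu> i})" using F(3) by simp
  from choice[OF this] obtain \<nu> where nu: "\<forall>n. F (Suc n) = (\<lambda>i. {w\<in>F n i. w n = \<nu> n i})" ..
  define z where "z i k = \<nu> k i" for i k
  have Feq: "F n i = {w\<in>C i. \<forall>j<n. w j = z i j}" for n i
    by (induction n) (auto simp: F(2) nu z_def less_Suc_eq)
  \<comment> \<open>Disjoint hulls for two of the indices are enough; every other index receives the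
    whole space.\<close>
  have sepI: "?S (F n)" if "i \<in> I" "B \<in> sets N" "B' \<in> sets N" "j \<in> I" "i \<noteq> j" "g i ` F n i \<subseteq> B" "g j ` F n j \<subseteq> B'" "B \<inter> B' = {}" for i j B B' n
    unfolding borel_separated_def
  proof (intro exI[of _ "\<lambda>l. if l = i then B else if l = j then B' else space N"] conjI ballI)
    fix l assume l: "l \<in> I"
    then show "(if l = i then B else if l = j then B' else space N) \<in> sets N" using that by simp
    have "g l ` F n l \<subseteq> space N" using C(2)[OF l] unfolding Feq by blast
    then show "g l ` F n l \<subseteq> (if l = i then B else if l = j then B' else space N)" using that by simp
  next
    show "(\<Inter>l\<in>I. if l = i then B else if l = j then B' else space N) = {}"
      using that(1,4,5,8) by (fastforce split: if_splits)
  qed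
  \<comment> \<open>An empty piece has the hull \<open>{}\<close>, which would separate the family.
    Nonempty pieces at all stages put \<open>z i\<close> into the closed set
    \<open>C i\<close>.\<close>
  have ne: "F n i \<noteq> {}" if "i \<in> I" for n i
  proof
    assume "F n i = {}"
    have "?S (F n)" unfolding borel_separated_def
    proof (intro exI[of _ "\<lambda>l. if l = i then {} else space N"] conjI ballI)
      fix l assume l: "l \<in> I"
      show "(if l = i then {} else space N) \<in> sets N" by simp
      have "g l ` F n l \<subseteq> space N" using C(2)[OF l] unfolding Feq by blast
      then show "g l ` F n l \<subseteq> (if l = i then {} else space N)" using \<open>F n i = {}\<close> by simp
    qed (use that in auto)
    then show False using F(1) by blast
  qed
  have zC: "z i \<in> C i" if "i \<in> I" for i
    by (rule closedND[OF C(1)[OF that]]) (use ne[OF that] Feq in blast)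
  obtain i0 where i0: "i0 \<in> I" using I by blast
  have "\<exists>i\<in>I. g i (z i) \<noteq> g i0 (z i0)"
  proof (rule ccontr)
    assume "\<not> (\<exists>i\<in>I. g i (z i) \<noteq> g i0 (z i0))"
    then have "\<forall>i\<in>I. g i0 (z i0) = g i (z i)" by auto
    then have "g i0 (z i0) \<in> (\<Inter>i\<in>I. g i ` C i)" using zC by blast
    then show False using disj by blast
  qed
  then obtain i where i: "i \<in> I" "g i (z i) \<noteq> g i0 (z i0)" by blast
  obtain B where B': "B \<in> \<B>" "(g i (z i) \<in> B) \<noteq> (g i0 (z i0) \<in> B)"
    using sep[OF _ _ i(2)] C(2) zC i i0 by blast
  have dk: "\<exists>k. \<forall>n\<ge>k. \<forall>w\<in>F n l. g l w \<in> B \<longleftrightarrow> g l (z l) \<in> B" if l: "l \<in> I" for l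
  proof -
    obtain k where k: "\<forall>w\<in>C l. (\<forall>i<k. w i = z l i) \<longrightarrow> (g l w \<in> B \<longleftrightarrow> g l (z l) \<in> B)"
      using B(2)[OF l B'(1)] zC[OF l] unfolding decides_def by blast
    show ?thesis
    proof (intro exI[of _ k] allI impI ballI)
      fix n w assume "k \<le> n" "w \<in> F n l"
      then have "w \<in> C l" "\<forall>i<k. w i = z l i" unfolding Feq by auto
      then show "g l w \<in> B \<longleftrightarrow> g l (z l) \<in> B" using k by blast
    qed
  qed
  obtain k where "\<forall>n\<ge>k. \<forall>w\<in>F n i. g i w \<in> B \<longleftrightarrow> g i (z i) \<in> B" using dk[OF i(1)] ..
  then have k: "\<And>n w. n \<ge> k \<Longrightarrow> w \<in> F n i \<Longrightarrow> g i w \<in> B \<longleftrightarrow> g i (z i) \<in> B" by simp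
  obtain k0 where "\<forall>n\<ge>k0. \<forall>w\<in>F n i0. g i0 w \<in> B \<longleftrightarrow> g i0 (z i0) \<in> B" using dk[OF i0] ..
  then have k0: "\<And>n w. n \<ge> k0 \<Longrightarrow> w \<in> F n i0 \<Longrightarrow> g i0 w \<in> B \<longleftrightarrow> g i0 (z i0) \<in> B" by simp
  define n where "n = max k k0"
  have n: "n \<ge> k" "n \<ge> k0" by (auto simp: n_def)
  have Bs: "B \<in> sets N" "space N - B \<in> sets N" using B(1) B'(1) by auto
  have sp: "g l w \<in> space N" if "l \<in> I" "w \<in> F n l" for l w using C(2) that unfolding Feq by blast
  have "i \<noteq> i0" using i by blast
  show False
  proof (cases "g i (z i) \<in> B")
    case True
    have "?S (F n)" by (rule sepI[of i B "space N - B" i0])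
      (use Bs i i0 \<open>i\<noteq>i0\<close> k[OF n(1)] k0[OF n(2)] True B'(2) sp in auto)
    then show False using F(1) by blast
  next
    case False
    have "?S (F n)" by (rule sepI[of i "space N - B" B i0])
      (use Bs i i0 \<open>i\<noteq>i0\<close> k[OF n(1)] k0[OF n(2)] False B'(2) sp in auto)
    then show False using F(1) by blast
  qed
qed

text \<open>Representations of the \<open>A i\<close> that decide the preimages of
  \<open>\<B>\<close> become, after composition with \<open>s\<close>, representations of the images
  that decide \<open>\<B>\<close>.\<close>

lemma analytic_separation:
  fixes A :: "'i \<Rightarrow> 'a set"
  assumes I: "finite I" "I \<noteq> {}"
    and A: "\<And>i. i \<in> I \<Longrightarrow> analytic_in M (A i)" "\<And>i. i \<in> I \<Longrightarrow> A i \<subseteq> space M"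
    and s: "s \<in> M \<rightarrow>\<^sub>M N" and B: "countable \<B>" "\<B> \<subseteq> sets N"
    and sep: "\<And>x y. x \<in> space N \<Longrightarrow> y \<in> space N \<Longrightarrow> x \<noteq> y \<Longrightarrow> \<exists>B\<in>\<B>. (x \<in> B) \<noteq> (y \<in> B)"
    and disj: "(\<Inter>i\<in>I. s ` A i) = {}"
  shows "borel_separated N I (\<lambda>i. s ` A i)"
proof -
  let ?D = "(\<lambda>B. s -` B \<inter> space M) ` \<B>"
  have D: "countable ?D" "?D \<subseteq> sets M" using B measurable_sets[OF s] by auto
  have "\<forall>i\<in>I. \<exists>C f. closedN C \<and> f ` C = A i \<and> (\<forall>D\<in>?D. decides C f D)"
  proof
    fix i assume "i \<in> I"
    show "\<exists>C f. closedN C \<and> f ` C = A i \<and> (\<forall>D\<in>?D. decides C f D)"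
      by (rule analytic_inD[OF A(1)[OF \<open>i \<in> I\<close>] D])
  qed
  from bchoice[OF this] obtain C where "\<forall>i\<in>I. \<exists>f. closedN (C i) \<and> f ` C i = A i \<and> (\<forall>D\<in>?D. decides (C i) f D)" ..
  from bchoice[OF this] obtain f where "\<forall>i\<in>I. closedN (C i) \<and> f i ` C i = A i \<and> (\<forall>D\<in>?D. decides (C i) (f i) D)" ..
  then have Cf: "\<And>i. i \<in> I \<Longrightarrow> closedN (C i)" "\<And>i. i \<in> I \<Longrightarrow> f i ` C i = A i"
    "\<And>i D. i \<in> I \<Longrightarrow> D \<in> ?D \<Longrightarrow> decides (C i) (f i) D" by auto
  have dec: "decides (C i) (\<lambda>z. s (f i z)) B" if "i \<in> I" "B \<in> \<B>" for i B
  proof -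
    have "decides (C i) (f i) (s -` B \<inter> space M)" using Cf(3)[OF that(1)] that(2) by blast
    moreover have "f i w \<in> space M" if "w \<in> C i" for w using Cf(2)[OF \<open>i \<in> I\<close>] A(2)[OF \<open>i \<in> I\<close>] that by blast
    ultimately show ?thesis unfolding decides_def by auto
  qed
  have im: "(\<lambda>z. s (f i z)) ` C i = s ` A i" if "i \<in> I" for i
    using Cf(2)[OF that] by (metis image_image)
  have "borel_separated N I (\<lambda>i. (\<lambda>z. s (f i z)) ` C i)"
  proof (rule borel_separated_reps[OF I _ _ B(2)])
    fix i assume i: "i \<in> I"
    show "closedN (C i)" by (rule Cf(1)[OF i])
  next
    fix i B assume "i \<in> I" "B \<in> \<B>"
    then show "decides (C i) (\<lambda>z. s (f i z)) B" by (rule dec)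
  next
    fix x y assume "x \<in> space N" "y \<in> space N" "x \<noteq> y"
    then show "\<exists>B\<in>\<B>. (x \<in> B) \<noteq> (y \<in> B)" by (rule sep)
  next
    fix i assume "i \<in> I"
    then show "(\<lambda>z. s (f i z)) ` C i \<subseteq> space N"
      unfolding im[OF \<open>i \<in> I\<close>] using A(2)[OF \<open>i \<in> I\<close>] measurable_space[OF s] by auto
  next
    show "(\<Inter>i\<in>I. (\<lambda>z. s (f i z)) ` C i) = {}" using im disj by simp
  qed
  then show ?thesis using im unfolding borel_separated_def by simp
qed

section \<open>The Lusin-Novikov theorem\<close>

text \<open>The setting of a dichotomy: either countably many Borel sets on which \<open>s\<close>
  is injective cover the space, or Cantor space embeds injectively into a single fibre. The fixed
  representation \<open>\<pi>\<close> decides the separating sets of \<open>M\<close> and the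
  preimages of those of \<open>N\<close>.\<close>

locale souslin_map =
  fixes M :: "'a measure" and N :: "'b measure" and s :: "'a \<Rightarrow> 'b"
    and \<B> :: "'b set set" and \<E> :: "'a set set"
    and C :: "(nat \<Rightarrow> nat) set" and \<pi> :: "(nat \<Rightarrow> nat) \<Rightarrow> 'a"
  assumes sb: "standard_borel_space M" and s: "s \<in> M \<rightarrow>\<^sub>M N"
    and B: "countable \<B>" "\<B> \<subseteq> sets N"
    and sepN: "\<And>x y. x \<in> space N \<Longrightarrow> y \<in> space N \<Longrightarrow> x \<noteq> y \<Longrightarrow> \<exists>B\<in>\<B>. (x \<in> B) \<noteq> (y \<in> B)"
    and E: "countable \<E>" "\<E> \<subseteq> sets M"
    and sepM: "\<And>x y. x \<in> space M \<Longrightarrow> y \<in> space M \<Longrightarrow> x \<noteq> y \<Longrightarrow> \<exists>E\<in>\<E>. (x \<in> E) \<noteq> (y \<in> E)"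
    and C: "closedN C" "\<pi> ` C = space M"
    and decE: "\<And>E. E \<in> \<E> \<Longrightarrow> decides C \<pi> E"
    and decB: "\<And>B. B \<in> \<B> \<Longrightarrow> decides C \<pi> (s -` B \<inter> space M)"
begin

text \<open>A sigma-ideal of subsets of \<open>M\<close>; the aim is to show that it contains the
  whole space when fibres are countable.\<close>

definition small :: "'a set \<Rightarrow> bool" where
  "small Z \<longleftrightarrow> (\<exists>\<F>. countable \<F> \<and> \<F> \<subseteq> sets M \<and> (\<forall>F\<in>\<F>. inj_on s F) \<and> Z \<subseteq> \<Union>\<F>)"

lemma small_subset: "small Z \<Longrightarrow> Z' \<subseteq> Z \<Longrightarrow> small Z'"
  unfolding small_def by (meson subset_trans)

lemma small_inj: "F \<in> sets M \<Longrightarrow> inj_on s F \<Longrightarrow> small F"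
  unfolding small_def by (rule exI[of _ "{F}"]) simp

text \<open>Separation applies to analytic sets. After removing a small set a piece stays analytic
  provided that the removed set is Borel.\<close>

lemma small_hull: "small Z \<Longrightarrow> \<exists>D\<in>sets M. Z \<subseteq> D \<and> small D"
  unfolding small_def
proof (elim exE conjE)
  fix \<F> assume F: "countable \<F>" "\<F> \<subseteq> sets M" "\<forall>F\<in>\<F>. inj_on s F" "Z \<subseteq> \<Union>\<F>"
  have "\<Union>\<F> \<in> sets M" using F(1,2) by (rule sets.countable_Union)
  then show "\<exists>D\<in>sets M. Z \<subseteq> D \<and> (\<exists>\<F>. countable \<F> \<and> \<F> \<subseteq> sets M \<and> (\<forall>F\<in>\<F>. inj_on s F) \<and> D \<subseteq> \<Union>\<F>)"
    by (intro bexI[of _ "\<Union>\<F>"] conjI exI[of _ \<F>]) (use F in auto)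
qed

lemma small_UN:
  assumes "countable I" "\<And>i. i \<in> I \<Longrightarrow> small (Z i)"
  shows "small (\<Union>i\<in>I. Z i)"
proof -
  have "\<forall>i\<in>I. \<exists>\<F>. countable \<F> \<and> \<F> \<subseteq> sets M \<and> (\<forall>F\<in>\<F>. inj_on s F) \<and> Z i \<subseteq> \<Union>\<F>"
    using assms(2) unfolding small_def by simp
  from bchoice[OF this] obtain \<F> where
    F: "\<forall>i\<in>I. countable (\<F> i) \<and> \<F> i \<subseteq> sets M \<and> (\<forall>F\<in>\<F> i. inj_on s F) \<and> Z i \<subseteq> \<Union>(\<F> i)" ..
  show ?thesis unfolding small_def
  proof (intro exI[of _ "\<Union>i\<in>I. \<F> i"] conjI ballI)
    show "countable (\<Union>i\<in>I. \<F> i)" using assms(1) F by auto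
  qed (use F in fastforce)+
qed

lemma small_empty: "small {}"
  unfolding small_def by (rule exI[of _ "{}"]) simp

lemma small_Un: "small A \<Longrightarrow> small A' \<Longrightarrow> small (A \<union> A')"
  using small_UN[of "UNIV :: bool set" "\<lambda>b. if b then A else A'"] by (simp add: UNIV_bool Un_commute)

section \<open>Cantor schemes in fibres\<close>

definition cyl :: "nat list \<Rightarrow> (nat \<Rightarrow> nat) set" where
  "cyl l = {z\<in>C. \<forall>i<length l. z i = l ! i}"

lemma cyl_sub: "cyl l \<subseteq> C" unfolding cyl_def by auto

lemma closedN_cyl: "closedN (cyl l)"
  unfolding closedN_def
proof (intro allI impI)
  fix z assume z: "\<forall>k. \<exists>w\<in>cyl l. \<forall>i<k. w i = z i"
  have "z \<in> C" by (rule closedND[OF C(1)]) (use z cyl_sub in \<open>meson subsetD\<close>)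
  moreover obtain w where "w \<in> cyl l" "\<forall>i<length l. w i = z i" using z[rule_format, of "length l"] by blast
  ultimately show "z \<in> cyl l" unfolding cyl_def by auto
qed

lemma analytic_cyl: "analytic_in M (\<pi> ` cyl l)"
proof (rule analytic_in_rep[OF sb closedN_cyl _ E])
  show "\<pi> ` cyl l \<subseteq> space M" using cyl_sub C(2) by auto
  fix E assume "E \<in> \<E>" then show "decides (cyl l) \<pi> E" using decE cyl_sub decides_subset by metis
next
  fix x y assume "x \<in> space M" "y \<in> space M" "x \<noteq> y"
  then show "\<exists>E\<in>\<E>. (x \<in> E) \<noteq> (y \<in> E)" by (rule sepM)
qed

definition lev :: "nat \<Rightarrow> bool list set" where "lev n = {t. length t = n}"

lemma finite_lev: "finite (lev n)"
  using finite_lists_length_eq[of "UNIV :: bool set" n] by (simp add: lev_def)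

lemma lev_ne: "lev n \<noteq> {}"
  unfolding lev_def using Ex_list_of_length by blast

lemma lev_Suc: "u \<in> lev (Suc n) \<longleftrightarrow> (\<exists>b. \<exists>t\<in>lev n. u = b # t)"
  unfolding lev_def by (auto simp: length_Suc_conv)

definition common :: "nat \<Rightarrow> (bool list \<Rightarrow> nat list) \<Rightarrow> 'b set" where
  "common n w = {y\<in>space N. \<forall>t\<in>lev n. y \<in> s ` \<pi> ` cyl (w t)}"

text \<open>An assignment \<open>w\<close> of prefixes to the bit strings of length \<open>n\<close> is one stage of a Cantor scheme in a
  fibre of \<open>s\<close>. Stages that are not \<open>covered\<close> can be extended, and infinitely many extensions produce an
  uncountable fibre; the initial stage is covered iff the whole space is \<open>small\<close>.\<close>

definition covered :: "nat \<Rightarrow> (bool list \<Rightarrow> nat list) \<Rightarrow> bool" where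
  "covered n w \<longleftrightarrow> (\<exists>B. (\<forall>t\<in>lev n. B t \<in> sets N \<and> small (s -` B t \<inter> \<pi> ` cyl (w t))) \<and> common n w \<subseteq> (\<Union>t\<in>lev n. B t))"

text \<open>Strictly growing prefixes make branches converge to points of \<open>C\<close>, and the
  set \<open>E\<close> keeps the \<open>\<pi>\<close>-images of the two children disjoint, which
  makes the limit map injective.\<close>

definition extends :: "nat \<Rightarrow> (bool list \<Rightarrow> nat list) \<Rightarrow> (bool list \<Rightarrow> nat list) \<Rightarrow> bool" where
  "extends n w w' \<longleftrightarrow> (\<forall>t\<in>lev n.
     (\<forall>b. length (w t) < length (w' (b # t)) \<and> (\<forall>i<length (w t). w' (b # t) ! i = w t ! i)) \<and>
     (\<exists>E\<in>\<E>. \<pi> ` cyl (w' (True # t)) \<subseteq> E \<and> \<pi> ` cyl (w' (False # t)) \<inter> E = {}))"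

text \<open>Membership of \<open>\<pi> (z t b)\<close> in \<open>\<epsilon> t\<close> is decided by
  a finite prefix of \<open>z t b\<close>. There are finitely many pieces, so one length
  \<open>K\<close>, also longer than the old prefixes, serves for all; the new prefixes are the
  first \<open>K\<close> entries of the points.\<close>

lemma separating_extension:
  assumes eps: "\<And>t. t \<in> lev n \<Longrightarrow> \<epsilon> t \<in> \<E>"
    and z: "\<And>t b. t \<in> lev n \<Longrightarrow> z t b \<in> cyl (w t)"
    and zT: "\<And>t. t \<in> lev n \<Longrightarrow> \<pi> (z t True) \<in> \<epsilon> t" and zF: "\<And>t. t \<in> lev n \<Longrightarrow> \<pi> (z t False) \<notin> \<epsilon> t"
  shows "\<exists>w'\<in>lev (Suc n) \<rightarrow>\<^sub>E UNIV. extends n w w' \<and> (\<forall>t\<in>lev n. \<forall>b. z t b \<in> cyl (w' (b # t)))"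
proof -
  have zC: "z t b \<in> C" if "t \<in> lev n" for t b using z[OF that] cyl_sub by blast
  have "\<forall>t\<in>lev n. \<forall>b. \<forall>\<^sub>F K in sequentially. length (w t) < K \<and> (\<forall>v\<in>C. (\<forall>i<K. v i = z t b i) \<longrightarrow> (\<pi> v \<in> \<epsilon> t \<longleftrightarrow> \<pi> (z t b) \<in> \<epsilon> t))"
  proof (intro ballI allI)
    fix t b assume t: "t \<in> lev n"
    obtain k where k: "\<forall>v\<in>C. (\<forall>i<k. v i = z t b i) \<longrightarrow> (\<pi> v \<in> \<epsilon> t \<longleftrightarrow> \<pi> (z t b) \<in> \<epsilon> t)"
      using decE[OF eps[OF t]] zC[OF t, of b] unfolding decides_def by blast
    show "\<forall>\<^sub>F K in sequentially. length (w t) < K \<and> (\<forall>v\<in>C. (\<forall>i<K. v i = z t b i) \<longrightarrow> (\<pi> v \<in> \<epsilon> t \<longleftrightarrow> \<pi> (z t b) \<in> \<epsilon> t))"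
      unfolding eventually_sequentially
    proof (intro exI[of _ "max k (Suc (length (w t)))"] allI impI conjI ballI)
      fix K v assume K: "max k (Suc (length (w t))) \<le> K"
      then show "length (w t) < K" by simp
      assume "v \<in> C" "\<forall>i<K. v i = z t b i"
      then show "\<pi> v \<in> \<epsilon> t \<longleftrightarrow> \<pi> (z t b) \<in> \<epsilon> t" using k K by simp
    qed
  qed
  then have "\<forall>t\<in>lev n. \<forall>\<^sub>F K in sequentially. \<forall>b\<in>UNIV. length (w t) < K \<and> (\<forall>v\<in>C. (\<forall>i<K. v i = z t b i) \<longrightarrow> (\<pi> v \<in> \<epsilon> t \<longleftrightarrow> \<pi> (z t b) \<in> \<epsilon> t))"
    by (intro ballI eventually_ball_finite) simp_all
  then have "\<forall>\<^sub>F K in sequentially. \<forall>t\<in>lev n. \<forall>b\<in>UNIV. length (w t) < K \<and> (\<forall>v\<in>C. (\<forall>i<K. v i = z t b i) \<longrightarrow> (\<pi> v \<in> \<epsilon> t \<longleftrightarrow> \<pi> (z t b) \<in> \<epsilon> t))"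
    by (intro eventually_ball_finite finite_lev)
  then obtain K where K: "\<forall>t\<in>lev n. \<forall>b\<in>UNIV. length (w t) < K \<and> (\<forall>v\<in>C. (\<forall>i<K. v i = z t b i) \<longrightarrow> (\<pi> v \<in> \<epsilon> t \<longleftrightarrow> \<pi> (z t b) \<in> \<epsilon> t))"
    using eventually_happens'[OF sequentially_bot] by blast
  define w' where "w' = (\<lambda>u\<in>lev (Suc n). map (z (tl u) (hd u)) [0..<K])"
  have w': "w' (b # t) = map (z t b) [0..<K]" if "t \<in> lev n" for t b
    using that by (simp add: w'_def lev_def)
  have cyl': "v \<in> cyl (w' (b # t)) \<longleftrightarrow> v \<in> C \<and> (\<forall>i<K. v i = z t b i)" if "t \<in> lev n" for t b v
    unfolding cyl_def w'[OF that] by auto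
  have "w' \<in> lev (Suc n) \<rightarrow>\<^sub>E UNIV" by (simp add: w'_def)
  moreover have "extends n w w'" unfolding extends_def
  proof (intro ballI conjI allI impI)
    fix t b assume t: "t \<in> lev n"
    show "length (w t) < length (w' (b # t))" using K t by (simp add: w')
    fix i assume i: "i < length (w t)"
    then have "i < K" using K t by fastforce
    then show "w' (b # t) ! i = w t ! i" using z[OF t, of b] i t by (simp add: w' cyl_def)
  next
    fix t assume t: "t \<in> lev n"
    show "\<exists>E\<in>\<E>. \<pi> ` cyl (w' (True # t)) \<subseteq> E \<and> \<pi> ` cyl (w' (False # t)) \<inter> E = {}"
    proof (intro bexI[of _ "\<epsilon> t"] conjI)
      have "\<pi> v \<in> \<epsilon> t \<longleftrightarrow> \<pi> (z t b) \<in> \<epsilon> t" if "v \<in> cyl (w' (b # t))" for v b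
        using K t that unfolding cyl'[OF t] by blast
      then show "\<pi> ` cyl (w' (True # t)) \<subseteq> \<epsilon> t" "\<pi> ` cyl (w' (False # t)) \<inter> \<epsilon> t = {}"
        using zT[OF t] zF[OF t] by auto
    qed (rule eps[OF t])
  qed
  moreover have "\<forall>t\<in>lev n. \<forall>b. z t b \<in> cyl (w' (b # t))" using zC cyl' by simp
  ultimately show ?thesis by blast
qed

text \<open>Let \<open>D t\<close> be a Borel hull of the small sets that the covered extensions
  leave in piece \<open>t\<close>. For a choice \<open>\<epsilon>\<close> of separating sets, cut
  each piece outside \<open>D t\<close> into its parts inside and outside
  \<open>\<epsilon> t\<close>. A value common to the images of all these parts would produce an
  extension, whose covering would put one of the chosen points into \<open>D t\<close>. So the
  images are separated by Borel hulls, and out of these hulls the covering of the present stage is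
  assembled.\<close>

lemma covered_step:
  assumes ext: "\<And>w'. extends n w w' \<Longrightarrow> covered (Suc n) w'"
  shows "covered n w"
proof -
  \<comment> \<open>Restricting to functions that are extensional on a finite level leaves countably
    many extensions, so that their small sets can be united.\<close>
  define V where "V = {w'\<in>lev (Suc n) \<rightarrow>\<^sub>E UNIV. extends n w w'}"
  have cV: "countable V"
    by (rule countable_subset[of _ "lev (Suc n) \<rightarrow>\<^sub>E UNIV"]) (auto simp: V_def intro!: countable_PiE finite_lev)
  have "\<forall>w'\<in>V. \<exists>B. (\<forall>t\<in>lev (Suc n). B t \<in> sets N \<and> small (s -` B t \<inter> \<pi> ` cyl (w' t))) \<and> common (Suc n) w' \<subseteq> (\<Union>t\<in>lev (Suc n). B t)"
    using ext unfolding V_def covered_def by simp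
  from bchoice[OF this] obtain B' where B': "\<forall>w'\<in>V. (\<forall>t\<in>lev (Suc n). B' w' t \<in> sets N \<and> small (s -` B' w' t \<inter> \<pi> ` cyl (w' t))) \<and> common (Suc n) w' \<subseteq> (\<Union>t\<in>lev (Suc n). B' w' t)" ..
  define Z where "Z t = (\<Union>w'\<in>V. \<Union>b. s -` B' w' (b # t) \<inter> \<pi> ` cyl (w' (b # t)))" for t
  have "\<forall>t\<in>lev n. \<exists>D. D\<in>sets M \<and> Z t \<subseteq> D \<and> small D"
  proof
    fix t assume t: "t \<in> lev n"
    have "small (Z t)" unfolding Z_def
    proof (intro small_UN cV)
      fix w' b assume "w' \<in> V"
      moreover have "b # t \<in> lev (Suc n)" using t by (simp add: lev_def)
      ultimately show "small (s -` B' w' (b # t) \<inter> \<pi> ` cyl (w' (b # t)))" using B' by blast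
    qed simp
    from small_hull[OF this] show "\<exists>D. D\<in>sets M \<and> Z t \<subseteq> D \<and> small D" by blast
  qed
  from bchoice[OF this] obtain D where D: "\<forall>t\<in>lev n. D t \<in> sets M \<and> Z t \<subseteq> D t \<and> small (D t)" ..
  define I where "I = lev n \<times> (UNIV :: bool set)"
  have I: "finite I" "I \<noteq> {}" using finite_lev lev_ne by (auto simp: I_def)
  define P where "P = lev n \<rightarrow>\<^sub>E \<E>"
  have cP: "countable P" unfolding P_def by (intro countable_PiE finite_lev E)
  \<comment> \<open>The second component of the index selects the side of \<open>\<epsilon>\<close>:
    \<open>True\<close> is inside, \<open>False\<close> outside.\<close>
  define A where "A \<epsilon> i = \<pi> ` cyl (w (fst i)) \<inter> ((if snd i then \<epsilon> (fst i) else space M - \<epsilon> (fst i)) - D (fst i))" for \<epsilon> i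
  have "\<forall>\<epsilon>\<in>P. \<exists>H. (\<forall>i\<in>I. H i \<in> sets N \<and> s ` A \<epsilon> i \<subseteq> H i) \<and> (\<Inter>i\<in>I. H i) = {}"
  proof
    fix \<epsilon> assume e: "\<epsilon> \<in> P"
    then have eE: "\<epsilon> t \<in> \<E>" if "t \<in> lev n" for t using that unfolding P_def by (auto dest: PiE_mem)
    have "borel_separated N I (\<lambda>i. s ` A \<epsilon> i)"
    proof (rule analytic_separation[OF I _ _ s B])
      fix i assume i: "i \<in> I"
      then have t: "fst i \<in> lev n" by (auto simp: I_def)
      have "\<epsilon> (fst i) \<in> sets M" using eE[OF t] E by blast
      then show "analytic_in M (A \<epsilon> i)" unfolding A_def
        by (intro analytic_in_Int analytic_cyl) (use D t in auto)
      show "A \<epsilon> i \<subseteq> space M" unfolding A_def using cyl_sub C(2) by auto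
    next
      fix x y assume "x \<in> space N" "y \<in> space N" "x \<noteq> y"
      then show "\<exists>B\<in>\<B>. (x \<in> B) \<noteq> (y \<in> B)" by (rule sepN)
    next
      show "(\<Inter>i\<in>I. s ` A \<epsilon> i) = {}"
      proof (rule ccontr)
        assume "(\<Inter>i\<in>I. s ` A \<epsilon> i) \<noteq> {}"
        then obtain y where y: "\<forall>i\<in>I. y \<in> s ` A \<epsilon> i" by auto
        have "\<forall>i\<in>I. \<exists>v. v \<in> cyl (w (fst i)) \<and> \<pi> v \<in> A \<epsilon> i \<and> s (\<pi> v) = y"
        proof
          fix i assume "i \<in> I"
          then obtain x where "x \<in> A \<epsilon> i" "s x = y" using y by force
          moreover then obtain v where "v \<in> cyl (w (fst i))" "x = \<pi> v" unfolding A_def by blast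
          ultimately show "\<exists>v. v \<in> cyl (w (fst i)) \<and> \<pi> v \<in> A \<epsilon> i \<and> s (\<pi> v) = y" by blast
        qed
        from bchoice[OF this] obtain v where v: "\<forall>i\<in>I. v i \<in> cyl (w (fst i)) \<and> \<pi> (v i) \<in> A \<epsilon> i \<and> s (\<pi> (v i)) = y" ..
        define z where "z t b = v (t, b)" for t b
        have z: "z t b \<in> cyl (w t)" "\<pi> (z t b) \<in> A \<epsilon> (t, b)" "s (\<pi> (z t b)) = y" if "t \<in> lev n" for t b
          using v that by (auto simp: z_def I_def)
        have zt: "\<pi> (z t True) \<in> \<epsilon> t" "\<pi> (z t False) \<notin> \<epsilon> t" if "t \<in> lev n" for t
          using z(2)[OF that, of True] z(2)[OF that, of False] by (auto simp: A_def)
        have "\<exists>w'\<in>lev (Suc n) \<rightarrow>\<^sub>E UNIV. extends n w w' \<and> (\<forall>t\<in>lev n. \<forall>b. z t b \<in> cyl (w' (b # t)))"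
          by (rule separating_extension[where \<epsilon>=\<epsilon>]) (use eE z(1) zt in simp_all)
        then obtain w' where
          w': "w'\<in>lev (Suc n) \<rightarrow>\<^sub>E UNIV" "extends n w w'" "\<forall>t\<in>lev n. \<forall>b. z t b \<in> cyl (w' (b # t))" by blast
        have w'V: "w' \<in> V" using w' by (simp add: V_def)
        obtain t0 where "t0 \<in> lev n" using lev_ne by blast
        then have "\<pi> (z t0 True) \<in> space M" using z(1) cyl_sub C(2) by blast
        then have yN: "y \<in> space N" 
          using z(3)[OF \<open>t0 \<in> lev n\<close>, of True] measurable_space[OF s, of "\<pi> (z t0 True)"] by simp
        have "y \<in> s ` \<pi> ` cyl (w' u)" if u: "u \<in> lev (Suc n)" for u
        proof -
          obtain b t where bt: "t \<in> lev n" "u = b # t" using u lev_Suc by blast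
          then have "z t b \<in> cyl (w' u)" using w'(3) by blast
          then show ?thesis using z(3)[OF bt(1), of b] by blast
        qed
        then have "y \<in> common (Suc n) w'" using yN by (simp add: common_def)
        then obtain u where u: "u \<in> lev (Suc n)" "y \<in> B' w' u" using B' w'V by blast
        obtain b t where bt: "t \<in> lev n" "u = b # t" using u lev_Suc by blast
        have "\<pi> (z t b) \<in> Z t" unfolding Z_def
          using w'V u(2) bt z(3)[OF bt(1), of b] w'(3) by blast
        then have "\<pi> (z t b) \<in> D t" using D bt by blast
        then show False using z(2)[OF bt(1), of b] by (simp add: A_def)
      qed
    qed
    then show "\<exists>H. (\<forall>i\<in>I. H i \<in> sets N \<and> s ` A \<epsilon> i \<subseteq> H i) \<and> (\<Inter>i\<in>I. H i) = {}"
      unfolding borel_separated_def .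
  qed
  from bchoice[OF this] obtain H where H: "\<forall>\<epsilon>\<in>P. (\<forall>i\<in>I. H \<epsilon> i \<in> sets N \<and> s ` A \<epsilon> i \<subseteq> H \<epsilon> i) \<and> (\<Inter>i\<in>I. H \<epsilon> i) = {}" ..
  \<comment> \<open>Making the hull at \<open>(t, b)\<close> depend on the set \<open>E\<close>
    chosen at \<open>t\<close> alone: all choices with \<open>\<epsilon> t = E\<close> are
    intersected.\<close>
  define J where "J t E b = (\<Inter>\<epsilon>\<in>{\<epsilon>\<in>P. \<epsilon> t = E}. H \<epsilon> (t, b))" for t E b
  have J: "J t E b \<in> sets N" if t: "t \<in> lev n" and E': "E \<in> \<E>" for t E b
  proof -
    have "(\<lambda>_\<in>lev n. E) \<in> {\<epsilon>\<in>P. \<epsilon> t = E}" using t E' by (simp add: P_def)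
    then have ne: "{\<epsilon>\<in>P. \<epsilon> t = E} \<noteq> {}" by blast
    have co: "countable {\<epsilon>\<in>P. \<epsilon> t = E}" by (rule countable_subset[OF _ cP]) auto
    have "(t, b) \<in> I" using t by (simp add: I_def)
    then show ?thesis unfolding J_def by (intro sets.countable_INT'[OF co ne]) (use H in auto)
  qed
  have JA: "s x \<in> J t E b" if t: "t \<in> lev n" and E': "E \<in> \<E>" and
    x: "x \<in> \<pi> ` cyl (w t)" "x \<notin> D t" "if b then x \<in> E else x \<in> space M - E" for t E b x
    unfolding J_def
  proof
    fix \<epsilon> assume e: "\<epsilon> \<in> {\<epsilon>\<in>P. \<epsilon> t = E}"
    then have "x \<in> A \<epsilon> (t, b)" using x by (auto simp: A_def split: if_splits)
    moreover have "(t, b) \<in> I" using t by (simp add: I_def)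
    ultimately show "s x \<in> H \<epsilon> (t, b)" using H e by blast
  qed
  define Cc where "Cc t = (\<Union>E\<in>\<E>. J t E True \<inter> J t E False)" for t
  have Cc: "Cc t \<in> sets N" if "t \<in> lev n" for t
    unfolding Cc_def by (rule sets.countable_UN''[OF E(1)]) (use J[OF that] in auto)
  show ?thesis unfolding covered_def
  proof (intro exI[of _ "\<lambda>t. space N - Cc t"] conjI ballI)
    fix t assume t: "t \<in> lev n"
    show "space N - Cc t \<in> sets N" using Cc[OF t] by auto
    \<comment> \<open>Points over the complement of \<open>Cc t\<close> that are consistent with the
      hulls. If two of them had the same image, a set \<open>E\<close> separating them would place
      that image in both \<open>J t E True\<close> and \<open>J t E False\<close>, hence in
      \<open>Cc t\<close>; so \<open>s\<close> is injective here.\<close>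
    define W where "W = (s -` (space N - Cc t) \<inter> space M) -
       (\<Union>E\<in>\<E>. (E \<inter> (s -` (space N - J t E True) \<inter> space M)) \<union> ((space M - E) \<inter> (s -` (space N - J t E False) \<inter> space M)))"
    have "W \<in> sets M" unfolding W_def
      by (intro sets.Diff measurable_sets[OF s] sets.countable_UN''[OF E(1)] sets.Un sets.Int)
        (use J[OF t] Cc[OF t] E in auto)
    moreover have "inj_on s W"
    proof (rule inj_onI, rule ccontr)
      fix x x' assume x: "x \<in> W" "x' \<in> W" "s x = s x'" "x \<noteq> x'"
      then have xM: "x \<in> space M" "x' \<in> space M" by (auto simp: W_def)
      obtain E where E': "E \<in> \<E>" "(x \<in> E) \<noteq> (x' \<in> E)" using sepM[OF xM x(4)] by blast
      have sN: "s x \<in> space N" using measurable_space[OF s] xM by blast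
      have *: "s v \<in> J t E True" if "v \<in> W" "v \<in> E" for v
        using that E'(1) measurable_space[OF s, of v] unfolding W_def by auto
      have **: "s v \<in> J t E False" if "v \<in> W" "v \<notin> E" for v
        using that E'(1) measurable_space[OF s, of v] unfolding W_def by auto
      have "s x \<in> J t E True \<inter> J t E False"
        using E'(2) *[OF x(1)] *[OF x(2)] **[OF x(1)] **[OF x(2)] x(3) by auto
      then have "s x \<in> Cc t" using E'(1) unfolding Cc_def by blast
      then show False using x(1) unfolding W_def by auto
    qed
    ultimately have "small W" by (rule small_inj)
    then have "small (D t \<union> W)" using D t by (intro small_Un) auto
    moreover have "s -` (space N - Cc t) \<inter> \<pi> ` cyl (w t) \<subseteq> D t \<union> W"
    proof
      fix x assume x: "x \<in> s -` (space N - Cc t) \<inter> \<pi> ` cyl (w t)"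
      have xM: "x \<in> space M" using x cyl_sub C(2) by auto
      show "x \<in> D t \<union> W"
      proof (cases "x \<in> D t")
        case False
        have "x \<in> W" using x xM JA[OF t _ _ False, where b=True] JA[OF t _ _ False, where b=False] unfolding W_def by auto
        then show ?thesis by simp
      qed simp
    qed
    ultimately show "small (s -` (space N - Cc t) \<inter> \<pi> ` cyl (w t))" by (rule small_subset)
  next
    \<comment> \<open>A value in every \<open>Cc t\<close> picks one set \<open>E\<close> for each
      \<open>t\<close>. These sets form a choice in \<open>P\<close>, all of whose hulls contain the
      value, although their intersection is empty.\<close>
    show "common n w \<subseteq> (\<Union>t\<in>lev n. space N - Cc t)"
    proof (rule ccontr)
      assume "\<not> common n w \<subseteq> (\<Union>t\<in>lev n. space N - Cc t)"
      then obtain y where y: "y \<in> common n w" "y \<notin> (\<Union>t\<in>lev n. space N - Cc t)" by auto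
      then have "\<forall>t\<in>lev n. y \<in> Cc t" by (auto simp: common_def)
      then have "\<forall>t\<in>lev n. \<exists>E. E \<in> \<E> \<and> y \<in> J t E True \<inter> J t E False" unfolding Cc_def by blast
      from bchoice[OF this] obtain \<epsilon> where e: "\<forall>t\<in>lev n. \<epsilon> t \<in> \<E> \<and> y \<in> J t (\<epsilon> t) True \<inter> J t (\<epsilon> t) False" ..
      define \<epsilon>' where "\<epsilon>' = restrict \<epsilon> (lev n)"
      have eP: "\<epsilon>' \<in> P" using e by (auto simp: \<epsilon>'_def P_def)
      have "y \<in> H \<epsilon>' i" if "i \<in> I" for i
      proof -
        obtain t b where i: "i = (t, b)" "t \<in> lev n" using \<open>i \<in> I\<close> by (auto simp: I_def)
        have "y \<in> J t (\<epsilon> t) b" using e i(2) by (cases b) auto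
        moreover have "\<epsilon>' t = \<epsilon> t" using i(2) by (simp add: \<epsilon>'_def)
        ultimately show ?thesis unfolding J_def i(1) using eP by blast
      qed
      then have "y \<in> (\<Inter>i\<in>I. H \<epsilon>' i)" by blast
      then show False using H eP by blast
    qed
  qed
qed

section \<open>Limits of uncovered schemes\<close>

fun branch :: "(nat \<Rightarrow> bool) \<Rightarrow> nat \<Rightarrow> bool list" where
  "branch \<zeta> 0 = []" | "branch \<zeta> (Suc n) = \<zeta> n # branch \<zeta> n"

lemma branch_lev: "branch \<zeta> n \<in> lev n"
  by (induction n) (auto simp: lev_def)

lemma branch_cong: "(\<And>i. i < n \<Longrightarrow> \<zeta> i = \<zeta>' i) \<Longrightarrow> branch \<zeta> n = branch \<zeta>' n"
  by (induction n) auto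

text \<open>If the space is not small, uncovered stages continue forever. Each has a common value
  \<open>y n\<close>, since otherwise empty sets would cover it. Every infinite branch converges to
  a point \<open>x \<zeta>\<close>; all these points lie over one value because the single sequence
  \<open>y n\<close> determines it along every branch, and different branches are separated where
  they part.\<close>

lemma uncountable_fibre:
  assumes "\<not> small (space M)"
  shows "\<exists>y\<in>space N. uncountable {x\<in>space M. s x = y}"
proof -
  \<comment> \<open>At level 0 there is one piece, the whole space, and every value of
    \<open>s\<close> is common. A covering would therefore make the space itself small.\<close>
  have c0: "\<not> covered 0 (\<lambda>_. [])"
  proof
    assume "covered 0 (\<lambda>_. [])"
    then obtain B where B0: "small (s -` B [] \<inter> \<pi> ` cyl [])" "common 0 (\<lambda>_. []) \<subseteq> B []"
      unfolding covered_def by (auto simp: lev_def)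
    have c: "cyl [] = C" unfolding cyl_def by auto
    have "space M \<subseteq> s -` B [] \<inter> \<pi> ` cyl []"
    proof
      fix x assume x: "x \<in> space M"
      then have "s x \<in> common 0 (\<lambda>_. [])" using measurable_space[OF s x] C(2) by (auto simp: common_def c)
      then show "x \<in> s -` B [] \<inter> \<pi> ` cyl []" using B0(2) x C(2) by (auto simp: c)
    qed
    with B0(1) have "small (space M)" by (rule small_subset)
    with assms show False ..
  qed
  have "\<exists>w. \<forall>n. (\<not> covered n (w n)) \<and> extends n (w n) (w (Suc n))"
  proof (rule dependent_nat_choice)
    show "\<exists>w. \<not> covered 0 w" using c0 by blast
    fix w n assume "\<not> covered n w"
    then show "\<exists>w'. \<not> covered (Suc n) w' \<and> extends n w w'" using covered_step[of n w] by blast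
  qed
  then obtain w where w: "\<And>n. \<not> covered n (w n)" "\<And>n. extends n (w n) (w (Suc n))" by blast
  define l where "l \<zeta> n = w n (branch \<zeta> n)" for \<zeta> n
  have ext: "length (l \<zeta> n) < length (l \<zeta> (Suc n)) \<and> (\<forall>i<length (l \<zeta> n). l \<zeta> (Suc n) ! i = l \<zeta> n ! i)" for \<zeta> n
    using w(2)[of n] branch_lev[of \<zeta> n] unfolding extends_def l_def branch.simps by blast
  have mono: "length (l \<zeta> n) \<le> length (l \<zeta> m) \<and> (\<forall>i<length (l \<zeta> n). l \<zeta> m ! i = l \<zeta> n ! i)" if "n \<le> m" for \<zeta> n m
    using that
  proof (induction m rule: dec_induct)
    case (step m)
    then show ?case using ext[where \<zeta>=\<zeta> and n=m] by auto
  qed simp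
  have len: "n \<le> length (l \<zeta> n)" for \<zeta> n
  proof (induction n)
    case (Suc n) then show ?case using ext[where \<zeta>=\<zeta> and n=n] by simp
  qed simp
  define x where "x \<zeta> i = l \<zeta> (Suc i) ! i" for \<zeta> i
  have x: "x \<zeta> i = l \<zeta> n ! i" if "i < length (l \<zeta> n)" for \<zeta> i n
  proof (cases "Suc i \<le> n")
    case True
    have "i < length (l \<zeta> (Suc i))" using len[of "Suc i" \<zeta>] by simp
    then show ?thesis using mono[OF True, of \<zeta>] by (simp add: x_def)
  next
    case False
    then show ?thesis using mono[of n "Suc i" \<zeta>] that by (simp add: x_def)
  qed
  have ne: "common n (w n) \<noteq> {}" for n
  proof
    assume "common n (w n) = {}"
    then have "covered n (w n)" unfolding covered_def
      by (intro exI[of _ "\<lambda>_. {}"]) (simp add: small_empty)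
    with w(1) show False by blast
  qed
  have "\<forall>n. \<exists>y. y \<in> common n (w n)" using ne by blast
  from choice[OF this] obtain y where y: "\<forall>n. y n \<in> common n (w n)" ..
  have pt: "\<exists>v\<in>cyl (l \<zeta> n). s (\<pi> v) = y n" for \<zeta> n
    using y branch_lev[of \<zeta> n] unfolding common_def l_def by force
  have agree: "v i = x \<zeta> i" if "v \<in> cyl (l \<zeta> n)" "i < n" for v \<zeta> n i
  proof -
    have "i < length (l \<zeta> n)" using len[of n \<zeta>] that by simp
    then show ?thesis using that x by (simp add: cyl_def)
  qed
  have xC: "x \<zeta> \<in> C" for \<zeta>
  proof (rule closedND[OF C(1)])
    fix k
    obtain v where "v \<in> cyl (l \<zeta> k)" using pt by blast
    then show "\<exists>v\<in>C. \<forall>i<k. v i = x \<zeta> i" using agree[of v \<zeta> k] cyl_sub by blast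
  qed
  have xcyl: "x \<zeta> \<in> cyl (l \<zeta> n)" for \<zeta> n
    unfolding cyl_def using xC x by simp
  have xM: "\<pi> (x \<zeta>) \<in> space M" for \<zeta> using xC C(2) by blast
  have same: "s (\<pi> (x \<zeta>)) = s (\<pi> (x \<zeta>'))" for \<zeta> \<zeta>'
  proof (rule ccontr)
    assume "s (\<pi> (x \<zeta>)) \<noteq> s (\<pi> (x \<zeta>'))"
    then obtain B where B': "B \<in> \<B>" "(s (\<pi> (x \<zeta>)) \<in> B) \<noteq> (s (\<pi> (x \<zeta>')) \<in> B)"
      using sepN measurable_space[OF s xM] by meson
    \<comment> \<open>Piece \<open>n\<close> of the branch contains a point over \<open>y n\<close>
      that shares \<open>n\<close> entries with \<open>x \<zeta>\<close>. As soon as the prefix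
      decides the preimage of \<open>B\<close>, both values lie on the same side of
      \<open>B\<close>.\<close>
    have "\<exists>k. \<forall>n\<ge>k. y n \<in> B \<longleftrightarrow> s (\<pi> (x \<zeta>)) \<in> B" for \<zeta>
    proof -
      obtain k where k: "\<forall>v\<in>C. (\<forall>i<k. v i = x \<zeta> i) \<longrightarrow> (\<pi> v \<in> s -` B \<inter> space M \<longleftrightarrow> \<pi> (x \<zeta>) \<in> s -` B \<inter> space M)"
        using decB[OF B'(1)] xC[of \<zeta>] unfolding decides_def by blast
      show ?thesis
      proof (intro exI[of _ k] allI impI)
        fix n assume n: "k \<le> n"
        obtain v where v: "v \<in> cyl (l \<zeta> n)" "s (\<pi> v) = y n" using pt by blast
        have "v \<in> C" "\<forall>i<k. v i = x \<zeta> i" using v agree[of v \<zeta> n] n cyl_sub by auto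
        then have "\<pi> v \<in> s -` B \<inter> space M \<longleftrightarrow> \<pi> (x \<zeta>) \<in> s -` B \<inter> space M" using k by blast
        moreover have "\<pi> v \<in> space M" using \<open>v \<in> C\<close> C(2) by blast
        ultimately show "y n \<in> B \<longleftrightarrow> s (\<pi> (x \<zeta>)) \<in> B" using xM[of \<zeta>] v(2) by auto
      qed
    qed
    then have "\<forall>\<zeta>. \<forall>\<^sub>F n in sequentially. y n \<in> B \<longleftrightarrow> s (\<pi> (x \<zeta>)) \<in> B"
      unfolding eventually_sequentially by simp
    then have "\<forall>\<^sub>F n in sequentially. (y n \<in> B \<longleftrightarrow> s (\<pi> (x \<zeta>)) \<in> B) \<and> (y n \<in> B \<longleftrightarrow> s (\<pi> (x \<zeta>')) \<in> B)"
      by (intro eventually_conj) simp_all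
    then have "s (\<pi> (x \<zeta>)) \<in> B \<longleftrightarrow> s (\<pi> (x \<zeta>')) \<in> B"
      using eventually_happens'[OF sequentially_bot] by blast
    with B'(2) show False by blast
  qed
  have inj: "inj (\<lambda>\<zeta>. \<pi> (x \<zeta>))"
  proof (rule injI, rule ccontr)
    fix \<zeta> \<zeta>' :: "nat \<Rightarrow> bool" assume eq: "\<pi> (x \<zeta>) = \<pi> (x \<zeta>')" and "\<zeta> \<noteq> \<zeta>'"
    then have ex: "\<exists>i. \<zeta> i \<noteq> \<zeta>' i" by auto
    define n where "n = (LEAST i. \<zeta> i \<noteq> \<zeta>' i)"
    have n: "\<zeta> n \<noteq> \<zeta>' n" unfolding n_def by (rule LeastI_ex[OF ex])
    have lt: "\<zeta> i = \<zeta>' i" if "i < n" for i using not_less_Least that unfolding n_def by blast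
    have br: "branch \<zeta> n = branch \<zeta>' n" using lt by (rule branch_cong)
    obtain E where E': "\<pi> ` cyl (w (Suc n) (True # branch \<zeta> n)) \<subseteq> E" "\<pi> ` cyl (w (Suc n) (False # branch \<zeta> n)) \<inter> E = {}"
      using w(2)[of n] branch_lev[of \<zeta> n] unfolding extends_def by blast
    have "x \<zeta> \<in> cyl (w (Suc n) (\<zeta> n # branch \<zeta> n))" "x \<zeta>' \<in> cyl (w (Suc n) (\<zeta>' n # branch \<zeta> n))"
      using xcyl[of \<zeta> "Suc n"] xcyl[of \<zeta>' "Suc n"] br by (simp_all add: l_def)
    then show False using E' eq n by (cases "\<zeta> n") auto
  qed
  have unc: "uncountable (UNIV :: (nat \<Rightarrow> bool) set)"
  proof
    assume c: "countable (UNIV :: (nat \<Rightarrow> bool) set)"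
    define e where "e = from_nat_into (UNIV :: (nat \<Rightarrow> bool) set)"
    have "range e = UNIV" unfolding e_def by (rule range_from_nat_into[OF _ c]) simp
    then obtain n where "(\<lambda>i. \<not> e i i) = e n" by (metis UNIV_I imageE)
    then show False by (metis)
  qed
  define y0 where "y0 = s (\<pi> (x (\<lambda>_. True)))"
  have "range (\<lambda>\<zeta>. \<pi> (x \<zeta>)) \<subseteq> {v\<in>space M. s v = y0}" using xM same unfolding y0_def by blast
  moreover have "uncountable (range (\<lambda>\<zeta>. \<pi> (x \<zeta>)))" using unc countable_image_inj_eq[OF inj] by simp
  ultimately have "uncountable {v\<in>space M. s v = y0}" using countable_subset by blast
  moreover have "y0 \<in> space N" unfolding y0_def using measurable_space[OF s xM] by blast
  ultimately show ?thesis by blast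
qed

end

section \<open>Countable-to-one maps and Borel images\<close>

definition separates_points :: "'a measure \<Rightarrow> 'a set set \<Rightarrow> bool" where
  "separates_points M \<E> \<longleftrightarrow> countable \<E> \<and> \<E> \<subseteq> sets M \<and>
     (\<forall>x\<in>space M. \<forall>y\<in>space M. x \<noteq> y \<longrightarrow> (\<exists>E\<in>\<E>. (x \<in> E) \<noteq> (y \<in> E)))"

lemma standard_borel_separates_points:
  assumes "standard_borel_space M"
  shows "\<exists>\<E>. separates_points M \<E>"
proof (rule standard_borel_coding[OF assms])
  fix U small meets inn
  assume U: "\<And>p::nat. U p \<in> sets M"
    and sep: "\<And>x y. x \<in> space M \<Longrightarrow> y \<in> space M \<Longrightarrow> (\<And>p. x \<in> U p \<longleftrightarrow> y \<in> U p) \<Longrightarrow> x = y"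
  show ?thesis unfolding separates_points_def
  proof (intro exI[of _ "range U"] conjI ballI impI)
    fix x y assume "x \<in> space M" "y \<in> space M" "x \<noteq> y"
    then show "\<exists>E\<in>range U. (x \<in> E) \<noteq> (y \<in> E)" using sep[of x y] by auto
  qed (use U in auto)
qed

text \<open>The dichotomy applied to a representation that decides both separating families;
  countability of the fibres excludes the Cantor scheme.\<close>

lemma countable_to_one_decomposition:
  assumes sb: "standard_borel_space M" and s: "s \<in> M \<rightarrow>\<^sub>M N" and B: "separates_points N \<B>"
    and fib: "\<And>y. y \<in> space N \<Longrightarrow> countable {x\<in>space M. s x = y}"
  shows "\<exists>\<F>. countable \<F> \<and> \<F> \<subseteq> sets M \<and> (\<forall>F\<in>\<F>. inj_on s F) \<and> space M \<subseteq> \<Union>\<F>"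
proof -
  obtain \<E> where E: "separates_points M \<E>" using standard_borel_separates_points[OF sb] by blast
  define \<D> where "\<D> = \<E> \<union> (\<lambda>B. s -` B \<inter> space M) ` \<B>"
  have "countable \<D>" "\<D> \<subseteq> sets M"
    using E B measurable_sets[OF s] unfolding \<D>_def separates_points_def by auto
  then obtain C \<pi> where C: "closedN C" "\<pi> ` C = space M" and dec: "\<forall>D\<in>\<D>. decides C \<pi> D"
    using analytic_inD[OF analytic_in_space[OF sb]] by meson
  have "souslin_map M N s \<B> \<E> C \<pi>"
  proof
    show "standard_borel_space M" "s \<in> M \<rightarrow>\<^sub>M N" "closedN C" "\<pi> ` C = space M" by fact+
    show "countable \<B>" "\<B> \<subseteq> sets N" "countable \<E>" "\<E> \<subseteq> sets M"
      using B E by (simp_all add: separates_points_def)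
    show "\<exists>E\<in>\<B>. (x \<in> E) \<noteq> (y \<in> E)" if "x \<in> space N" "y \<in> space N" "x \<noteq> y" for x y
      using B that by (simp add: separates_points_def)
    show "\<exists>E\<in>\<E>. (x \<in> E) \<noteq> (y \<in> E)" if "x \<in> space M" "y \<in> space M" "x \<noteq> y" for x y
      using E that by (simp add: separates_points_def)
    show "decides C \<pi> E" if "E \<in> \<E>" for E using dec that by (simp add: \<D>_def)
    show "decides C \<pi> (s -` B \<inter> space M)" if "B \<in> \<B>" for B using dec that by (simp add: \<D>_def)
  qed
  then interpret souslin_map M N s \<B> \<E> C \<pi> .
  have "small (space M)"
  proof (rule ccontr)
    assume "\<not> small (space M)"
    then obtain y where "y \<in> space N" "uncountable {x\<in>space M. s x = y}" using uncountable_fibre by auto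
    with fib show False by simp
  qed
  then show ?thesis unfolding small_def .
qed

text \<open>By injectivity the images of \<open>A \<inter> U p\<close> and \<open>A - U p\<close>
  are disjoint analytic sets, so a Borel set \<open>H p\<close> separates them. For \<open>y\<close>
  in the image, membership in the sets \<open>H p\<close> spells the code of its preimage. Decoding
  defines a measurable partial inverse \<open>x\<close>, and the image is the Borel set of those
  \<open>y\<close> that decode into \<open>A\<close> and satisfy \<open>s (x y) = y\<close>.\<close>

lemma Borel_image_inj:
  assumes sb: "standard_borel_space M" and s: "s \<in> M \<rightarrow>\<^sub>M N" and B: "separates_points N \<B>"
    and A: "A \<in> sets M" and inj: "inj_on s A"
  shows "s ` A \<in> sets N"
proof (rule standard_borel_coding[OF sb])
  fix U small meets inn
  assume U: "\<And>p::nat. U p \<in> sets M" and gen: "sets M = sigma_sets (space M) (range U)"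
    and pts: "\<And>x. x \<in> space M \<Longrightarrow> coding small meets inn (\<lambda>p. x \<in> U p)"
    and ex: "\<And>\<omega>. coding small meets inn \<omega> \<Longrightarrow> \<exists>x\<in>space M. \<forall>p. \<omega> p \<longleftrightarrow> x \<in> U p"
    and sep: "\<And>x y. x \<in> space M \<Longrightarrow> y \<in> space M \<Longrightarrow> (\<And>p. x \<in> U p \<longleftrightarrow> y \<in> U p) \<Longrightarrow> x = y"
  have AM: "A \<subseteq> space M" using A by (rule sets.sets_into_space)
  have "\<forall>p. \<exists>H. H \<in> sets N \<and> s ` (A \<inter> U p) \<subseteq> H \<and> s ` (A - U p) \<inter> H = {}"
  proof
    fix p
    have "borel_separated N UNIV (\<lambda>b. s ` (if b then A \<inter> U p else A - U p))"
    proof (rule analytic_separation[OF _ _ _ _ s, where \<B>=\<B>])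
      show "analytic_in M (if b then A \<inter> U p else A - U p)" for b
        by (rule analytic_in_sets[OF sb]) (use A U in auto)
      show "(if b then A \<inter> U p else A - U p) \<subseteq> space M" for b using AM by auto
      show "countable \<B>" "\<B> \<subseteq> sets N" using B by (simp_all add: separates_points_def)
      show "\<exists>E\<in>\<B>. (x \<in> E) \<noteq> (y \<in> E)" if "x \<in> space N" "y \<in> space N" "x \<noteq> y" for x y
        using B that by (simp add: separates_points_def)
      show "(\<Inter>b. s ` (if b then A \<inter> U p else A - U p)) = {}"
        using inj by (auto simp: UNIV_bool inj_on_def)
    qed auto
    then obtain H where H: "\<forall>b. H b \<in> sets N \<and> s ` (if b then A \<inter> U p else A - U p) \<subseteq> H b" "(\<Inter>b. H b) = {}"
      unfolding borel_separated_def by auto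
    have "s ` (A \<inter> U p) \<subseteq> H True" "s ` (A - U p) \<subseteq> H False" "H True \<inter> H False = {}" "H True \<in> sets N"
      using H(1)[rule_format, of True] H(1)[rule_format, of False] H(2) by (simp_all add: UNIV_bool Int_commute)
    then show "\<exists>H. H \<in> sets N \<and> s ` (A \<inter> U p) \<subseteq> H \<and> s ` (A - U p) \<inter> H = {}"
      by (intro exI[of _ "H True"]) auto
  qed
  from choice[OF this] obtain H where H: "\<forall>p. H p \<in> sets N \<and> s ` (A \<inter> U p) \<subseteq> H p \<and> s ` (A - U p) \<inter> H p = {}" ..
  have HN[measurable]: "H p \<in> sets N" for p using H by simp
  have HU: "s a \<in> H p \<longleftrightarrow> a \<in> U p" if "a \<in> A" for a p
    using H[rule_format, of p] that by blast
  define Y where "Y = {y\<in>space N. coding small meets inn (\<lambda>p. y \<in> H p)}"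
  \<comment> \<open>The conditions in \<open>coding\<close> quantify over natural numbers alone, so
    the set of valid codes is Borel.\<close>
  have Y: "Y \<in> sets N" unfolding Y_def coding_def by measurable
  define x where "x y = (SOME x. x \<in> space M \<and> (\<forall>p. y \<in> H p \<longleftrightarrow> x \<in> U p))" for y
  have x: "x y \<in> space M \<and> (\<forall>p. y \<in> H p \<longleftrightarrow> x y \<in> U p)" if "y \<in> Y" for y
  proof -
    have "\<exists>x. x \<in> space M \<and> (\<forall>p. y \<in> H p \<longleftrightarrow> x \<in> U p)"
      using ex[of "\<lambda>p. y \<in> H p"] that unfolding Y_def by auto
    then show ?thesis unfolding x_def by (rule someI_ex)
  qed
  have spY: "space (restrict_space N Y) = Y" using sets.sets_into_space[OF Y] by (auto simp: space_restrict_space)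
  have xm: "x \<in> restrict_space N Y \<rightarrow>\<^sub>M M"
  proof (rule measurable_sigma_sets[OF gen])
    show "range U \<subseteq> Pow (space M)" using U sets.sets_into_space by blast
    show "x \<in> space (restrict_space N Y) \<rightarrow> space M" unfolding spY using x by blast
    fix u assume "u \<in> range U"
    then obtain p where u: "u = U p" by blast
    have "x -` u \<inter> space (restrict_space N Y) = H p \<inter> Y" unfolding spY u using x by blast
    then show "x -` u \<inter> space (restrict_space N Y) \<in> sets (restrict_space N Y)"
      using Y HN by (auto simp: sets_restrict_space_iff)
  qed
  have pre: "{y\<in>Y. f y \<in> S} \<in> sets N" if "f \<in> restrict_space N Y \<rightarrow>\<^sub>M K" "S \<in> sets K" for f S and K :: "'z measure"
  proof -
    have "f -` S \<inter> space (restrict_space N Y) \<in> sets (restrict_space N Y)" using measurable_sets[OF that] .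
    moreover have "f -` S \<inter> space (restrict_space N Y) = {y\<in>Y. f y \<in> S}" unfolding spY by auto
    ultimately show ?thesis using Y by (auto simp: sets_restrict_space_iff)
  qed
  have sxm: "(\<lambda>y. s (x y)) \<in> restrict_space N Y \<rightarrow>\<^sub>M N" by (rule measurable_compose[OF xm s])
  \<comment> \<open>The equation \<open>s (x y) = y\<close> is expressed by agreement on the
    countable separating family \<open>\<B>\<close>.\<close>
  have "s ` A = {y\<in>Y. x y \<in> A} - (\<Union>B\<in>\<B>. ({y\<in>Y. s (x y) \<in> B} - B) \<union> (B - {y\<in>Y. s (x y) \<in> B}))"
    (is "_ = ?R")
  proof
    show "s ` A \<subseteq> ?R"
    proof
      fix y assume "y \<in> s ` A"
      then obtain a where a: "a \<in> A" "y = s a" by blast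
      have aM: "a \<in> space M" using a AM by blast
      have "y \<in> space N" using a aM measurable_space[OF s] by blast
      then have yY: "y \<in> Y" using pts[OF aM] HU[OF a(1)] a(2) by (simp add: Y_def)
      then have "x y = a" using x[OF yY] HU[OF a(1)] a(2) aM by (intro sep) auto
      then show "y \<in> ?R" using a yY by auto
    qed
    show "?R \<subseteq> s ` A"
    proof
      fix y assume y: "y \<in> ?R"
      then have yY: "y \<in> Y" "x y \<in> A" by auto
      have "y \<in> space N" using yY by (simp add: Y_def)
      moreover have "s (x y) \<in> space N" using x[OF yY(1)] measurable_space[OF s] by blast
      moreover have "\<forall>B\<in>\<B>. s (x y) \<in> B \<longleftrightarrow> y \<in> B" using y yY by auto
      ultimately have "s (x y) = y" using B unfolding separates_points_def by blast
      then show "y \<in> s ` A" using yY(2) by (metis imageI)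
    qed
  qed
  moreover have "?R \<in> sets N"
  proof (intro sets.Diff pre[OF xm A] sets.countable_UN'')
    show "countable \<B>" using B by (simp add: separates_points_def)
    fix S assume "S \<in> \<B>"
    then have "S \<in> sets N" using B by (auto simp: separates_points_def)
    then show "({y\<in>Y. s (x y) \<in> S} - S) \<union> (S - {y\<in>Y. s (x y) \<in> S}) \<in> sets N"
      using pre[OF sxm, of S] by auto
  qed
  ultimately show ?thesis by simp
qed

lemma Borel_image_countable_to_one:
  assumes sb: "standard_borel_space M" and s: "s \<in> M \<rightarrow>\<^sub>M N" and B: "separates_points N \<B>"
    and fib: "\<And>y. y \<in> space N \<Longrightarrow> countable {x\<in>space M. s x = y}" and A: "A \<in> sets M"
  shows "s ` A \<in> sets N"
proof -
  obtain \<F> where F: "countable \<F>" "\<F> \<subseteq> sets M" "\<forall>F\<in>\<F>. inj_on s F" "space M \<subseteq> \<Union>\<F>"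
    using countable_to_one_decomposition[OF sb s B fib] by blast
  have "s ` A = (\<Union>F\<in>\<F>. s ` (A \<inter> F))" using F(4) sets.sets_into_space[OF A] by blast
  moreover have "s ` (A \<inter> F) \<in> sets N" if "F \<in> \<F>" for F
    by (rule Borel_image_inj[OF sb s B]) (use A F that in \<open>auto intro: inj_on_subset\<close>)
  ultimately show ?thesis using F(1) by auto
qed

section \<open>Hilbert space theory of \<open>L\<^sup>2\<close>\<close>

definition l2_ip :: "'a measure \<Rightarrow> ('a \<Rightarrow> complex) \<Rightarrow> ('a \<Rightarrow> complex) \<Rightarrow> complex" where
  "l2_ip M f g = (\<integral>x. f x * cnj (g x) \<partial>M)"

definition sq_norm :: "'a measure \<Rightarrow> ('a \<Rightarrow> complex) \<Rightarrow> real" where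
  "sq_norm M f = (\<integral>x. (cmod (f x))\<^sup>2 \<partial>M)"

lemma l2_fun_measurable[measurable_dest]: "f \<in> l2_fun M \<Longrightarrow> f \<in> borel_measurable M"
  by (simp add: l2_fun_def)

lemma l2_fun_integrable: "f \<in> l2_fun M \<Longrightarrow> integrable M (\<lambda>x. (cmod (f x))\<^sup>2)"
  by (simp add: l2_fun_def)

lemma l2_fun_dominated:
  assumes "f \<in> borel_measurable M" "integrable M u" "\<And>x. x \<in> space M \<Longrightarrow> (cmod (f x))\<^sup>2 \<le> u x"
  shows "f \<in> l2_fun M"
proof -
  have "integrable M (\<lambda>x. (cmod (f x))\<^sup>2)"
    by (rule Bochner_Integration.integrable_bound[OF assms(2)]) (use assms in \<open>auto intro!: AE_I2 order_trans[OF _ abs_ge_self]\<close>)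
  then show ?thesis using assms(1) by (simp add: l2_fun_def)
qed

lemma borel_measurable_cnj[measurable]:
  "f \<in> borel_measurable M \<Longrightarrow> (\<lambda>x. cnj (f x)) \<in> borel_measurable M"
  by (rule measurable_compose[OF _ borel_measurable_continuous_onI[OF continuous_on_cnj[OF continuous_on_id]]])

lemma cmod_add_sq: "(cmod (a + b))\<^sup>2 \<le> 2 * (cmod a)\<^sup>2 + 2 * (cmod b)\<^sup>2"
proof -
  have "(cmod (a + b))\<^sup>2 \<le> (cmod a + cmod b)\<^sup>2" by (intro power_mono norm_triangle_ineq) simp
  also have "\<dots> \<le> 2 * (cmod a)\<^sup>2 + 2 * (cmod b)\<^sup>2"
    using sum_squares_bound[of "cmod a" "cmod b"] by (simp add: power2_sum)
  finally show ?thesis .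
qed

lemma l2_fun_add:
  assumes "f \<in> l2_fun M" "g \<in> l2_fun M"
  shows "(\<lambda>x. f x + g x) \<in> l2_fun M"
proof (rule l2_fun_dominated)
  show "integrable M (\<lambda>x. 2 * (cmod (f x))\<^sup>2 + 2 * (cmod (g x))\<^sup>2)"
    using assms by (simp add: l2_fun_integrable)
  show "(\<lambda>x. f x + g x) \<in> borel_measurable M" using assms by measurable
qed (rule cmod_add_sq)

lemma l2_fun_scale:
  assumes "f \<in> l2_fun M"
  shows "(\<lambda>x. c * f x) \<in> l2_fun M"
proof (rule l2_fun_dominated)
  show "integrable M (\<lambda>x. (cmod c)\<^sup>2 * (cmod (f x))\<^sup>2)" using assms by (simp add: l2_fun_integrable)
  show "(\<lambda>x. c * f x) \<in> borel_measurable M" using assms by measurable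
qed (simp add: norm_mult power_mult_distrib)

lemma l2_fun_minus: "f \<in> l2_fun M \<Longrightarrow> (\<lambda>x. - f x) \<in> l2_fun M"
  using l2_fun_scale[of f M "-1"] by simp

lemma l2_fun_diff: "f \<in> l2_fun M \<Longrightarrow> g \<in> l2_fun M \<Longrightarrow> (\<lambda>x. f x - g x) \<in> l2_fun M"
  using l2_fun_add[of f M "\<lambda>x. - g x"] l2_fun_minus[of g M] by simp

lemma l2_fun_zero: "(\<lambda>x. 0) \<in> l2_fun M"
  by (simp add: l2_fun_def)

lemma l2_fun_sum:
  assumes "finite I" "\<And>i. i \<in> I \<Longrightarrow> f i \<in> l2_fun M"
  shows "(\<lambda>x. \<Sum>i\<in>I. f i x) \<in> l2_fun M"
  using assms by (induction I rule: finite_induct) (auto intro: l2_fun_add simp: l2_fun_zero)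

lemma l2_fun_indicator:
  assumes "E \<in> sets M" "emeasure M E < \<infinity>"
  shows "(indicator E :: 'a \<Rightarrow> complex) \<in> l2_fun M"
proof -
  have "(\<lambda>x. (cmod (indicator E x :: complex))\<^sup>2) = (indicator E :: 'a \<Rightarrow> real)"
    by (auto simp: indicator_def)
  moreover have "integrable M (indicator E :: 'a \<Rightarrow> real)" using assms by (intro integrable_real_indicator) auto
  ultimately show ?thesis using assms(1) by (simp add: l2_fun_def)
qed

lemma integrable_l2_ip:
  assumes "f \<in> l2_fun M" "g \<in> l2_fun M"
  shows "integrable M (\<lambda>x. f x * cnj (g x))"
proof (rule Bochner_Integration.integrable_bound)
  show "integrable M (\<lambda>x. (cmod (f x))\<^sup>2 + (cmod (g x))\<^sup>2)" using assms by (simp add: l2_fun_integrable)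
  show "(\<lambda>x. f x * cnj (g x)) \<in> borel_measurable M" using assms by measurable
  show "AE x in M. norm (f x * cnj (g x)) \<le> norm ((cmod (f x))\<^sup>2 + (cmod (g x))\<^sup>2)"
  proof (rule AE_I2)
    fix x
    have "0 \<le> cmod (f x) * cmod (g x)" by simp
    then have "cmod (f x) * cmod (g x) \<le> (cmod (f x))\<^sup>2 + (cmod (g x))\<^sup>2"
      using sum_squares_bound[of "cmod (f x)" "cmod (g x)"] by linarith
    then show "norm (f x * cnj (g x)) \<le> norm ((cmod (f x))\<^sup>2 + (cmod (g x))\<^sup>2)" by (simp add: norm_mult)
  qed
qed

lemma l2_ip_add_left: "f \<in> l2_fun M \<Longrightarrow> g \<in> l2_fun M \<Longrightarrow> h \<in> l2_fun M \<Longrightarrow>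
    l2_ip M (\<lambda>x. f x + g x) h = l2_ip M f h + l2_ip M g h"
  unfolding l2_ip_def by (simp add: distrib_right integrable_l2_ip)

lemma l2_ip_scale_left: "l2_ip M (\<lambda>x. c * f x) h = c * l2_ip M f h"
  unfolding l2_ip_def by (simp add: mult.assoc)

lemma l2_ip_commute: "l2_ip M f g = cnj (l2_ip M g f)"
  unfolding l2_ip_def by (simp add: mult.commute flip: Bochner_Integration.integral_cnj)

lemma l2_ip_add_right: "f \<in> l2_fun M \<Longrightarrow> g \<in> l2_fun M \<Longrightarrow> h \<in> l2_fun M \<Longrightarrow>
    l2_ip M h (\<lambda>x. f x + g x) = l2_ip M h f + l2_ip M h g"
  by (subst (1 2 3) l2_ip_commute) (simp add: l2_ip_add_left)

lemma l2_ip_scale_right: "l2_ip M h (\<lambda>x. c * f x) = cnj c * l2_ip M h f"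
  by (subst (1 2) l2_ip_commute) (simp add: l2_ip_scale_left)

lemma l2_ip_self: "l2_ip M f f = of_real (sq_norm M f)"
  unfolding l2_ip_def sq_norm_def by (simp add: complex_norm_square[symmetric] flip: integral_complex_of_real)

lemma sq_norm_nonneg: "0 \<le> sq_norm M f" unfolding sq_norm_def by simp

lemma sq_norm_scale: "sq_norm M (\<lambda>x. c * f x) = (cmod c)\<^sup>2 * sq_norm M f"
  unfolding sq_norm_def by (simp add: norm_mult power_mult_distrib)

lemma sq_norm_add:
  assumes "f \<in> l2_fun M" "g \<in> l2_fun M"
  shows "sq_norm M (\<lambda>x. f x + g x) = sq_norm M f + sq_norm M g + 2 * Re (l2_ip M f g)"
proof -
  have "of_real (sq_norm M (\<lambda>x. f x + g x)) = l2_ip M f f + l2_ip M f g + (l2_ip M g f + l2_ip M g g)"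
    using assms by (simp add: l2_ip_self[symmetric] l2_ip_add_left l2_ip_add_right l2_fun_add)
  also have "l2_ip M g f = cnj (l2_ip M f g)" by (rule l2_ip_commute)
  finally have "Re (of_real (sq_norm M (\<lambda>x. f x + g x))) = sq_norm M f + sq_norm M g + 2 * Re (l2_ip M f g)"
    by (simp only: l2_ip_self) simp
  then show ?thesis by simp
qed

lemma sq_norm_diff:
  assumes "f \<in> l2_fun M" "g \<in> l2_fun M"
  shows "sq_norm M (\<lambda>x. f x - g x) = sq_norm M f + sq_norm M g - 2 * Re (l2_ip M f g)"
proof -
  have "l2_ip M f (\<lambda>x. - g x) = - l2_ip M f g" "sq_norm M (\<lambda>x. - g x) = sq_norm M g" by (simp_all add: l2_ip_def sq_norm_def)
  then show ?thesis using sq_norm_add[OF assms(1) l2_fun_minus[OF assms(2)]] by simp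
qed

lemma sq_norm_add_le:
  assumes "f \<in> l2_fun M" "g \<in> l2_fun M"
  shows "sq_norm M (\<lambda>x. f x + g x) \<le> 2 * sq_norm M f + 2 * sq_norm M g"
proof -
  have "sq_norm M (\<lambda>x. f x + g x) \<le> (\<integral>x. 2 * (cmod (f x))\<^sup>2 + 2 * (cmod (g x))\<^sup>2 \<partial>M)"
    unfolding sq_norm_def using assms l2_fun_add[OF assms]
    by (intro integral_mono) (auto simp: l2_fun_integrable cmod_add_sq)
  also have "\<dots> = 2 * sq_norm M f + 2 * sq_norm M g" unfolding sq_norm_def using assms by (simp add: l2_fun_integrable)
  finally show ?thesis .
qed

lemma sq_norm_cong_AE:
  assumes "f \<in> borel_measurable M" "g \<in> borel_measurable M" "AE x in M. f x = g x"
  shows "sq_norm M f = sq_norm M g"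
  unfolding sq_norm_def by (rule integral_cong_AE) (use assms in auto)

lemma l2_ip_cong_AE:
  assumes "f \<in> borel_measurable M" "g \<in> borel_measurable M" "AE x in M. f x = g x"
    and "h \<in> borel_measurable M" "k \<in> borel_measurable M" "AE x in M. h x = k x"
  shows "l2_ip M f h = l2_ip M g k"
  unfolding l2_ip_def by (rule integral_cong_AE) (use assms in auto)

lemma sq_norm_eq_0_iff:
  assumes "f \<in> l2_fun M"
  shows "sq_norm M f = 0 \<longleftrightarrow> (AE x in M. f x = 0)"
  unfolding sq_norm_def using integral_nonneg_eq_0_iff_AE[OF l2_fun_integrable[OF assms]] by simp

lemma Cauchy_Schwarz_l2_ip:
  assumes f: "f \<in> l2_fun M" and g: "g \<in> l2_fun M"
  shows "(cmod (l2_ip M f g))\<^sup>2 \<le> sq_norm M f * sq_norm M g"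
proof (cases "sq_norm M g = 0")
  case True
  then have "AE x in M. g x = 0" using sq_norm_eq_0_iff[OF g] by simp
  then have "l2_ip M f g = l2_ip M f (\<lambda>x. 0)" using f g by (intro l2_ip_cong_AE) auto
  then show ?thesis using True by (simp add: l2_ip_def)
next
  case False
  then have pos: "sq_norm M g > 0" using sq_norm_nonneg[of M g] by simp
  \<comment> \<open>The coefficient of the orthogonal projection of \<open>f\<close> onto
    \<open>g\<close>; the squared distance to it is nonnegative.\<close>
  define c where "c = l2_ip M f g / of_real (sq_norm M g)"
  have "0 \<le> sq_norm M (\<lambda>x. f x - c * g x)" by (rule sq_norm_nonneg)
  also have "\<dots> = sq_norm M f + (cmod c)\<^sup>2 * sq_norm M g - 2 * Re (cnj c * l2_ip M f g)"
    by (simp add: sq_norm_diff[OF f l2_fun_scale[OF g]] sq_norm_scale l2_ip_scale_right)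
  also have "cnj c * l2_ip M f g = of_real ((cmod (l2_ip M f g))\<^sup>2 / sq_norm M g)"
    unfolding of_real_divide complex_norm_square c_def by simp
  also have "(cmod c)\<^sup>2 * sq_norm M g = (cmod (l2_ip M f g))\<^sup>2 / sq_norm M g"
    using pos by (simp add: c_def norm_divide power_divide power2_eq_square)
  finally show ?thesis using pos by (simp add: field_simps)
qed

text \<open>The weights \<open>2^n\<close> against the rate \<open>4^-n\<close> make the integrals
  of \<open>u n\<close> summable, so the sum of the \<open>u n\<close> is finite almost everywhere.
  This bounds the increments by a summable series and gives a pointwise limit; Fatou's lemma passes
  the estimates on to the limit.\<close>

lemma l2_complete:
  assumes f: "\<And>n. f n \<in> l2_fun M"
    and cauchy: "\<And>n k. n \<le> k \<Longrightarrow> sq_norm M (\<lambda>x. f k x - f n x) \<le> c * (1/4)^n"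
  shows "\<exists>g\<in>l2_fun M. \<forall>n. sq_norm M (\<lambda>x. g x - f n x) \<le> c * (1/4)^n"
proof -
  have [measurable]: "f n \<in> borel_measurable M" for n using f by (rule l2_fun_measurable)
  have c0: "0 \<le> c" using order_trans[OF sq_norm_nonneg cauchy[of 0 0]] by simp
  have nn: "(\<integral>\<^sup>+x. ennreal ((cmod (h x))\<^sup>2) \<partial>M) = ennreal (sq_norm M h)" if "h \<in> l2_fun M" for h
    unfolding sq_norm_def by (rule nn_integral_eq_integral) (use that l2_fun_integrable in auto)
  define u where "u n x = 2^n * (cmod (f (Suc n) x - f n x))\<^sup>2" for n x
  have [measurable]: "u n \<in> borel_measurable M" for n unfolding u_def by measurable
  have u: "(\<integral>\<^sup>+x. ennreal (u n x) \<partial>M) \<le> ennreal (c * (1/2)^n)" for n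
  proof -
    have "(\<integral>\<^sup>+x. ennreal (u n x) \<partial>M) = (\<integral>\<^sup>+x. ennreal (2^n) * ennreal ((cmod (f (Suc n) x - f n x))\<^sup>2) \<partial>M)"
      unfolding u_def by (simp add: ennreal_mult)
    also have "\<dots> = ennreal (2^n) * ennreal (sq_norm M (\<lambda>x. f (Suc n) x - f n x))"
      by (subst nn_integral_cmult) (simp_all add: nn l2_fun_diff f)
    also have "\<dots> = ennreal (2^n * sq_norm M (\<lambda>x. f (Suc n) x - f n x))" by (simp add: ennreal_mult sq_norm_nonneg)
    also have "\<dots> \<le> ennreal (2^n * (c * (1/4)^n))"
      by (intro ennreal_leI mult_left_mono cauchy) auto
    also have "2^n * (c * (1/4)^n) = c * (1/2::real)^n" by (simp add: power_divide field_simps flip: power_mult_distrib)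
    finally show ?thesis .
  qed
  have "(\<integral>\<^sup>+x. (\<Sum>n. ennreal (u n x)) \<partial>M) = (\<Sum>n. \<integral>\<^sup>+x. ennreal (u n x) \<partial>M)"
    by (rule nn_integral_suminf) measurable
  also have "\<dots> \<le> (\<Sum>n. ennreal (c * (1/2)^n))" by (intro suminf_le u) auto
  also have "\<dots> = ennreal (\<Sum>n. c * (1/2)^n)"
    by (rule suminf_ennreal2) (use c0 in \<open>auto intro!: summable_mult summable_geometric\<close>)
  finally have "(\<integral>\<^sup>+x. (\<Sum>n. ennreal (u n x)) \<partial>M) \<noteq> \<infinity>" by (auto simp: top_unique)
  then have "AE x in M. (\<Sum>n. ennreal (u n x)) \<noteq> \<infinity>" by (intro nn_integral_PInf_AE) measurable
  then have conv: "AE x in M. convergent (\<lambda>n. f n x)"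
  proof eventually_elim
    case (elim x)
    have "summable (\<lambda>n. u n x)" by (rule summable_suminf_not_top) (use elim in \<open>auto simp: u_def\<close>)
    then have s: "summable (\<lambda>n. ((1/2)^n + u n x) / 2)"
      by (intro summable_divide summable_add summable_geometric) auto
    have "summable (\<lambda>n. f (Suc n) x - f n x)"
    proof (rule summable_comparison_test'[OF s])
      fix n
      let ?d = "cmod (f (Suc n) x - f n x)"
      \<comment> \<open>Arithmetic-geometric mean: an increment is at most half the sum of
        \<open>2^-n\<close> and \<open>2^n\<close> times its square.\<close>
      have "0 \<le> (1 - 2^n * ?d)\<^sup>2 / 2^n" by simp
      also have "\<dots> = (1/2)^n + u n x - 2 * ?d" by (simp add: u_def power2_eq_square field_simps power_divide)
      finally show "norm (f (Suc n) x - f n x) \<le> ((1/2)^n + u n x) / 2" by simp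
    qed
    then have "(\<lambda>n. \<Sum>i<n. f (Suc i) x - f i x) \<longlonglongrightarrow> (\<Sum>i. f (Suc i) x - f i x)" by (rule summable_LIMSEQ)
    then have "(\<lambda>n. f n x - f 0 x) \<longlonglongrightarrow> (\<Sum>i. f (Suc i) x - f i x)" 
      unfolding sum_lessThan_telescope[of "\<lambda>n. f n x"] .
    then have "(\<lambda>n. f n x - f 0 x + f 0 x) \<longlonglongrightarrow> (\<Sum>i. f (Suc i) x - f i x) + f 0 x" by (intro tendsto_add tendsto_const)
    then show ?case by (auto simp: convergent_def)
  qed
  define g where "g x = lim (\<lambda>n. f n x)" for x
  have [measurable]: "g \<in> borel_measurable M" unfolding g_def by (rule borel_measurable_lim_metric) simp
  have fatou: "(\<integral>\<^sup>+x. ennreal ((cmod (g x - f n x))\<^sup>2) \<partial>M) \<le> ennreal (c * (1/4)^n)" for n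
  proof -
    have "(\<integral>\<^sup>+x. ennreal ((cmod (g x - f n x))\<^sup>2) \<partial>M) = (\<integral>\<^sup>+x. liminf (\<lambda>k. ennreal ((cmod (f k x - f n x))\<^sup>2)) \<partial>M)"
    proof (rule nn_integral_cong_AE)
      show "AE x in M. ennreal ((cmod (g x - f n x))\<^sup>2) = liminf (\<lambda>k. ennreal ((cmod (f k x - f n x))\<^sup>2))"
        using conv
      proof eventually_elim
        case (elim x)
        then have "(\<lambda>k. f k x) \<longlonglongrightarrow> g x" unfolding g_def by (simp add: convergent_LIMSEQ_iff)
        then have "(\<lambda>k. ennreal ((cmod (f k x - f n x))\<^sup>2)) \<longlonglongrightarrow> ennreal ((cmod (g x - f n x))\<^sup>2)"
          by (intro tendsto_intros)
        then show ?case by (rule lim_imp_Liminf[symmetric, rotated]) simp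
      qed
    qed
    also have "\<dots> \<le> liminf (\<lambda>k. \<integral>\<^sup>+x. ennreal ((cmod (f k x - f n x))\<^sup>2) \<partial>M)"
      by (rule nn_integral_liminf) measurable
    also have "\<dots> = liminf (\<lambda>k. ennreal (sq_norm M (\<lambda>x. f k x - f n x)))" by (simp add: nn l2_fun_diff f)
    also have "\<dots> \<le> liminf (\<lambda>k. ennreal (c * (1/4)^n))"
      by (intro Liminf_mono) (auto intro!: eventually_sequentiallyI[of n] ennreal_leI cauchy)
    also have "\<dots> = ennreal (c * (1/4)^n)" by (simp add: Liminf_const)
    finally show ?thesis .
  qed
  have gf: "(\<lambda>x. g x - f n x) \<in> l2_fun M" for n
  proof -
    have "(\<integral>\<^sup>+x. ennreal ((cmod (g x - f n x))\<^sup>2) \<partial>M) < \<infinity>" using fatou[of n] by (simp add: le_less_trans)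
    then have "integrable M (\<lambda>x. (cmod (g x - f n x))\<^sup>2)" by (intro integrableI_bounded) auto
    then show ?thesis by (simp add: l2_fun_def)
  qed
  have "g \<in> l2_fun M" using l2_fun_add[OF gf[of 0] f[of 0]] by simp
  moreover have "sq_norm M (\<lambda>x. g x - f n x) \<le> c * (1/4)^n" for n
    using fatou[of n] c0 unfolding nn[OF gf] by (simp add: ennreal_le_iff)
  ultimately show ?thesis by blast
qed

text \<open>The representing vector maximizes \<open>2 Re \<psi>(f) - \<parallel>f\<parallel>\<^sup>2\<close>; by the parallelogram identity maximizing
  sequences are Cauchy.\<close>

lemma riesz_representation:
  assumes add: "\<And>f g. f \<in> l2_fun M \<Longrightarrow> g \<in> l2_fun M \<Longrightarrow> \<psi> (\<lambda>x. f x + g x) = \<psi> f + \<psi> g"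
    and scale: "\<And>c f. f \<in> l2_fun M \<Longrightarrow> \<psi> (\<lambda>x. c * f x) = c * \<psi> f"
    and bd: "\<And>f. f \<in> l2_fun M \<Longrightarrow> (cmod (\<psi> f))\<^sup>2 \<le> K * sq_norm M f"
  shows "\<exists>\<eta>\<in>l2_fun M. \<forall>f\<in>l2_fun M. \<psi> f = l2_ip M f \<eta>"
proof -
  define \<Phi> where "\<Phi> f = 2 * Re (\<psi> f) - sq_norm M f" for f
  \<comment> \<open>The given \<open>K\<close> may be negative when all norms vanish; the estimate
    of \<open>\<Phi>\<close> takes a nonnegative constant.\<close>
  define K' where "K' = max K 0"
  have Kb: "(cmod (\<psi> f))\<^sup>2 \<le> K' * sq_norm M f" if "f \<in> l2_fun M" for f
    using bd[OF that] sq_norm_nonneg[of M f] unfolding K'_def by (smt (verit) mult_right_mono)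
  have diff: "\<psi> (\<lambda>x. f x - g x) = \<psi> f - \<psi> g" if "f \<in> l2_fun M" "g \<in> l2_fun M" for f g
    using add[OF that(1) l2_fun_scale[OF that(2), of "-1"]] scale[OF that(2), of "-1"] by simp
  have \<Phi>_le: "\<Phi> f \<le> K'" if "f \<in> l2_fun M" for f
  proof -
    have "(2 * Re (\<psi> f))\<^sup>2 \<le> 4 * (cmod (\<psi> f))\<^sup>2" by (simp add: power_mult_distrib cmod_power2)
    also have "\<dots> \<le> 4 * (K' * sq_norm M f)" using Kb[OF that] by simp
    also have "\<dots> \<le> (K' + sq_norm M f)\<^sup>2" using sum_squares_bound[of K' "sq_norm M f"] by (simp add: power2_sum)
    finally have "2 * Re (\<psi> f) \<le> K' + sq_norm M f"
      by (rule power2_le_imp_le) (simp add: K'_def sq_norm_nonneg)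
    then show ?thesis by (simp add: \<Phi>_def)
  qed
  define m where "m = (SUP f\<in>l2_fun M. \<Phi> f)"
  have bdd: "bdd_above (\<Phi> ` l2_fun M)" using \<Phi>_le by (auto intro!: bdd_aboveI[of _ K'])
  have le_m: "\<Phi> f \<le> m" if "f \<in> l2_fun M" for f unfolding m_def by (rule cSUP_upper[OF that bdd])
  have "\<exists>f\<in>l2_fun M. m - (1/4)^n < \<Phi> f" for n :: nat
  proof -
    have "m - (1/4)^n < m" by simp
    then show ?thesis unfolding m_def by (subst (asm) less_cSUP_iff[OF _ bdd]) (use l2_fun_zero in auto)
  qed
  then have "\<forall>n. \<exists>f. f \<in> l2_fun M \<and> m - (1/4)^n < \<Phi> f" by auto
  from choice[OF this] obtain f where f: "\<forall>n::nat. f n \<in> l2_fun M \<and> m - (1/4)^n < \<Phi> (f n)" ..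
  \<comment> \<open>The midpoint of \<open>g\<close> and \<open>h\<close> also has
    \<open>\<Phi>\<close> at most \<open>m\<close>; strict concavity of \<open>\<Phi>\<close> then
    bounds the distance of two near-maximizers.\<close>
  have par: "sq_norm M (\<lambda>x. g x - h x) \<le> 4 * m - 2 * \<Phi> g - 2 * \<Phi> h" if g: "g \<in> l2_fun M" and h: "h \<in> l2_fun M" for g h
  proof -
    have "\<Phi> (\<lambda>x. (1/2) * (g x + h x)) \<le> m" by (intro le_m l2_fun_scale l2_fun_add g h)
    moreover have "\<psi> (\<lambda>x. (1/2) * (g x + h x)) = (1/2) * (\<psi> g + \<psi> h)"
      unfolding scale[OF l2_fun_add[OF g h]] add[OF g h] ..
    moreover have "sq_norm M (\<lambda>x. (1/2) * (g x + h x)) = (1/4) * (sq_norm M g + sq_norm M h + 2 * Re (l2_ip M g h))"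
      unfolding sq_norm_scale sq_norm_add[OF g h] by (simp add: power_divide)
    ultimately have "2 * Re ((1/2) * (\<psi> g + \<psi> h)) - (1/4) * (sq_norm M g + sq_norm M h + 2 * Re (l2_ip M g h)) \<le> m"
      unfolding \<Phi>_def by (simp only:)
    then show ?thesis unfolding sq_norm_diff[OF g h] \<Phi>_def by (simp add: field_simps)
  qed
  have "sq_norm M (\<lambda>x. f k x - f n x) \<le> 4 * (1/4)^n" if "n \<le> k" for n k
  proof -
    have "(1/4::real)^k \<le> (1/4)^n" using that by (intro power_decreasing) auto
    then show ?thesis using par[of "f k" "f n"] f[rule_format, of k] f[rule_format, of n] by linarith
  qed
  from l2_complete[of f M 4, OF _ this] f obtain \<eta> where
    eta: "\<eta> \<in> l2_fun M" "\<forall>n. sq_norm M (\<lambda>x. \<eta> x - f n x) \<le> 4 * (1/4)^n" by blast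
  have lim0: "(\<lambda>n. 4 * (1/4)^n) \<longlonglongrightarrow> (0::real)"
    by (intro tendsto_eq_intros LIMSEQ_power_zero) auto
  have n2lim: "(\<lambda>n. sq_norm M (\<lambda>x. \<eta> x - f n x)) \<longlonglongrightarrow> 0"
    by (rule tendsto_sandwich[OF _ _ tendsto_const lim0]) (use eta in \<open>auto simp: sq_norm_nonneg intro!: always_eventually\<close>)
  have to0: "(\<lambda>n. a n :: complex) \<longlonglongrightarrow> 0" if "\<And>n. (cmod (a n))\<^sup>2 \<le> L * sq_norm M (\<lambda>x. \<eta> x - f n x)" for a L
  proof -
    have "(\<lambda>n. (cmod (a n))\<^sup>2) \<longlonglongrightarrow> 0"
      by (rule tendsto_sandwich[OF _ _ tendsto_const tendsto_mult_right_zero[OF n2lim, of L]]) (use that in auto)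
    then have "(\<lambda>n. sqrt ((cmod (a n))\<^sup>2)) \<longlonglongrightarrow> sqrt 0" by (intro tendsto_intros)
    then show ?thesis by (simp add: tendsto_norm_zero_iff)
  qed
  have p1: "(\<lambda>n. \<psi> (\<lambda>x. \<eta> x - f n x)) \<longlonglongrightarrow> 0"
    by (rule to0) (use Kb eta f l2_fun_diff in blast)
  have p2: "(\<lambda>n. l2_ip M (\<lambda>x. \<eta> x - f n x) \<eta>) \<longlonglongrightarrow> 0"
  proof (rule to0[of _ "sq_norm M \<eta>"])
    fix n show "(cmod (l2_ip M (\<lambda>x. \<eta> x - f n x) \<eta>))\<^sup>2 \<le> sq_norm M \<eta> * sq_norm M (\<lambda>x. \<eta> x - f n x)"
      using Cauchy_Schwarz_l2_ip[of "\<lambda>x. \<eta> x - f n x" M \<eta>] eta f l2_fun_diff[of \<eta> M "f n"] by (simp add: mult.commute)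
  qed
  have \<Phi>f: "\<Phi> (f n) = \<Phi> \<eta> - 2 * Re (\<psi> (\<lambda>x. \<eta> x - f n x)) + 2 * Re (l2_ip M (\<lambda>x. \<eta> x - f n x) \<eta>) - sq_norm M (\<lambda>x. \<eta> x - f n x)" for n
  proof -
    have fn: "f n \<in> l2_fun M" "(\<lambda>x. \<eta> x - f n x) \<in> l2_fun M" using f eta l2_fun_diff by blast+
    have "sq_norm M (f n) = sq_norm M (\<lambda>x. \<eta> x - (\<eta> x - f n x))" by simp
    also have "\<dots> = sq_norm M \<eta> + sq_norm M (\<lambda>x. \<eta> x - f n x) - 2 * Re (l2_ip M \<eta> (\<lambda>x. \<eta> x - f n x))"
      by (rule sq_norm_diff[OF eta(1) fn(2)])
    also have "Re (l2_ip M \<eta> (\<lambda>x. \<eta> x - f n x)) = Re (l2_ip M (\<lambda>x. \<eta> x - f n x) \<eta>)"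
      by (subst l2_ip_commute) simp
    finally show ?thesis using diff[OF eta(1) fn(1)] by (simp add: \<Phi>_def)
  qed
  have "(\<lambda>n. \<Phi> \<eta> - 2 * Re (\<psi> (\<lambda>x. \<eta> x - f n x)) + 2 * Re (l2_ip M (\<lambda>x. \<eta> x - f n x) \<eta>) - sq_norm M (\<lambda>x. \<eta> x - f n x)) \<longlonglongrightarrow>
     \<Phi> \<eta> - 2 * Re 0 + 2 * Re 0 - 0"
    by (intro tendsto_intros p1 p2 n2lim)
  then have "(\<lambda>n. \<Phi> (f n)) \<longlonglongrightarrow> \<Phi> \<eta>" unfolding \<Phi>f by simp
  moreover have "(\<lambda>n. m - (1/4)^n) \<longlonglongrightarrow> m - 0" by (intro tendsto_intros LIMSEQ_power_zero) simp
  ultimately have "m - 0 \<le> \<Phi> \<eta>"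
    by (intro LIMSEQ_le[of "\<lambda>n. m - (1/4)^n" "m - 0"]) (use f in \<open>auto intro: less_imp_le\<close>)
  then have mx: "m \<le> \<Phi> \<eta>" by simp
  have Re_eq: "Re (\<psi> g) = Re (l2_ip M g \<eta>)" if g: "g \<in> l2_fun M" for g
  proof -
    define b where "b = Re (\<psi> g) - Re (l2_ip M g \<eta>)"
    \<comment> \<open>First variation at the maximizer in the direction \<open>g\<close>: the linear
      term in \<open>t\<close> cannot exceed the quadratic one.\<close>
    have key: "2 * t * b \<le> t\<^sup>2 * sq_norm M g" for t :: real
    proof -
      have tg: "(\<lambda>x. of_real t * g x) \<in> l2_fun M" by (rule l2_fun_scale[OF g])
      have "\<Phi> (\<lambda>x. \<eta> x + of_real t * g x) \<le> \<Phi> \<eta>" using le_m[OF l2_fun_add[OF eta(1) tg]] mx by simp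
      moreover have "\<Phi> (\<lambda>x. \<eta> x + of_real t * g x) = \<Phi> \<eta> + 2 * t * b - t\<^sup>2 * sq_norm M g"
      proof -
        have "Re (l2_ip M \<eta> (\<lambda>x. of_real t * g x)) = t * Re (l2_ip M g \<eta>)"
          unfolding l2_ip_scale_right by (subst l2_ip_commute) simp
        then show ?thesis
          unfolding \<Phi>_def add[OF eta(1) tg] scale[OF g] sq_norm_add[OF eta(1) tg] sq_norm_scale b_def
          by (simp add: algebra_simps)
      qed
      ultimately show ?thesis by simp
    qed
    have "b = 0"
    proof (rule ccontr)
      assume "b \<noteq> 0"
      \<comment> \<open>Near the optimal value of \<open>t\<close>; the added 1 keeps the
        denominator positive when \<open>g\<close> has norm zero.\<close>
      define t where "t = b / (sq_norm M g + 1)"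
      have n: "sq_norm M g \<ge> 0" "sq_norm M g + 1 > 0" using sq_norm_nonneg[of M g] by auto
      have "2 * t * b = 2 * t\<^sup>2 * (sq_norm M g + 1)" using n by (simp add: t_def power2_eq_square)
      moreover have "t\<^sup>2 > 0" using \<open>b \<noteq> 0\<close> n by (simp add: t_def)
      moreover have "t\<^sup>2 * sq_norm M g \<ge> 0" using n by simp
      moreover have "2 * t\<^sup>2 * (sq_norm M g + 1) = 2 * (t\<^sup>2 * sq_norm M g) + 2 * t\<^sup>2" by (simp add: algebra_simps)
      ultimately show False using key[of t] by linarith
    qed
    then show ?thesis by (simp add: b_def)
  qed
  have "\<psi> g = l2_ip M g \<eta>" if g: "g \<in> l2_fun M" for g
  proof (rule complex_eqI)
    show "Re (\<psi> g) = Re (l2_ip M g \<eta>)" by (rule Re_eq[OF g])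
    show "Im (\<psi> g) = Im (l2_ip M g \<eta>)"
      using Re_eq[OF l2_fun_scale[OF g, of \<i>]] unfolding scale[OF g] l2_ip_scale_left by simp
  qed
  then show ?thesis using eta(1) by blast
qed

section \<open>Almost everywhere classes and bounded operators\<close>

lemma l2_class_memI: "f \<in> l2_fun M \<Longrightarrow> f \<in> l2_class M f"
  by (simp add: l2_class_def)

lemma l2_class_eq:
  assumes "AE x in M. f x = g x"
  shows "l2_class M f = l2_class M g"
proof -
  have "(AE x in M. h x = f x) \<longleftrightarrow> (AE x in M. h x = g x)" for h
  proof
    assume "AE x in M. h x = f x" then show "AE x in M. h x = g x" using assms by eventually_elim simp
  next
    assume "AE x in M. h x = g x" then show "AE x in M. h x = f x" using assms by eventually_elim simp
  qed
  then show ?thesis by (simp add: l2_class_def)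
qed

lemma l2_class_eqD:
  assumes "l2_class M f = l2_class M g" "f \<in> l2_fun M"
  shows "AE x in M. f x = g x"
  using l2_class_memI[OF assms(2)] unfolding assms(1) by (simp add: l2_class_def)

lemma L2I: "f \<in> l2_fun M \<Longrightarrow> l2_class M f \<in> L2 M"
  by (simp add: L2_def)

lemma l2_rep_class:
  assumes "f \<in> l2_fun M"
  shows "l2_rep (l2_class M f) \<in> l2_fun M" "AE x in M. l2_rep (l2_class M f) x = f x"
proof -
  have "l2_rep (l2_class M f) \<in> l2_class M f"
    unfolding l2_rep_def
    by (rule someI[where P="\<lambda>h. h \<in> l2_class M f" and x=f]) (rule l2_class_memI[OF assms])
  then show "l2_rep (l2_class M f) \<in> l2_fun M" "AE x in M. l2_rep (l2_class M f) x = f x"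
    by (simp_all add: l2_class_def)
qed

lemma L2_rep:
  assumes "X \<in> L2 M"
  shows "l2_rep X \<in> l2_fun M" "l2_class M (l2_rep X) = X"
proof -
  obtain f where f: "f \<in> l2_fun M" "X = l2_class M f" using assms by (auto simp: L2_def)
  show "l2_rep X \<in> l2_fun M" unfolding f(2) by (rule l2_rep_class[OF f(1)])
  show "l2_class M (l2_rep X) = X" unfolding f(2) by (rule l2_class_eq[OF l2_rep_class(2)[OF f(1)]])
qed

lemma l2_add_class:
  assumes "f \<in> l2_fun M" "g \<in> l2_fun M"
  shows "l2_add M (l2_class M f) (l2_class M g) = l2_class M (\<lambda>x. f x + g x)"
  unfolding l2_add_def
  by (rule l2_class_eq) (use l2_rep_class(2)[OF assms(1)] l2_rep_class(2)[OF assms(2)] in eventually_elim, simp)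

lemma l2_scale_class:
  assumes "f \<in> l2_fun M"
  shows "l2_scale M c (l2_class M f) = l2_class M (\<lambda>x. c * f x)"
  unfolding l2_scale_def
  by (rule l2_class_eq) (use l2_rep_class(2)[OF assms] in eventually_elim, simp)

lemma l2_inner_class:
  assumes "f \<in> l2_fun M" "g \<in> l2_fun M"
  shows "l2_inner M (l2_class M f) (l2_class M g) = l2_ip M f g"
  unfolding l2_inner_def l2_ip_def[symmetric]
  by (intro l2_ip_cong_AE l2_fun_measurable[OF l2_rep_class(1)] l2_rep_class(2) l2_fun_measurable assms)

lemma l2_norm_class:
  assumes "f \<in> l2_fun M"
  shows "l2_norm M (l2_class M f) = sqrt (sq_norm M f)"
  unfolding l2_norm_def sq_norm_def[symmetric]
  by (intro arg_cong[of _ _ sqrt] sq_norm_cong_AE l2_fun_measurable[OF l2_rep_class(1)] l2_rep_class(2) l2_fun_measurable assms)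

lemma L2_eqI:
  assumes "X \<in> L2 M" "Y \<in> L2 M" "\<And>Z. Z \<in> L2 M \<Longrightarrow> l2_inner M Z X = l2_inner M Z Y"
  shows "X = Y"
proof -
  let ?f = "l2_rep X" and ?g = "l2_rep Y"
  have f: "?f \<in> l2_fun M" "?g \<in> l2_fun M" and X: "l2_class M ?f = X" "l2_class M ?g = Y"
    using assms(1,2) L2_rep by blast+
  let ?d = "\<lambda>x. ?f x - ?g x"
  have d: "?d \<in> l2_fun M" by (rule l2_fun_diff[OF f])
  have "l2_ip M ?d ?f = l2_ip M ?d ?g"
    using assms(3)[OF L2I[OF d]] l2_inner_class[OF d f(1)] l2_inner_class[OF d f(2)] by (simp add: X)
  moreover have "l2_ip M ?d ?f = l2_ip M ?d ?d + l2_ip M ?d ?g"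
    using l2_ip_add_right[OF d f(2) d] by simp
  ultimately have "sq_norm M ?d = 0" by (simp add: l2_ip_self)
  then have "AE x in M. ?f x = ?g x" unfolding sq_norm_eq_0_iff[OF d] by simp
  then show ?thesis using l2_class_eq X by metis
qed

text \<open>Lets an operator on classes act on functions through chosen representatives. Its
  linearity therefore holds almost everywhere only.\<close>

definition op_fun :: "'a measure \<Rightarrow> 'a l2_operator \<Rightarrow> ('a \<Rightarrow> complex) \<Rightarrow> 'a \<Rightarrow> complex" where
  "op_fun M T f = l2_rep (T (l2_class M f))"

lemma bounded_op_L2: "T \<in> l2_bounded_ops M \<Longrightarrow> X \<in> L2 M \<Longrightarrow> T X \<in> L2 M"
  unfolding l2_bounded_ops_def by auto

lemma op_fun_l2:
  assumes "T \<in> l2_bounded_ops M" "f \<in> l2_fun M"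
  shows "op_fun M T f \<in> l2_fun M"
  unfolding op_fun_def by (rule L2_rep(1)[OF bounded_op_L2[OF assms(1) L2I[OF assms(2)]]])

lemma op_fun_class:
  assumes "T \<in> l2_bounded_ops M" "f \<in> l2_fun M"
  shows "T (l2_class M f) = l2_class M (op_fun M T f)"
  unfolding op_fun_def by (rule L2_rep(2)[OF bounded_op_L2[OF assms(1) L2I[OF assms(2)]], symmetric])

lemma op_fun_add:
  assumes "T \<in> l2_bounded_ops M" "f \<in> l2_fun M" "g \<in> l2_fun M"
  shows "AE x in M. op_fun M T (\<lambda>x. f x + g x) x = op_fun M T f x + op_fun M T g x"
proof -
  have "T (l2_add M (l2_class M f) (l2_class M g)) = l2_add M (T (l2_class M f)) (T (l2_class M g))"
    using assms L2I unfolding l2_bounded_ops_def by blast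
  then have "l2_class M (op_fun M T (\<lambda>x. f x + g x)) = l2_class M (\<lambda>x. op_fun M T f x + op_fun M T g x)"
    by (simp add: l2_add_class op_fun_class op_fun_l2 l2_fun_add assms)
  then show ?thesis by (rule l2_class_eqD) (intro op_fun_l2 l2_fun_add assms)
qed

lemma op_fun_scale:
  assumes "T \<in> l2_bounded_ops M" "f \<in> l2_fun M"
  shows "AE x in M. op_fun M T (\<lambda>x. c * f x) x = c * op_fun M T f x"
proof -
  have "T (l2_scale M c (l2_class M f)) = l2_scale M c (T (l2_class M f))"
    using assms L2I unfolding l2_bounded_ops_def by blast
  then have "l2_class M (op_fun M T (\<lambda>x. c * f x)) = l2_class M (\<lambda>x. c * op_fun M T f x)"
    by (simp add: l2_scale_class op_fun_class op_fun_l2 l2_fun_scale assms)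
  then show ?thesis by (rule l2_class_eqD) (intro op_fun_l2 l2_fun_scale assms)
qed

lemma op_fun_bounded:
  assumes "T \<in> l2_bounded_ops M"
  shows "\<exists>K\<ge>0. \<forall>f\<in>l2_fun M. sq_norm M (op_fun M T f) \<le> K * sq_norm M f"
proof -
  obtain K where K: "\<forall>X\<in>L2 M. l2_norm M (T X) \<le> K * l2_norm M X"
    using assms unfolding l2_bounded_ops_def by blast
  have "sq_norm M (op_fun M T f) \<le> K\<^sup>2 * sq_norm M f" if f: "f \<in> l2_fun M" for f
  proof -
    have "sqrt (sq_norm M (op_fun M T f)) \<le> K * sqrt (sq_norm M f)"
      using K[rule_format, OF L2I[OF f]] by (simp add: op_fun_class[OF assms f] l2_norm_class op_fun_l2[OF assms f] f)
    then have "(sqrt (sq_norm M (op_fun M T f)))\<^sup>2 \<le> (K * sqrt (sq_norm M f))\<^sup>2"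
      by (intro power_mono) (auto simp: sq_norm_nonneg)
    then show ?thesis by (simp add: power_mult_distrib sq_norm_nonneg)
  qed
  then show ?thesis by (intro exI[of _ "K\<^sup>2"] conjI ballI) simp_all
qed

definition lift_op :: "'a measure \<Rightarrow> (('a \<Rightarrow> complex) \<Rightarrow> 'a \<Rightarrow> complex) \<Rightarrow> 'a l2_operator" where
  "lift_op M \<Phi> = (\<lambda>X\<in>L2 M. l2_class M (\<Phi> (l2_rep X)))"

text \<open>The requirements under which a map of functions descends to a bounded operator; the
  clause on almost everywhere equal functions is well-definedness on classes.\<close>

definition l2_linear :: "'a measure \<Rightarrow> (('a \<Rightarrow> complex) \<Rightarrow> 'a \<Rightarrow> complex) \<Rightarrow> bool" where
  "l2_linear M \<Phi> \<longleftrightarrow> (\<forall>f\<in>l2_fun M. \<Phi> f \<in> l2_fun M) \<and>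
     (\<forall>f\<in>l2_fun M. \<forall>g\<in>l2_fun M. (AE x in M. f x = g x) \<longrightarrow> (AE x in M. \<Phi> f x = \<Phi> g x)) \<and>
     (\<forall>f\<in>l2_fun M. \<forall>g\<in>l2_fun M. AE x in M. \<Phi> (\<lambda>x. f x + g x) x = \<Phi> f x + \<Phi> g x) \<and>
     (\<forall>c. \<forall>f\<in>l2_fun M. AE x in M. \<Phi> (\<lambda>x. c * f x) x = c * \<Phi> f x) \<and>
     (\<exists>K. \<forall>f\<in>l2_fun M. sq_norm M (\<Phi> f) \<le> K * sq_norm M f)"

lemma lift_op:
  assumes "l2_linear M \<Phi>"
  shows "lift_op M \<Phi> \<in> l2_bounded_ops M"
    and "f \<in> l2_fun M \<Longrightarrow> lift_op M \<Phi> (l2_class M f) = l2_class M (\<Phi> f)"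
proof -
  have l2: "\<And>f. f \<in> l2_fun M \<Longrightarrow> \<Phi> f \<in> l2_fun M"
    and cong: "\<And>f g. f \<in> l2_fun M \<Longrightarrow> g \<in> l2_fun M \<Longrightarrow> AE x in M. f x = g x \<Longrightarrow> AE x in M. \<Phi> f x = \<Phi> g x"
    and add: "\<And>f g. f \<in> l2_fun M \<Longrightarrow> g \<in> l2_fun M \<Longrightarrow> AE x in M. \<Phi> (\<lambda>x. f x + g x) x = \<Phi> f x + \<Phi> g x"
    and scale: "\<And>c f. f \<in> l2_fun M \<Longrightarrow> AE x in M. \<Phi> (\<lambda>x. c * f x) x = c * \<Phi> f x"
    using assms unfolding l2_linear_def by simp_all
  obtain K where "\<forall>f\<in>l2_fun M. sq_norm M (\<Phi> f) \<le> K * sq_norm M f" using assms unfolding l2_linear_def by auto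
  then have bd: "\<And>f. f \<in> l2_fun M \<Longrightarrow> sq_norm M (\<Phi> f) \<le> K * sq_norm M f" by simp
  have cl: "lift_op M \<Phi> (l2_class M f) = l2_class M (\<Phi> f)" if f: "f \<in> l2_fun M" for f
  proof -
    have "l2_class M (\<Phi> (l2_rep (l2_class M f))) = l2_class M (\<Phi> f)"
      by (rule l2_class_eq[OF cong[OF _ f]]) (use l2_rep_class[OF f] in auto)
    then show ?thesis using L2I[OF f] by (simp add: lift_op_def)
  qed
  show "lift_op M \<Phi> \<in> l2_bounded_ops M" unfolding l2_bounded_ops_def
  proof (intro CollectI conjI ballI allI exI[of _ "sqrt (max K 0)"])
    have "l2_class M (\<Phi> (l2_rep X)) \<in> L2 M" if "X \<in> L2 M" for X
      by (rule L2I[OF l2[OF L2_rep(1)[OF that]]])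
    then show "lift_op M \<Phi> \<in> L2 M \<rightarrow>\<^sub>E L2 M" by (simp add: lift_op_def)
    fix X Y assume X: "X \<in> L2 M" and Y: "Y \<in> L2 M"
    have f: "l2_rep X \<in> l2_fun M" "l2_rep Y \<in> l2_fun M" using X Y L2_rep by auto
    have "lift_op M \<Phi> (l2_add M (l2_class M (l2_rep X)) (l2_class M (l2_rep Y)))
       = l2_add M (lift_op M \<Phi> (l2_class M (l2_rep X))) (lift_op M \<Phi> (l2_class M (l2_rep Y)))"
      by (simp add: l2_add_class f cl l2_fun_add l2 l2_class_eq[OF add[OF f]])
    then show "lift_op M \<Phi> (l2_add M X Y) = l2_add M (lift_op M \<Phi> X) (lift_op M \<Phi> Y)"
      using L2_rep(2)[OF X] L2_rep(2)[OF Y] by simp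
  next
    fix c X assume X: "X \<in> L2 M"
    have f: "l2_rep X \<in> l2_fun M" using X L2_rep by auto
    have "lift_op M \<Phi> (l2_scale M c (l2_class M (l2_rep X))) = l2_scale M c (lift_op M \<Phi> (l2_class M (l2_rep X)))"
      by (simp add: l2_scale_class f cl l2_fun_scale l2 l2_class_eq[OF scale[OF f]])
    then show "lift_op M \<Phi> (l2_scale M c X) = l2_scale M c (lift_op M \<Phi> X)"
      using L2_rep(2)[OF X] by simp
  next
    fix X assume X: "X \<in> L2 M"
    have f: "l2_rep X \<in> l2_fun M" using X L2_rep by auto
    have "sq_norm M (\<Phi> (l2_rep X)) \<le> max K 0 * sq_norm M (l2_rep X)"
      by (rule order_trans[OF bd[OF f]]) (intro mult_right_mono sq_norm_nonneg, simp)
    then have "l2_norm M (lift_op M \<Phi> (l2_class M (l2_rep X))) \<le> sqrt (max K 0) * l2_norm M (l2_class M (l2_rep X))"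
      by (simp add: cl f l2 l2_norm_class flip: real_sqrt_mult)
    then show "l2_norm M (lift_op M \<Phi> X) \<le> sqrt (max K 0) * l2_norm M X"
      using L2_rep(2)[OF X] by simp
  qed
  show "f \<in> l2_fun M \<Longrightarrow> lift_op M \<Phi> (l2_class M f) = l2_class M (\<Phi> f)" by (rule cl)
qed

lemma bounded_op_eqI:
  assumes "T \<in> l2_bounded_ops M" "S \<in> l2_bounded_ops M"
    and "\<And>f. f \<in> l2_fun M \<Longrightarrow> T (l2_class M f) = S (l2_class M f)"
  shows "T = S"
proof (rule PiE_ext[of T "L2 M" "\<lambda>_. L2 M"])
  show "T \<in> L2 M \<rightarrow>\<^sub>E L2 M" "S \<in> L2 M \<rightarrow>\<^sub>E L2 M" using assms(1,2) unfolding l2_bounded_ops_def by auto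
  fix X assume "X \<in> L2 M"
  then show "T X = S X" using assms(3)[OF L2_rep(1)[of X M]] L2_rep(2)[of X M] by simp
qed

text \<open>Density of simple functions supported in finitely many \<open>B n\<close>. The
  approximations \<open>F i\<close> are dominated by \<open>2 |f|\<close> and cut off to the first
  pieces; they converge to \<open>f\<close> in norm by dominated convergence, and boundedness of
  both operators carries the equality over.\<close>

lemma bounded_op_eqI_indicator:
  assumes T: "T \<in> l2_bounded_ops M" and S: "S \<in> l2_bounded_ops M"
    and B: "\<And>n. B n \<in> sets M" "disjoint_family B" "(\<Union>n::nat. B n) = space M" "\<And>n. emeasure M (B n) < \<infinity>"
    and eq: "\<And>E n. E \<in> sets M \<Longrightarrow> E \<subseteq> B n \<Longrightarrow> T (l2_class M (indicator E)) = S (l2_class M (indicator E))"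
  shows "T = S"
proof (rule bounded_op_eqI[OF T S])
  let ?P = "\<lambda>f. AE x in M. op_fun M T f x = op_fun M S f x"
  have P: "T (l2_class M f) = S (l2_class M f) \<longleftrightarrow> ?P f" if f: "f \<in> l2_fun M" for f
    unfolding op_fun_class[OF T f] op_fun_class[OF S f] using l2_class_eq l2_class_eqD[OF _ op_fun_l2[OF T f]] by metis
  have P_add: "?P (\<lambda>x. f x + g x)" if "f \<in> l2_fun M" "g \<in> l2_fun M" "?P f" "?P g" for f g
    using op_fun_add[OF T that(1,2)] op_fun_add[OF S that(1,2)] that(3,4) by eventually_elim simp
  have P_scale: "?P (\<lambda>x. c * f x)" if "f \<in> l2_fun M" "?P f" for f c
    using op_fun_scale[OF T that(1), of c] op_fun_scale[OF S that(1), of c] that(2) by eventually_elim simp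
  have P_zero: "?P (\<lambda>x. 0)"
    using op_fun_scale[OF T l2_fun_zero, of 0] op_fun_scale[OF S l2_fun_zero, of 0] by eventually_elim simp
  have P_sum: "?P (\<lambda>x. \<Sum>i\<in>I. f i x)" if "finite I" "\<And>i. i \<in> I \<Longrightarrow> f i \<in> l2_fun M" "\<And>i. i \<in> I \<Longrightarrow> ?P (f i)" for I :: "(complex \<times> nat) set" and f
    using that
  proof (induction I rule: finite_induct)
    case empty then show ?case using P_zero by simp
  next
    case (insert i I)
    have "?P (\<lambda>x. f i x + (\<Sum>i\<in>I. f i x))"
      by (rule P_add) (use insert in \<open>auto intro!: l2_fun_sum\<close>)
    then show ?case using insert by simp
  qed
  have small: "E \<in> sets M \<Longrightarrow> E \<subseteq> B n \<Longrightarrow> emeasure M E < \<infinity>" for E n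
    using emeasure_mono[of E "B n" M] B(1,4) by (meson le_less_trans)
  fix f assume f: "f \<in> l2_fun M"
  obtain F where F: "\<And>i. simple_function M (F i)" "\<And>x. x \<in> space M \<Longrightarrow> (\<lambda>i. F i x) \<longlonglongrightarrow> f x"
     "\<And>i x. x \<in> space M \<Longrightarrow> dist (F i x) 0 \<le> 2 * dist (f x) 0"
    using borel_measurable_implies_sequence_metric[OF l2_fun_measurable[OF f], of 0] by blast
  define g where "g i x = F i x * indicator (\<Union>n\<le>i. B n) x" for i x
  have [measurable]: "F i \<in> borel_measurable M" for i using F(1) by (rule borel_measurable_simple_function)
  have [measurable]: "B n \<in> sets M" for n by (rule B(1))
  have [measurable]: "f \<in> borel_measurable M" using f by (rule l2_fun_measurable)
  have gm[measurable]: "g i \<in> borel_measurable M" for i unfolding g_def by measurable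
  have gl: "g i \<in> l2_fun M" for i
  proof (rule l2_fun_dominated[OF gm])
    show "integrable M (\<lambda>x. 4 * (cmod (f x))\<^sup>2)" using f by (simp add: l2_fun_integrable)
    fix x assume "x \<in> space M"
    then have "cmod (F i x) \<le> 2 * cmod (f x)" using F(3)[of x i] by simp
    then have "(cmod (F i x))\<^sup>2 \<le> (2 * cmod (f x))\<^sup>2" by (intro power_mono) auto
    then show "(cmod (g i x))\<^sup>2 \<le> 4 * (cmod (f x))\<^sup>2"
      by (auto simp: g_def indicator_def power_mult_distrib)
  qed
  have Pg: "?P (g i)" for i
  proof -
    define E where "E p = (F i -` {fst p} \<inter> space M) \<inter> B (snd p)" for p :: "complex \<times> nat"
    have E: "E p \<in> sets M" "E p \<subseteq> B (snd p)" for p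
      unfolding E_def using simple_functionD(2)[OF F(1)[of i]] B(1) by auto
    \<comment> \<open>The cut-off simple function is a finite combination of indicators indexed by a
      value and a piece; by disjointness at most one term is nonzero at each point.\<close>
    let ?I = "F i ` space M \<times> {..i}"
    have fin: "finite ?I" using simple_functionD(1)[OF F(1)[of i]] by simp
    have Il: "(indicator (E p) :: 'a \<Rightarrow> complex) \<in> l2_fun M" for p
      by (rule l2_fun_indicator[OF E(1) small[OF E]])
    have "?P (\<lambda>x. \<Sum>p\<in>?I. fst p * indicator (E p) x)"
      by (rule P_sum[OF fin]) (use Il P[OF Il] eq[OF E] in \<open>auto intro!: l2_fun_scale P_scale\<close>)
    moreover have "l2_class M (\<lambda>x. \<Sum>p\<in>?I. fst p * indicator (E p) x) = l2_class M (g i)"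
    proof (rule l2_class_eq, rule AE_I2)
      fix x assume x: "x \<in> space M"
      have 1: "fst p * indicator (E p) x = (if F i x = fst p \<and> x \<in> B (snd p) then F i x else 0)" for p
        using x by (auto simp: E_def)
      have "(\<Sum>p\<in>?I. fst p * indicator (E p) x) = (\<Sum>v\<in>F i ` space M. \<Sum>n\<le>i. if F i x = v \<and> x \<in> B n then F i x else 0)"
        unfolding 1 by (simp add: sum.cartesian_product case_prod_beta)
      also have "\<dots> = (\<Sum>v\<in>F i ` space M. if v = F i x then (\<Sum>n\<le>i. if x \<in> B n then F i x else 0) else 0)"
        by (intro sum.cong) auto
      also have "\<dots> = (\<Sum>n\<le>i. if x \<in> B n then F i x else 0)"
        using simple_functionD(1)[OF F(1)[of i]] x by (subst sum.delta) auto
      also have "\<dots> = g i x"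
      proof (cases "\<exists>n\<le>i. x \<in> B n")
        case True
        then obtain n where n: "n \<le> i" "x \<in> B n" by blast
        have "x \<in> B m \<longleftrightarrow> m = n" for m using n(2) B(2) unfolding disjoint_family_on_def by blast
        then show ?thesis using n by (auto simp: g_def)
      next
        case False
        then show ?thesis by (auto simp: g_def)
      qed
      finally show "(\<Sum>p\<in>?I. fst p * indicator (E p) x) = g i x" .
    qed
    ultimately show ?thesis unfolding op_fun_def by simp
  qed
  have conv: "(\<lambda>i. sq_norm M (\<lambda>x. g i x - f x)) \<longlonglongrightarrow> (\<integral>x. 0 \<partial>M)"
    unfolding sq_norm_def
  proof (rule integral_dominated_convergence)
    \<comment> \<open>As \<open>g i\<close> is bounded by \<open>2 |f|\<close>, the difference
      \<open>g i - f\<close> is bounded by \<open>3 |f|\<close>.\<close>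
    show "integrable M (\<lambda>x. 9 * (cmod (f x))\<^sup>2)" using f by (simp add: l2_fun_integrable)
    show "AE x in M. (\<lambda>i. (cmod (g i x - f x))\<^sup>2) \<longlonglongrightarrow> 0"
    proof (rule AE_I2)
      fix x assume x: "x \<in> space M"
      then obtain n where n: "x \<in> B n" using B(3) by blast
      have "(\<lambda>i. F i x) \<longlonglongrightarrow> f x" using F(2) x by blast
      moreover have "\<forall>\<^sub>F i in sequentially. F i x = g i x"
      proof (rule eventually_sequentiallyI[of n])
        fix i assume "n \<le> i"
        then have "x \<in> (\<Union>n\<le>i. B n)" using n by blast
        then show "F i x = g i x" by (simp add: g_def)
      qed
      ultimately have "(\<lambda>i. g i x) \<longlonglongrightarrow> f x" by (rule Lim_transform_eventually)
      then have "(\<lambda>i. (cmod (g i x - f x))\<^sup>2) \<longlonglongrightarrow> (cmod (f x - f x))\<^sup>2" by (intro tendsto_intros)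
      then show "(\<lambda>i. (cmod (g i x - f x))\<^sup>2) \<longlonglongrightarrow> 0" by simp
    qed
    fix i
    show "AE x in M. norm ((cmod (g i x - f x))\<^sup>2) \<le> 9 * (cmod (f x))\<^sup>2"
    proof (rule AE_I2)
      fix x assume "x \<in> space M"
      then have "cmod (F i x) \<le> 2 * cmod (f x)" using F(3)[of x i] by simp
      then have "cmod (g i x) \<le> 2 * cmod (f x)" by (auto simp: g_def indicator_def)
      then have "cmod (g i x - f x) \<le> 3 * cmod (f x)" using norm_triangle_ineq4[of "g i x" "f x"] by linarith
      then have "(cmod (g i x - f x))\<^sup>2 \<le> (3 * cmod (f x))\<^sup>2" by (intro power_mono) auto
      then show "norm ((cmod (g i x - f x))\<^sup>2) \<le> 9 * (cmod (f x))\<^sup>2" by (simp add: power_mult_distrib)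
    qed
  qed measurable
  obtain K where K: "K \<ge> 0" "\<forall>f\<in>l2_fun M. sq_norm M (op_fun M T f) \<le> K * sq_norm M f" using op_fun_bounded[OF T] by blast
  obtain L where L: "L \<ge> 0" "\<forall>f\<in>l2_fun M. sq_norm M (op_fun M S f) \<le> L * sq_norm M f" using op_fun_bounded[OF S] by blast
  let ?d = "\<lambda>x. op_fun M T f x - op_fun M S f x"
  have dl: "?d \<in> l2_fun M" by (intro l2_fun_diff op_fun_l2 T S f)
  have bd: "sq_norm M ?d \<le> (2 * K + 2 * L) * sq_norm M (\<lambda>x. g i x - f x)" for i
  proof -
    let ?h = "\<lambda>x. g i x - f x"
    have h: "?h \<in> l2_fun M" by (intro l2_fun_diff gl f)
    have "AE x in M. ?d x = op_fun M S ?h x + (-1) * op_fun M T ?h x"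
    proof -
      have e: "(\<lambda>x. f x + ?h x) = g i" by auto
      show ?thesis using op_fun_add[OF T f h, unfolded e] op_fun_add[OF S f h, unfolded e] Pg[of i]
        by eventually_elim (auto simp: algebra_simps)
    qed
    then have "sq_norm M ?d = sq_norm M (\<lambda>x. op_fun M S ?h x + (-1) * op_fun M T ?h x)"
      by (intro sq_norm_cong_AE l2_fun_measurable l2_fun_add l2_fun_scale op_fun_l2 T S h dl)
    also have "\<dots> \<le> 2 * sq_norm M (op_fun M S ?h) + 2 * sq_norm M (\<lambda>x. (-1) * op_fun M T ?h x)"
      by (intro sq_norm_add_le l2_fun_scale op_fun_l2 T S h)
    also have "\<dots> = 2 * sq_norm M (op_fun M S ?h) + 2 * sq_norm M (op_fun M T ?h)" unfolding sq_norm_scale by simp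
    also have "\<dots> \<le> 2 * (L * sq_norm M ?h) + 2 * (K * sq_norm M ?h)" using K L h by (intro add_mono mult_left_mono) auto
    finally show ?thesis by (simp add: algebra_simps)
  qed
  have "(\<lambda>i. (2 * K + 2 * L) * sq_norm M (\<lambda>x. g i x - f x)) \<longlonglongrightarrow> 0"
    using tendsto_mult_right_zero[of "\<lambda>i. sq_norm M (\<lambda>x. g i x - f x)" sequentially "2 * K + 2 * L"] conv by simp
  then have "sq_norm M ?d \<le> 0" by (rule LIMSEQ_le_const) (use bd in auto)
  then have "sq_norm M ?d = 0" using sq_norm_nonneg[of M ?d] by simp
  then show "T (l2_class M f) = S (l2_class M f)" unfolding P[OF f] sq_norm_eq_0_iff[OF dl] by simp
qed

text \<open>For fixed \<open>h\<close> the functional sending \<open>f\<close> to the inner product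
  of \<open>T f\<close> with \<open>h\<close> is bounded, and Riesz represents it by a vector
  \<open>A h\<close>. Uniqueness of representing vectors makes \<open>A\<close> linear and
  independent of representatives.\<close>

lemma adjoint_exists:
  assumes T: "T \<in> l2_bounded_ops M"
  shows "\<exists>S\<in>l2_bounded_ops M. is_l2_adjoint M T S"
proof -
  obtain K where K: "K \<ge> 0" "\<forall>f\<in>l2_fun M. sq_norm M (op_fun M T f) \<le> K * sq_norm M f" using op_fun_bounded[OF T] by blast
  have "\<forall>h\<in>l2_fun M. \<exists>\<eta>. \<eta> \<in> l2_fun M \<and> (\<forall>f\<in>l2_fun M. l2_ip M (op_fun M T f) h = l2_ip M f \<eta>)"
  proof
    fix h assume h: "h \<in> l2_fun M"
    have "\<exists>\<eta>\<in>l2_fun M. \<forall>f\<in>l2_fun M. l2_ip M (op_fun M T f) h = l2_ip M f \<eta>"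
    proof (rule riesz_representation)
      fix f g assume fg: "f \<in> l2_fun M" "g \<in> l2_fun M"
      have "l2_ip M (op_fun M T (\<lambda>x. f x + g x)) h = l2_ip M (\<lambda>x. op_fun M T f x + op_fun M T g x) h"
        by (rule l2_ip_cong_AE[OF _ _ op_fun_add[OF T fg]]) (simp_all add: l2_fun_measurable op_fun_l2[OF T] fg l2_fun_add h)
      also have "\<dots> = l2_ip M (op_fun M T f) h + l2_ip M (op_fun M T g) h"
        by (intro l2_ip_add_left op_fun_l2 T fg h)
      finally show "l2_ip M (op_fun M T (\<lambda>x. f x + g x)) h = l2_ip M (op_fun M T f) h + l2_ip M (op_fun M T g) h" .
    next
      fix c f assume f: "f \<in> l2_fun M"
      have "l2_ip M (op_fun M T (\<lambda>x. c * f x)) h = l2_ip M (\<lambda>x. c * op_fun M T f x) h"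
        by (rule l2_ip_cong_AE[OF _ _ op_fun_scale[OF T f]]) (simp_all add: l2_fun_measurable op_fun_l2[OF T] f l2_fun_scale h)
      then show "l2_ip M (op_fun M T (\<lambda>x. c * f x)) h = c * l2_ip M (op_fun M T f) h" by (simp add: l2_ip_scale_left)
    next
      fix f assume f: "f \<in> l2_fun M"
      have "(cmod (l2_ip M (op_fun M T f) h))\<^sup>2 \<le> sq_norm M (op_fun M T f) * sq_norm M h"
        by (intro Cauchy_Schwarz_l2_ip op_fun_l2 T f h)
      also have "\<dots> \<le> (K * sq_norm M f) * sq_norm M h" using K f by (intro mult_right_mono sq_norm_nonneg) auto
      finally show "(cmod (l2_ip M (op_fun M T f) h))\<^sup>2 \<le> (K * sq_norm M h) * sq_norm M f" by (simp add: mult.commute mult.left_commute)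
    qed
    then show "\<exists>\<eta>. \<eta> \<in> l2_fun M \<and> (\<forall>f\<in>l2_fun M. l2_ip M (op_fun M T f) h = l2_ip M f \<eta>)" by blast
  qed
  from bchoice[OF this] obtain A where A: "\<forall>h\<in>l2_fun M. A h \<in> l2_fun M \<and> (\<forall>f\<in>l2_fun M. l2_ip M (op_fun M T f) h = l2_ip M f (A h))" ..
  have eqI: "AE x in M. u x = v x" if "u \<in> l2_fun M" "v \<in> l2_fun M" "\<And>f. f \<in> l2_fun M \<Longrightarrow> l2_ip M f u = l2_ip M f v" for u v
  proof (rule l2_class_eqD[OF L2_eqI that(1)])
    show "l2_class M u \<in> L2 M" "l2_class M v \<in> L2 M" using that L2I by auto
    fix Z assume "Z \<in> L2 M"
    then obtain f where f: "f \<in> l2_fun M" "Z = l2_class M f" by (auto simp: L2_def)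
    show "l2_inner M Z (l2_class M u) = l2_inner M Z (l2_class M v)"
      unfolding f(2) l2_inner_class[OF f(1) that(1)] l2_inner_class[OF f(1) that(2)] by (rule that(3)[OF f(1)])
  qed
  have Al: "A h \<in> l2_fun M" if "h \<in> l2_fun M" for h using A that by blast
  have Ai: "l2_ip M f (A h) = l2_ip M (op_fun M T f) h" if "f \<in> l2_fun M" "h \<in> l2_fun M" for f h using A that by simp
  have 1: "AE x in M. A f x = A g x" if fg: "f \<in> l2_fun M" "g \<in> l2_fun M" and e: "AE x in M. f x = g x" for f g
  proof (rule eqI[OF Al Al])
    fix k assume k: "k \<in> l2_fun M"
    show "l2_ip M k (A f) = l2_ip M k (A g)" unfolding Ai[OF k fg(1)] Ai[OF k fg(2)]
      by (rule l2_ip_cong_AE) (simp_all add: l2_fun_measurable op_fun_l2[OF T k] fg e)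
  qed (use fg in auto)
  have 2: "AE x in M. A (\<lambda>x. f x + g x) x = A f x + A g x" if fg: "f \<in> l2_fun M" "g \<in> l2_fun M" for f g
  proof (rule eqI)
    show "A (\<lambda>x. f x + g x) \<in> l2_fun M" "(\<lambda>x. A f x + A g x) \<in> l2_fun M" by (intro Al l2_fun_add fg)+
    fix k assume k: "k \<in> l2_fun M"
    show "l2_ip M k (A (\<lambda>x. f x + g x)) = l2_ip M k (\<lambda>x. A f x + A g x)"
      unfolding Ai[OF k l2_fun_add[OF fg]] l2_ip_add_right[OF Al[OF fg(1)] Al[OF fg(2)] k] Ai[OF k fg(1)] Ai[OF k fg(2)]
      by (rule l2_ip_add_right[OF fg op_fun_l2[OF T k]])
  qed
  have 3: "AE x in M. A (\<lambda>x. c * f x) x = c * A f x" if f: "f \<in> l2_fun M" for c f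
  proof (rule eqI)
    show "A (\<lambda>x. c * f x) \<in> l2_fun M" "(\<lambda>x. c * A f x) \<in> l2_fun M" by (intro Al l2_fun_scale f)+
    fix k assume k: "k \<in> l2_fun M"
    show "l2_ip M k (A (\<lambda>x. c * f x)) = l2_ip M k (\<lambda>x. c * A f x)"
      unfolding Ai[OF k l2_fun_scale[OF f]] l2_ip_scale_right Ai[OF k f] ..
  qed
  have 4: "sq_norm M (A h) \<le> K * sq_norm M h" if h: "h \<in> l2_fun M" for h
  proof (cases "sq_norm M (A h) = 0")
    case True then show ?thesis using K(1) sq_norm_nonneg[of M h] by simp
  next
    case False
    then have pos: "sq_norm M (A h) > 0" using sq_norm_nonneg[of M "A h"] by simp
    \<comment> \<open>Tested on \<open>f = A h\<close>; one factor \<open>sq_norm M (A h)\<close> is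
      cancelled afterwards.\<close>
    have "(sq_norm M (A h))\<^sup>2 = (cmod (l2_ip M (op_fun M T (A h)) h))\<^sup>2"
      unfolding Ai[OF Al[OF h] h, symmetric] l2_ip_self by simp
    also have "\<dots> \<le> sq_norm M (op_fun M T (A h)) * sq_norm M h" by (intro Cauchy_Schwarz_l2_ip op_fun_l2 T Al h)
    also have "\<dots> \<le> (K * sq_norm M (A h)) * sq_norm M h" using K Al[OF h] by (intro mult_right_mono sq_norm_nonneg) auto
    finally have "sq_norm M (A h) * sq_norm M (A h) \<le> sq_norm M (A h) * (K * sq_norm M h)" by (simp add: power2_eq_square mult.commute mult.left_commute)
    then show ?thesis using pos by simp
  qed
  have "l2_linear M A" unfolding l2_linear_def
    by (intro conjI ballI allI impI exI[of _ K]) (fact Al 1 2 3 4 | simp add: Al 1 2 3 4)+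
  note L = lift_op[OF this]
  have "is_l2_adjoint M T (lift_op M A)" unfolding is_l2_adjoint_def
  proof (intro ballI)
    fix X Y assume "X \<in> L2 M" "Y \<in> L2 M"
    then obtain f h where f: "f \<in> l2_fun M" "X = l2_class M f" and h: "h \<in> l2_fun M" "Y = l2_class M h"
      by (auto simp: L2_def)
    have "l2_inner M (T X) Y = l2_ip M (op_fun M T f) h"
      unfolding f(2) h(2) op_fun_class[OF T f(1)] by (rule l2_inner_class[OF op_fun_l2[OF T f(1)] h(1)])
    also have "\<dots> = l2_ip M f (A h)" by (rule Ai[OF f(1) h(1), symmetric])
    also have "\<dots> = l2_inner M X (lift_op M A Y)"
      unfolding f(2) h(2) L(2)[OF h(1)] by (rule l2_inner_class[OF f(1) Al[OF h(1)], symmetric])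
    finally show "l2_inner M (T X) Y = l2_inner M X (lift_op M A Y)" .
  qed
  then show ?thesis using L(1) by blast
qed

lemma is_l2_adjoint_sym:
  assumes "is_l2_adjoint M T S"
  shows "is_l2_adjoint M S T"
proof -
  have conj: "l2_inner M X Y = cnj (l2_inner M Y X)" for X Y
    unfolding l2_inner_def l2_ip_def[symmetric] by (rule l2_ip_commute)
  show ?thesis unfolding is_l2_adjoint_def
  proof (intro ballI)
    fix X Y assume "X \<in> L2 M" "Y \<in> L2 M"
    then have "l2_inner M (T Y) X = l2_inner M Y (S X)" using assms unfolding is_l2_adjoint_def by simp
    then show "l2_inner M (S X) Y = l2_inner M X (T Y)" using conj by metis
  qed
qed

section \<open>Commutants\<close>

lemma compose_eq_iff:
  "compose (L2 M) T S = compose (L2 M) S T \<longleftrightarrow> (\<forall>X\<in>L2 M. T (S X) = S (T X))"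
  unfolding compose_def by (auto simp: fun_eq_iff restrict_def)

lemma commutant_iff:
  "T \<in> commutant M N \<longleftrightarrow> T \<in> l2_bounded_ops M \<and> (\<forall>S\<in>N. \<forall>X\<in>L2 M. T (S X) = S (T X))"
  unfolding commutant_def compose_eq_iff by simp

lemma adjoints_commute:
  assumes T: "T \<in> l2_bounded_ops M" "T' \<in> l2_bounded_ops M" "is_l2_adjoint M T T'"
    and R: "R \<in> l2_bounded_ops M" "R' \<in> l2_bounded_ops M" "is_l2_adjoint M R R'"
    and comm: "\<forall>X\<in>L2 M. T (R X) = R (T X)" and Y: "Y \<in> L2 M"
  shows "T' (R' Y) = R' (T' Y)"
proof (rule L2_eqI)
  have [simp]: "V X \<in> L2 M" if "V \<in> {T, T', R, R'}" "X \<in> L2 M" for V X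
    using that T R bounded_op_L2 by auto
  show "T' (R' Y) \<in> L2 M" "R' (T' Y) \<in> L2 M" using Y by simp_all
  fix Z assume Z: "Z \<in> L2 M"
  have adjT: "l2_inner M (T A) B = l2_inner M A (T' B)" if "A \<in> L2 M" "B \<in> L2 M" for A B
    using T(3) that unfolding is_l2_adjoint_def by simp
  have adjR: "l2_inner M (R A) B = l2_inner M A (R' B)" if "A \<in> L2 M" "B \<in> L2 M" for A B
    using R(3) that unfolding is_l2_adjoint_def by simp
  have "l2_inner M Z (T' (R' Y)) = l2_inner M (R (T Z)) Y"
    using adjT[of Z "R' Y"] adjR[of "T Z" Y] Z Y by simp
  also have "\<dots> = l2_inner M Z (R' (T' Y))"
    using adjT[of "R Z" Y] adjR[of Z "T' Y"] Z Y comm by simp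
  finally show "l2_inner M Z (T' (R' Y)) = l2_inner M Z (R' (T' Y))" .
qed

lemma commutant_subset: "commutant M N \<subseteq> l2_bounded_ops M"
  unfolding commutant_def by auto

text \<open>An element of the commutant is an arbitrary bounded operator, so its adjoint has to come
  from the Riesz theorem. Taking adjoints in the commutation relations, with \<open>N\<close> closed
  under adjoints, shows that it lies in the commutant again.\<close>

lemma commutant_adjoint_closed:
  assumes N: "N \<subseteq> l2_bounded_ops M" and adj: "\<forall>T\<in>N. \<exists>S\<in>N. is_l2_adjoint M T S"
  shows "\<forall>T\<in>commutant M N. \<exists>S\<in>commutant M N. is_l2_adjoint M T S"
proof
  fix T assume T: "T \<in> commutant M N"
  then have Tb: "T \<in> l2_bounded_ops M" using commutant_subset by auto
  from adjoint_exists[OF this] obtain T' where T': "T' \<in> l2_bounded_ops M" "is_l2_adjoint M T T'" by auto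
  have "T' (R X) = R (T' X)" if R: "R \<in> N" and X: "X \<in> L2 M" for R X
  proof -
    obtain R' where R': "R' \<in> N" "is_l2_adjoint M R R'" using adj R by auto
    show ?thesis
      by (rule adjoints_commute[OF Tb T' _ _ is_l2_adjoint_sym[OF R'(2)] _ X])
        (use N R R' T in \<open>auto simp: commutant_iff\<close>)
  qed
  then have "T' \<in> commutant M N" using T' by (simp add: commutant_iff)
  then show "\<exists>S\<in>commutant M N. is_l2_adjoint M T S" using T'(2) by auto
qed

lemma subset_bicommutant:
  assumes "N \<subseteq> l2_bounded_ops M"
  shows "N \<subseteq> commutant M (commutant M N)"
proof
  fix T assume "T \<in> N"
  moreover from this have "T (S X) = S (T X)" if "S \<in> commutant M N" "X \<in> L2 M" for S X
    using that unfolding commutant_iff by simp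
  ultimately show "T \<in> commutant M (commutant M N)"
    using assms unfolding commutant_iff[of T M "commutant M N"] by auto
qed

lemma commutant_antimono: "N \<subseteq> N' \<Longrightarrow> commutant M N' \<subseteq> commutant M N"
  unfolding commutant_def by auto

lemma commutant_tricommutant:
  assumes "N \<subseteq> l2_bounded_ops M"
  shows "commutant M (commutant M (commutant M N)) = commutant M N"
  by (intro equalityI commutant_antimono subset_bicommutant assms commutant_subset)

lemma bicommutant_von_neumann:
  assumes "N \<subseteq> l2_bounded_ops M" "\<forall>T\<in>N. \<exists>S\<in>N. is_l2_adjoint M T S"
  shows "von_neumann_algebra M (commutant M (commutant M N))"
  unfolding von_neumann_algebra_def commutant_tricommutant[OF assms(1)]
  by (intro conjI commutant_subset commutant_adjoint_closed commutant_adjoint_closed[OF assms] refl)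

section \<open>Composition operators\<close>

definition pull :: "'a set \<Rightarrow> ('a \<Rightarrow> 'a) \<Rightarrow> ('a \<Rightarrow> complex) \<Rightarrow> 'a \<Rightarrow> complex" where
  "pull D \<phi> f = (\<lambda>x. if x \<in> D then f (\<phi> x) else 0)"

text \<open>The image of \<open>M\<close> restricted to \<open>D\<close> is at most \<open>K\<close>
  times \<open>M\<close>. In other words its density is bounded by \<open>K\<close>, which is what
  makes composition with \<open>\<phi>\<close> bounded on \<open>L2 M\<close>, with squared norm at
  most \<open>K\<close>.\<close>

definition bounded_map :: "'a measure \<Rightarrow> real \<Rightarrow> 'a set \<Rightarrow> ('a \<Rightarrow> 'a) \<Rightarrow> bool" where
  "bounded_map M K D \<phi> \<longleftrightarrow> D \<in> sets M \<and> \<phi> \<in> restrict_space M D \<rightarrow>\<^sub>M M \<and>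
     (\<forall>E\<in>sets M. emeasure M {x\<in>D. \<phi> x \<in> E} \<le> ennreal K * emeasure M E)"

lemma bounded_map_vimage_sets:
  assumes "bounded_map M K D \<phi>" "E \<in> sets M"
  shows "{x\<in>D. \<phi> x \<in> E} \<in> sets M"
proof -
  have D: "D \<in> sets M" and phi: "\<phi> \<in> restrict_space M D \<rightarrow>\<^sub>M M" using assms(1) by (auto simp: bounded_map_def)
  have sp: "space (restrict_space M D) = D" using sets.sets_into_space[OF D] by (auto simp: space_restrict_space)
  have "\<phi> -` E \<inter> space (restrict_space M D) \<in> sets (restrict_space M D)" by (rule measurable_sets[OF phi assms(2)])
  moreover have "\<phi> -` E \<inter> space (restrict_space M D) = {x\<in>D. \<phi> x \<in> E}" unfolding sp by auto
  ultimately show ?thesis using D by (auto simp: sets_restrict_space_iff)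
qed

lemma bounded_map_AE:
  assumes "bounded_map M K D \<phi>" "AE x in M. P x"
  shows "AE x in M. x \<in> D \<longrightarrow> P (\<phi> x)"
proof -
  obtain E where E: "{x\<in>space M. \<not> P x} \<subseteq> E" "E \<in> null_sets M" using assms(2) by (auto elim: AE_E simp: null_sets_def)
  have D: "D \<in> sets M" and phi: "\<phi> \<in> restrict_space M D \<rightarrow>\<^sub>M M" using assms(1) by (auto simp: bounded_map_def)
  have sp: "space (restrict_space M D) = D" using sets.sets_into_space[OF D] by (auto simp: space_restrict_space)
  have "emeasure M {x\<in>D. \<phi> x \<in> E} \<le> ennreal K * emeasure M E" using assms(1) E by (auto simp: bounded_map_def null_sets_def)
  then have "{x\<in>D. \<phi> x \<in> E} \<in> null_sets M"
    using E bounded_map_vimage_sets[OF assms(1), of E] by (auto simp: null_sets_def)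
  moreover have "{x\<in>space M. \<not> (x \<in> D \<longrightarrow> P (\<phi> x))} \<subseteq> {x\<in>D. \<phi> x \<in> E}"
    using E(1) measurable_space[OF phi] sp by auto
  ultimately show ?thesis by (rule AE_I'[rotated 1, rotated]) 
qed

lemma pull_measurable:
  assumes "bounded_map M K D \<phi>" "f \<in> borel_measurable M"
  shows "pull D \<phi> f \<in> borel_measurable M"
proof -
  have D: "D \<in> sets M" and phi: "\<phi> \<in> restrict_space M D \<rightarrow>\<^sub>M M" using assms(1) by (auto simp: bounded_map_def)
  have "(\<lambda>x. f (\<phi> x)) \<in> borel_measurable (restrict_space M D)" by (rule measurable_compose[OF phi assms(2)])
  then show ?thesis unfolding pull_def
    by (subst measurable_If_restrict_space_iff) (use D sets.sets_into_space[OF D] in \<open>auto simp: Int_absorb2\<close>)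
qed

text \<open>Change of variables to the image measure, followed by its comparison with
  \<open>K\<close> times \<open>M\<close>.\<close>

lemma pull_nn_integral:
  assumes "bounded_map M K D \<phi>" "u \<in> borel_measurable M"
  shows "(\<integral>\<^sup>+x. u (\<phi> x) * indicator D x \<partial>M) \<le> ennreal K * (\<integral>\<^sup>+x. u x \<partial>M)"
proof -
  have D: "D \<in> sets M" and phi: "\<phi> \<in> restrict_space M D \<rightarrow>\<^sub>M M" using assms(1) by (auto simp: bounded_map_def)
  have sp: "space (restrict_space M D) = D" using sets.sets_into_space[OF D] by (auto simp: space_restrict_space)
  have DM: "D \<inter> space M \<in> sets M" using D by auto
  have "(\<integral>\<^sup>+x. u (\<phi> x) * indicator D x \<partial>M) = (\<integral>\<^sup>+x. u (\<phi> x) \<partial>restrict_space M D)"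
    by (rule nn_integral_restrict_space[OF DM, symmetric])
  also have "\<dots> = (\<integral>\<^sup>+x. u x \<partial>distr (restrict_space M D) M \<phi>)"
    by (rule nn_integral_distr[OF phi, symmetric]) (use assms in simp)
  also have "\<dots> \<le> (\<integral>\<^sup>+x. u x \<partial>scale_measure (ennreal K) M)"
  proof (rule nn_integral_mono_measure)
    show "distr (restrict_space M D) M \<phi> \<le> scale_measure (ennreal K) M"
    proof (subst le_measure)
      show "\<forall>E\<in>sets (distr (restrict_space M D) M \<phi>).
        emeasure (distr (restrict_space M D) M \<phi>) E \<le> emeasure (scale_measure (ennreal K) M) E"
      proof
        fix E assume "E \<in> sets (distr (restrict_space M D) M \<phi>)"
        then have E: "E \<in> sets M" by simp
        have "\<phi> -` E \<inter> space (restrict_space M D) = {x\<in>D. \<phi> x \<in> E}" unfolding sp by auto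
        moreover have "{x\<in>D. \<phi> x \<in> E} \<subseteq> D \<inter> space M" using sets.sets_into_space[OF D] by auto
        ultimately have "emeasure (distr (restrict_space M D) M \<phi>) E = emeasure M {x\<in>D. \<phi> x \<in> E}"
          using emeasure_distr[OF phi E] emeasure_restrict_space[OF DM, of "{x\<in>D. \<phi> x \<in> E}"] by auto
        then show "emeasure (distr (restrict_space M D) M \<phi>) E \<le> emeasure (scale_measure (ennreal K) M) E"
          using assms(1) E by (simp add: bounded_map_def)
      qed
    qed simp
  qed simp
  also have "\<dots> = ennreal K * (\<integral>\<^sup>+x. u x \<partial>M)" using assms by (simp add: nn_integral_scale_measure)
  finally show ?thesis .
qed

lemma pull_linear:
  assumes bm: "bounded_map M K D \<phi>" and K: "0 \<le> K"
  shows "l2_linear M (pull D \<phi>)"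
proof -
  have b: "pull D \<phi> f \<in> l2_fun M \<and> sq_norm M (pull D \<phi> f) \<le> K * sq_norm M f" if f: "f \<in> l2_fun M" for f
  proof -
    have [measurable]: "f \<in> borel_measurable M" using f by (rule l2_fun_measurable)
    have [measurable]: "pull D \<phi> f \<in> borel_measurable M" by (rule pull_measurable[OF bm]) simp
    have nf: "(\<integral>\<^sup>+x. ennreal ((cmod (f x))\<^sup>2) \<partial>M) = ennreal (sq_norm M f)"
      unfolding sq_norm_def by (rule nn_integral_eq_integral) (use f l2_fun_integrable in auto)
    have "(\<integral>\<^sup>+x. ennreal ((cmod (pull D \<phi> f x))\<^sup>2) \<partial>M) = (\<integral>\<^sup>+x. ennreal ((cmod (f (\<phi> x)))\<^sup>2) * indicator D x \<partial>M)"
      by (rule nn_integral_cong) (simp add: pull_def)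
    also have "\<dots> \<le> ennreal K * (\<integral>\<^sup>+x. ennreal ((cmod (f x))\<^sup>2) \<partial>M)"
      by (rule pull_nn_integral[OF bm]) simp
    also have "\<dots> = ennreal (K * sq_norm M f)" unfolding nf using K by (simp add: ennreal_mult sq_norm_nonneg)
    finally have le: "(\<integral>\<^sup>+x. ennreal ((cmod (pull D \<phi> f x))\<^sup>2) \<partial>M) \<le> ennreal (K * sq_norm M f)" .
    then have "integrable M (\<lambda>x. (cmod (pull D \<phi> f x))\<^sup>2)"
      by (intro integrableI_bounded) (auto simp: le_less_trans)
    then have l: "pull D \<phi> f \<in> l2_fun M" by (simp add: l2_fun_def)
    have "(\<integral>\<^sup>+x. ennreal ((cmod (pull D \<phi> f x))\<^sup>2) \<partial>M) = ennreal (sq_norm M (pull D \<phi> f))"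
      unfolding sq_norm_def by (rule nn_integral_eq_integral) (use l l2_fun_integrable in auto)
    then show ?thesis using l le K by (simp add: ennreal_le_iff sq_norm_nonneg)
  qed
  have c: "AE x in M. pull D \<phi> f x = pull D \<phi> g x" if "AE x in M. f x = g x" for f g
    using bounded_map_AE[OF bm that] by eventually_elim (simp add: pull_def)
  show ?thesis unfolding l2_linear_def
    by (intro conjI ballI allI impI exI[of _ K] c) (use b in \<open>auto simp: pull_def\<close>)
qed

section \<open>Groupoids, bisections and translations\<close>

context groupoid begin

lemma composableI: "g \<in> arrows G \<Longrightarrow> h \<in> arrows G \<Longrightarrow> src G g = tgt G h \<Longrightarrow> (g, h) \<in> composable G"
  by (simp add: composable_def)

lemma mult_arrow[simp]: "g \<in> arrows G \<Longrightarrow> h \<in> arrows G \<Longrightarrow> src G g = tgt G h \<Longrightarrow> mult G g h \<in> arrows G"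
  and src_mult'[simp]: "g \<in> arrows G \<Longrightarrow> h \<in> arrows G \<Longrightarrow> src G g = tgt G h \<Longrightarrow> src G (mult G g h) = src G h"
  and tgt_mult'[simp]: "g \<in> arrows G \<Longrightarrow> h \<in> arrows G \<Longrightarrow> src G g = tgt G h \<Longrightarrow> tgt G (mult G g h) = tgt G g"
  by (simp_all add: mult_in src_mult tgt_mult composableI)

lemma unit_arrow: "x \<in> units G \<Longrightarrow> x \<in> arrows G"
  using units_subset by blast

lemma assoc: "g \<in> arrows G \<Longrightarrow> h \<in> arrows G \<Longrightarrow> k \<in> arrows G \<Longrightarrow> src G g = tgt G h \<Longrightarrow> src G h = tgt G k \<Longrightarrow>
    mult G (mult G g h) k = mult G g (mult G h k)"
  by (simp add: mult_assoc composableI)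

declare ginv_in[simp] src_ginv[simp] tgt_ginv[simp] src_unit[simp] tgt_unit[simp] src_in[simp] tgt_in[simp]

lemma ginv_mult_cancel[simp]:
  "g \<in> arrows G \<Longrightarrow> h \<in> arrows G \<Longrightarrow> src G g = tgt G h \<Longrightarrow> mult G (ginv G g) (mult G g h) = h"
  by (simp add: assoc[symmetric] ginv_mult mult_tgt)

lemma mult_ginv_cancel[simp]:
  "g \<in> arrows G \<Longrightarrow> h \<in> arrows G \<Longrightarrow> tgt G g = tgt G h \<Longrightarrow> mult G g (mult G (ginv G g) h) = h"
  by (simp add: assoc[symmetric] mult_ginv mult_tgt)

lemma mult_mult_ginv[simp]:
  "g \<in> arrows G \<Longrightarrow> h \<in> arrows G \<Longrightarrow> src G h = tgt G g \<Longrightarrow> mult G (mult G h g) (ginv G g) = h"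
  using mult_src[of h] by (simp add: assoc mult_ginv)

lemma mult_ginv_mult[simp]:
  "g \<in> arrows G \<Longrightarrow> h \<in> arrows G \<Longrightarrow> src G h = src G g \<Longrightarrow> mult G (mult G h (ginv G g)) g = h"
  using mult_src[of h] by (simp add: assoc ginv_mult)

lemma ginv_unit[simp]: "x \<in> units G \<Longrightarrow> ginv G x = x"
  using ginv_mult[of x] mult_src[of "ginv G x"] unit_arrow[of x] by simp

lemma mult_unit_left[simp]: "x \<in> units G \<Longrightarrow> g \<in> arrows G \<Longrightarrow> x = tgt G g \<Longrightarrow> mult G x g = g"
  by (simp add: mult_tgt)

lemma mult_unit_right[simp]: "x \<in> units G \<Longrightarrow> g \<in> arrows G \<Longrightarrow> x = src G g \<Longrightarrow> mult G g x = g"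
  by (simp add: mult_src)

lemma ginv_unique:
  assumes "g \<in> arrows G" "h \<in> arrows G" "src G g = tgt G h" "mult G g h = tgt G g"
  shows "ginv G g = h"
proof -
  have "h = mult G (ginv G g) (mult G g h)" using ginv_mult_cancel[OF assms(1-3)] by (rule sym)
  also have "\<dots> = mult G (ginv G g) (tgt G g)" by (simp only: assms(4))
  also have "\<dots> = ginv G g" using mult_src[of "ginv G g"] assms(1) by simp
  finally show ?thesis by (rule sym)
qed

lemma ginv_ginv[simp]: "g \<in> arrows G \<Longrightarrow> ginv G (ginv G g) = g"
  by (rule ginv_unique) (simp_all add: ginv_mult)

lemma ginv_mult_distrib:
  assumes "g \<in> arrows G" "h \<in> arrows G" "src G g = tgt G h"
  shows "ginv G (mult G g h) = mult G (ginv G h) (ginv G g)"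
proof (rule ginv_unique)
  have "mult G (mult G g h) (mult G (ginv G h) (ginv G g)) = mult G g (mult G h (mult G (ginv G h) (ginv G g)))"
    using assms by (intro assoc) simp_all
  also have "\<dots> = tgt G g" using assms by (simp add: mult_ginv)
  finally show "mult G (mult G g h) (mult G (ginv G h) (ginv G g)) = tgt G (mult G g h)" using assms by simp
qed (use assms in simp_all)

end

text \<open>On a piece where \<open>p\<close> is injective the count in a fibre is the indicator of
  the image; hence the count is a measurable sum of indicators and the integral is countably
  additive. The latter matters because \<open>measure_of\<close> yields the zero measure for a set
  function that is no measure. The map \<open>p\<close> is a parameter in order to cover source and
  target alike.\<close>

lemma fibre_count_measure:
  fixes p :: "'a \<Rightarrow> 'a" and D :: "nat \<Rightarrow> 'a set"
  assumes D: "\<And>n. D n \<in> sets B" "disjoint_family D" "(\<Union>n. D n) = space B" "\<And>n. inj_on p (D n)"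
    and im: "\<And>A. A \<in> sets B \<Longrightarrow> p ` A \<in> sets \<mu>"
  defines "c \<equiv> \<lambda>A x. emeasure (count_space UNIV) {g\<in>A. p g = x}"
  defines "N \<equiv> measure_of (space B) (sets B) (\<lambda>A. \<integral>\<^sup>+x. c A x \<partial>\<mu>)"
  shows "A \<in> sets B \<Longrightarrow> c A = (\<lambda>x. \<Sum>n. indicator (p ` (A \<inter> D n)) x)"
    and "A \<in> sets B \<Longrightarrow> c A \<in> borel_measurable \<mu>"
    and "A \<in> sets B \<Longrightarrow> emeasure N A = (\<integral>\<^sup>+x. c A x \<partial>\<mu>)"
    and "A \<in> sets B \<Longrightarrow> emeasure N A = (\<Sum>n. emeasure \<mu> (p ` (A \<inter> D n)))"
    and "sets N = sets B"
proof -
  have c: "c A = (\<lambda>x. \<Sum>n. indicator (p ` (A \<inter> D n)) x)" if A: "A \<in> sets B" for A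
  proof
    fix x
    have AD: "A \<subseteq> (\<Union>n. D n)" using sets.sets_into_space[OF A] D(3) by simp
    have eq: "{g\<in>A. p g = x} = (\<Union>n. {g\<in>A \<inter> D n. p g = x})" using AD by blast
    have dj: "disjoint_family (\<lambda>n. {g\<in>A \<inter> D n. p g = x})"
      using D(2) unfolding disjoint_family_on_def by blast
    have "c A x = (\<Sum>n. emeasure (count_space UNIV) {g\<in>A \<inter> D n. p g = x})"
      unfolding c_def eq by (rule suminf_emeasure[symmetric, OF _ dj]) auto
    also have "\<dots> = (\<Sum>n. indicator (p ` (A \<inter> D n)) x)"
    proof (rule suminf_cong)
      fix n
      show "emeasure (count_space UNIV) {g\<in>A \<inter> D n. p g = x} = indicator (p ` (A \<inter> D n)) x"
      proof (cases "x \<in> p ` (A \<inter> D n)")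
        case True
        then obtain g where g: "g \<in> A \<inter> D n" "p g = x" by blast
        then have "{g\<in>A \<inter> D n. p g = x} = {g}" using D(4)[of n] unfolding inj_on_def by blast
        then show ?thesis using True by simp
      next
        case False
        then have e: "{g\<in>A \<inter> D n. p g = x} = {}" by blast
        show ?thesis unfolding e using False by (simp add: indicator_def)
      qed
    qed
    finally show "c A x = (\<Sum>n. indicator (p ` (A \<inter> D n)) x)" .
  qed
  have im': "p ` (A \<inter> D n) \<in> sets \<mu>" if "A \<in> sets B" for A n using im that D(1) by auto
  have m: "c A \<in> borel_measurable \<mu>" if "A \<in> sets B" for A
    unfolding c[OF that] using im'[OF that] by measurable
  have sN: "sets N = sets B" unfolding N_def by (simp add: sets.sigma_sets_eq sets.space_closed)
  have e: "emeasure N A = (\<integral>\<^sup>+x. c A x \<partial>\<mu>)" if A: "A \<in> sets B" for A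
  proof (rule emeasure_measure_of[of N "space B" "sets B" "\<lambda>A. \<integral>\<^sup>+x. c A x \<partial>\<mu>"])
    show "N = measure_of (space B) (sets B) (\<lambda>A. \<integral>\<^sup>+x. c A x \<partial>\<mu>)" by (simp add: N_def)
    show "sets B \<subseteq> Pow (space B)" by (rule sets.space_closed)
    show "A \<in> sets N" using A sN by simp
    show "positive (sets N) (\<lambda>A. \<integral>\<^sup>+x. c A x \<partial>\<mu>)" by (simp add: positive_def c_def)
    show "countably_additive (sets N) (\<lambda>A. \<integral>\<^sup>+x. c A x \<partial>\<mu>)" unfolding countably_additive_def sN
    proof (intro allI impI)
      fix F :: "nat \<Rightarrow> 'a set" assume F: "range F \<subseteq> sets B" "disjoint_family F" "(\<Union>i. F i) \<in> sets B"
      have "(\<Sum>i. c (F i) x) = c (\<Union>i. F i) x" for x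
      proof -
        have eq: "{g\<in>(\<Union>i. F i). p g = x} = (\<Union>i. {g\<in>F i. p g = x})" by blast
        show ?thesis unfolding c_def eq
          by (rule suminf_emeasure) (use F(2) in \<open>auto simp: disjoint_family_on_def\<close>)
      qed
      then show "(\<Sum>i. \<integral>\<^sup>+x. c (F i) x \<partial>\<mu>) = (\<integral>\<^sup>+x. c (\<Union>i. F i) x \<partial>\<mu>)"
        using F(1) m by (subst nn_integral_suminf[symmetric]) auto
    qed
  qed
  show "A \<in> sets B \<Longrightarrow> c A = (\<lambda>x. \<Sum>n. indicator (p ` (A \<inter> D n)) x)"
    "A \<in> sets B \<Longrightarrow> c A \<in> borel_measurable \<mu>"
    "A \<in> sets B \<Longrightarrow> emeasure N A = (\<integral>\<^sup>+x. c A x \<partial>\<mu>)" "sets N = sets B"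
    by (fact c m e sN)+
  show "emeasure N A = (\<Sum>n. emeasure \<mu> (p ` (A \<inter> D n)))" if A: "A \<in> sets B"
    unfolding e[OF A] c[OF A] using im'[OF A] by (subst nn_integral_suminf) auto
qed

context discrete_borel_groupoid begin

lemma src_measurable_Borel[measurable]: "src G \<in> Borel G \<rightarrow>\<^sub>M Borel G"
  and tgt_measurable_Borel[measurable]: "tgt G \<in> Borel G \<rightarrow>\<^sub>M Borel G"
  using src_measurable tgt_measurable by (auto simp: measurable_restrict_space2_iff)

lemma separating_sets: "\<exists>\<B>. separates_points (Borel G) \<B>"
  by (rule standard_borel_separates_points[OF standard])

lemma src_fibre_countable: "countable {g\<in>arrows G. src G g = y}"
proof (cases "y \<in> units G")
  case False
  then have e: "{g\<in>arrows G. src G g = y} = {}" using src_in by auto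
  show ?thesis unfolding e by simp
qed (rule src_countable)

lemma tgt_fibre_countable: "countable {g\<in>arrows G. tgt G g = y}"
proof (cases "y \<in> units G")
  case False
  then have e: "{g\<in>arrows G. tgt G g = y} = {}" using tgt_in by auto
  show ?thesis unfolding e by simp
qed (rule tgt_countable)

lemma src_image[measurable]: "A \<in> sets (Borel G) \<Longrightarrow> src G ` A \<in> sets (Borel G)"
  and tgt_image[measurable]: "A \<in> sets (Borel G) \<Longrightarrow> tgt G ` A \<in> sets (Borel G)"
proof -
  obtain \<B> where B: "separates_points (Borel G) \<B>" using separating_sets by blast
  show "src G ` A \<in> sets (Borel G)" if "A \<in> sets (Borel G)"
    by (rule Borel_image_countable_to_one[OF standard src_measurable_Borel B src_fibre_countable that])
  show "tgt G ` A \<in> sets (Borel G)" if "A \<in> sets (Borel G)"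
    by (rule Borel_image_countable_to_one[OF standard tgt_measurable_Borel B tgt_fibre_countable that])
qed

lemma arrow_mem: "A \<in> sets (Borel G) \<Longrightarrow> g \<in> A \<Longrightarrow> g \<in> arrows G"
  using sets.sets_into_space by blast

lemma measurable_mult:
  assumes f: "f \<in> K \<rightarrow>\<^sub>M Borel G" and g: "g \<in> K \<rightarrow>\<^sub>M Borel G" and c: "\<And>x. x \<in> space K \<Longrightarrow> src G (f x) = tgt G (g x)"
  shows "(\<lambda>x. mult G (f x) (g x)) \<in> K \<rightarrow>\<^sub>M Borel G"
proof -
  have "(\<lambda>x. (f x, g x)) \<in> K \<rightarrow>\<^sub>M restrict_space (Borel G \<Otimes>\<^sub>M Borel G) (composable G)"
  proof (rule measurable_restrict_space2)
    show "(\<lambda>x. (f x, g x)) \<in> space K \<rightarrow> composable G"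
      using measurable_space[OF f] measurable_space[OF g] c by (auto intro: composableI)
    show "(\<lambda>x. (f x, g x)) \<in> K \<rightarrow>\<^sub>M Borel G \<Otimes>\<^sub>M Borel G" using f g by measurable
  qed
  from measurable_compose[OF this mult_measurable] show ?thesis by simp
qed

lemma equalizer_sets:
  assumes f: "f \<in> Borel G \<rightarrow>\<^sub>M Borel G" and g: "g \<in> Borel G \<rightarrow>\<^sub>M Borel G"
  shows "{x\<in>arrows G. f x = g x} \<in> sets (Borel G)"
proof -
  obtain \<B> where B: "separates_points (Borel G) \<B>" using separating_sets by blast
  then have cB: "countable \<B>" and [measurable]: "\<And>B. B \<in> \<B> \<Longrightarrow> B \<in> sets (Borel G)"
    by (auto simp: separates_points_def)
  have sp: "f x = g x" if x: "x \<in> arrows G" and eq: "\<forall>B\<in>\<B>. f x \<in> B \<longleftrightarrow> g x \<in> B" for x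
  proof (rule ccontr)
    assume "f x \<noteq> g x"
    then have "\<exists>E\<in>\<B>. (f x \<in> E) \<noteq> (g x \<in> E)"
      using B measurable_space[OF f x] measurable_space[OF g x] by (simp add: separates_points_def)
    with eq show False by simp
  qed
  have "{x\<in>arrows G. f x = g x} = {x\<in>arrows G. \<forall>B\<in>\<B>. f x \<in> B \<longleftrightarrow> g x \<in> B}"
    using sp by (intro Collect_cong) auto
  also have "\<dots> \<in> sets (Borel G)"
    using cB f g by measurable
  finally show ?thesis .
qed

lemma Iso_sets[measurable]: "Iso G \<in> sets (Borel G)"
  unfolding Iso_def by (rule equalizer_sets[OF src_measurable_Borel tgt_measurable_Borel])

lemma bisection_subset: "bisection G A \<Longrightarrow> A' \<subseteq> A \<Longrightarrow> bisection G A'"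
  unfolding bisection_def by (auto intro: inj_on_subset)

text \<open>Intersections of a member of the decomposition for the source with one for the target
  are injective for both maps. The empty set is added so that the family can be enumerated, and the
  enumeration is then made disjoint.\<close>

lemma bisection_cover:
  "\<exists>D :: nat \<Rightarrow> 'a set. (\<forall>n. D n \<in> sets (Borel G) \<and> bisection G (D n)) \<and> disjoint_family D \<and> (\<Union>n. D n) = arrows G"
proof -
  obtain \<B> where B: "separates_points (Borel G) \<B>" using separating_sets by blast
  obtain \<F> where F: "countable \<F>" "\<F> \<subseteq> sets (Borel G)" "\<forall>F\<in>\<F>. inj_on (src G) F" "arrows G \<subseteq> \<Union>\<F>"
    using countable_to_one_decomposition[OF standard src_measurable_Borel B src_fibre_countable] by blast
  obtain \<H> where H: "countable \<H>" "\<H> \<subseteq> sets (Borel G)" "\<forall>F\<in>\<H>. inj_on (tgt G) F" "arrows G \<subseteq> \<Union>\<H>"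
    using countable_to_one_decomposition[OF standard tgt_measurable_Borel B tgt_fibre_countable] by blast
  define \<K> where "\<K> = insert {} ((\<lambda>(X, Y). X \<inter> Y) ` (\<F> \<times> \<H>))"
  have K: "countable \<K>" "\<K> \<noteq> {}" using F(1) H(1) by (auto simp: \<K>_def)
  have Kb: "X \<in> sets (Borel G) \<and> bisection G X" if XK: "X \<in> \<K>" for X
  proof -
    consider "X = {}" | F1 H1 where "F1 \<in> \<F>" "H1 \<in> \<H>" "X = F1 \<inter> H1" using XK by (auto simp: \<K>_def)
    then show ?thesis
    proof cases
      case 1 then show ?thesis by (simp add: bisection_def)
    next
      case 2
      have "F1 \<in> sets (Borel G)" "H1 \<in> sets (Borel G)" using 2 F H by auto
      moreover have "inj_on (src G) (F1 \<inter> H1)" "inj_on (tgt G) (F1 \<inter> H1)"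
        using F(3) H(3) 2 by (auto intro: inj_on_subset)
      ultimately show ?thesis using 2(3) sets.sets_into_space[of F1 "Borel G"] by (auto simp: bisection_def)
    qed
  qed
  define e where "e = from_nat_into \<K>"
  have e: "e n \<in> \<K>" for n unfolding e_def by (rule from_nat_into[OF K(2)])
  have re: "range e = \<K>" unfolding e_def by (rule range_from_nat_into[OF K(2,1)])
  have es: "range e \<subseteq> sets (Borel G)" using Kb unfolding re by auto
  show ?thesis
  proof (intro exI[of _ "disjointed e"] conjI allI)
    fix n
    show "disjointed e n \<in> sets (Borel G)" using sets.range_disjointed_sets[OF es] by auto
    show "bisection G (disjointed e n)"
      by (rule bisection_subset[OF _ disjointed_subset]) (use Kb e in auto)
    show "disjoint_family (disjointed e)" by (rule disjoint_family_disjointed)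
    have "\<Union>\<K> = arrows G"
    proof
      show "\<Union>\<K> \<subseteq> arrows G" using Kb sets.sets_into_space by blast
      show "arrows G \<subseteq> \<Union>\<K>"
      proof
        fix g assume "g \<in> arrows G"
        then obtain F1 H1 where "F1 \<in> \<F>" "g \<in> F1" "H1 \<in> \<H>" "g \<in> H1" using F(4) H(4) by blast
        then show "g \<in> \<Union>\<K>" unfolding \<K>_def by (intro UnionI[of "F1 \<inter> H1"]) auto
      qed
    qed
    then show "(\<Union>n. disjointed e n) = arrows G" using re by (simp add: UN_disjointed_eq)
  qed
qed

definition cover :: "nat \<Rightarrow> 'a set" where
  "cover = (SOME D. (\<forall>n. D n \<in> sets (Borel G) \<and> bisection G (D n)) \<and> disjoint_family D \<and> (\<Union>n. D n) = arrows G)"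

lemma cover: "cover n \<in> sets (Borel G)" "bisection G (cover n)" "disjoint_family cover" "(\<Union>n. cover n) = arrows G"
  using someI_ex[OF bisection_cover] unfolding cover_def[symmetric] by blast+

section \<open>Translations by bisections\<close>

definition tgt_section :: "'a set \<Rightarrow> 'a \<Rightarrow> 'a" where
  "tgt_section A x = inv_into A (tgt G) x"

lemma tgt_section: "x \<in> tgt G ` A \<Longrightarrow> tgt_section A x \<in> A" "x \<in> tgt G ` A \<Longrightarrow> tgt G (tgt_section A x) = x"
  unfolding tgt_section_def by (simp_all add: inv_into_into f_inv_into_f)

lemma tgt_section_tgt: "bisection G A \<Longrightarrow> a \<in> A \<Longrightarrow> tgt_section A (tgt G a) = a"
  unfolding tgt_section_def bisection_def by (simp add: inv_into_f_f)

lemma tgt_section_eq: "bisection G A \<Longrightarrow> a \<in> A \<Longrightarrow> tgt G a = x \<Longrightarrow> tgt_section A x = a"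
  using tgt_section_tgt by blast

text \<open>The preimage of \<open>E\<close> under the section is the target image of
  \<open>A \<inter> E\<close>, a Borel set by the image theorem.\<close>

lemma tgt_section_meas:
  assumes A: "A \<in> sets (Borel G)" "bisection G A"
  shows "tgt_section A \<in> restrict_space (Borel G) (tgt G ` A) \<rightarrow>\<^sub>M Borel G"
proof (rule measurableI)
  have tA: "tgt G ` A \<in> sets (Borel G)" using A(1) by (rule tgt_image)
  have sp: "space (restrict_space (Borel G) (tgt G ` A)) = tgt G ` A"
    using sets.sets_into_space[OF tA] by (auto simp: space_restrict_space)
  show "tgt_section A x \<in> arrows G" if "x \<in> space (restrict_space (Borel G) (tgt G ` A))" for x
    using that tgt_section(1)[of x A] A(1) arrow_mem unfolding sp by blast
  fix E assume E: "E \<in> sets (Borel G)"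
  have "tgt_section A -` E \<inter> tgt G ` A = tgt G ` (A \<inter> E)"
  proof safe
    fix a assume "a \<in> A" "tgt_section A (tgt G a) \<in> E"
    then show "tgt G a \<in> tgt G ` (A \<inter> E)" using tgt_section_tgt[OF A(2)] by auto
  next
    fix a assume "a \<in> A" "a \<in> E"
    then show "tgt G a \<in> tgt_section A -` E" using tgt_section_tgt[OF A(2)] by auto
  qed auto
  then show "tgt_section A -` E \<inter> space (restrict_space (Borel G) (tgt G ` A)) \<in> sets (restrict_space (Borel G) (tgt G ` A))"
    unfolding sp using tgt_image[of "A \<inter> E"] A(1) E tA by (auto simp: sets_restrict_space_iff)
qed

definition left_dom :: "'a set \<Rightarrow> 'a set" where "left_dom A = {g\<in>arrows G. tgt G g \<in> tgt G ` A}"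
definition right_dom :: "'a set \<Rightarrow> 'a set" where "right_dom A = {g\<in>arrows G. src G g \<in> tgt G ` A}"
text \<open>If \<open>a\<close> is the element of \<open>A\<close> with the same target as
  \<open>g\<close>, this is \<open>a^-1 g\<close>. It lies in \<open>E\<close> iff \<open>g\<close>
  lies in the product of \<open>A\<close> and \<open>E\<close>, so composition with it realizes the
  operator of \<open>A\<close>. The right version is \<open>g a\<close>, with the target of
  \<open>a\<close> at the source of \<open>g\<close>.\<close>

definition left_trans :: "'a set \<Rightarrow> 'a \<Rightarrow> 'a" where "left_trans A g = mult G (ginv G (tgt_section A (tgt G g))) g"
definition right_trans :: "'a set \<Rightarrow> 'a \<Rightarrow> 'a" where "right_trans A g = mult G g (tgt_section A (src G g))"

lemma left_dom_sets[measurable]: "A \<in> sets (Borel G) \<Longrightarrow> left_dom A \<in> sets (Borel G)"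
  using measurable_sets[OF tgt_measurable_Borel tgt_image, of A] by (simp add: left_dom_def vimage_def Int_def conj_commute)

lemma right_dom_sets[measurable]: "A \<in> sets (Borel G) \<Longrightarrow> right_dom A \<in> sets (Borel G)"
  using measurable_sets[OF src_measurable_Borel tgt_image, of A] by (simp add: right_dom_def vimage_def Int_def conj_commute)

lemma tgt_section_arrow: "A \<in> sets (Borel G) \<Longrightarrow> x \<in> tgt G ` A \<Longrightarrow> tgt_section A x \<in> arrows G"
  using tgt_section(1) arrow_mem by blast

lemma left_trans:
  assumes "A \<in> sets (Borel G)" "g \<in> left_dom A"
  shows "left_trans A g \<in> arrows G" "src G (left_trans A g) = src G g" "tgt G (left_trans A g) = src G (tgt_section A (tgt G g))"
    "mult G (tgt_section A (tgt G g)) (left_trans A g) = g"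
  using assms tgt_section_arrow[of A "tgt G g"] tgt_section(2)[of "tgt G g" A] unfolding left_trans_def left_dom_def by simp_all

lemma right_trans:
  assumes "A \<in> sets (Borel G)" "g \<in> right_dom A"
  shows "right_trans A g \<in> arrows G" "tgt G (right_trans A g) = tgt G g" "src G (right_trans A g) = src G (tgt_section A (src G g))"
    "mult G (right_trans A g) (ginv G (tgt_section A (src G g))) = g"
  using assms tgt_section_arrow[of A "src G g"] tgt_section(2)[of "src G g" A] unfolding right_trans_def right_dom_def by simp_all

lemma tgt_section_comp_meas:
  assumes A: "A \<in> sets (Borel G)" "bisection G A" and f: "f \<in> Borel G \<rightarrow>\<^sub>M Borel G"
    and D: "D = {g\<in>arrows G. f g \<in> tgt G ` A}"
  shows "(\<lambda>g. tgt_section A (f g)) \<in> restrict_space (Borel G) D \<rightarrow>\<^sub>M Borel G"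
proof (rule measurable_compose[OF _ tgt_section_meas[OF A]])
  show "f \<in> restrict_space (Borel G) D \<rightarrow>\<^sub>M restrict_space (Borel G) (tgt G ` A)"
    by (rule measurable_restrict_space2[OF _ measurable_restrict_space1[OF f]]) (auto simp: D space_restrict_space)
qed

lemma left_trans_measurable:
  assumes A: "A \<in> sets (Borel G)" "bisection G A"
  shows "left_trans A \<in> restrict_space (Borel G) (left_dom A) \<rightarrow>\<^sub>M Borel G"
  unfolding left_trans_def
proof (rule measurable_mult)
  show "(\<lambda>g. ginv G (tgt_section A (tgt G g))) \<in> restrict_space (Borel G) (left_dom A) \<rightarrow>\<^sub>M Borel G"
    by (rule measurable_compose[OF tgt_section_comp_meas[OF A tgt_measurable_Borel] ginv_measurable]) (simp add: left_dom_def)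
  show "(\<lambda>g. g) \<in> restrict_space (Borel G) (left_dom A) \<rightarrow>\<^sub>M Borel G" by (rule measurable_restrict_space1) simp
  fix x assume "x \<in> space (restrict_space (Borel G) (left_dom A))"
  then have "x \<in> left_dom A" by (auto simp: space_restrict_space)
  then show "src G (ginv G (tgt_section A (tgt G x))) = tgt G x"
    using tgt_section_arrow[OF A(1), of "tgt G x"] tgt_section(2)[of "tgt G x" A] by (auto simp: left_dom_def)
qed

lemma right_trans_measurable:
  assumes A: "A \<in> sets (Borel G)" "bisection G A"
  shows "right_trans A \<in> restrict_space (Borel G) (right_dom A) \<rightarrow>\<^sub>M Borel G"
  unfolding right_trans_def
proof (rule measurable_mult)
  show "(\<lambda>g. tgt_section A (src G g)) \<in> restrict_space (Borel G) (right_dom A) \<rightarrow>\<^sub>M Borel G"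
    by (rule tgt_section_comp_meas[OF A src_measurable_Borel]) (simp add: right_dom_def)
  show "(\<lambda>g. g) \<in> restrict_space (Borel G) (right_dom A) \<rightarrow>\<^sub>M Borel G" by (rule measurable_restrict_space1) simp
  fix x assume "x \<in> space (restrict_space (Borel G) (right_dom A))"
  then have "x \<in> right_dom A" by (auto simp: space_restrict_space)
  then show "src G x = tgt G (tgt_section A (src G x))"
    using tgt_section(2)[of "src G x" A] by (auto simp: right_dom_def)
qed

lemma restrict_pre_sets:
  assumes "\<phi> \<in> restrict_space (Borel G) D \<rightarrow>\<^sub>M Borel G" "D \<in> sets (Borel G)" "E \<in> sets (Borel G)"
  shows "{g\<in>D. \<phi> g \<in> E} \<in> sets (Borel G)"
proof -
  have sp: "space (restrict_space (Borel G) D) = D" using sets.sets_into_space[OF assms(2)] by (auto simp: space_restrict_space)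
  have "\<phi> -` E \<inter> space (restrict_space (Borel G) D) \<in> sets (restrict_space (Borel G) D)" by (rule measurable_sets[OF assms(1,3)])
  moreover have "\<phi> -` E \<inter> space (restrict_space (Borel G) D) = {g\<in>D. \<phi> g \<in> E}" unfolding sp by auto
  ultimately show ?thesis using assms(2) by (auto simp: sets_restrict_space_iff)
qed

lemma bisection_units:
  assumes "E \<subseteq> units G"
  shows "bisection G E"
proof -
  have "src G x = x" "tgt G x = x" "x \<in> arrows G" if "x \<in> E" for x
    using assms that unit_arrow by auto
  then show ?thesis unfolding bisection_def inj_on_def by auto
qed

lemma tgt_image_units: "E \<subseteq> units G \<Longrightarrow> tgt G ` E = E"
  using tgt_unit by (force simp: subset_iff)

lemma src_image_units: "E \<subseteq> units G \<Longrightarrow> src G ` E = E"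
  using src_unit by (force simp: subset_iff)

lemma tgt_section_units: "E \<subseteq> units G \<Longrightarrow> x \<in> E \<Longrightarrow> tgt_section E x = x"
  by (rule tgt_section_eq[OF bisection_units]) auto

lemma tgt_image_subset_units: "A \<in> sets (Borel G) \<Longrightarrow> tgt G ` A \<subseteq> units G"
  using arrow_mem tgt_in by auto

section \<open>Conjugacy classes\<close>

lemma conj_mem_conj_class:
  assumes "\<omega> \<in> conj_class G A" "A \<subseteq> Iso G" "b \<in> arrows G" "src G b = tgt G \<omega>"
  shows "mult G (mult G b \<omega>) (ginv G b) \<in> conj_class G A"
proof -
  obtain a g where a: "a \<in> A" "g \<in> arrows G" "src G g = tgt G a" "\<omega> = mult G (mult G g a) (ginv G g)"
    using assms(1) unfolding conj_class_def by blast
  have aI: "a \<in> arrows G" "src G a = tgt G a" using a(1) assms(2) by (auto simp: Iso_def)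
  have tw: "tgt G \<omega> = tgt G g" using a aI by simp
  have "mult G (mult G b \<omega>) (ginv G b) = mult G (mult G (mult G b g) a) (ginv G (mult G b g))"
    unfolding a(4) using a aI assms(3,4) tw by (simp add: ginv_mult_distrib assoc)
  then show ?thesis unfolding conj_class_def using a aI assms(3,4) tw by force
qed

lemma conj_class_Iso: "A \<subseteq> Iso G \<Longrightarrow> conj_class G A \<subseteq> Iso G"
  unfolding conj_class_def Iso_def by auto

lemma subset_conj_class:
  assumes "A \<subseteq> Iso G"
  shows "A \<subseteq> conj_class G A"
proof
  fix a assume a: "a \<in> A"
  then have aI: "a \<in> arrows G" "src G a = tgt G a" using assms by (auto simp: Iso_def)
  have u: "tgt G a \<in> units G" using aI by simp
  have "a = mult G (mult G (tgt G a) a) (ginv G (tgt G a))" using aI u by (simp add: unit_arrow)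
  then show "a \<in> conj_class G A" unfolding conj_class_def using a u unit_arrow by force
qed

text \<open>An isotropy arrow \<open>\<omega>\<close> is in the class iff
  \<open>b^-1 \<omega> b\<close> lies in \<open>A\<close> for some arrow \<open>b\<close> ending at
  the target of \<open>\<omega>\<close>, and \<open>b\<close> may be sought in the members of a
  countable cover by bisections. This turns a union over all arrows into a countable union of Borel
  sets. The cover is a parameter because it is used for \<open>cover\<close> and for tame
  pieces.\<close>

lemma conj_class_eq_UN:
  assumes A: "A \<subseteq> Iso G" and B: "\<And>n::nat. B n \<in> sets (Borel G) \<and> bisection G (B n)" "(\<Union>n. B n) = arrows G"
  shows "conj_class G A = (\<Union>n. {g\<in>Iso G. g \<in> left_dom (B n) \<and> right_trans (B n) (left_trans (B n) g) \<in> A})"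
proof safe
  fix \<omega> assume w: "\<omega> \<in> conj_class G A"
  then obtain a g where a: "a \<in> A" "g \<in> arrows G" "src G g = tgt G a" "\<omega> = mult G (mult G g a) (ginv G g)"
    unfolding conj_class_def by blast
  have aI: "a \<in> arrows G" "src G a = tgt G a" using a(1) A by (auto simp: Iso_def)
  obtain n where n: "g \<in> B n" using a(2) B(2) by blast
  have tw: "tgt G \<omega> = tgt G g" "src G \<omega> = tgt G g" "\<omega> \<in> arrows G" using a aI by simp_all
  have LDw: "\<omega> \<in> left_dom (B n)" using tw n by (simp add: left_dom_def)
  have ts: "tgt_section (B n) (tgt G g) = g" by (rule tgt_section_tgt) (use B n in auto)
  have L: "left_trans (B n) \<omega> = mult G a (ginv G g)"
    unfolding left_trans_def tw ts unfolding a(4) using a(2,3) aI by (simp add: assoc)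
  have "right_trans (B n) (left_trans (B n) \<omega>) = a"
    unfolding right_trans_def L using a(2,3) aI ts by simp
  then show "\<omega> \<in> (\<Union>n. {g\<in>Iso G. g \<in> left_dom (B n) \<and> right_trans (B n) (left_trans (B n) g) \<in> A})"
    using LDw a(1) conj_class_Iso[OF A] w by blast
next
  fix n \<omega> assume w: "\<omega> \<in> Iso G" "\<omega> \<in> left_dom (B n)" and wA: "right_trans (B n) (left_trans (B n) \<omega>) \<in> A"
  have BS: "B n \<in> sets (Borel G)" using B by blast
  define b where "b = tgt_section (B n) (tgt G \<omega>)"
  have b: "b \<in> arrows G" "tgt G b = tgt G \<omega>"
    unfolding b_def using w(2) tgt_section_arrow[OF BS] tgt_section(2) by (auto simp: left_dom_def)
  have wI: "\<omega> \<in> arrows G" "src G \<omega> = tgt G \<omega>" using w by (auto simp: Iso_def)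
  have e: "right_trans (B n) (left_trans (B n) \<omega>) = mult G (mult G (ginv G b) \<omega>) b"
    unfolding right_trans_def left_trans(2)[OF BS w(2)] unfolding left_trans_def wI(2) b_def ..
  have "mult G (mult G b (mult G (mult G (ginv G b) \<omega>) b)) (ginv G b) = \<omega>"
    using b wI by (simp add: assoc mult_ginv mult_src[of \<omega>, unfolded wI(2)])
  moreover have "src G b = tgt G (mult G (mult G (ginv G b) \<omega>) b)" using b wI by simp
  ultimately show "\<omega> \<in> conj_class G A" unfolding conj_class_def using wA b(1) unfolding e by force
qed

lemma conj_pre_sets:
  assumes B: "B \<in> sets (Borel G)" "bisection G B" and A: "A \<in> sets (Borel G)"
  shows "{g\<in>Iso G. g \<in> left_dom B \<and> right_trans B (left_trans B g) \<in> A} \<in> sets (Borel G)"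
proof -
  let ?E = "{g\<in>right_dom B. right_trans B g \<in> A}"
  have E: "?E \<in> sets (Borel G)" by (rule restrict_pre_sets[OF right_trans_measurable[OF B]]) (use A B in auto)
  have L: "{g\<in>left_dom B. left_trans B g \<in> ?E} \<in> sets (Borel G)" by (rule restrict_pre_sets[OF left_trans_measurable[OF B] _ E]) (use B in auto)
  have "{g\<in>Iso G. g \<in> left_dom B \<and> right_trans B (left_trans B g) \<in> A} = Iso G \<inter> {g\<in>left_dom B. left_trans B g \<in> ?E}"
    using left_trans(1,2)[OF B(1)] by (auto simp: Iso_def right_dom_def left_dom_def)
  then show ?thesis using L by auto
qed

lemma conj_class_sets:
  assumes "A \<in> sets (Borel G)" "A \<subseteq> Iso G"
  shows "conj_class G A \<in> sets (Borel G)"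
proof -
  have c: "cover n \<in> sets (Borel G) \<and> bisection G (cover n)" for n using cover by blast
  show ?thesis
    unfolding conj_class_eq_UN[OF assms(2), of cover, OF c cover(4)]
    by (intro sets.countable_UN image_subsetI conj_pre_sets cover assms)
qed

end

section \<open>The measure and the regular representation\<close>

lemma bounded_mapD:
  "bounded_map M K D \<phi> \<Longrightarrow> E \<in> sets M \<Longrightarrow> emeasure M {x\<in>D. \<phi> x \<in> E} \<le> ennreal K * emeasure M E"
  by (simp add: bounded_map_def)

context discrete_measured_groupoid begin

abbreviation M where "M \<equiv> mu_src G \<mu>"

definition fibre_count :: "'a set \<Rightarrow> 'a \<Rightarrow> ennreal" where
  "fibre_count A x = emeasure (count_space UNIV) {g\<in>A. src G g = x}"

lemma sets_mu_iff: "E \<in> sets \<mu> \<longleftrightarrow> E \<in> sets (Borel G) \<and> E \<subseteq> units G"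
  unfolding sets_mu using units_sets sets.sets_into_space[OF units_sets] by (auto simp: sets_restrict_space_iff)

lemma space_mu: "space \<mu> = units G"
  using sets_eq_imp_space_eq[OF sets_mu] units_subset by (auto simp: space_restrict_space)

lemma src_image_mu: "A \<in> sets (Borel G) \<Longrightarrow> src G ` A \<in> sets \<mu>"
  unfolding sets_mu_iff using src_image arrow_mem src_in by auto

lemma tgt_image_mu: "A \<in> sets (Borel G) \<Longrightarrow> tgt G ` A \<in> sets \<mu>"
  unfolding sets_mu_iff using tgt_image tgt_image_subset_units by auto

lemma cover_inj: "inj_on (src G) (cover n)" "inj_on (tgt G) (cover n)"
  using cover(2)[of n] by (simp_all add: bisection_def)

lemma cover_D: "cover n \<in> sets (Borel G)" "disjoint_family cover" "(\<Union>n. cover n) = space (Borel G)"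
  using cover by simp_all

lemma fibre_count_measurable: "A \<in> sets (Borel G) \<Longrightarrow> fibre_count A \<in> borel_measurable \<mu>"
  unfolding fibre_count_def by (rule fibre_count_measure(2)[OF cover_D cover_inj(1) src_image_mu])

lemma emeasure_M: "A \<in> sets (Borel G) \<Longrightarrow> emeasure M A = (\<integral>\<^sup>+x. fibre_count A x \<partial>\<mu>)"
  unfolding fibre_count_def mu_src_def by (rule fibre_count_measure(3)[OF cover_D cover_inj(1) src_image_mu])

lemma emeasure_tgt_sum: "A \<in> sets (Borel G) \<Longrightarrow> emeasure (mu_tgt G \<mu>) A = (\<Sum>n. emeasure \<mu> (tgt G ` (A \<inter> cover n)))"
  unfolding mu_tgt_def by (rule fibre_count_measure(4)[OF cover_D cover_inj(2) tgt_image_mu])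

lemma sets_M[simp, measurable_cong]: "sets M = sets (Borel G)"
  unfolding mu_src_def by (rule fibre_count_measure(5)[OF cover_D cover_inj(1) src_image_mu])

lemma space_M[simp]: "space M = arrows G"
  by (rule sets_eq_imp_space_eq) simp

lemma emeasure_M_bisection:
  assumes A: "A \<in> sets (Borel G)" "inj_on (src G) A"
  shows "emeasure M A = emeasure \<mu> (src G ` A)"
proof -
  have "fibre_count A x = indicator (src G ` A) x" for x
  proof (cases "x \<in> src G ` A")
    case True
    then obtain g where g: "g \<in> A" "src G g = x" by blast
    then have e: "{g\<in>A. src G g = x} = {g}" using A(2) unfolding inj_on_def by blast
    show ?thesis unfolding fibre_count_def e using True by simp
  next
    case False
    then have e: "{g\<in>A. src G g = x} = {}" by blast
    show ?thesis unfolding fibre_count_def e using False by (simp add: indicator_def)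
  qed
  then have "fibre_count A = indicator (src G ` A)" by (rule ext)
  then show ?thesis unfolding emeasure_M[OF A(1)] using src_image_mu[OF A(1)] by simp
qed

lemma emeasure_M_units:
  assumes "E \<in> sets (Borel G)" "E \<subseteq> units G"
  shows "emeasure M E = emeasure \<mu> E"
  using emeasure_M_bisection[OF assms(1)] bisection_units[OF assms(2)] src_image_units[OF assms(2)]
  by (simp add: bisection_def)

lemma mu_finite: "emeasure \<mu> E < \<infinity>"
proof -
  interpret prob_space \<mu> by (rule prob)
  show ?thesis by (simp add: less_top[symmetric])
qed

lemma emeasure_bisection_finite: "A \<in> sets (Borel G) \<Longrightarrow> bisection G A \<Longrightarrow> emeasure M A < \<infinity>"
  using emeasure_M_bisection[of A] mu_finite by (simp add: bisection_def)

text \<open>A bisection has source measure equal to the measure of its source image, and its target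
  measure is the sum of the measures of the target images of its pieces. Equivalence of the two
  measures transfers nullity from one side to the other.\<close>

lemma quasi_invariant:
  assumes A: "A \<in> sets (Borel G)" "bisection G A" and null: "emeasure \<mu> (src G ` A) = 0"
  shows "emeasure \<mu> (tgt G ` A) = 0"
proof -
  have "emeasure M A = 0" using emeasure_M_bisection[OF A(1)] A(2) null by (simp add: bisection_def)
  then have "A \<in> null_sets (mu_tgt G \<mu>)" using A(1) equivalent by (auto simp: null_sets_def)
  then have "emeasure (mu_tgt G \<mu>) A = 0" by (auto simp: null_sets_def)
  then have z: "emeasure \<mu> (tgt G ` (A \<inter> cover n)) = 0" for n
    unfolding emeasure_tgt_sum[OF A(1)] by (subst (asm) suminf_eq_zero_iff) auto
  have "A \<subseteq> (\<Union>n. cover n)" using A(1) arrow_mem cover(4) by blast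
  then have "tgt G ` A = (\<Union>n. tgt G ` (A \<inter> cover n))" by blast
  moreover have "(\<Union>n. tgt G ` (A \<inter> cover n)) \<in> null_sets \<mu>"
    using z by (intro null_sets_UN') (auto simp: null_sets_def intro!: tgt_image_mu A cover)
  ultimately show ?thesis by (simp add: null_sets_def)
qed

text \<open>The transport \<open>tgt a \<mapsto> src a\<close> along a bisection is nonsingular, but right translation is bounded on
  \<open>L\<^sup>2(\<mu>\<^sub>s)\<close> only if its Radon-Nikodym derivative is.\<close>

definition tame :: "real \<Rightarrow> 'a set \<Rightarrow> bool" where
  "tame K A \<longleftrightarrow> 0 \<le> K \<and> bounded_map \<mu> K (tgt G ` A) (\<lambda>x. src G (tgt_section A x))"

lemma measurable_transport:
  assumes A: "A \<in> sets (Borel G)" "bisection G A"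
  shows "(\<lambda>x. src G (tgt_section A x)) \<in> restrict_space \<mu> (tgt G ` A) \<rightarrow>\<^sub>M \<mu>"
proof -
  have tA: "tgt G ` A \<subseteq> units G" by (rule tgt_image_subset_units[OF A(1)])
  have sp: "space (restrict_space (Borel G) (tgt G ` A)) = tgt G ` A"
    using tA units_subset by (auto simp: space_restrict_space)
  have c: "(\<lambda>x. src G (tgt_section A x)) \<in> restrict_space (Borel G) (tgt G ` A) \<rightarrow>\<^sub>M restrict_space (Borel G) (units G)"
    by (rule measurable_compose[OF tgt_section_meas[OF A] src_measurable])
  have s1: "sets (restrict_space \<mu> (tgt G ` A)) = sets (restrict_space (Borel G) (tgt G ` A))"
  proof -
    have "sets (restrict_space \<mu> (tgt G ` A)) = sets (restrict_space (restrict_space (Borel G) (units G)) (tgt G ` A))"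
      by (rule sets_restrict_space_cong[OF sets_mu])
    also have "\<dots> = sets (restrict_space (Borel G) (units G \<inter> tgt G ` A))"
      by (subst restrict_restrict_space) (use units_sets A tgt_image[OF A(1)] sets.sets_into_space[of _ "Borel G"] in auto)
    also have "units G \<inter> tgt G ` A = tgt G ` A" using tA by blast
    finally show ?thesis .
  qed
  show ?thesis using c unfolding measurable_cong_sets[OF s1 sets_mu] .
qed

lemma transport_pre: "bisection G A \<Longrightarrow> {x\<in>tgt G ` A. src G (tgt_section A x) \<in> E} = tgt G ` {a\<in>A. src G a \<in> E}"
  using tgt_section_tgt by auto

lemma tame_units: "E \<in> sets (Borel G) \<Longrightarrow> E \<subseteq> units G \<Longrightarrow> tame 1 E"
proof -
  assume E: "E \<in> sets (Borel G)" "E \<subseteq> units G"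
  have "{x\<in>tgt G ` E. src G (tgt_section E x) \<in> F} = E \<inter> F" for F
    unfolding transport_pre[OF bisection_units[OF E(2)]] using E(2) tgt_unit src_unit by (force simp: subset_iff)
  then show "tame 1 E" unfolding tame_def bounded_map_def
    using tgt_image_mu[OF E(1)] measurable_transport[OF E(1) bisection_units[OF E(2)]] by (auto intro!: emeasure_mono)
qed

text \<open>Transport along \<open>A\<close> carries \<open>\<mu>\<close> on the target image to a
  finite measure \<open>\<nu>\<close>, absolutely continuous by quasi-invariance. Its Radon-Nikodym
  derivative \<open>r\<close> has a finite-valued version, and on the piece where \<open>r\<close>
  is at most \<open>k\<close> at the source the transport is bounded by \<open>k\<close>.\<close>

lemma tame_pieces:
  assumes A: "A \<in> sets (Borel G)" "bisection G A"
  shows "\<exists>B :: nat \<Rightarrow> 'a set. \<forall>k. B k \<in> sets (Borel G) \<and> B k \<subseteq> A \<and> tame (real k) (B k) \<and> (\<Union>k. B k) = A"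
proof -
  interpret prob_space \<mu> by (rule prob)
  let ?tA = "tgt G ` A" and ?\<phi> = "\<lambda>x. src G (tgt_section A x)"
  define \<nu> where "\<nu> = distr (restrict_space \<mu> ?tA) \<mu> ?\<phi>"
  note tm = measurable_transport[OF A]
  have tA: "?tA \<in> sets \<mu>" by (rule tgt_image_mu[OF A(1)])
  then have tA': "?tA \<inter> space \<mu> \<in> sets \<mu>" by auto
  have nu: "emeasure \<nu> E = emeasure \<mu> (tgt G ` {a\<in>A. src G a \<in> E})" if E: "E \<in> sets \<mu>" for E
  proof -
    have sp: "space (restrict_space \<mu> ?tA) = ?tA" using sets.sets_into_space[OF tA] by (auto simp: space_restrict_space)
    have "?\<phi> -` E \<inter> space (restrict_space \<mu> ?tA) = {x\<in>?tA. ?\<phi> x \<in> E}" unfolding sp by auto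
    then have e: "?\<phi> -` E \<inter> space (restrict_space \<mu> ?tA) = tgt G ` {a\<in>A. src G a \<in> E}"
      unfolding transport_pre[OF A(2)] .
    have "emeasure \<nu> E = emeasure (restrict_space \<mu> ?tA) (tgt G ` {a\<in>A. src G a \<in> E})"
      unfolding \<nu>_def emeasure_distr[OF tm E] e ..
    also have "\<dots> = emeasure \<mu> (tgt G ` {a\<in>A. src G a \<in> E})"
      by (rule emeasure_restrict_space[OF tA']) auto
    finally show ?thesis .
  qed
  have sub: "{a\<in>A. src G a \<in> E} \<in> sets (Borel G)" if "E \<in> sets \<mu>" for E
  proof -
    have "{a\<in>A. src G a \<in> E} = A \<inter> (src G -` E \<inter> space (Borel G))" using A(1) arrow_mem by auto
    then show ?thesis using A(1) measurable_sets[OF src_measurable_Borel, of E] that sets_mu_iff by auto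
  qed
  have "finite_measure \<nu>"
    unfolding \<nu>_def
    by (rule finite_measure.finite_measure_distr[OF finite_measure_restrict_space[OF finite_measure_axioms tA] tm])
  moreover have "absolutely_continuous \<mu> \<nu>" unfolding absolutely_continuous_def
  proof
    fix E assume E: "E \<in> null_sets \<mu>"
    then have Es: "E \<in> sets \<mu>" by auto
    have "src G ` {a\<in>A. src G a \<in> E} \<in> sets \<mu>" by (rule src_image_mu[OF sub[OF Es]])
    then have "src G ` {a\<in>A. src G a \<in> E} \<in> null_sets \<mu>" by (rule null_sets_subset[OF E]) auto
    then have "emeasure \<mu> (tgt G ` {a\<in>A. src G a \<in> E}) = 0"
      by (intro quasi_invariant[OF sub[OF Es] bisection_subset[OF A(2)]]) auto
    then show "E \<in> null_sets \<nu>" using nu[OF Es] Es by (auto simp: null_sets_def \<nu>_def)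
  qed
  moreover have "sets \<nu> = sets \<mu>" by (simp add: \<nu>_def)
  ultimately obtain r where r: "r \<in> borel_measurable \<mu>" "AE x in \<mu>. RN_deriv \<mu> \<nu> x = ennreal (r x)" "\<And>x. 0 \<le> r x"
    and dn: "density \<mu> (RN_deriv \<mu> \<nu>) = \<nu>"
    using real_RN_deriv density_RN_deriv by metis
  have nur: "emeasure \<nu> E = (\<integral>\<^sup>+x. ennreal (r x) * indicator E x \<partial>\<mu>)" if E: "E \<in> sets \<mu>" for E
  proof -
    have "emeasure \<nu> E = (\<integral>\<^sup>+x. RN_deriv \<mu> \<nu> x * indicator E x \<partial>\<mu>)"
      by (subst dn[symmetric]) (rule emeasure_density[OF borel_measurable_RN_deriv E])
    also have "\<dots> = (\<integral>\<^sup>+x. ennreal (r x) * indicator E x \<partial>\<mu>)"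
      by (rule nn_integral_cong_AE) (use r(2) in eventually_elim, simp)
    finally show ?thesis .
  qed
  define V where "V k = {x\<in>space \<mu>. r x \<le> real k}" for k :: nat
  have V: "V k \<in> sets \<mu>" for k unfolding V_def using r(1) by measurable
  define B where "B k = {a\<in>A. src G a \<in> V k}" for k
  have Bs: "B k \<in> sets (Borel G)" "B k \<subseteq> A" "bisection G (B k)" for k
    using sub[OF V] bisection_subset[OF A(2), of "B k"] by (auto simp: B_def)
  have "tame (real k) (B k)" for k unfolding tame_def bounded_map_def
  proof (intro conjI ballI)
    show "tgt G ` B k \<in> sets \<mu>" by (rule tgt_image_mu[OF Bs(1)])
    show "(\<lambda>x. src G (tgt_section (B k) x)) \<in> restrict_space \<mu> (tgt G ` B k) \<rightarrow>\<^sub>M \<mu>" by (rule measurable_transport[OF Bs(1,3)])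
    fix E assume E: "E \<in> sets \<mu>"
    have EV: "E \<inter> V k \<in> sets \<mu>" using E V by auto
    have "{x\<in>tgt G ` B k. src G (tgt_section (B k) x) \<in> E} = tgt G ` {a\<in>A. src G a \<in> E \<inter> V k}"
      unfolding transport_pre[OF Bs(3)] by (auto simp: B_def)
    then have "emeasure \<mu> {x\<in>tgt G ` B k. src G (tgt_section (B k) x) \<in> E} = emeasure \<nu> (E \<inter> V k)"
      using nu[OF EV] by simp
    also have "\<dots> = (\<integral>\<^sup>+x. ennreal (r x) * indicator (E \<inter> V k) x \<partial>\<mu>)" by (rule nur[OF EV])
    also have "\<dots> \<le> (\<integral>\<^sup>+x. ennreal (real k) * indicator E x \<partial>\<mu>)"
      by (rule nn_integral_mono) (auto simp: V_def indicator_def intro: ennreal_leI)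
    also have "\<dots> = ennreal (real k) * emeasure \<mu> E" using E by (simp add: nn_integral_cmult_indicator)
    finally show "emeasure \<mu> {x\<in>tgt G ` B k. src G (tgt_section (B k) x) \<in> E} \<le> ennreal (real k) * emeasure \<mu> E" .
  qed simp
  moreover have "(\<Union>k. B k) = A"
  proof
    show "A \<subseteq> (\<Union>k. B k)"
    proof
      fix a assume a: "a \<in> A"
      have "src G a \<in> space \<mu>" using a A(1) arrow_mem src_in by (simp add: space_mu)
      moreover obtain k :: nat where "r (src G a) \<le> real k" using real_arch_simple by blast
      ultimately show "a \<in> (\<Union>k. B k)" using a by (auto simp: B_def V_def)
    qed
  qed (use Bs in auto)
  ultimately show ?thesis using Bs by (intro exI[of _ B]) simp
qed

lemma tame_cover:
  "\<exists>B K. (\<forall>n::nat. B n \<in> sets (Borel G) \<and> bisection G (B n) \<and> tame (K n) (B n)) \<and> (\<Union>n. B n) = arrows G"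
proof -
  have "\<forall>n. \<exists>B :: nat \<Rightarrow> 'a set. \<forall>k. B k \<in> sets (Borel G) \<and> B k \<subseteq> cover n \<and> tame (real k) (B k) \<and> (\<Union>k. B k) = cover n"
    using tame_pieces[OF cover(1,2)] by blast
  from choice[OF this] obtain B where B: "\<forall>n. \<forall>k. B n k \<in> sets (Borel G) \<and> B n k \<subseteq> cover n \<and> tame (real k) (B n k) \<and> (\<Union>k. B n k) = cover n" ..
  define B' where "B' p = B (fst (prod_decode p)) (snd (prod_decode p))" for p
  define K' where "K' p = real (snd (prod_decode p))" for p
  have "(\<Union>p. B' p) = arrows G"
  proof
    show "(\<Union>p. B' p) \<subseteq> arrows G" using B arrow_mem unfolding B'_def by blast
    show "arrows G \<subseteq> (\<Union>p. B' p)"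
    proof
      fix g assume "g \<in> arrows G"
      then obtain n where "g \<in> cover n" using cover(4) by blast
      then obtain k where "g \<in> B n k" using B[rule_format, of n] by blast
      then have "g \<in> B' (prod_encode (n, k))" by (simp add: B'_def)
      then show "g \<in> (\<Union>p. B' p)" by blast
    qed
  qed
  moreover have "B' p \<in> sets (Borel G) \<and> bisection G (B' p) \<and> tame (K' p) (B' p)" for p
    using B[rule_format, of "fst (prod_decode p)" "snd (prod_decode p)"]
      bisection_subset[OF cover(2), of "B' p" "fst (prod_decode p)"] by (simp add: B'_def K'_def)
  ultimately show ?thesis by (intro exI[of _ B'] exI[of _ K']) simp
qed

text \<open>Left translation preserves sources and is injective: the target of \<open>a^-1 g\<close>
  is the source of \<open>a\<close>, which determines \<open>a\<close> in the bisection. So it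
  injects each source fibre of the preimage into that of \<open>E\<close>, and the constant is
  1.\<close>

lemma bounded_left_trans:
  assumes A: "A \<in> sets (Borel G)" "bisection G A"
  shows "bounded_map M 1 (left_dom A) (left_trans A)"
  unfolding bounded_map_def
proof (intro conjI ballI)
  show "left_dom A \<in> sets M" using left_dom_sets[OF A(1)] by simp
  show "left_trans A \<in> restrict_space M (left_dom A) \<rightarrow>\<^sub>M M"
    using left_trans_measurable[OF A] unfolding measurable_cong_sets[OF sets_restrict_space_cong[OF sets_M] sets_M] .
  fix E assume "E \<in> sets M"
  then have E: "E \<in> sets (Borel G)" by simp
  have P: "{g\<in>left_dom A. left_trans A g \<in> E} \<in> sets (Borel G)"
    by (rule restrict_pre_sets[OF left_trans_measurable[OF A] left_dom_sets[OF A(1)] E])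
  have inj: "inj_on (left_trans A) (left_dom A \<inter> {g. src G g = x})" for x
  proof (rule inj_onI)
    fix g h assume g: "g \<in> left_dom A \<inter> {g. src G g = x}" and h: "h \<in> left_dom A \<inter> {g. src G g = x}" and e: "left_trans A g = left_trans A h"
    have gt: "tgt_section A (tgt G g) \<in> A" "tgt_section A (tgt G h) \<in> A" using g h tgt_section(1) by (auto simp: left_dom_def)
    have "src G (tgt_section A (tgt G g)) = src G (tgt_section A (tgt G h))"
      using left_trans(3)[OF A(1), of g] left_trans(3)[OF A(1), of h] g h e by simp
    then have te: "tgt_section A (tgt G g) = tgt_section A (tgt G h)"
      using A(2) gt unfolding bisection_def by (elim conjE) (rule inj_onD)
    have gL: "g \<in> left_dom A" "h \<in> left_dom A" using g h by auto
    have "mult G (tgt_section A (tgt G g)) (left_trans A g) = mult G (tgt_section A (tgt G h)) (left_trans A h)" by (simp only: te e)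
    then show "g = h" unfolding left_trans(4)[OF A(1) gL(1)] left_trans(4)[OF A(1) gL(2)] .
  qed
  have "fibre_count {g\<in>left_dom A. left_trans A g \<in> E} x \<le> fibre_count E x" for x
  proof -
    let ?S = "{g\<in>{g\<in>left_dom A. left_trans A g \<in> E}. src G g = x}"
    have i: "inj_on (left_trans A) ?S" by (rule inj_on_subset[OF inj[of x]]) auto
    have "emeasure (count_space UNIV) ?S = emeasure (count_space UNIV) (left_trans A ` ?S)"
      using i by (simp add: emeasure_count_space card_image finite_image_iff)
    also have "\<dots> \<le> emeasure (count_space UNIV) {g\<in>E. src G g = x}"
      by (rule emeasure_mono) (use left_trans(2)[OF A(1)] in auto)
    finally show ?thesis by (simp add: fibre_count_def)
  qed
  then have "emeasure M {g\<in>left_dom A. left_trans A g \<in> E} \<le> emeasure M E"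
    unfolding emeasure_M[OF P] emeasure_M[OF E] by (intro nn_integral_mono)
  then show "emeasure M {g\<in>left_dom A. left_trans A g \<in> E} \<le> ennreal 1 * emeasure M E" by simp
qed

text \<open>The source fibre over \<open>x\<close> is carried injectively into the fibre over the
  transported unit. Integrating over \<open>x\<close> therefore leads to the image measure of the
  transport, which tameness controls.\<close>

lemma bounded_right_trans:
  assumes A: "A \<in> sets (Borel G)" "bisection G A" and K: "tame K A"
  shows "bounded_map M K (right_dom A) (right_trans A)"
  unfolding bounded_map_def
proof (intro conjI ballI)
  show "right_dom A \<in> sets M" using right_dom_sets[OF A(1)] by simp
  show "right_trans A \<in> restrict_space M (right_dom A) \<rightarrow>\<^sub>M M"
    using right_trans_measurable[OF A] unfolding measurable_cong_sets[OF sets_restrict_space_cong[OF sets_M] sets_M] .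
  fix E assume "E \<in> sets M"
  then have E: "E \<in> sets (Borel G)" by simp
  have P: "{g\<in>right_dom A. right_trans A g \<in> E} \<in> sets (Borel G)"
    by (rule restrict_pre_sets[OF right_trans_measurable[OF A] right_dom_sets[OF A(1)] E])
  let ?\<phi> = "\<lambda>x. src G (tgt_section A x)"
  have "fibre_count {g\<in>right_dom A. right_trans A g \<in> E} x \<le> fibre_count E (?\<phi> x) * indicator (tgt G ` A) x" for x
  proof (cases "x \<in> tgt G ` A")
    case True
    let ?S = "{g\<in>{g\<in>right_dom A. right_trans A g \<in> E}. src G g = x}"
    have i: "inj_on (right_trans A) ?S"
    proof (rule inj_onI)
      fix g h assume g: "g \<in> ?S" and h: "h \<in> ?S" and e: "right_trans A g = right_trans A h"
      have gR: "g \<in> right_dom A" "h \<in> right_dom A" and se: "src G g = src G h" using g h by auto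
      have "mult G (right_trans A g) (ginv G (tgt_section A (src G g))) = mult G (right_trans A h) (ginv G (tgt_section A (src G h)))"
        by (simp only: se e)
      then show "g = h" unfolding right_trans(4)[OF A(1) gR(1)] right_trans(4)[OF A(1) gR(2)] .
    qed
    have "emeasure (count_space UNIV) ?S = emeasure (count_space UNIV) (right_trans A ` ?S)"
      using i by (simp add: emeasure_count_space card_image finite_image_iff)
    also have "\<dots> \<le> emeasure (count_space UNIV) {g\<in>E. src G g = ?\<phi> x}"
      by (rule emeasure_mono) (use right_trans(3)[OF A(1)] in auto)
    finally show ?thesis using True by (simp add: fibre_count_def)
  next
    case False
    then have e: "{g\<in>{g\<in>right_dom A. right_trans A g \<in> E}. src G g = x} = {}" by (auto simp: right_dom_def)
    show ?thesis unfolding fibre_count_def e by simp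
  qed
  then have "emeasure M {g\<in>right_dom A. right_trans A g \<in> E} \<le> (\<integral>\<^sup>+x. fibre_count E (?\<phi> x) * indicator (tgt G ` A) x \<partial>\<mu>)"
    unfolding emeasure_M[OF P] by (intro nn_integral_mono)
  also have "\<dots> \<le> ennreal K * (\<integral>\<^sup>+x. fibre_count E x \<partial>\<mu>)"
    using K unfolding tame_def by (intro pull_nn_integral fibre_count_measurable E) auto
  finally show "emeasure M {g\<in>right_dom A. right_trans A g \<in> E} \<le> ennreal K * emeasure M E"
    unfolding emeasure_M[OF E] .
qed

section \<open>Left and right translation operators\<close>

definition lam :: "'a set \<Rightarrow> 'a l2_operator" where "lam A = lift_op M (pull (left_dom A) (left_trans A))"
definition rho :: "'a set \<Rightarrow> 'a l2_operator" where "rho A = lift_op M (pull (right_dom A) (right_trans A))"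

lemma lam_linear: "A \<in> sets (Borel G) \<Longrightarrow> bisection G A \<Longrightarrow> l2_linear M (pull (left_dom A) (left_trans A))"
  by (rule pull_linear[OF bounded_left_trans]) auto

lemma rho_linear: "A \<in> sets (Borel G) \<Longrightarrow> bisection G A \<Longrightarrow> tame K A \<Longrightarrow> l2_linear M (pull (right_dom A) (right_trans A))"
  by (rule pull_linear[OF bounded_right_trans]) (auto simp: tame_def)

lemma l2_linear_l2: "l2_linear N \<Phi> \<Longrightarrow> f \<in> l2_fun N \<Longrightarrow> \<Phi> f \<in> l2_fun N"
  unfolding l2_linear_def by blast

lemma lam_bounded: "A \<in> sets (Borel G) \<Longrightarrow> bisection G A \<Longrightarrow> lam A \<in> l2_bounded_ops M"
  unfolding lam_def by (rule lift_op(1)[OF lam_linear])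

lemma lam_class: "A \<in> sets (Borel G) \<Longrightarrow> bisection G A \<Longrightarrow> f \<in> l2_fun M \<Longrightarrow>
    lam A (l2_class M f) = l2_class M (pull (left_dom A) (left_trans A) f)"
  unfolding lam_def by (rule lift_op(2)[OF lam_linear])

lemma rho_class: "A \<in> sets (Borel G) \<Longrightarrow> bisection G A \<Longrightarrow> tame K A \<Longrightarrow> f \<in> l2_fun M \<Longrightarrow>
    rho A (l2_class M f) = l2_class M (pull (right_dom A) (right_trans A) f)"
  unfolding rho_def by (rule lift_op(2)[OF rho_linear])

lemma set_mult_iff:
  assumes A: "A \<in> sets (Borel G)" "bisection G A" and E: "E \<subseteq> arrows G"
  shows "g \<in> set_mult G A E \<longleftrightarrow> g \<in> left_dom A \<and> left_trans A g \<in> E"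
proof
  assume "g \<in> set_mult G A E"
  then obtain a h where a: "a \<in> A" "h \<in> E" "src G a = tgt G h" "g = mult G a h" unfolding set_mult_def by blast
  have ar: "a \<in> arrows G" "h \<in> arrows G" using a E arrow_mem[OF A(1)] by auto
  have t: "tgt G g = tgt G a" "g \<in> arrows G" using a ar by simp_all
  have "tgt_section A (tgt G g) = a" unfolding t(1) by (rule tgt_section_tgt[OF A(2) a(1)])
  then have "left_trans A g = h" unfolding left_trans_def using a ar by simp
  then show "g \<in> left_dom A \<and> left_trans A g \<in> E" using a t by (simp add: left_dom_def)
next
  assume g: "g \<in> left_dom A \<and> left_trans A g \<in> E"
  have "tgt_section A (tgt G g) \<in> A" using g tgt_section(1) by (auto simp: left_dom_def)
  then show "g \<in> set_mult G A E" unfolding set_mult_def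
    using left_trans(3,4)[OF A(1), of g] g by (intro CollectI exI[of _ "tgt_section A (tgt G g)"] exI[of _ "left_trans A g"]) simp
qed

lemma cover_M: "\<And>n. cover n \<in> sets M" "disjoint_family cover" "(\<Union>n. cover n) = space M" "\<And>n. emeasure M (cover n) < \<infinity>"
  using cover emeasure_bisection_finite by simp_all

text \<open>Existence: translating an indicator gives the indicator of the product set. Uniqueness:
  indicators of subsets of the members of \<open>cover\<close>, which have finite measure, determine
  a bounded operator.\<close>

lemma bisection_op_eq:
  assumes A: "A \<in> sets (Borel G)" "bisection G A"
  shows "bisection_op G \<mu> A = lam A"
  unfolding bisection_op_def
proof (rule the_equality)
  have ind: "lam A (l2_class M (indicator E)) = l2_class M (indicator (set_mult G A E))"
    if E: "E \<in> sets (Borel G)" "emeasure M E < \<infinity>" for E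
  proof -
    have "(indicator E :: 'a \<Rightarrow> complex) \<in> l2_fun M" using E by (intro l2_fun_indicator) auto
    then have "lam A (l2_class M (indicator E)) = l2_class M (pull (left_dom A) (left_trans A) (indicator E))"
      by (rule lam_class[OF A])
    also have "pull (left_dom A) (left_trans A) (indicator E) = (indicator (set_mult G A E) :: 'a \<Rightarrow> complex)"
      using set_mult_iff[OF A sets.sets_into_space[OF E(1)]] by (auto simp: pull_def indicator_def fun_eq_iff)
    finally show ?thesis .
  qed
  then show "lam A \<in> l2_bounded_ops M \<and> (\<forall>E\<in>sets (Borel G). emeasure M E < \<infinity> \<longrightarrow>
      lam A (l2_class M (indicator E)) = l2_class M (indicator (set_mult G A E)))"
    using lam_bounded[OF A] by simp
  fix T assume T: "T \<in> l2_bounded_ops M \<and> (\<forall>E\<in>sets (Borel G). emeasure M E < \<infinity> \<longrightarrow>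
      T (l2_class M (indicator E)) = l2_class M (indicator (set_mult G A E)))"
  show "T = lam A"
  proof (rule bounded_op_eqI_indicator[OF _ lam_bounded[OF A] cover_M])
    fix E n assume E: "E \<in> sets M" "E \<subseteq> cover n"
    then have "emeasure M E < \<infinity>" using emeasure_mono[OF E(2), of M] cover_M(1,4) by (meson le_less_trans)
    then show "T (l2_class M (indicator E)) = lam A (l2_class M (indicator E))" using T E ind by simp
  qed (use T in auto)
qed

definition gens :: "'a l2_operator set" where
  "gens = {lam A | A. A \<in> sets (Borel G) \<and> bisection G A}"

lemma groupoid_vN_eq: "groupoid_vN G \<mu> = commutant M (commutant M gens)"
proof -
  have "{bisection_op G \<mu> A | A. A \<in> sets (Borel G) \<and> bisection G A} = gens"
    unfolding gens_def using bisection_op_eq by (intro Collect_cong) (metis)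
  then show ?thesis unfolding groupoid_vN_def by simp
qed

lemma gens_bounded: "gens \<subseteq> l2_bounded_ops M"
  unfolding gens_def using lam_bounded by auto

section \<open>Adjoints of the generators\<close>

lemma ginv_bisection:
  assumes A: "A \<in> sets (Borel G)" "bisection G A"
  shows "ginv G ` A \<in> sets (Borel G)" "bisection G (ginv G ` A)"
proof -
  have Aa: "a \<in> arrows G" if "a \<in> A" for a using that A(1) arrow_mem by blast
  have "ginv G ` A = ginv G -` A \<inter> space (Borel G)"
  proof safe
    fix a assume "a \<in> A"
    then show "ginv G a \<in> ginv G -` A" "ginv G a \<in> arrows G" using Aa by simp_all
  next
    fix g assume "g \<in> arrows G" "ginv G g \<in> A"
    then show "g \<in> ginv G ` A" by (metis ginv_ginv imageI)
  qed
  then show "ginv G ` A \<in> sets (Borel G)" using measurable_sets[OF ginv_measurable A(1)] by simp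
  show "bisection G (ginv G ` A)" using A(2) Aa unfolding bisection_def inj_on_def by auto
qed

lemma left_trans_ginv:
  assumes A: "A \<in> sets (Borel G)" "bisection G A" and g: "g \<in> left_dom A"
  shows "left_trans A g \<in> left_dom (ginv G ` A)" "left_trans (ginv G ` A) (left_trans A g) = g"
proof -
  define a where "a = tgt_section A (tgt G g)"
  have a: "a \<in> A" "tgt G a = tgt G g" using g tgt_section[of "tgt G g" A] by (auto simp: a_def left_dom_def)
  have ar: "a \<in> arrows G" "g \<in> arrows G" using a(1) A(1) arrow_mem g by (auto simp: left_dom_def)
  have L: "left_trans A g = mult G (ginv G a) g" by (simp add: left_trans_def a_def)
  have t: "tgt G (left_trans A g) = tgt G (ginv G a)" unfolding L using ar a by simp
  have "left_trans A g \<in> arrows G" unfolding L using ar a by simp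
  then show "left_trans A g \<in> left_dom (ginv G ` A)" using t a(1) by (auto simp: left_dom_def)
  have "tgt_section (ginv G ` A) (tgt G (left_trans A g)) = ginv G a"
    unfolding t by (rule tgt_section_tgt[OF ginv_bisection(2)[OF A]]) (use a in simp)
  then show "left_trans (ginv G ` A) (left_trans A g) = g"
    unfolding left_trans_def[of "ginv G ` A"] L using ar a by simp
qed

lemma ginv_image_twice: "A \<subseteq> arrows G \<Longrightarrow> ginv G ` ginv G ` A = A"
  unfolding image_image by (force simp: subset_iff)

lemma distr_left_trans:
  assumes A: "A \<in> sets (Borel G)" "bisection G A"
  shows "distr (restrict_space M (left_dom A)) (restrict_space M (left_dom (ginv G ` A))) (left_trans A) = restrict_space M (left_dom (ginv G ` A))"
proof -
  let ?A' = "ginv G ` A"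
  note A' = ginv_bisection[OF A]
  have A'': "ginv G ` ?A' = A" using ginv_image_twice A(2) by (simp add: bisection_def)
  have D: "left_dom A \<inter> space M \<in> sets M" "left_dom ?A' \<inter> space M \<in> sets M" using left_dom_sets A(1) A'(1) by auto
  have sp: "space (restrict_space M (left_dom A)) = left_dom A" "space (restrict_space M (left_dom ?A')) = left_dom ?A'"
    by (auto simp: space_restrict_space left_dom_def)
  have m: "left_trans A \<in> restrict_space M (left_dom A) \<rightarrow>\<^sub>M restrict_space M (left_dom ?A')"
  proof (rule measurable_restrict_space2)
    show "left_trans A \<in> space (restrict_space M (left_dom A)) \<rightarrow> left_dom ?A'" unfolding sp using left_trans_ginv(1)[OF A] by auto
    show "left_trans A \<in> restrict_space M (left_dom A) \<rightarrow>\<^sub>M M" using bounded_left_trans[OF A] by (simp add: bounded_map_def)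
  qed
  show ?thesis
  proof (rule measure_eqI)
    fix E assume "E \<in> sets (distr (restrict_space M (left_dom A)) (restrict_space M (left_dom ?A')) (left_trans A))"
    then have E: "E \<in> sets (restrict_space M (left_dom ?A'))" by simp
    then have E': "E \<in> sets (Borel G)" "E \<subseteq> left_dom ?A'" using D by (auto simp: sets_restrict_space_iff)
    let ?F = "{g\<in>left_dom A. left_trans A g \<in> E}"
    have F: "?F \<in> sets (Borel G)" by (rule restrict_pre_sets[OF left_trans_measurable[OF A] left_dom_sets[OF A(1)] E'(1)])
    have le1: "emeasure M ?F \<le> emeasure M E" using bounded_left_trans[OF A] E' by (simp add: bounded_map_def)
    have "E = {h\<in>left_dom ?A'. left_trans ?A' h \<in> ?F}"
      using E'(2) left_trans_ginv[OF A'] A'' by auto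
    moreover have "emeasure M {h\<in>left_dom ?A'. left_trans ?A' h \<in> ?F} \<le> ennreal 1 * emeasure M ?F"
      by (rule bounded_mapD[OF bounded_left_trans[OF A']]) (simp add: F)
    ultimately have "emeasure M ?F = emeasure M E" using le1 by (simp add: antisym)
    moreover have "left_trans A -` E \<inter> space (restrict_space M (left_dom A)) = ?F" unfolding sp by auto
    moreover have "emeasure (restrict_space M (left_dom A)) ?F = emeasure M ?F"
      by (rule emeasure_restrict_space[OF D(1)]) auto
    moreover have "emeasure (restrict_space M (left_dom ?A')) E = emeasure M E"
      by (rule emeasure_restrict_space[OF D(2) E'(2)])
    ultimately show "emeasure (distr (restrict_space M (left_dom A)) (restrict_space M (left_dom ?A')) (left_trans A)) E = emeasure (restrict_space M (left_dom ?A')) E"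
      using emeasure_distr[OF m E] by simp
  qed simp
qed

text \<open>Change of variables along the measure-preserving translation moves it from the first to
  the second argument, where it appears as its inverse.\<close>

lemma lam_adjoint:
  assumes A: "A \<in> sets (Borel G)" "bisection G A"
  shows "is_l2_adjoint M (lam A) (lam (ginv G ` A))"
  unfolding is_l2_adjoint_def
proof (intro ballI)
  let ?A' = "ginv G ` A"
  note A' = ginv_bisection[OF A]
  have D: "left_dom A \<inter> space M \<in> sets M" "left_dom ?A' \<inter> space M \<in> sets M" using left_dom_sets A(1) A'(1) by auto
  have sp: "space (restrict_space M (left_dom A)) = left_dom A" by (auto simp: space_restrict_space left_dom_def)
  fix X Y assume "X \<in> L2 M" "Y \<in> L2 M"
  then obtain f h where f: "f \<in> l2_fun M" "X = l2_class M f" and h: "h \<in> l2_fun M" "Y = l2_class M h"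
    by (auto simp: L2_def)
  note pf = l2_linear_l2[OF lam_linear[OF A] f(1)] and ph = l2_linear_l2[OF lam_linear[OF A'] h(1)]
  let ?H = "\<lambda>y. f y * cnj (h (left_trans ?A' y))"
  have m: "left_trans A \<in> restrict_space M (left_dom A) \<rightarrow>\<^sub>M restrict_space M (left_dom ?A')"
  proof (rule measurable_restrict_space2)
    show "left_trans A \<in> space (restrict_space M (left_dom A)) \<rightarrow> left_dom ?A'" unfolding sp using left_trans_ginv(1)[OF A] by auto
    show "left_trans A \<in> restrict_space M (left_dom A) \<rightarrow>\<^sub>M M" using bounded_left_trans[OF A] by (simp add: bounded_map_def)
  qed
  have Lm': "left_trans ?A' \<in> restrict_space M (left_dom ?A') \<rightarrow>\<^sub>M M" using bounded_left_trans[OF A'] by (simp add: bounded_map_def)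
  have Hm: "?H \<in> borel_measurable (restrict_space M (left_dom ?A'))"
    using measurable_compose[OF Lm' l2_fun_measurable[OF h(1)]] measurable_restrict_space1[OF l2_fun_measurable[OF f(1)], of "left_dom ?A'"]
    by measurable
  have "l2_inner M (lam A X) Y = (\<integral>x. pull (left_dom A) (left_trans A) f x * cnj (h x) \<partial>M)"
    unfolding f(2) h(2) lam_class[OF A f(1)] l2_inner_class[OF pf h(1)] l2_ip_def ..
  also have "\<dots> = (\<integral>x. indicator (left_dom A) x *\<^sub>R (f (left_trans A x) * cnj (h x)) \<partial>M)"
    by (rule Bochner_Integration.integral_cong) (auto simp: pull_def indicator_def)
  also have "\<dots> = (\<integral>x. f (left_trans A x) * cnj (h x) \<partial>restrict_space M (left_dom A))"
    by (rule integral_restrict_space[OF D(1), symmetric])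
  also have "\<dots> = (\<integral>x. ?H (left_trans A x) \<partial>restrict_space M (left_dom A))"
    by (rule Bochner_Integration.integral_cong) (simp_all add: sp left_trans_ginv(2)[OF A])
  also have "\<dots> = (\<integral>y. ?H y \<partial>distr (restrict_space M (left_dom A)) (restrict_space M (left_dom ?A')) (left_trans A))"
    by (rule integral_distr[OF m Hm, symmetric])
  also have "\<dots> = (\<integral>y. ?H y \<partial>restrict_space M (left_dom ?A'))" unfolding distr_left_trans[OF A] ..
  also have "\<dots> = (\<integral>y. indicator (left_dom ?A') y *\<^sub>R ?H y \<partial>M)" by (rule integral_restrict_space[OF D(2)])
  also have "\<dots> = (\<integral>y. f y * cnj (pull (left_dom ?A') (left_trans ?A') h y) \<partial>M)"
    by (rule Bochner_Integration.integral_cong) (auto simp: pull_def indicator_def)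
  also have "\<dots> = l2_inner M X (lam ?A' Y)"
    unfolding f(2) h(2) lam_class[OF A' h(1)] l2_inner_class[OF f(1) ph] l2_ip_def ..
  finally show "l2_inner M (lam A X) Y = l2_inner M X (lam ?A' Y)" .
qed

lemma groupoid_vN_von_neumann: "von_neumann_algebra M (groupoid_vN G \<mu>)"
  unfolding groupoid_vN_eq
proof (rule bicommutant_von_neumann[OF gens_bounded])
  show "\<forall>T\<in>gens. \<exists>S\<in>gens. is_l2_adjoint M T S"
  proof
    fix T assume "T \<in> gens"
    then obtain A where A: "A \<in> sets (Borel G)" "bisection G A" "T = lam A" by (auto simp: gens_def)
    have "lam (ginv G ` A) \<in> gens" unfolding gens_def using ginv_bisection[OF A(1,2)] by blast
    then show "\<exists>S\<in>gens. is_l2_adjoint M T S" using lam_adjoint[OF A(1,2)] A(3) by blast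
  qed
qed

end

section \<open>Factors are ergodic and icc\<close>

lemma l2_linear_scale: "l2_linear N (\<lambda>f x. c * f x)"
proof -
  have "sq_norm N (\<lambda>x. c * f x) \<le> (cmod c)\<^sup>2 * sq_norm N f" for f by (simp add: sq_norm_scale)
  moreover have "AE x in N. c * f x = c * g x" if "AE x in N. f x = g x" for f g :: "'a \<Rightarrow> complex"
    using that by eventually_elim simp
  ultimately show ?thesis unfolding l2_linear_def
    by (intro conjI ballI impI allI exI[of _ "(cmod c)\<^sup>2"] l2_fun_scale) (simp_all add: distrib_left)
qed

lemma l2_linear_zero: "l2_linear N (\<lambda>f x. 0)"
  using l2_linear_scale[of N 0] by simp

lemma l2_linear_add:
  assumes "l2_linear N \<Phi>" "l2_linear N \<Psi>"
  shows "l2_linear N (\<lambda>f x. \<Phi> f x + \<Psi> f x)"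
proof -
  obtain K where K: "\<forall>f\<in>l2_fun N. sq_norm N (\<Phi> f) \<le> K * sq_norm N f" using assms(1) unfolding l2_linear_def by auto
  obtain L where L: "\<forall>f\<in>l2_fun N. sq_norm N (\<Psi> f) \<le> L * sq_norm N f" using assms(2) unfolding l2_linear_def by auto
  have l: "\<Phi> f \<in> l2_fun N" "\<Psi> f \<in> l2_fun N" if "f \<in> l2_fun N" for f
    using assms that unfolding l2_linear_def by simp_all
  show ?thesis unfolding l2_linear_def
  proof (intro conjI ballI impI allI exI[of _ "2 * K + 2 * L"])
    fix f assume f: "f \<in> l2_fun N"
    show "(\<lambda>x. \<Phi> f x + \<Psi> f x) \<in> l2_fun N" using l[OF f] by (rule l2_fun_add)
    have "sq_norm N (\<lambda>x. \<Phi> f x + \<Psi> f x) \<le> 2 * sq_norm N (\<Phi> f) + 2 * sq_norm N (\<Psi> f)" by (rule sq_norm_add_le[OF l[OF f]])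
    also have "\<dots> \<le> 2 * (K * sq_norm N f) + 2 * (L * sq_norm N f)" using K L f by (intro add_mono mult_left_mono) auto
    finally show "sq_norm N (\<lambda>x. \<Phi> f x + \<Psi> f x) \<le> (2 * K + 2 * L) * sq_norm N f" by (simp add: algebra_simps)
    fix g assume g: "g \<in> l2_fun N"
    have 1: "AE x in N. \<Phi> (\<lambda>x. f x + g x) x = \<Phi> f x + \<Phi> g x" "AE x in N. \<Psi> (\<lambda>x. f x + g x) x = \<Psi> f x + \<Psi> g x"
      using assms f g unfolding l2_linear_def by simp_all
    show "AE x in N. \<Phi> (\<lambda>x. f x + g x) x + \<Psi> (\<lambda>x. f x + g x) x = \<Phi> f x + \<Psi> f x + (\<Phi> g x + \<Psi> g x)"
      using 1 by eventually_elim simp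
    assume "AE x in N. f x = g x"
    then have "AE x in N. \<Phi> f x = \<Phi> g x" "AE x in N. \<Psi> f x = \<Psi> g x"
      using assms f g unfolding l2_linear_def by simp_all
    then show "AE x in N. \<Phi> f x + \<Psi> f x = \<Phi> g x + \<Psi> g x" by eventually_elim simp
  next
    fix c f assume f: "f \<in> l2_fun N"
    have "AE x in N. \<Phi> (\<lambda>x. c * f x) x = c * \<Phi> f x" "AE x in N. \<Psi> (\<lambda>x. c * f x) x = c * \<Psi> f x"
      using assms f unfolding l2_linear_def by simp_all
    then show "AE x in N. \<Phi> (\<lambda>x. c * f x) x + \<Psi> (\<lambda>x. c * f x) x = c * (\<Phi> f x + \<Psi> f x)"
      by eventually_elim (simp add: distrib_left)
  qed
qed

lemma lift_op_add_commutant: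
  assumes lin: "l2_linear N \<Phi>" "l2_linear N \<Psi>" and S: "S \<subseteq> l2_bounded_ops N"
    and c: "lift_op N \<Phi> \<in> commutant N S" "lift_op N \<Psi> \<in> commutant N S"
  shows "lift_op N (\<lambda>f x. \<Phi> f x + \<Psi> f x) \<in> commutant N S"
proof -
  let ?T = "lift_op N (\<lambda>f x. \<Phi> f x + \<Psi> f x)"
  have T: "?T X = l2_add N (lift_op N \<Phi> X) (lift_op N \<Psi> X)" if X: "X \<in> L2 N" for X
  proof -
    note f = L2_rep(1)[OF X]
    have "?T (l2_class N (l2_rep X)) = l2_add N (lift_op N \<Phi> (l2_class N (l2_rep X))) (lift_op N \<Psi> (l2_class N (l2_rep X)))"
      unfolding lift_op(2)[OF lin(1) f] lift_op(2)[OF lin(2) f] lift_op(2)[OF l2_linear_add[OF lin] f]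
      by (rule l2_add_class[symmetric]) (use lin f in \<open>simp_all add: l2_linear_def\<close>)
    then show ?thesis by (simp only: L2_rep(2)[OF X])
  qed
  show ?thesis unfolding commutant_iff
  proof (intro conjI ballI)
    show "?T \<in> l2_bounded_ops N" by (rule lift_op(1)[OF l2_linear_add[OF lin]])
    fix R X assume R: "R \<in> S" and X: "X \<in> L2 N"
    have Rb: "R \<in> l2_bounded_ops N" using R S by blast
    have tX: "lift_op N \<Phi> X \<in> L2 N" "lift_op N \<Psi> X \<in> L2 N"
      using lift_op(1)[OF lin(1)] lift_op(1)[OF lin(2)] X by (auto intro: bounded_op_L2)
    have "R (?T X) = l2_add N (R (lift_op N \<Phi> X)) (R (lift_op N \<Psi> X))"
      unfolding T[OF X] using Rb tX by (simp add: l2_bounded_ops_def)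
    also have "\<dots> = ?T (R X)"
      unfolding T[OF bounded_op_L2[OF Rb X]] using c R X by (simp add: commutant_iff)
    finally show "?T (R X) = R (?T X)" by simp
  qed
qed

lemma scalar_commutant:
  assumes "S \<subseteq> l2_bounded_ops N"
  shows "restrict (l2_scale N c) (L2 N) \<in> commutant N S"
proof -
  have e: "restrict (l2_scale N c) (L2 N) = lift_op N (\<lambda>f x. c * f x)"
    unfolding lift_op_def l2_scale_def ..
  have b: "restrict (l2_scale N c) (L2 N) \<in> l2_bounded_ops N"
    unfolding e by (rule lift_op(1)[OF l2_linear_scale])
  show ?thesis unfolding commutant_iff
  proof (intro conjI b ballI)
    fix R X assume R: "R \<in> S" and X: "X \<in> L2 N"
    have Rb: "R \<in> l2_bounded_ops N" using R assms by blast
    then show "restrict (l2_scale N c) (L2 N) (R X) = R (restrict (l2_scale N c) (L2 N) X)"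
      using X bounded_op_L2[OF Rb X] by (simp add: l2_bounded_ops_def)
  qed
qed

context discrete_measured_groupoid begin

text \<open>The commutant of \<open>L(G)\<close> equals that of the generators by the triple
  commutant identity, and scalars lie in every commutant. The content of factoriality is therefore
  the inclusion of the center in the scalars.\<close>

lemma factor_iff:
  "factor M (groupoid_vN G \<mu>) \<longleftrightarrow>
     (\<forall>T. T \<in> groupoid_vN G \<mu> \<and> T \<in> commutant M gens \<longrightarrow> (\<exists>c. T = restrict (l2_scale M c) (L2 M)))"
proof -
  have e: "commutant M (groupoid_vN G \<mu>) = commutant M gens"
    unfolding groupoid_vN_eq by (rule commutant_tricommutant[OF gens_bounded])
  have "restrict (l2_scale M c) (L2 M) \<in> groupoid_vN G \<mu> \<inter> commutant M gens" for c
    unfolding groupoid_vN_eq using scalar_commutant[OF commutant_subset] scalar_commutant[OF gens_bounded] by simp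
  then show ?thesis unfolding factor_def e using groupoid_vN_von_neumann by blast
qed

lemma lift_op_commutes_gens:
  assumes lin: "l2_linear M \<Phi>"
    and comm: "\<And>A f g. A \<in> sets (Borel G) \<Longrightarrow> bisection G A \<Longrightarrow> g \<in> arrows G \<Longrightarrow>
       \<Phi> (pull (left_dom A) (left_trans A) f) g = pull (left_dom A) (left_trans A) (\<Phi> f) g"
  shows "lift_op M \<Phi> \<in> commutant M gens"
  unfolding commutant_iff
proof (intro conjI ballI)
  show "lift_op M \<Phi> \<in> l2_bounded_ops M" by (rule lift_op(1)[OF lin])
  fix S X assume "S \<in> gens" and X: "X \<in> L2 M"
  then obtain A where A: "A \<in> sets (Borel G)" "bisection G A" "S = lam A" by (auto simp: gens_def)
  obtain f where f: "f \<in> l2_fun M" "X = l2_class M f" using X by (auto simp: L2_def)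
  have "l2_class M (\<Phi> (pull (left_dom A) (left_trans A) f)) = l2_class M (pull (left_dom A) (left_trans A) (\<Phi> f))"
    by (rule l2_class_eq, rule AE_I2) (use comm[OF A(1,2)] in simp)
  then show "lift_op M \<Phi> (S X) = S (lift_op M \<Phi> X)"
    unfolding f(2) A(3) lam_class[OF A(1,2) f(1)] lift_op(2)[OF lin f(1)]
      lift_op(2)[OF lin l2_linear_l2[OF lam_linear[OF A(1,2)] f(1)]] lam_class[OF A(1,2) l2_linear_l2[OF lin f(1)]] .
qed

text \<open>Left and right translations commute by associativity. Their domains depend on the target
  and on the source respectively, and each translation preserves the one that matters for the other.
  These are the elements of the commutant against which the bicommutant is tested.\<close>

lemma rho_commutant:
  assumes A: "A \<in> sets (Borel G)" "bisection G A" "tame K A"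
  shows "rho A \<in> commutant M gens"
  unfolding rho_def
proof (rule lift_op_commutes_gens[OF rho_linear[OF A]])
  fix B f g assume B: "B \<in> sets (Borel G)" "bisection G B" and g: "g \<in> arrows G"
  show "pull (right_dom A) (right_trans A) (pull (left_dom B) (left_trans B) f) g = pull (left_dom B) (left_trans B) (pull (right_dom A) (right_trans A) f) g"
  proof (cases "g \<in> left_dom B \<and> g \<in> right_dom A")
    case True
    then have gL: "g \<in> left_dom B" and gR: "g \<in> right_dom A" by auto
    have 1: "right_trans A g \<in> left_dom B" using gL right_trans(1,2)[OF A(1) gR] by (simp add: left_dom_def)
    have 2: "left_trans B g \<in> right_dom A" using gR left_trans(1,2)[OF B(1) gL] by (simp add: right_dom_def)
    have a: "tgt_section A (src G g) \<in> arrows G" "tgt G (tgt_section A (src G g)) = src G g"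
      using gR tgt_section_arrow[OF A(1)] tgt_section(2) by (auto simp: right_dom_def)
    have b: "tgt_section B (tgt G g) \<in> arrows G" "tgt G (tgt_section B (tgt G g)) = tgt G g"
      using gL tgt_section_arrow[OF B(1)] tgt_section(2) by (auto simp: left_dom_def)
    have "left_trans B (right_trans A g) = right_trans A (left_trans B g)"
      unfolding left_trans_def[of B "right_trans A g"] right_trans_def[of A "left_trans B g"] right_trans(2)[OF A(1) gR] left_trans(2)[OF B(1) gL]
      unfolding left_trans_def right_trans_def using a b g by (simp add: assoc)
    then show ?thesis using gL gR 1 2 by (simp add: pull_def)
  next
    case False
    then show ?thesis
      using right_trans(1,2)[OF A(1), of g] left_trans(1,2)[OF B(1), of g] by (auto simp: pull_def left_dom_def right_dom_def)
  qed
qed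

abbreviation unit_fun :: "'a \<Rightarrow> complex" where "unit_fun \<equiv> indicator (units G)"

lemma unit_fun_l2: "unit_fun \<in> l2_fun M"
  using l2_fun_indicator[of "units G" M] units_sets emeasure_bisection_finite[OF units_sets bisection_units] by simp

text \<open>Translation by units is trivial, so for a set \<open>E\<close> of units
  \<open>lam E\<close> is the projection onto functions supported on arrows with target in
  \<open>E\<close>.\<close>

lemma pull_units:
  assumes "E \<in> sets (Borel G)" "E \<subseteq> units G"
  shows "pull (left_dom E) (left_trans E) f g = (if g \<in> arrows G \<and> tgt G g \<in> E then f g else 0)"
proof -
  have LDE: "g \<in> left_dom E \<longleftrightarrow> g \<in> arrows G \<and> tgt G g \<in> E" unfolding left_dom_def tgt_image_units[OF assms(2)] by simp
  have "left_trans E g = g" if "g \<in> left_dom E"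
  proof -
    have t: "tgt G g \<in> E" "g \<in> arrows G" using that LDE by auto
    have "tgt_section E (tgt G g) = tgt G g" by (rule tgt_section_units[OF assms(2) t(1)])
    moreover have "tgt G g \<in> units G" using t by simp
    ultimately show ?thesis unfolding left_trans_def using t by simp
  qed
  then show ?thesis using LDE by (simp add: pull_def)
qed

lemma gens_subset_vN: "gens \<subseteq> groupoid_vN G \<mu>"
  unfolding groupoid_vN_eq by (rule subset_bicommutant[OF gens_bounded])

lemma AE_unitsD:
  assumes "AE g in M. g \<in> units G \<longrightarrow> P g"
  shows "AE x in \<mu>. P x"
proof -
  obtain N where N: "{g\<in>space M. \<not> (g \<in> units G \<longrightarrow> P g)} \<subseteq> N" "emeasure M N = 0" "N \<in> sets M"
    using assms by (rule AE_E)
  have NU: "N \<inter> units G \<in> sets (Borel G)" using N(3) units_sets by auto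
  have "emeasure M (N \<inter> units G) \<le> emeasure M N" by (rule emeasure_mono) (use N in auto)
  then have "emeasure \<mu> (N \<inter> units G) = 0" using emeasure_M_units[OF NU] N(2) by simp
  moreover have "N \<inter> units G \<in> sets \<mu>" using NU by (simp add: sets_mu_iff)
  moreover have "{x\<in>space \<mu>. \<not> P x} \<subseteq> N \<inter> units G" using N(1) units_subset by (auto simp: space_mu)
  ultimately show ?thesis by (intro AE_I[of _ _ "N \<inter> units G"])
qed

text \<open>\<open>lam E\<close> is multiplication by the indicator of the arrows ending in
  \<open>E\<close>. By invariance of \<open>E\<close>, passing from \<open>g\<close> to
  \<open>a^-1 g\<close> does not change whether the target lies in \<open>E\<close>, so the
  projection is central. Evaluated on \<open>unit_fun\<close>, a scalar forces the indicator of
  \<open>E\<close> to be constant almost everywhere.\<close>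

lemma factor_imp_ergodic:
  assumes F: "factor M (groupoid_vN G \<mu>)"
  shows "ergodic G \<mu>"
  unfolding ergodic_def
proof (intro ballI impI)
  fix E assume E: "E \<in> sets (Borel G)" "E \<subseteq> units G" and inv: "\<forall>(x, y)\<in>orbit_rel G. x \<in> E \<longleftrightarrow> y \<in> E"
  have inv': "tgt G g \<in> E \<longleftrightarrow> src G g \<in> E" if "g \<in> arrows G" for g
    using inv that unfolding orbit_rel_def by blast
  note bE = bisection_units[OF E(2)]
  have "lam E \<in> commutant M gens" unfolding lam_def
  proof (rule lift_op_commutes_gens[OF lam_linear[OF E(1) bE]])
    fix A f g assume A: "A \<in> sets (Borel G)" "bisection G A" and g: "g \<in> arrows G"
    have "tgt G (left_trans A g) \<in> E \<longleftrightarrow> tgt G g \<in> E" if gL: "g \<in> left_dom A"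
    proof -
      have "tgt_section A (tgt G g) \<in> arrows G" "tgt G (tgt_section A (tgt G g)) = tgt G g"
        using gL tgt_section_arrow[OF A(1)] tgt_section(2) by (auto simp: left_dom_def)
      then show ?thesis using inv'[of "tgt_section A (tgt G g)"] left_trans(3)[OF A(1) gL] by simp
    qed
    then show "pull (left_dom E) (left_trans E) (pull (left_dom A) (left_trans A) f) g = pull (left_dom A) (left_trans A) (pull (left_dom E) (left_trans E) f) g"
      unfolding pull_units[OF E] using g left_trans(1)[OF A(1), of g] by (auto simp: pull_def pull_units[OF E])
  qed
  moreover have "lam E \<in> groupoid_vN G \<mu>" using gens_subset_vN E(1) bE by (auto simp: gens_def)
  ultimately obtain c where c: "lam E = restrict (l2_scale M c) (L2 M)" using F unfolding factor_iff by blast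
  have "l2_class M (pull (left_dom E) (left_trans E) unit_fun) = l2_class M (\<lambda>x. c * unit_fun x)"
    using lam_class[OF E(1) bE unit_fun_l2] L2I[OF unit_fun_l2] l2_scale_class[OF unit_fun_l2, of c] unfolding c by simp
  then have "AE g in M. pull (left_dom E) (left_trans E) unit_fun g = c * unit_fun g"
    by (rule l2_class_eqD) (rule l2_linear_l2[OF lam_linear[OF E(1) bE] unit_fun_l2])
  then have "AE g in M. g \<in> units G \<longrightarrow> (if g \<in> E then 1 else 0) = c"
    by eventually_elim (auto simp: pull_units[OF E] unit_arrow split: if_splits)
  then have ae: "AE x in \<mu>. (if x \<in> E then 1 else 0) = c" by (rule AE_unitsD)
  have Es: "E \<in> sets \<mu>" "units G - E \<in> sets \<mu>" using E units_sets by (auto simp: sets_mu_iff)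
  show "emeasure \<mu> E = 0 \<or> emeasure \<mu> (units G - E) = 0"
  proof (cases "c = 1")
    case True
    have "AE x in \<mu>. x \<notin> units G - E" using ae by eventually_elim (use True in \<open>auto split: if_splits\<close>)
    then show ?thesis using AE_iff_null_sets[OF Es(2)] by (auto simp: null_sets_def)
  next
    case False
    have "AE x in \<mu>. x \<notin> E" using ae by eventually_elim (use False in \<open>auto split: if_splits\<close>)
    then show ?thesis using AE_iff_null_sets[OF Es(1)] by (auto simp: null_sets_def)
  qed
qed

text \<open>A bisection has at most one element with target \<open>x\<close>, namely the value of
  its section. Disjointness excludes double counting, so the right-hand side depends only on the
  union.\<close>

lemma finite_partition_sum:
  fixes u :: "'a \<Rightarrow> complex" and C :: "nat \<Rightarrow> 'a set"
  assumes C: "\<And>i. i < k \<Longrightarrow> bisection G (C i)" and dj: "\<And>i j. i < k \<Longrightarrow> j < k \<Longrightarrow> i \<noteq> j \<Longrightarrow> C i \<inter> C j = {}"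
  shows "(\<Sum>i<k. if x \<in> tgt G ` C i then u (tgt_section (C i) x) else 0) = (\<Sum>\<omega>\<in>{\<omega>\<in>(\<Union>i<k. C i). tgt G \<omega> = x}. u \<omega>)"
proof -
  have one: "(\<Sum>\<omega>\<in>{\<omega>\<in>C i. tgt G \<omega> = x}. u \<omega>) = (if x \<in> tgt G ` C i then u (tgt_section (C i) x) else 0)"
    and fin: "finite {\<omega>\<in>C i. tgt G \<omega> = x}" if i: "i < k" for i
  proof -
    have "{\<omega>\<in>C i. tgt G \<omega> = x} = (if x \<in> tgt G ` C i then {tgt_section (C i) x} else {})"
    proof (cases "x \<in> tgt G ` C i")
      case True
      have "{\<omega>\<in>C i. tgt G \<omega> = x} = {tgt_section (C i) x}"
      proof (rule equalityI; rule subsetI)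
        fix \<omega> assume "\<omega> \<in> {\<omega>\<in>C i. tgt G \<omega> = x}"
        then have "tgt_section (C i) x = \<omega>" by (intro tgt_section_eq[OF C[OF i]]) simp_all
        then show "\<omega> \<in> {tgt_section (C i) x}" by simp
      next
        fix \<omega> assume "\<omega> \<in> {tgt_section (C i) x}"
        then show "\<omega> \<in> {\<omega>\<in>C i. tgt G \<omega> = x}" using tgt_section[OF True] by simp
      qed
      then show ?thesis using True by simp
    next
      case False
      then have "{\<omega>\<in>C i. tgt G \<omega> = x} = {}" by blast
      then show ?thesis using False by (simp only: if_False)
    qed
    then show "(\<Sum>\<omega>\<in>{\<omega>\<in>C i. tgt G \<omega> = x}. u \<omega>) = (if x \<in> tgt G ` C i then u (tgt_section (C i) x) else 0)"
      "finite {\<omega>\<in>C i. tgt G \<omega> = x}" by simp_all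
  qed
  have "{\<omega>\<in>(\<Union>i<k. C i). tgt G \<omega> = x} = (\<Union>i\<in>{..<k}. {\<omega>\<in>C i. tgt G \<omega> = x})" by blast
  also have "(\<Sum>\<omega>\<in>\<dots>. u \<omega>) = (\<Sum>i<k. \<Sum>\<omega>\<in>{\<omega>\<in>C i. tgt G \<omega> = x}. u \<omega>)"
  proof (rule sum.UNION_disjoint)
    show "\<forall>i\<in>{..<k}. finite {\<omega>\<in>C i. tgt G \<omega> = x}" using fin by simp
    show "\<forall>i\<in>{..<k}. \<forall>j\<in>{..<k}. i \<noteq> j \<longrightarrow> {\<omega>\<in>C i. tgt G \<omega> = x} \<inter> {\<omega>\<in>C j. tgt G \<omega> = x} = {}"
    proof (intro ballI impI)
      fix i j assume "i \<in> {..<k}" "j \<in> {..<k}" "i \<noteq> j"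
      then have "C i \<inter> C j = {}" by (intro dj) auto
      then show "{\<omega>\<in>C i. tgt G \<omega> = x} \<inter> {\<omega>\<in>C j. tgt G \<omega> = x} = {}" by blast
    qed
  qed simp
  also have "\<dots> = (\<Sum>i<k. if x \<in> tgt G ` C i then u (tgt_section (C i) x) else 0)"
    by (rule sum.cong) (simp_all add: one)
  finally show ?thesis by simp
qed

text \<open>Numbering the elements of each fibre by the pieces of \<open>cover\<close> that they lie in splits an isotropy
  set with at most \<open>k\<close> elements per fibre into \<open>k\<close> bisections.\<close>

lemma isotropy_partition:
  assumes \<Omega>: "\<Omega> \<in> sets (Borel G)" "\<Omega> \<subseteq> Iso G" and bd: "\<And>x. fibre_count \<Omega> x \<le> of_nat k"
  shows "\<exists>C. (\<forall>i<k. C i \<in> sets (Borel G) \<and> bisection G (C i)) \<and> (\<forall>i<k. \<forall>j<k. i \<noteq> j \<longrightarrow> C i \<inter> C j = {}) \<and> (\<Union>i<k. C i) = \<Omega>"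
proof -
  define P where "P n = \<Omega> \<inter> cover n" for n
  have P: "P n \<in> sets (Borel G)" for n unfolding P_def using \<Omega>(1) cover(1) by auto
  have Pinj: "inj_on (src G) (P n)" for n using cover_inj(1)[of n] by (rule inj_on_subset) (auto simp: P_def)
  have Pdj: "P n \<inter> P m = {}" if "n \<noteq> m" for n m using cover(3) that unfolding P_def disjoint_family_on_def by blast
  have PU: "(\<Union>n. P n) = \<Omega>" using cover(4) \<Omega>(1) arrow_mem unfolding P_def by blast
  \<comment> \<open>The number of earlier pieces that meet the fibre over \<open>x\<close>. It
    increases strictly along the pieces that meet the fibre, so an element is determined by its
    source and this rank.\<close>
  define r where "r n x = card {m. m < n \<and> x \<in> src G ` P m}" for n x
  define C where "C i = (\<Union>n. {\<omega>\<in>P n. r n (src G \<omega>) = i})" for i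
  have rm: "{\<omega>\<in>P n. r n (src G \<omega>) = i} \<in> sets (Borel G)" for n i
  proof -
    have [measurable]: "src G ` P m \<in> sets (Borel G)" for m by (rule src_image[OF P])
    have "r n x = (\<Sum>m<n. if x \<in> src G ` P m then 1 else 0)" for x
      unfolding r_def by (simp add: sum.If_cases Int_def lessThan_def)
    then have "(\<lambda>\<omega>. r n (src G \<omega>)) \<in> Borel G \<rightarrow>\<^sub>M count_space UNIV"
      by (simp only:) (intro measurable_compose[OF src_measurable_Borel], measurable)
    then have "(\<lambda>\<omega>. r n (src G \<omega>)) -` {i} \<inter> arrows G \<in> sets (Borel G)" by (rule measurable_sets) simp
    then have "P n \<inter> ((\<lambda>\<omega>. r n (src G \<omega>)) -` {i} \<inter> arrows G) \<in> sets (Borel G)" using P by auto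
    moreover have "P n \<inter> ((\<lambda>\<omega>. r n (src G \<omega>)) -` {i} \<inter> arrows G) = {\<omega>\<in>P n. r n (src G \<omega>) = i}"
      using P arrow_mem by blast
    ultimately show ?thesis by simp
  qed
  have CS: "C i \<in> sets (Borel G)" for i unfolding C_def using rm by auto
  have COm: "C i \<subseteq> \<Omega>" for i unfolding C_def P_def by auto
  have less: "r n x < r m x" if "n < m" "x \<in> src G ` P n" for n m x
    unfolding r_def by (rule psubset_card_mono) (use that in auto)
  have Cb: "bisection G (C i)" for i
  proof -
    have inj: "inj_on (src G) (C i)"
    proof (rule inj_onI)
      fix v w assume "v \<in> C i" "w \<in> C i" and e: "src G v = src G w"
      then obtain n m where v: "v \<in> P n" "r n (src G v) = i" and w: "w \<in> P m" "r m (src G w) = i" unfolding C_def by blast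
      have "n = m"
      proof (rule ccontr)
        assume "n \<noteq> m"
        then consider "n < m" | "m < n" by linarith
        then show False
        proof cases
          case 1 then show False using less[OF 1 imageI[OF v(1)]] v(2) w(2) e by simp
        next
          case 2 then show False using less[OF 2 imageI[OF w(1)]] v(2) w(2) e by simp
        qed
      qed
      then show "v = w" using Pinj[of n] v w e unfolding inj_on_def by blast
    qed
    \<comment> \<open>On isotropy source and target coincide, so injectivity of the source gives
      that of the target.\<close>
    have "tgt G a = src G a" if "a \<in> C i" for a
      using subsetD[OF COm that] \<Omega>(2) by (auto simp: Iso_def)
    then have "inj_on (tgt G) (C i) \<longleftrightarrow> inj_on (src G) (C i)" by (rule inj_on_cong)
    then show ?thesis using inj CS[of i] sets.sets_into_space unfolding bisection_def by blast
  qed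
  have Cdj: "C i \<inter> C j = {}" if "i \<noteq> j" for i j
  proof (rule ccontr)
    assume "C i \<inter> C j \<noteq> {}"
    then obtain w n m where w: "w \<in> P n" "r n (src G w) = i" "w \<in> P m" "r m (src G w) = j" unfolding C_def by blast
    then have "n = m" using Pdj by blast
    then show False using w that by simp
  qed
  \<comment> \<open>Choosing one element from each piece up to \<open>n\<close> that meets the fibre
    gives distinct elements, at most \<open>k\<close> in number. The piece of
    \<open>\<omega>\<close> itself is among them but is not counted in the rank, which makes the
    inequality strict.\<close>
  have rk: "r n (src G \<omega>) < k" if w: "\<omega> \<in> P n" for n \<omega>
  proof -
    let ?x = "src G \<omega>"
    let ?I = "{m. m \<le> n \<and> ?x \<in> src G ` P m}"
    have fI: "finite ?I" by simp
    have "\<forall>m\<in>?I. \<exists>v. v \<in> P m \<and> src G v = ?x" by auto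
    from bchoice[OF this] obtain v where v: "\<forall>m\<in>?I. v m \<in> P m \<and> src G (v m) = ?x" ..
    have iv: "inj_on v ?I"
    proof (rule inj_onI, rule ccontr)
      fix m l assume "m \<in> ?I" "l \<in> ?I" "v m = v l" "m \<noteq> l"
      then have "v m \<in> P m \<inter> P l" using v by auto
      then show False using Pdj[OF \<open>m \<noteq> l\<close>] by blast
    qed
    have "of_nat (card ?I) = emeasure (count_space UNIV) (v ` ?I)"
      using fI iv by (simp add: emeasure_count_space card_image)
    also have "\<dots> \<le> fibre_count \<Omega> ?x" unfolding fibre_count_def
      by (rule emeasure_mono) (use v in \<open>auto simp: P_def\<close>)
    also have "\<dots> \<le> of_nat k" by (rule bd)
    finally have "card ?I \<le> k" by simp
    moreover have "{m. m < n \<and> ?x \<in> src G ` P m} \<subset> ?I" using w by auto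
    then have "r n ?x < card ?I" unfolding r_def by (rule psubset_card_mono[OF fI])
    ultimately show ?thesis by simp
  qed
  have "(\<Union>i<k. C i) = \<Omega>"
  proof
    show "\<Omega> \<subseteq> (\<Union>i<k. C i)"
    proof
      fix \<omega> assume "\<omega> \<in> \<Omega>"
      then obtain n where "\<omega> \<in> P n" using PU by blast
      then show "\<omega> \<in> (\<Union>i<k. C i)" using rk unfolding C_def by blast
    qed
  qed (use COm in blast)
  then show ?thesis using CS Cb Cdj by (intro exI[of _ C]) simp
qed

definition lam_sum :: "(nat \<Rightarrow> 'a set) \<Rightarrow> nat \<Rightarrow> ('a \<Rightarrow> complex) \<Rightarrow> 'a \<Rightarrow> complex" where
  "lam_sum C k f g = (\<Sum>i<k. pull (left_dom (C i)) (left_trans (C i)) f g)"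

lemma lam_sum_linear_vN:
  assumes "\<forall>i<k. C i \<in> sets (Borel G) \<and> bisection G (C i)"
  shows "l2_linear M (lam_sum C k) \<and> lift_op M (lam_sum C k) \<in> groupoid_vN G \<mu>"
  using assms
proof (induction k)
  case 0
  have e: "lam_sum C 0 = (\<lambda>f x. 0)" by (simp add: lam_sum_def fun_eq_iff)
  have "lift_op M (lam_sum C 0) = restrict (l2_scale M 0) (L2 M)"
    unfolding e lift_op_def l2_scale_def by simp
  then have "lift_op M (lam_sum C 0) \<in> groupoid_vN G \<mu>"
    unfolding groupoid_vN_eq by (simp only: scalar_commutant[OF commutant_subset])
  then show ?case using l2_linear_zero[of M] unfolding e by blast
next
  case (Suc k)
  have e: "lam_sum C (Suc k) = (\<lambda>f x. lam_sum C k f x + pull (left_dom (C k)) (left_trans (C k)) f x)"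
    by (simp add: lam_sum_def fun_eq_iff)
  have IH: "l2_linear M (lam_sum C k)" "lift_op M (lam_sum C k) \<in> groupoid_vN G \<mu>" using Suc by simp_all
  have Ck: "C k \<in> sets (Borel G)" "bisection G (C k)" using Suc.prems by simp_all
  note lk = lam_linear[OF Ck]
  have "lift_op M (pull (left_dom (C k)) (left_trans (C k))) \<in> groupoid_vN G \<mu>"
    using gens_subset_vN Ck unfolding gens_def lam_def by blast
  then have "lift_op M (lam_sum C (Suc k)) \<in> groupoid_vN G \<mu>"
    unfolding e groupoid_vN_eq using IH(2)
    by (intro lift_op_add_commutant[OF IH(1) lk commutant_subset]) (simp_all add: groupoid_vN_eq)
  then show ?case using l2_linear_add[OF IH(1) lk] by (simp add: e)
qed

text \<open>The operator sending \<open>f\<close> to the function that sums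
  \<open>f (\<omega>^-1 g)\<close> over all \<open>\<omega>\<close> in a conjugation invariant set
  \<open>W\<close> with the target of \<open>g\<close> is central. On \<open>unit_fun\<close> it
  takes the value 1 throughout \<open>W\<close>, whereas a scalar multiple of
  \<open>unit_fun\<close> vanishes at non-units. Hence \<open>W\<close> cannot contain non-null many
  non-units.\<close>

lemma factor_imp_icc:
  assumes F: "factor M (groupoid_vN G \<mu>)"
  shows "icc G \<mu>"
  unfolding icc_def
proof (intro ballI impI, rule ccontr)
  fix A assume A: "A \<in> sets (Borel G)" "bisection G A" "A \<subseteq> Iso G"
    and fin: "emeasure M (conj_class G A) < \<infinity>" and pos: "emeasure M (A - units G) \<noteq> 0"
  \<comment> \<open>Dropping the units can only shrink the conjugacy class, and it leaves a non-null
    set of arrows where \<open>unit_fun\<close> vanishes.\<close>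
  let ?A = "A - units G"
  have A': "?A \<in> sets (Borel G)" "?A \<subseteq> Iso G" using A units_sets by auto
  define \<Omega> where "\<Omega> = conj_class G ?A"
  have Om: "\<Omega> \<in> sets (Borel G)" "\<Omega> \<subseteq> Iso G" "?A \<subseteq> \<Omega>"
    unfolding \<Omega>_def using conj_class_sets[OF A'] conj_class_Iso[OF A'(2)] subset_conj_class[OF A'(2)] by auto
  have "\<Omega> \<subseteq> conj_class G A" unfolding \<Omega>_def conj_class_def by blast
  then have Omfin: "emeasure M \<Omega> < \<infinity>"
    using emeasure_mono[of \<Omega> "conj_class G A" M] conj_class_sets[OF A(1,3)] fin by (simp add: le_less_trans)
  have conj: "mult G (mult G b \<omega>) (ginv G b) \<in> \<Omega>" if "\<omega> \<in> \<Omega>" "b \<in> arrows G" "src G b = tgt G \<omega>" for \<omega> b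
    using conj_mem_conj_class[OF _ A'(2) that(2,3)] that(1) by (simp add: \<Omega>_def)
  have OmD: "\<omega> \<in> arrows G" "src G \<omega> = tgt G \<omega>" if "\<omega> \<in> \<Omega>" for \<omega> using that Om(2) by (auto simp: Iso_def)
  \<comment> \<open>Conjugation by \<open>b\<close> injects the isotropy elements of the class at
    the source of \<open>b\<close> into those at its target; applied to the inverse of
    \<open>b\<close> it gives equality.\<close>
  have fibre_count_le: "fibre_count \<Omega> (src G b) \<le> fibre_count \<Omega> (tgt G b)" if b: "b \<in> arrows G" for b
  proof -
    let ?S = "{g\<in>\<Omega>. src G g = src G b}" and ?h = "\<lambda>\<omega>. mult G (mult G b \<omega>) (ginv G b)"
    have inj: "inj_on ?h ?S"
    proof (rule inj_onI)
      fix v w assume v: "v \<in> ?S" and w: "w \<in> ?S" and e: "?h v = ?h w"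
      have r: "mult G (ginv G b) (mult G (?h u) b) = u" if "u \<in> ?S" for u
        using that b OmD[of u] by simp
      have "v = mult G (ginv G b) (mult G (?h v) b)" by (rule r[OF v, symmetric])
      also have "\<dots> = mult G (ginv G b) (mult G (?h w) b)" by (simp only: e)
      also have "\<dots> = w" by (rule r[OF w])
      finally show "v = w" .
    qed
    have "emeasure (count_space UNIV) ?S = emeasure (count_space UNIV) (?h ` ?S)"
      using inj by (simp add: emeasure_count_space card_image finite_image_iff)
    also have "\<dots> \<le> emeasure (count_space UNIV) {g\<in>\<Omega>. src G g = tgt G b}"
    proof (rule emeasure_mono)
      show "?h ` ?S \<subseteq> {g\<in>\<Omega>. src G g = tgt G b}"
      proof
        fix y assume "y \<in> ?h ` ?S"
        then obtain u where u: "u \<in> \<Omega>" "src G u = src G b" "y = ?h u" by blast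
        have t: "src G b = tgt G u" using u OmD[of u] by simp
        have "src G y = tgt G b" unfolding u(3) using b OmD[OF u(1)] t by simp
        then show "y \<in> {g\<in>\<Omega>. src G g = tgt G b}" using conj[OF u(1) b t] u(3) by simp
      qed
    qed simp
    finally show ?thesis by (simp add: fibre_count_def)
  qed
  have fibre_count_inv: "fibre_count \<Omega> (src G b) = fibre_count \<Omega> (tgt G b)" if "b \<in> arrows G" for b
    using fibre_count_le[OF that] fibre_count_le[of "ginv G b"] that by (simp add: antisym)
  define V where "V k = {x\<in>units G. fibre_count \<Omega> x \<le> of_nat k}" for k :: nat
  have V: "V k \<in> sets (Borel G)" for k
  proof -
    have "{x\<in>space \<mu>. fibre_count \<Omega> x \<le> of_nat k} \<in> sets \<mu>" using fibre_count_measurable[OF Om(1)] by measurable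
    then show ?thesis by (simp add: V_def space_mu sets_mu_iff)
  qed
  have As: "{a\<in>?A. src G a \<in> W} \<in> sets (Borel G)" if "W \<in> sets (Borel G)" for W
  proof -
    have "{a\<in>?A. src G a \<in> W} = ?A \<inter> (src G -` W \<inter> space (Borel G))" using A'(1) arrow_mem by auto
    then show ?thesis using A'(1) measurable_sets[OF src_measurable_Borel that] by auto
  qed
  \<comment> \<open>Finite measure of the class makes its fibre counts finite almost everywhere. The
    sets \<open>V k\<close> therefore exhaust almost all units, and one of them meets the sources of
    the non-null set.\<close>
  have "\<exists>k. emeasure M {a\<in>?A. src G a \<in> V k} \<noteq> 0"
  proof (rule ccontr)
    assume "\<not> (\<exists>k. emeasure M {a\<in>?A. src G a \<in> V k} \<noteq> 0)"
    then have "(\<Union>k. {a\<in>?A. src G a \<in> V k}) \<in> null_sets M"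
      using As[OF V] by (intro null_sets_UN') (auto simp: null_sets_def)
    moreover have "{a\<in>?A. src G a \<in> units G - (\<Union>k. V k)} \<in> null_sets M"
    proof -
      let ?W = "units G - (\<Union>k. V k)"
      have W: "?W \<in> sets (Borel G)" using V units_sets by auto
      have aeF: "AE x in \<mu>. fibre_count \<Omega> x \<noteq> \<infinity>"
        by (rule nn_integral_PInf_AE[OF fibre_count_measurable[OF Om(1)]]) (use Omfin emeasure_M[OF Om(1)] in auto)
      have inf: "fibre_count \<Omega> x = \<infinity>" if x: "x \<in> ?W" for x
      proof (rule ccontr)
        assume "fibre_count \<Omega> x \<noteq> \<infinity>"
        then obtain k :: nat where "fibre_count \<Omega> x < of_nat k" using ennreal_Ex_less_of_nat by (auto simp: less_top)
        moreover have "x \<in> units G" using x by blast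
        ultimately have "x \<in> V k" unfolding V_def using less_imp_le by blast
        then show False using x by blast
      qed
      have "AE x in \<mu>. x \<notin> ?W" using aeF by eventually_elim (use inf in blast)
      then have W0: "?W \<in> null_sets \<mu>" using W by (subst AE_iff_null_sets) (auto simp: sets_mu_iff)
      have "src G ` {a\<in>?A. src G a \<in> ?W} \<in> null_sets \<mu>"
        by (rule null_sets_subset[OF W0 src_image_mu[OF As[OF W]]]) auto
      moreover have "inj_on (src G) {a\<in>?A. src G a \<in> ?W}" using A(2) unfolding bisection_def by (auto intro: inj_on_subset)
      ultimately show ?thesis using emeasure_M_bisection[OF As[OF W]] As[OF W] by (auto simp: null_sets_def)
    qed
    ultimately have "(\<Union>k. {a\<in>?A. src G a \<in> V k}) \<union> {a\<in>?A. src G a \<in> units G - (\<Union>k. V k)} \<in> null_sets M" by auto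
    moreover have "(\<Union>k. {a\<in>?A. src G a \<in> V k}) \<union> {a\<in>?A. src G a \<in> units G - (\<Union>k. V k)} = ?A"
      using A'(1) arrow_mem src_in by blast
    ultimately show False using pos by (simp add: null_sets_def)
  qed
  then obtain k where k: "emeasure M {a\<in>?A. src G a \<in> V k} \<noteq> 0" ..
  \<comment> \<open>Constancy of the fibre count along arrows keeps this cut closed under
    conjugation, and its fibres have at most \<open>k\<close> elements.\<close>
  define W where "W = {\<omega>\<in>\<Omega>. src G \<omega> \<in> V k}"
  have WS: "W \<in> sets (Borel G)" "W \<subseteq> Iso G"
  proof -
    have "W = \<Omega> \<inter> (src G -` V k \<inter> space (Borel G))" using Om(1) arrow_mem by (auto simp: W_def)
    then show "W \<in> sets (Borel G)" using Om(1) measurable_sets[OF src_measurable_Borel V] by auto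
    show "W \<subseteq> Iso G" using Om(2) by (auto simp: W_def)
  qed
  have WD: "\<omega> \<in> arrows G" "src G \<omega> = tgt G \<omega>" if "\<omega> \<in> W" for \<omega> using that OmD by (auto simp: W_def)
  have Wconj: "mult G (mult G b \<omega>) (ginv G b) \<in> W" if "\<omega> \<in> W" "b \<in> arrows G" "src G b = tgt G \<omega>" for \<omega> b
  proof -
    have w: "\<omega> \<in> \<Omega>" "fibre_count \<Omega> (tgt G \<omega>) \<le> of_nat k" using that(1) OmD by (auto simp: W_def V_def)
    have "src G (mult G (mult G b \<omega>) (ginv G b)) = tgt G b" using that WD[OF that(1)] by simp
    then show ?thesis using conj[OF w(1) that(2,3)] w(2) fibre_count_inv[OF that(2)] that(2,3) by (simp add: W_def V_def)
  qed
  have Wcnt: "fibre_count W x \<le> of_nat k" for x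
  proof (cases "x \<in> V k")
    case True
    have "fibre_count W x \<le> fibre_count \<Omega> x" unfolding fibre_count_def by (rule emeasure_mono) (auto simp: W_def)
    also have "\<dots> \<le> of_nat k" using True by (simp add: V_def)
    finally show ?thesis .
  next
    case False
    then have e: "{g\<in>W. src G g = x} = {}" by (auto simp: W_def)
    show ?thesis unfolding fibre_count_def e by simp
  qed
  from isotropy_partition[OF WS Wcnt] obtain C where
    C: "\<forall>i<k. C i \<in> sets (Borel G) \<and> bisection G (C i)" and
    Cdj: "\<forall>i<k. \<forall>j<k. i \<noteq> j \<longrightarrow> C i \<inter> C j = {}" and CW: "(\<Union>i<k. C i) = W" by blast
  \<comment> \<open>The partition into bisections disappears from the formula, so the commutation
    below uses invariance of \<open>W\<close> alone.\<close>
  have cs: "lam_sum C k f g = (\<Sum>\<omega>\<in>{\<omega>\<in>W. tgt G \<omega> = tgt G g}. f (mult G (ginv G \<omega>) g))" if g: "g \<in> arrows G" for f g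
  proof -
    have "lam_sum C k f g = (\<Sum>i<k. if tgt G g \<in> tgt G ` C i then f (mult G (ginv G (tgt_section (C i) (tgt G g))) g) else 0)"
      unfolding lam_sum_def by (rule sum.cong) (use g in \<open>auto simp: pull_def left_dom_def left_trans_def\<close>)
    also have "\<dots> = (\<Sum>\<omega>\<in>{\<omega>\<in>(\<Union>i<k. C i). tgt G \<omega> = tgt G g}. f (mult G (ginv G \<omega>) g))"
      by (rule finite_partition_sum[where u="\<lambda>\<omega>. f (mult G (ginv G \<omega>) g)"]) (use C Cdj in auto)
    finally show ?thesis unfolding CW .
  qed
  note lin = conjunct1[OF lam_sum_linear_vN[OF C]]
  have "lift_op M (lam_sum C k) \<in> commutant M gens"
  proof (rule lift_op_commutes_gens[OF lin])
    fix B f g assume B: "B \<in> sets (Borel G)" "bisection G B" and g: "g \<in> arrows G"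
    let ?p = "pull (left_dom B) (left_trans B)"
    have tg: "tgt G (mult G (ginv G \<omega>) g) = tgt G g" "mult G (ginv G \<omega>) g \<in> arrows G" if "\<omega> \<in> W" "tgt G \<omega> = tgt G g" for \<omega>
      using that g WD[OF that(1)] by simp_all
    show "lam_sum C k (?p f) g = ?p (lam_sum C k f) g"
    proof (cases "g \<in> left_dom B")
      case False
      have z: "?p f (mult G (ginv G \<omega>) g) = 0" if "\<omega> \<in> W" "tgt G \<omega> = tgt G g" for \<omega>
        using False tg[OF that] g by (simp add: pull_def left_dom_def)
      have "lam_sum C k (?p f) g = (\<Sum>\<omega>\<in>{\<omega>\<in>W. tgt G \<omega> = tgt G g}. 0)"
        unfolding cs[OF g] by (rule sum.cong) (use z in auto)
      then show ?thesis using False by (simp add: pull_def)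
    next
      case True
      define b where "b = tgt_section B (tgt G g)"
      have b: "b \<in> arrows G" "tgt G b = tgt G g"
        unfolding b_def using True tgt_section_arrow[OF B(1)] tgt_section(2) by (auto simp: left_dom_def)
      have L: "left_trans B g = mult G (ginv G b) g" by (simp add: left_trans_def b_def)
      have Lg: "mult G (ginv G b) g \<in> arrows G" "tgt G (mult G (ginv G b) g) = src G b" using b g by simp_all
      have "lam_sum C k (?p f) g = (\<Sum>\<omega>\<in>{\<omega>\<in>W. tgt G \<omega> = tgt G g}. f (mult G (ginv G b) (mult G (ginv G \<omega>) g)))"
        unfolding cs[OF g]
      proof (rule sum.cong)
        fix \<omega> assume "\<omega> \<in> {\<omega>\<in>W. tgt G \<omega> = tgt G g}"
        then have w: "\<omega> \<in> W" "tgt G \<omega> = tgt G g" by auto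
        have "mult G (ginv G \<omega>) g \<in> left_dom B" using tg[OF w] True by (simp add: left_dom_def)
        then show "?p f (mult G (ginv G \<omega>) g) = f (mult G (ginv G b) (mult G (ginv G \<omega>) g))"
          unfolding pull_def left_trans_def tg(1)[OF w] b_def by simp
      qed simp
      also have "\<dots> = (\<Sum>\<omega>\<in>{\<omega>\<in>W. tgt G \<omega> = src G b}. f (mult G (ginv G \<omega>) (mult G (ginv G b) g)))"
      \<comment> \<open>Conjugation by \<open>b\<close> is a bijection between the elements of
        \<open>W\<close> at the two ends of \<open>b\<close>.\<close>
      proof (rule sum.reindex_bij_witness[of _ "\<lambda>\<omega>. mult G (mult G b \<omega>) (ginv G b)" "\<lambda>\<omega>. mult G (mult G (ginv G b) \<omega>) b"])
        fix \<omega> assume "\<omega> \<in> {\<omega>\<in>W. tgt G \<omega> = tgt G g}"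
        then have w: "\<omega> \<in> W" "tgt G \<omega> = tgt G g" by auto
        note wd = WD[OF w(1)]
        show "mult G (mult G b (mult G (mult G (ginv G b) \<omega>) b)) (ginv G b) = \<omega>"
          using b w wd mult_src[OF wd(1)] by (simp add: assoc mult_ginv)
        show "mult G (mult G (ginv G b) \<omega>) b \<in> {\<omega>\<in>W. tgt G \<omega> = src G b}"
          using Wconj[OF w(1), of "ginv G b"] b w wd by simp
        have "ginv G (mult G (mult G (ginv G b) \<omega>) b) = mult G (ginv G b) (mult G (ginv G \<omega>) b)"
          using b w wd by (simp add: ginv_mult_distrib)
        then show "f (mult G (ginv G (mult G (mult G (ginv G b) \<omega>) b)) (mult G (ginv G b) g)) = f (mult G (ginv G b) (mult G (ginv G \<omega>) g))"
          using b w wd g by (simp add: assoc)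
      next
        fix \<omega> assume "\<omega> \<in> {\<omega>\<in>W. tgt G \<omega> = src G b}"
        then have w: "\<omega> \<in> W" "tgt G \<omega> = src G b" by auto
        note wd = WD[OF w(1)]
        show "mult G (mult G (ginv G b) (mult G (mult G b \<omega>) (ginv G b))) b = \<omega>"
          using b w wd mult_src[OF wd(1)] by (simp add: assoc ginv_mult)
        show "mult G (mult G b \<omega>) (ginv G b) \<in> {\<omega>\<in>W. tgt G \<omega> = tgt G g}"
          using Wconj[OF w(1), of b] b w wd by simp
      qed
      also have "\<dots> = lam_sum C k f (mult G (ginv G b) g)" unfolding cs[OF Lg(1)] Lg(2) ..
      also have "\<dots> = ?p (lam_sum C k f) g" using True by (simp add: pull_def L)
      finally show ?thesis .
    qed
  qed
  then obtain c where c: "lift_op M (lam_sum C k) = restrict (l2_scale M c) (L2 M)"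
    using F conjunct2[OF lam_sum_linear_vN[OF C]] unfolding factor_iff by blast
  have "l2_class M (lam_sum C k unit_fun) = l2_class M (\<lambda>x. c * unit_fun x)"
    using lift_op(2)[OF lin unit_fun_l2] L2I[OF unit_fun_l2] l2_scale_class[OF unit_fun_l2, of c] unfolding c by simp
  then have ae: "AE g in M. lam_sum C k unit_fun g = c * unit_fun g"
    by (rule l2_class_eqD) (rule l2_linear_l2[OF lin unit_fun_l2])
  \<comment> \<open>Among the \<open>\<omega>\<close> in the fibre of \<open>g\<close>, the product
    \<open>\<omega>^-1 g\<close> is a unit for \<open>\<omega> = g\<close> only.\<close>
  have val: "lam_sum C k unit_fun g = 1" if g: "g \<in> W" for g
  proof -
    note gd = WD[OF g]
    have "\<exists>i<k. g \<in> C i" using g CW by blast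
    then obtain i where i: "i < k" "g \<in> C i" by blast
    have fin: "finite {\<omega>\<in>W. tgt G \<omega> = tgt G g}"
    proof -
      have "{\<omega>\<in>C j. tgt G \<omega> = tgt G g} \<subseteq> {tgt_section (C j) (tgt G g)}" if "j < k" for j
        using tgt_section_eq[of "C j"] C that by auto
      then have "{\<omega>\<in>W. tgt G \<omega> = tgt G g} \<subseteq> (\<lambda>j. tgt_section (C j) (tgt G g)) ` {..<k}" unfolding CW[symmetric] by fastforce
      then show ?thesis by (rule finite_subset) simp
    qed
    have u: "unit_fun (mult G (ginv G \<omega>) g) = (if \<omega> = g then 1 else 0)" if "\<omega> \<in> {\<omega>\<in>W. tgt G \<omega> = tgt G g}" for \<omega>
    proof -
      have w: "\<omega> \<in> arrows G" "tgt G \<omega> = tgt G g" "src G \<omega> = tgt G \<omega>" using that WD by auto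
      show ?thesis
      proof (cases "\<omega> = g")
        case True
        then show ?thesis using gd by (simp add: ginv_mult)
      next
        case False
        have "mult G (ginv G \<omega>) g \<notin> units G"
        proof
          assume un: "mult G (ginv G \<omega>) g \<in> units G"
          have "mult G (ginv G \<omega>) g = src G (mult G (ginv G \<omega>) g)" using un by simp
          also have "\<dots> = src G \<omega>" using w gd by simp
          finally have "mult G \<omega> (mult G (ginv G \<omega>) g) = mult G \<omega> (src G \<omega>)" by simp
          then have "g = \<omega>" using w gd mult_src[of \<omega>] by simp
          then show False using False by simp
        qed
        then show ?thesis using False by simp
      qed
    qed
    have "lam_sum C k unit_fun g = (\<Sum>\<omega>\<in>{\<omega>\<in>W. tgt G \<omega> = tgt G g}. if \<omega> = g then 1 else 0)"
      unfolding cs[OF gd(1)] by (rule sum.cong) (use u in auto)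
    also have "\<dots> = 1" using fin g by simp
    finally show ?thesis .
  qed
  have "AE g in M. g \<notin> {a\<in>?A. src G a \<in> V k}"
    using ae
  proof eventually_elim
    case (elim g)
    show ?case
    proof
      assume g: "g \<in> {a\<in>?A. src G a \<in> V k}"
      then have "g \<in> W" "g \<notin> units G" using Om(3) by (auto simp: W_def)
      then show False using val[of g] elim by simp
    qed
  qed
  then have "{a\<in>?A. src G a \<in> V k} \<in> null_sets M" using As[OF V] by (subst AE_iff_null_sets) auto
  then show False using k by (simp add: null_sets_def)
qed

end

section \<open>The center of an ergodic icc groupoid\<close>

context discrete_measured_groupoid begin

text \<open>The vector \<open>\<xi> = T 1\<close> of a central element \<open>T\<close> is fixed by conjugation with every bisection: \<open>\<lambda>\<^sub>A \<rho>\<^sub>A\<close> maps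
  \<open>1\<close> to \<open>\<lambda>\<^sub>E 1\<close>, where \<open>E = tgt ` A\<close>, and \<open>T\<close> commutes with \<open>\<lambda>\<^sub>A\<close>, \<open>\<rho>\<^sub>A\<close> and \<open>\<lambda>\<^sub>E\<close>.\<close>

lemma central_vector_conj:
  assumes T: "T \<in> groupoid_vN G \<mu>" "T \<in> commutant M gens"
    and A: "A \<in> sets (Borel G)" "bisection G A" "tame K A"
  defines "\<xi> \<equiv> op_fun M T unit_fun"
  shows "AE g in M. g \<in> left_dom A \<longrightarrow> (if g \<in> right_dom A then \<xi> (right_trans A (left_trans A g)) else 0) = \<xi> g"
proof -
  have Tb: "T \<in> l2_bounded_ops M" using T(2) commutant_subset by blast
  have xi: "\<xi> \<in> l2_fun M" unfolding \<xi>_def by (rule op_fun_l2[OF Tb unit_fun_l2])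
  have Tu: "T (l2_class M unit_fun) = l2_class M \<xi>" unfolding \<xi>_def by (rule op_fun_class[OF Tb unit_fun_l2])
  define E where "E = tgt G ` A"
  have E: "E \<in> sets (Borel G)" "E \<subseteq> units G" "bisection G E"
    unfolding E_def using tgt_image[OF A(1)] tgt_image_subset_units[OF A(1)] bisection_units by auto
  have T_lam: "T (lam B X) = lam B (T X)" if "B \<in> sets (Borel G)" "bisection G B" "X \<in> L2 M" for B X
    using T(2) that unfolding commutant_iff gens_def by blast
  \<comment> \<open>Here membership in the bicommutant is used: right translation by a tame
    bisection commutes with all generators, hence with \<open>T\<close>.\<close>
  have T_rho: "T (rho A X) = rho A (T X)" if "X \<in> L2 M" for X
    using T(1) rho_commutant[OF A] that unfolding groupoid_vN_eq commutant_iff[of T] by blast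
  note Ll = l2_linear_l2[OF lam_linear[OF A(1,2)]] and Rl = l2_linear_l2[OF rho_linear[OF A]] and El = l2_linear_l2[OF lam_linear[OF E(1,3)]]
  note up = Rl[OF unit_fun_l2]
  have "l2_class M (pull (left_dom A) (left_trans A) (pull (right_dom A) (right_trans A) unit_fun)) = l2_class M (pull (left_dom E) (left_trans E) unit_fun)"
  proof (rule l2_class_eq, rule AE_I2)
    fix g assume "g \<in> space M"
    then have g: "g \<in> arrows G" by simp
    show "pull (left_dom A) (left_trans A) (pull (right_dom A) (right_trans A) unit_fun) g = pull (left_dom E) (left_trans E) unit_fun g"
    proof (cases "g \<in> left_dom A")
      case False
      then show ?thesis using g unfolding pull_units[OF E(1,2)] by (simp add: pull_def left_dom_def E_def)
    next
      case True
      define a where "a = tgt_section A (tgt G g)"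
      have a: "a \<in> A" "tgt G a = tgt G g" "a \<in> arrows G"
        unfolding a_def using True tgt_section[of "tgt G g" A] tgt_section_arrow[OF A(1)] by (auto simp: left_dom_def)
      have L: "left_trans A g = mult G (ginv G a) g" by (simp add: left_trans_def a_def)
      have RDL: "left_trans A g \<in> right_dom A \<longleftrightarrow> src G g \<in> tgt G ` A" using left_trans(1,2)[OF A(1) True] by (simp add: right_dom_def)
      \<comment> \<open>If \<open>a^-1 g a'\<close> is a unit, its source and target agree, so
        \<open>a\<close> and \<open>a'\<close> have equal sources and coincide in the bisection.
        Then \<open>a^-1 g a\<close> is a unit, and \<open>g\<close> is one as well.\<close>
      have "(left_trans A g \<in> right_dom A \<and> right_trans A (left_trans A g) \<in> units G) \<longleftrightarrow> g \<in> units G"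
      proof
        assume h: "left_trans A g \<in> right_dom A \<and> right_trans A (left_trans A g) \<in> units G"
        define a' where "a' = tgt_section A (src G g)"
        have a': "a' \<in> A" "tgt G a' = src G g" "a' \<in> arrows G"
          unfolding a'_def using h RDL tgt_section[of "src G g" A] tgt_section_arrow[OF A(1)] by auto
        have R: "right_trans A (left_trans A g) = mult G (mult G (ginv G a) g) a'"
          unfolding right_trans_def left_trans(2)[OF A(1) True] a'_def by (simp only: L)
        have Ru: "mult G (mult G (ginv G a) g) a' \<in> units G" using h R by simp
        have "src G a' = src G (mult G (mult G (ginv G a) g) a')" using a a' g by simp
        also have "\<dots> = mult G (mult G (ginv G a) g) a'" using Ru by simp
        also have e1: "\<dots> = tgt G (mult G (mult G (ginv G a) g) a')" using Ru by simp
        also have "\<dots> = src G a" using a a' g by simp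
        finally have "src G a' = src G a" .
        then have aa: "a' = a" using A(2) a(1) a'(1) unfolding bisection_def inj_on_def by blast
        have gs: "src G g = tgt G a" using a'(2) aa by simp
        have "mult G (mult G (ginv G a) g) a = src G a" using e1 a g gs unfolding aa by simp
        then have "mult G (mult G (mult G (ginv G a) g) a) (ginv G a) = ginv G a"
          using a mult_tgt[of "ginv G a"] by simp
        then have "mult G (ginv G a) g = ginv G a" using a g gs by simp
        then have "mult G a (mult G (ginv G a) g) = mult G a (ginv G a)" by simp
        then have "g = tgt G a" using a g by (simp add: mult_ginv)
        then show "g \<in> units G" using tgt_in[OF g] a(2) by simp
      next
        assume u: "g \<in> units G"
        then have sg: "src G g = g" "tgt G g = g" by simp_all
        have "left_trans A g \<in> right_dom A" using RDL True sg by (simp add: left_dom_def)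
        moreover have "left_trans A g = ginv G a" unfolding L using a sg mult_src[of "ginv G a"] by simp
        moreover have "tgt_section A (src G g) = a" by (simp add: a_def sg)
        then have "right_trans A (left_trans A g) = mult G (left_trans A g) a" unfolding right_trans_def left_trans(2)[OF A(1) True] by simp
        ultimately show "left_trans A g \<in> right_dom A \<and> right_trans A (left_trans A g) \<in> units G" using a by (simp add: ginv_mult)
      qed
      then show ?thesis
        using g True unfolding pull_units[OF E(1,2)] by (auto simp: pull_def left_dom_def E_def indicator_def)
    qed
  qed
  then have "lam A (rho A (l2_class M unit_fun)) = lam E (l2_class M unit_fun)"
    unfolding rho_class[OF A unit_fun_l2] lam_class[OF A(1,2) up] lam_class[OF E(1,3) unit_fun_l2] .
  then have "T (lam A (rho A (l2_class M unit_fun))) = T (lam E (l2_class M unit_fun))" by simp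
  then have "lam A (rho A (l2_class M \<xi>)) = lam E (l2_class M \<xi>)"
    using T_lam[OF A(1,2), of "rho A (l2_class M unit_fun)"] T_lam[OF E(1,3) L2I[OF unit_fun_l2]] T_rho[OF L2I[OF unit_fun_l2]]
      L2I[OF up] rho_class[OF A unit_fun_l2] Tu by simp
  then have "l2_class M (pull (left_dom A) (left_trans A) (pull (right_dom A) (right_trans A) \<xi>)) = l2_class M (pull (left_dom E) (left_trans E) \<xi>)"
    unfolding rho_class[OF A xi] lam_class[OF A(1,2) Rl[OF xi]] lam_class[OF E(1,3) xi] .
  then have "AE g in M. pull (left_dom A) (left_trans A) (pull (right_dom A) (right_trans A) \<xi>) g = pull (left_dom E) (left_trans E) \<xi> g"
    by (rule l2_class_eqD) (rule Ll[OF Rl[OF xi]])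
  moreover have "AE g in M. g \<in> arrows G" using AE_space[of M] by simp
  ultimately show ?thesis
  proof eventually_elim
    case (elim g)
    show ?case
    proof
      assume gL: "g \<in> left_dom A"
      have "left_trans A g \<in> right_dom A \<longleftrightarrow> g \<in> right_dom A" using left_trans(1,2)[OF A(1) gL] elim(2) by (simp add: right_dom_def)
      then show "(if g \<in> right_dom A then \<xi> (right_trans A (left_trans A g)) else 0) = \<xi> g"
        using elim gL unfolding pull_units[OF E(1,2)] by (auto simp: pull_def left_dom_def E_def)
    qed
  qed
qed

text \<open>A level set is invariant almost everywhere only, while ergodicity concerns truly
  invariant Borel sets. Its saturation is invariant, is Borel by the image theorem, and exceeds it
  by a null set because every arrow lies in one of countably many bisections. The resulting
  dichotomy is applied to the sets where \<open>f\<close> is above and below its mean.\<close>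

lemma ergodic_AE_const:
  fixes f :: "'a \<Rightarrow> real"
  assumes erg: "ergodic G \<mu>" and f: "f \<in> borel_measurable \<mu>" "integrable \<mu> f"
    and B: "\<And>n::nat. B n \<in> sets (Borel G) \<and> bisection G (B n)" "(\<Union>n. B n) = arrows G"
    and inv: "\<And>n. AE x in \<mu>. x \<in> tgt G ` B n \<longrightarrow> f (src G (tgt_section (B n) x)) = f x"
  shows "AE x in \<mu>. f x = (\<integral>x. f x \<partial>\<mu>)"
proof -
  interpret prob_space \<mu> by (rule prob)
  have dich: "(AE x in \<mu>. \<not> P (f x)) \<or> (AE x in \<mu>. P (f x))" if P: "{x\<in>space \<mu>. P (f x)} \<in> sets \<mu>" for P
  proof -
    let ?Q = "{x\<in>units G. P (f x)}"
    have Q: "?Q \<in> sets (Borel G)" using P by (simp add: space_mu sets_mu_iff)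
    \<comment> \<open>The saturation of \<open>?Q\<close> under the orbit relation.\<close>
    define Q' where "Q' = tgt G ` {g\<in>arrows G. src G g \<in> ?Q}"
    have "{g\<in>arrows G. src G g \<in> ?Q} = src G -` ?Q \<inter> space (Borel G)" by auto
    then have "{g\<in>arrows G. src G g \<in> ?Q} \<in> sets (Borel G)" using measurable_sets[OF src_measurable_Borel Q] by simp
    then have Q': "Q' \<in> sets (Borel G)" "Q' \<subseteq> units G" unfolding Q'_def using tgt_image tgt_image_subset_units by auto
    have Q'I: "tgt G g \<in> Q'" if "g \<in> arrows G" "src G g \<in> ?Q" for g unfolding Q'_def using that by blast
    have Q'D: "\<exists>g\<in>arrows G. src G g \<in> ?Q \<and> tgt G g = x" if "x \<in> Q'" for x using that unfolding Q'_def by blast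
    have QQ: "x \<in> Q'" if "x \<in> ?Q" for x using Q'I[of x] that unit_arrow[of x] by auto
    have inv1: "tgt G g \<in> Q'" if g: "g \<in> arrows G" and s: "src G g \<in> Q'" for g
    proof -
      obtain h where h: "h \<in> arrows G" "src G h \<in> ?Q" "tgt G h = src G g" using Q'D[OF s] by blast
      have "tgt G (mult G g h) \<in> Q'" using g h by (intro Q'I) auto
      then show ?thesis using g h by simp
    qed
    have "\<forall>(x, y)\<in>orbit_rel G. x \<in> Q' \<longleftrightarrow> y \<in> Q'"
    proof safe
      fix x y assume "(x, y) \<in> orbit_rel G"
      then obtain g where g: "g \<in> arrows G" "x = tgt G g" "y = src G g" unfolding orbit_rel_def by blast
      show "y \<in> Q'" if "x \<in> Q'" using inv1[of "ginv G g"] g that by simp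
      show "x \<in> Q'" if "y \<in> Q'" using inv1[of g] g that by simp
    qed
    then have erg': "emeasure \<mu> Q' = 0 \<or> emeasure \<mu> (units G - Q') = 0" using erg Q' unfolding ergodic_def by blast
    have "AE x in \<mu>. \<forall>n. x \<in> tgt G ` B n \<longrightarrow> f (src G (tgt_section (B n) x)) = f x" using inv by (simp add: AE_all_countable)
    then have ae: "AE x in \<mu>. x \<in> Q' \<longrightarrow> P (f x)"
    proof eventually_elim
      case (elim x)
      show ?case
      proof
        assume "x \<in> Q'"
        then obtain g where g: "g \<in> arrows G" "src G g \<in> ?Q" "tgt G g = x" using Q'D by blast
        obtain n where n: "g \<in> B n" using g(1) B(2) by blast
        have "tgt_section (B n) x = g" by (rule tgt_section_eq[of "B n"]) (use B n g in auto)
        moreover have "x \<in> tgt G ` B n" using n g by blast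
        ultimately have "f (src G g) = f x" using elim by auto
        then show "P (f x)" using g(2) by simp
      qed
    qed
    have s: "Q' \<in> sets \<mu>" "units G - Q' \<in> sets \<mu>" using Q' units_sets by (auto simp: sets_mu_iff)
    from erg' show ?thesis
    proof
      assume "emeasure \<mu> Q' = 0"
      then have "AE x in \<mu>. x \<notin> Q'" using s(1) by (subst AE_iff_null_sets[symmetric]) (auto simp: null_sets_def)
      then have "AE x in \<mu>. \<not> P (f x)" using AE_space[of \<mu>]
        by eventually_elim (use QQ in \<open>auto simp: space_mu\<close>)
      then show ?thesis ..
    next
      assume "emeasure \<mu> (units G - Q') = 0"
      then have "AE x in \<mu>. x \<notin> units G - Q'" using s(2) by (subst AE_iff_null_sets[symmetric]) (auto simp: null_sets_def)
      then have "AE x in \<mu>. P (f x)" using ae AE_space[of \<mu>]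
        by eventually_elim (auto simp: space_mu)
      then show ?thesis ..
    qed
  qed
  \<comment> \<open>On a probability space a function cannot be almost everywhere strictly above its
    mean, nor strictly below it, so the dichotomy leaves one alternative in each case.\<close>
  let ?c = "\<integral>x. f x \<partial>\<mu>"
  have "{x\<in>space \<mu>. f x > ?c} \<in> sets \<mu>" using f(1) by measurable
  moreover have "\<not> (AE x in \<mu>. f x > ?c)"
  proof
    assume "AE x in \<mu>. f x > ?c" then have "?c < ?c" by (rule expectation_greater[OF f(2)]) then show False by simp
  qed
  ultimately have 1: "AE x in \<mu>. \<not> f x > ?c" using dich[of "\<lambda>y. y > ?c"] by blast
  have "{x\<in>space \<mu>. f x < ?c} \<in> sets \<mu>" using f(1) by measurable
  moreover have "\<not> (AE x in \<mu>. f x < ?c)"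
  proof
    assume "AE x in \<mu>. f x < ?c" then have "?c < ?c" by (rule expectation_less[OF f(2)]) then show False by simp
  qed
  ultimately have 2: "AE x in \<mu>. \<not> f x < ?c" using dich[of "\<lambda>y. y < ?c"] by blast
  show ?thesis using 1 2 by eventually_elim simp
qed

lemma AE_unitsI:
  assumes "AE x in \<mu>. P x"
  shows "AE g in M. g \<in> units G \<longrightarrow> P g"
proof -
  obtain N where N: "{x\<in>space \<mu>. \<not> P x} \<subseteq> N" "emeasure \<mu> N = 0" "N \<in> sets \<mu>"
    using assms by (rule AE_E)
  then have N': "N \<in> sets (Borel G)" "N \<subseteq> units G" by (simp_all add: sets_mu_iff)
  show ?thesis
  proof (rule AE_I[of _ _ N])
    show "emeasure M N = 0" using emeasure_M_units[OF N'] N(2) by simp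
    show "N \<in> sets M" using N' by simp
    show "{g\<in>space M. \<not> (g \<in> units G \<longrightarrow> P g)} \<subseteq> N" using N(1) by (auto simp: space_mu)
  qed
qed

lemma center_trivial:
  assumes erg: "ergodic G \<mu>" and icc: "icc G \<mu>"
    and T: "T \<in> groupoid_vN G \<mu>" "T \<in> commutant M gens"
  shows "\<exists>c. T = restrict (l2_scale M c) (L2 M)"
proof -
  interpret prob_space \<mu> by (rule prob)
  have Tb: "T \<in> l2_bounded_ops M" using T(2) commutant_subset by blast
  define \<xi> where "\<xi> = op_fun M T unit_fun"
  have xi: "\<xi> \<in> l2_fun M" unfolding \<xi>_def by (rule op_fun_l2[OF Tb unit_fun_l2])
  have xim[measurable]: "\<xi> \<in> borel_measurable M" by (rule l2_fun_measurable[OF xi])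
  have Tu: "T (l2_class M unit_fun) = l2_class M \<xi>" unfolding \<xi>_def by (rule op_fun_class[OF Tb unit_fun_l2])
  note inv = central_vector_conj[OF T, folded \<xi>_def]
  obtain B K where BK: "\<forall>n::nat. B n \<in> sets (Borel G) \<and> bisection G (B n) \<and> tame (K n) (B n)" and BU: "(\<Union>n. B n) = arrows G"
    using tame_cover by blast
  have Bn: "B n \<in> sets (Borel G) \<and> bisection G (B n)" for n using BK by blast
  obtain \<B> where sB: "separates_points (Borel G) \<B>" using separating_sets by blast
  then have cB: "countable \<B>" and Bs: "\<And>E. E \<in> \<B> \<Longrightarrow> E \<in> sets (Borel G)" by (auto simp: separates_points_def)
  \<comment> \<open>Conjugation invariance for a bisection of units: it fixes the arrows from
    \<open>E\<close> to \<open>E\<close> and sends \<open>\<xi>\<close> to 0 at those that end in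
    \<open>E\<close> without starting there.\<close>
  have offE: "AE g in M. tgt G g \<in> E \<longrightarrow> src G g \<notin> E \<longrightarrow> \<xi> g = 0" if E: "E \<in> sets (Borel G)" "E \<subseteq> units G" for E
  proof -
    have "AE g in M. g \<in> left_dom E \<longrightarrow> (if g \<in> right_dom E then \<xi> (right_trans E (left_trans E g)) else 0) = \<xi> g"
      by (rule inv[OF E(1) bisection_units[OF E(2)] tame_units[OF E]])
    then show ?thesis using AE_space[of M]
      by eventually_elim (auto simp: left_dom_def right_dom_def tgt_image_units[OF E(2)])
  qed
  \<comment> \<open>A set separating source and target may contain either of them, so its complement
    in the units is used as well.\<close>
  have "AE g in M. \<forall>E\<in>\<B>. (tgt G g \<in> E \<inter> units G \<longrightarrow> src G g \<notin> E \<inter> units G \<longrightarrow> \<xi> g = 0) \<and>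
      (tgt G g \<in> units G - E \<longrightarrow> src G g \<notin> units G - E \<longrightarrow> \<xi> g = 0)"
  proof (rule AE_ball_countable', rule AE_conjI)
    show "countable \<B>" by (rule cB)
    fix E assume "E \<in> \<B>"
    then have EU: "E \<inter> units G \<in> sets (Borel G)" "units G - E \<in> sets (Borel G)" using Bs units_sets by auto
    show "AE g in M. tgt G g \<in> E \<inter> units G \<longrightarrow> src G g \<notin> E \<inter> units G \<longrightarrow> \<xi> g = 0"
      "AE g in M. tgt G g \<in> units G - E \<longrightarrow> src G g \<notin> units G - E \<longrightarrow> \<xi> g = 0"
      by (rule offE[OF EU(1)], simp) (rule offE[OF EU(2)], simp)
  qed
  then have offIso: "AE g in M. g \<notin> Iso G \<longrightarrow> \<xi> g = 0" using AE_space[of M]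
  proof eventually_elim
    case (elim g)
    show ?case
    proof
      assume "g \<notin> Iso G"
      then have g: "g \<in> arrows G" "src G g \<noteq> tgt G g" using elim(2) by (auto simp: Iso_def)
      have u: "src G g \<in> units G" "tgt G g \<in> units G" using g by auto
      obtain E where "E \<in> \<B>" "(src G g \<in> E) \<noteq> (tgt G g \<in> E)"
        using sB g u unit_arrow unfolding separates_points_def by blast
      then show "\<xi> g = 0" using elim(1) u by blast
    qed
  qed
  have "AE g in M. \<forall>n. g \<in> left_dom (B n) \<longrightarrow> (if g \<in> right_dom (B n) then \<xi> (right_trans (B n) (left_trans (B n) g)) else 0) = \<xi> g"
    unfolding AE_all_countable
  proof
    fix n show "AE g in M. g \<in> left_dom (B n) \<longrightarrow> (if g \<in> right_dom (B n) then \<xi> (right_trans (B n) (left_trans (B n) g)) else 0) = \<xi> g"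
      by (rule inv[of "B n" "K n"]) (use BK in simp_all)
  qed
  then have conj: "AE g in M. \<forall>n. g \<in> Iso G \<longrightarrow> g \<in> left_dom (B n) \<longrightarrow> \<xi> (right_trans (B n) (left_trans (B n) g)) = \<xi> g"
  proof eventually_elim
    case (elim g)
    show ?case
    proof (intro allI impI)
      fix n assume "g \<in> Iso G" and gL: "g \<in> left_dom (B n)"
      then have "g \<in> right_dom (B n)" by (simp add: left_dom_def right_dom_def Iso_def)
      then show "\<xi> (right_trans (B n) (left_trans (B n) g)) = \<xi> g" 
        using elim[rule_format, OF gL] by (simp only: if_True)
    qed
  qed
  \<comment> \<open>Markov's inequality for the square of \<open>|\<xi>|\<close> makes the set where
    \<open>|\<xi>|\<close> exceeds \<open>\<epsilon>\<close> one of finite measure.\<close>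
  have level: "AE g in M. g \<in> Iso G - units G \<longrightarrow> cmod (\<xi> g) \<le> \<epsilon>" if eps: "\<epsilon> > 0" for \<epsilon>
  proof -
    let ?L = "{g\<in>space M. cmod (\<xi> g) > \<epsilon>}"
    have L: "?L \<in> sets M" by measurable
    have Lfin: "emeasure M ?L < \<infinity>"
    proof -
      have "emeasure M ?L \<le> emeasure M {g\<in>space M. 1 \<le> ennreal (1/\<epsilon>\<^sup>2) * ennreal ((cmod (\<xi> g))\<^sup>2)}"
      proof (rule emeasure_mono)
        show "?L \<subseteq> {g\<in>space M. 1 \<le> ennreal (1/\<epsilon>\<^sup>2) * ennreal ((cmod (\<xi> g))\<^sup>2)}"
        proof safe
          fix g assume "cmod (\<xi> g) > \<epsilon>"
          then have "\<epsilon>\<^sup>2 \<le> (cmod (\<xi> g))\<^sup>2" using eps by (intro power_mono) auto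
          then have "1 \<le> (1/\<epsilon>\<^sup>2) * (cmod (\<xi> g))\<^sup>2" using eps by (simp add: field_simps)
          then show "1 \<le> ennreal (1/\<epsilon>\<^sup>2) * ennreal ((cmod (\<xi> g))\<^sup>2)"
            by (simp add: ennreal_mult[symmetric] ennreal_1[symmetric] ennreal_leI del: ennreal_1)
        qed
      qed measurable
      also have "\<dots> \<le> ennreal (1/\<epsilon>\<^sup>2) * (\<integral>\<^sup>+g. ennreal ((cmod (\<xi> g))\<^sup>2) \<partial>M)"
      proof -
        have "emeasure M {g\<in>space M. 1 \<le> ennreal (1/\<epsilon>\<^sup>2) * ennreal ((cmod (\<xi> g))\<^sup>2)}
           \<le> ennreal (1/\<epsilon>\<^sup>2) * (\<integral>\<^sup>+g. ennreal ((cmod (\<xi> g))\<^sup>2) * indicator (space M) g \<partial>M)"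
          by (rule nn_integral_Markov_inequality) measurable
        also have "(\<integral>\<^sup>+g. ennreal ((cmod (\<xi> g))\<^sup>2) * indicator (space M) g \<partial>M) = (\<integral>\<^sup>+g. ennreal ((cmod (\<xi> g))\<^sup>2) \<partial>M)"
          by (rule nn_integral_cong) simp
        finally show ?thesis .
      qed
      also have "(\<integral>\<^sup>+g. ennreal ((cmod (\<xi> g))\<^sup>2) \<partial>M) = ennreal (sq_norm M \<xi>)"
        unfolding sq_norm_def by (rule nn_integral_eq_integral) (use xi l2_fun_integrable in auto)
      finally show ?thesis by (simp add: ennreal_mult[symmetric] sq_norm_nonneg le_less_trans)
    qed
    \<comment> \<open>The definition of \<open>icc\<close> speaks about bisections, so the level set
      is cut by the members of \<open>cover\<close>.\<close>
    define A where "A n = (Iso G - units G) \<inter> ?L \<inter> cover n" for n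
    have A0: "A n \<in> null_sets M" for n
    proof -
      have AS: "A n \<in> sets (Borel G)" unfolding A_def using L cover(1) Iso_sets units_sets by auto
      have Ab: "bisection G (A n)" by (rule bisection_subset[OF cover(2)[of n]]) (auto simp: A_def)
      have AI: "A n \<subseteq> Iso G" by (auto simp: A_def)
      have CS: "conj_class G (A n) \<in> sets (Borel G)" by (rule conj_class_sets[OF AS AI])
      have cc: "conj_class G (A n) = (\<Union>m. {g\<in>Iso G. g \<in> left_dom (B m) \<and> right_trans (B m) (left_trans (B m) g) \<in> A n})"
        by (rule conj_class_eq_UN[OF AI, of B, OF Bn BU])
      \<comment> \<open>Conjugation leaves \<open>\<xi>\<close> unchanged almost everywhere, so the
        class stays in the level set up to a null set and inherits finite measure.\<close>
      have "AE g in M. g \<in> conj_class G (A n) \<longrightarrow> g \<in> ?L"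
        using conj AE_space[of M]
      proof eventually_elim
        case (elim g)
        show ?case
        proof
          assume "g \<in> conj_class G (A n)"
          then obtain m where m: "g \<in> Iso G" "g \<in> left_dom (B m)" "right_trans (B m) (left_trans (B m) g) \<in> A n" unfolding cc by blast
          then have "\<xi> (right_trans (B m) (left_trans (B m) g)) = \<xi> g" using elim(1) by blast
          then show "g \<in> ?L" using m(3) elim(2) by (simp add: A_def)
        qed
      qed
      then have "emeasure M (conj_class G (A n)) \<le> emeasure M ?L" by (rule emeasure_mono_AE[OF _ L])
      then have fin: "emeasure M (conj_class G (A n)) < \<infinity>" using Lfin by (rule le_less_trans)
      have "emeasure M (A n) = 0"
      proof (rule ccontr)
        assume "emeasure M (A n) \<noteq> 0"
        then have "emeasure M (A n) > 0" by (simp add: zero_less_iff_neq_zero)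
        then have "emeasure M (A n - units G) = 0" using icc AS Ab AI fin unfolding icc_def by blast
        moreover have "A n - units G = A n" by (auto simp: A_def)
        ultimately show False using \<open>emeasure M (A n) \<noteq> 0\<close> by simp
      qed
      then show ?thesis using AS by (auto simp: null_sets_def)
    qed
    then have "(\<Union>n. A n) \<in> null_sets M" by (intro null_sets_UN') auto
    moreover have "(\<Union>n. A n) = (Iso G - units G) \<inter> ?L" unfolding A_def using cover(4) by auto
    ultimately have "(Iso G - units G) \<inter> ?L \<in> null_sets M" by simp
    then have "AE g in M. g \<notin> (Iso G - units G) \<inter> ?L" by (rule AE_not_in)
    then show ?thesis using AE_space[of M] by eventually_elim auto
  qed
  have "AE g in M. \<forall>k::nat. g \<in> Iso G - units G \<longrightarrow> cmod (\<xi> g) \<le> 1 / real (Suc k)"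
    unfolding AE_all_countable by (intro allI level) simp
  then have offU: "AE g in M. g \<notin> units G \<longrightarrow> \<xi> g = 0" using offIso
  proof eventually_elim
    case (elim g)
    show ?case
    proof (intro impI, rule ccontr)
      assume g: "g \<notin> units G" and "\<xi> g \<noteq> 0"
      then have gI: "g \<in> Iso G - units G" using elim(2) by blast
      obtain k where "1 / real (Suc k) < cmod (\<xi> g)"
        using reals_Archimedean[of "cmod (\<xi> g)"] \<open>\<xi> g \<noteq> 0\<close> by (auto simp: inverse_eq_divide)
      then show False using elim(1) gI by (meson not_less)
    qed
  qed
  \<comment> \<open>At a unit \<open>x\<close> the conjugate by the arrow \<open>b\<close> with
    target \<open>x\<close> is \<open>b^-1 b\<close>, the source of \<open>b\<close>. Conjugation
    invariance of \<open>\<xi>\<close> thus becomes invariance along orbits.\<close>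
  have invU: "AE x in \<mu>. x \<in> tgt G ` B n \<longrightarrow> \<xi> (src G (tgt_section (B n) x)) = \<xi> x" for n
  proof -
    have "AE g in M. g \<in> units G \<longrightarrow> (g \<in> tgt G ` B n \<longrightarrow> \<xi> (src G (tgt_section (B n) g)) = \<xi> g)"
      using conj
    proof eventually_elim
      case (elim g)
      show ?case
      proof (intro impI)
        assume g: "g \<in> units G" "g \<in> tgt G ` B n"
        have ga: "g \<in> arrows G" "src G g = g" "tgt G g = g" using g unit_arrow by auto
        have gI: "g \<in> Iso G" "g \<in> left_dom (B n)" using ga g by (simp_all add: Iso_def left_dom_def)
        let ?b = "tgt_section (B n) g"
        have b: "?b \<in> arrows G" "tgt G ?b = g" using g tgt_section_arrow[of "B n"] Bn tgt_section(2) by auto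
        have L: "left_trans (B n) g = ginv G ?b"
          unfolding left_trans_def ga(3) using b ga mult_src[of "ginv G ?b"] by simp
        have "right_trans (B n) (left_trans (B n) g) = mult G (ginv G ?b) ?b"
          unfolding L right_trans_def using b by simp
        also have "\<dots> = src G ?b" using b by (simp add: ginv_mult)
        finally show "\<xi> (src G ?b) = \<xi> g" using elim gI by metis
      qed
    qed
    then show ?thesis by (rule AE_unitsD)
  qed
  have xmu: "\<xi> \<in> borel_measurable \<mu>"
  proof -
    have "\<xi> \<in> borel_measurable (restrict_space (Borel G) (units G))"
      using xim measurable_cong_sets[OF sets_M refl] by (intro measurable_restrict_space1) auto
    then show ?thesis using measurable_cong_sets[OF sets_mu refl] by blast
  qed
  have int2: "integrable \<mu> (\<lambda>x. (cmod (\<xi> x))\<^sup>2)"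
  proof -
    have "(\<integral>\<^sup>+x. ennreal ((cmod (\<xi> x))\<^sup>2) \<partial>\<mu>) \<le> (\<integral>\<^sup>+x. ennreal ((cmod (\<xi> x))\<^sup>2) \<partial>M)"
    proof -
      have U: "units G \<inter> space M \<in> sets M" using units_sets by auto
      \<comment> \<open>Each unit is the single unit in its source fibre, so counting over units
        reproduces \<open>\<mu>\<close>; square integrability of \<open>\<xi>\<close> passes to
        \<open>\<mu>\<close>.\<close>
      have "\<mu> = restrict_space M (units G)"
      proof (rule measure_eqI)
        show "sets \<mu> = sets (restrict_space M (units G))"
          unfolding sets_mu by (rule sets_restrict_space_cong[symmetric]) simp
        fix E assume "E \<in> sets \<mu>"
        then have E: "E \<in> sets (Borel G)" "E \<subseteq> units G" by (simp_all add: sets_mu_iff)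
        show "emeasure \<mu> E = emeasure (restrict_space M (units G)) E"
          using emeasure_restrict_space[OF U E(2)] emeasure_M_units[OF E] by simp
      qed
      then have "(\<integral>\<^sup>+x. ennreal ((cmod (\<xi> x))\<^sup>2) \<partial>\<mu>) = (\<integral>\<^sup>+x. ennreal ((cmod (\<xi> x))\<^sup>2) * indicator (units G) x \<partial>M)"
        using nn_integral_restrict_space[OF U] by simp
      also have "\<dots> \<le> (\<integral>\<^sup>+x. ennreal ((cmod (\<xi> x))\<^sup>2) \<partial>M)"
        by (rule nn_integral_mono) (simp add: indicator_def)
      finally show ?thesis .
    qed
    also have "\<dots> = ennreal (sq_norm M \<xi>)"
      unfolding sq_norm_def by (rule nn_integral_eq_integral) (use xi l2_fun_integrable in auto)
    finally have "(\<integral>\<^sup>+x. ennreal ((cmod (\<xi> x))\<^sup>2) \<partial>\<mu>) < \<infinity>" by (simp add: le_less_trans)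
    then show ?thesis using xmu by (intro integrableI_bounded) auto
  qed
  \<comment> \<open>Square integrable functions on a probability space are integrable, by comparison
    with \<open>1 + |\<xi>|^2\<close>.\<close>
  have int: "integrable \<mu> \<xi>"
  proof (rule Bochner_Integration.integrable_bound)
    show "integrable \<mu> (\<lambda>x. 1 + (cmod (\<xi> x))\<^sup>2)" using int2 by simp
    show "AE x in \<mu>. norm (\<xi> x) \<le> norm (1 + (cmod (\<xi> x))\<^sup>2)"
    proof (rule AE_I2)
      fix x
      have "2 * cmod (\<xi> x) \<le> 1 + (cmod (\<xi> x))\<^sup>2" using sum_squares_bound[of 1 "cmod (\<xi> x)"] by simp
      then have "cmod (\<xi> x) \<le> 1 + (cmod (\<xi> x))\<^sup>2" using norm_ge_zero[of "\<xi> x"] by linarith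
      then show "norm (\<xi> x) \<le> norm (1 + (cmod (\<xi> x))\<^sup>2)" by simp
    qed
  qed (rule xmu)
  have "AE x in \<mu>. Re (\<xi> x) = (\<integral>x. Re (\<xi> x) \<partial>\<mu>)"
  proof (rule ergodic_AE_const[OF erg _ _ Bn BU])
    show "AE x in \<mu>. x \<in> tgt G ` B n \<longrightarrow> Re (\<xi> (src G (tgt_section (B n) x))) = Re (\<xi> x)" for n
      using invU[of n] by eventually_elim simp
  qed (use xmu int in auto)
  moreover have "AE x in \<mu>. Im (\<xi> x) = (\<integral>x. Im (\<xi> x) \<partial>\<mu>)"
  proof (rule ergodic_AE_const[OF erg _ _ Bn BU])
    show "AE x in \<mu>. x \<in> tgt G ` B n \<longrightarrow> Im (\<xi> (src G (tgt_section (B n) x))) = Im (\<xi> x)" for n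
      using invU[of n] by eventually_elim simp
  qed (use xmu int in auto)
  ultimately have "AE x in \<mu>. \<xi> x = Complex (\<integral>x. Re (\<xi> x) \<partial>\<mu>) (\<integral>x. Im (\<xi> x) \<partial>\<mu>)"
    by eventually_elim (simp add: complex_eq_iff)
  then obtain c where "AE x in \<mu>. \<xi> x = c" by blast
  then have "AE g in M. g \<in> units G \<longrightarrow> \<xi> g = c" by (rule AE_unitsI)
  then have "AE g in M. \<xi> g = c * unit_fun g" using offU
    by eventually_elim (auto simp: indicator_def)
  then have Tc: "T (l2_class M unit_fun) = l2_class M (\<lambda>g. c * unit_fun g)"
    unfolding Tu by (rule l2_class_eq)
  \<comment> \<open>For a bisection \<open>E\<close> the indicator of \<open>E\<close> is
    \<open>lam E\<close> applied to \<open>unit_fun\<close>. As \<open>T\<close> commutes with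
    \<open>lam E\<close>, its value there is \<open>c\<close> times that indicator, and such
    indicators determine a bounded operator.\<close>
  have "T = restrict (l2_scale M c) (L2 M)"
  proof (rule bounded_op_eqI_indicator[OF Tb _ cover_M])
    show "restrict (l2_scale M c) (L2 M) \<in> l2_bounded_ops M"
      using scalar_commutant[OF gens_bounded, of c] commutant_subset by blast
    fix E n assume "E \<in> sets M" "E \<subseteq> cover n"
    then have E: "E \<in> sets (Borel G)" "bisection G E" using bisection_subset[OF cover(2)] by auto
    have El: "(indicator E :: 'a \<Rightarrow> complex) \<in> l2_fun M"
      by (rule l2_fun_indicator) (use E emeasure_bisection_finite in auto)
    have pe: "pull (left_dom E) (left_trans E) (\<lambda>g. d * unit_fun g) g = d * indicator E g" if g: "g \<in> arrows G" for g d
    proof -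
      have "g \<in> left_dom E \<and> left_trans E g \<in> units G \<longleftrightarrow> g \<in> E"
        unfolding set_mult_iff[OF E units_subset, symmetric]
      proof
        assume "g \<in> set_mult G E (units G)"
        then obtain a x where ax: "a \<in> E" "x \<in> units G" "src G a = tgt G x" "g = mult G a x" unfolding set_mult_def by blast
        then show "g \<in> E" using arrow_mem[OF E(1) ax(1)] by simp
      next
        assume gE: "g \<in> E"
        show "g \<in> set_mult G E (units G)" unfolding set_mult_def
          by (intro CollectI exI[of _ g] exI[of _ "src G g"] conjI) (use gE g in simp_all)
      qed
      then show ?thesis by (auto simp: pull_def indicator_def)
    qed
    have "lam E (l2_class M unit_fun) = l2_class M (indicator E)"
      unfolding lam_class[OF E unit_fun_l2]
      by (rule l2_class_eq, rule AE_I2) (use pe[of _ 1] in simp)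
    then have "T (l2_class M (indicator E)) = T (lam E (l2_class M unit_fun))" by simp
    also have "\<dots> = lam E (T (l2_class M unit_fun))"
      using T(2) E L2I[OF unit_fun_l2] unfolding commutant_iff gens_def by blast
    also have "\<dots> = l2_class M (pull (left_dom E) (left_trans E) (\<lambda>g. c * unit_fun g))"
      unfolding Tc by (rule lam_class[OF E l2_fun_scale[OF unit_fun_l2]])
    also have "\<dots> = l2_class M (\<lambda>g. c * indicator E g)"
      by (rule l2_class_eq, rule AE_I2) (use pe in simp)
    also have "\<dots> = l2_scale M c (l2_class M (indicator E))" by (rule l2_scale_class[OF El, symmetric])
    finally show "T (l2_class M (indicator E)) = restrict (l2_scale M c) (L2 M) (l2_class M (indicator E))"
      using L2I[OF El] by simp
  qed
  then show ?thesis by blast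
qed

end

theorem corollary2:
  fixes G :: "'g groupoid_str" and \<mu> :: "'g measure"
  assumes "discrete_measured_groupoid G \<mu>"
  shows "(ergodic G \<mu> \<and> icc G \<mu>) \<longleftrightarrow> factor (mu_src G \<mu>) (groupoid_vN G \<mu>)"
proof -
  interpret discrete_measured_groupoid G \<mu> by (rule assms)
  show ?thesis
    using center_trivial factor_imp_ergodic factor_imp_icc factor_iff by blast
qed

end
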